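(* Let $X$ be an open manifold of dimension $n\ge3$ with tame ends $Z\times[0,\infty)$ and $h$ a Riemannian metric on $Z$. Assume that $\lambda(\mathcal L_h)<0$. Then $Y^{cyl}_{\bar C}(X)=-\infty$ for any cylindrical conformal class $\bar C=[\bar g]$ with $\bar g$ a cylindrical metric on $X$ and $\partial_\infty\bar g=h$. In particular, $Y^{cyl}_{\bar C}(X)=-\infty$ if the scalar curvature $R_h<0$ on $Z$.
   Context: An open manifold with tame ends $Z\times[0,\infty)$ is a connected noncompact manifold $X$ without boundary having a relatively compact open submanifold $W\subset X$ with $\partial\overline W=Z=\bigsqcup_{j=1}^m Z_j$, each $Z_j$ a connected closed $(n-1)$-manifold, such that $X\setminus W\cong Z\times[0,\infty)$. A cylindrical metric on $X$ is a complete Riemannian metric $\bar g$ such that, in some coordinate system $(x,t)$ on $Z\times[0,\infty)$, $\bar g(x,t)=h(x)+dt^2$ on $Z\times[1,\infty)$ for some Riemannian metric $h$ on $Z$; one writes $\partial_\infty\bar g=h$. With $\alpha_n=\frac{4(n-1)}{n-2}$ and $L^{1,2}_{\bar g}(X)$ the Sobolev space of functions square-integrable with their first weak derivatives, $$Y^{cyl}_{\bar C}(X)=\inf_{u\in L^{1,2}_{\bar g}(X),\,u\not\equiv0}\frac{\int_X(\alpha_n|du|^2+R_{\bar g}u^2)\,d\sigma_{\bar g}}{\left(\int_X|u|^{\frac{2n}{n-2}}d\sigma_{\bar g}\right)^{\frac{n-2}{n}}}\in[-\infty,\infty)$$ (independent of the cylindrical metric $\bar g\in\bar C$). $\lambda(\mathcal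 L_h)$ is the first eigenvalue of $\mathcal L_h=-\alpha_n\Delta_h+R_h$ on $(Z,h)$ (note $n=\dim Z+1$), i.e. the infimum over $u\in L^{1,2}(Z)$, $u\not\equiv0$, of $\int_Z(\alpha_n|du|^2+R_hu^2)d\sigma_h/\int_Zu^2d\sigma_h$. *)

theory Defs
  imports "HOL-Analysis.Analysis"
begin

section \<open>Smooth manifolds\<close>

text \<open>
  A manifold is a Hausdorff second countable type together with an atlas. A chart is a pair
  \<open>(U, \<phi>)\<close>; \<open>\<phi>\<close> is a total function, but only its values on \<open>U\<close> matter.
\<close>

type_synonym ('a, 'e) chart = "'a set \<times> ('a \<Rightarrow> 'e)"
type_synonym ('a, 'e) atlas = "('a, 'e) chart set"

abbreviation chart_dom :: "('a, 'e) chart \<Rightarrow> 'a set" where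
  "chart_dom c \<equiv> fst c"

abbreviation chart_map :: "('a, 'e) chart \<Rightarrow> 'a \<Rightarrow> 'e" where
  "chart_map c \<equiv> snd c"

definition chart_inv :: "('a, 'e) chart \<Rightarrow> 'e \<Rightarrow> 'a" where
  "chart_inv c = inv_into (chart_dom c) (chart_map c)"

definition chart_img :: "('a, 'e) chart \<Rightarrow> 'e set" where
  "chart_img c = chart_map c ` chart_dom c"

definition transition :: "('a, 'e) chart \<Rightarrow> ('a, 'e) chart \<Rightarrow> 'e \<Rightarrow> 'e" where
  "transition c d = chart_map d \<circ> chart_inv c"

definition overlap :: "('a, 'e) chart \<Rightarrow> ('a, 'e) chart \<Rightarrow> 'e set" where
  "overlap c d = chart_map c ` (chart_dom c \<inter> chart_dom d)"

definition dir_deriv :: "'e::real_normed_vector \<Rightarrow> ('e \<Rightarrow> 'f::real_normed_vector) \<Rightarrow> 'e \<Rightarrow> 'f" where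
  "dir_deriv v f x = frechet_derivative f (at x) v"

primrec Ck_on :: "nat \<Rightarrow> ('e::euclidean_space \<Rightarrow> 'f::real_normed_vector) \<Rightarrow> 'e set \<Rightarrow> bool" where
  "Ck_on 0 f S \<longleftrightarrow> continuous_on S f"
| "Ck_on (Suc k) f S \<longleftrightarrow> (\<forall>x\<in>S. f differentiable (at x)) \<and> (\<forall>v. Ck_on k (dir_deriv v f) S)"

text \<open>Only used for open \<open>S\<close>.\<close>

definition smooth_on :: "('e::euclidean_space \<Rightarrow> 'f::real_normed_vector) \<Rightarrow> 'e set \<Rightarrow> bool" where
  "smooth_on f S \<longleftrightarrow> (\<forall>k. Ck_on k f S)"

definition smooth_atlas ::
  "('a::{t2_space, second_countable_topology}, 'e::euclidean_space) atlas \<Rightarrow> bool" where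
  "smooth_atlas A \<longleftrightarrow>
     (\<forall>c\<in>A. open (chart_dom c) \<and> open (chart_img c) \<and>
        homeomorphism (chart_dom c) (chart_img c) (chart_map c) (chart_inv c)) \<and>
     (\<Union>c\<in>A. chart_dom c) = UNIV \<and>
     (\<forall>c\<in>A. \<forall>d\<in>A. smooth_on (transition c d) (overlap c d))"

text \<open>Some chart of the atlas around \<open>p\<close>; it is only used for chart-independent quantities.\<close>

definition chart_at :: "('a, 'e) atlas \<Rightarrow> 'a \<Rightarrow> ('a, 'e) chart" where
  "chart_at A p = (SOME c. c \<in> A \<and> p \<in> chart_dom c)"

text \<open>
  Smoothness of a map on an arbitrary subset \<open>S\<close> of a manifold: around each point of \<open>S\<close> the map
  extends to a smooth map on an open set. This gives smoothness up to the boundary on manifolds with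
  boundary of codimension 0.
\<close>

definition smooth_map_on ::
  "('a, 'e::euclidean_space) atlas \<Rightarrow> ('b, 'f::euclidean_space) atlas \<Rightarrow> 'a set \<Rightarrow> ('a \<Rightarrow> 'b) \<Rightarrow> bool" where
  "smooth_map_on A B S f \<longleftrightarrow>
     (\<forall>p\<in>S. \<exists>c\<in>A. \<exists>d\<in>B. \<exists>N F. p \<in> chart_dom c \<and> f p \<in> chart_dom d \<and>
        open N \<and> chart_map c p \<in> N \<and> smooth_on F N \<and>
        (\<forall>q\<in>S \<inter> chart_dom c. chart_map c q \<in> N \<longrightarrow>
           f q \<in> chart_dom d \<and> chart_map d (f q) = F (chart_map c q)))"

definition diffeo_on ::
  "('a, 'e::euclidean_space) atlas \<Rightarrow> ('b, 'f::euclidean_space) atlas \<Rightarrow> 'a set \<Rightarrow> 'b set \<Rightarrow> ('a \<Rightarrow> 'b) \<Rightarrow> bool" where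
  "diffeo_on A B S T f \<longleftrightarrow>
     bij_betw f S T \<and> smooth_map_on A B S f \<and> smooth_map_on B A T (inv_into S f)"

text \<open>The product atlas on \<open>Z \<times> \<real>\<close>.\<close>

definition line_product :: "('z, 'e) atlas \<Rightarrow> ('z \<times> real, 'e \<times> real) atlas" where
  "line_product B = (\<lambda>c. (chart_dom c \<times> UNIV, map_prod (chart_map c) id)) ` B"


section \<open>Riemannian metrics and scalar curvature\<close>

text \<open>
  A covariant 2-tensor field is given by its components in all charts: \<open>g c x v w\<close> is the value at
  the point with coordinates \<open>x \<in> chart_img c\<close> on the tangent vectors with components \<open>v\<close> and \<open>w\<close>.
  A covector field is likewise given by component vectors \<open>\<omega> c x\<close>, acting by \<open>v \<mapsto> \<omega> c x \<bullet> v\<close>.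
\<close>

type_synonym ('a, 'e) tensor2 = "('a, 'e) chart \<Rightarrow> 'e \<Rightarrow> 'e \<Rightarrow> 'e \<Rightarrow> real"
type_synonym ('a, 'e) covector = "('a, 'e) chart \<Rightarrow> 'e \<Rightarrow> 'e"

definition riemannian_metric :: "('a, 'e::euclidean_space) atlas \<Rightarrow> ('a, 'e) tensor2 \<Rightarrow> bool" where
  "riemannian_metric A g \<longleftrightarrow>
     (\<forall>c\<in>A. \<forall>x\<in>chart_img c. bilinear (g c x) \<and> (\<forall>v w. g c x v w = g c x w v) \<and>
        (\<forall>v. v \<noteq> 0 \<longrightarrow> 0 < g c x v v)) \<and>
     (\<forall>c\<in>A. \<forall>v w. smooth_on (\<lambda>x. g c x v w) (chart_img c)) \<and>
     (\<forall>c\<in>A. \<forall>d\<in>A. \<forall>x\<in>overlap c d. \<forall>v w.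
        g c x v w = g d (transition c d x) (dir_deriv v (transition c d) x) (dir_deriv w (transition c d) x))"

definition covector_field :: "('a, 'e::euclidean_space) atlas \<Rightarrow> ('a, 'e) covector \<Rightarrow> bool" where
  "covector_field A \<omega> \<longleftrightarrow>
     (\<forall>c\<in>A. \<forall>d\<in>A. \<forall>x\<in>overlap c d. \<forall>v.
        \<omega> c x \<bullet> v = \<omega> d (transition c d x) \<bullet> dir_deriv v (transition c d) x)"

text \<open>
  For an inner product \<open>b\<close>, the vector \<open>b\<close>-dual to the linear form \<open>w \<mapsto> a \<bullet> w\<close>. So, in an orthonormal
  basis, \<open>sharp b i = (\<Sum>j. b\<^sup>i\<^sup>j *\<^sub>R j)\<close> with the inverse matrix \<open>b\<^sup>i\<^sup>j\<close>.
\<close>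

definition sharp :: "('e::euclidean_space \<Rightarrow> 'e \<Rightarrow> real) \<Rightarrow> 'e \<Rightarrow> 'e" where
  "sharp b a = (THE v. \<forall>w. b v w = a \<bullet> w)"

definition covector_norm2 ::
  "('a, 'e::euclidean_space) atlas \<Rightarrow> ('a, 'e) tensor2 \<Rightarrow> ('a, 'e) covector \<Rightarrow> 'a \<Rightarrow> real" where
  "covector_norm2 A g \<omega> p =
     (let c = chart_at A p; x = chart_map c p in \<omega> c x \<bullet> sharp (g c x) (\<omega> c x))"

text \<open>
  In the following, \<open>\<gamma>\<close> is a metric on an open set of a Euclidean space. The Christoffel map is
  \<open>\<Gamma>(v,w) = \<nabla>\<^sub>v w\<close> for constant fields \<open>v\<close>, \<open>w\<close>, and
  \<open>R(u,v)w = \<nabla>\<^sub>u\<nabla>\<^sub>v w - \<nabla>\<^sub>v\<nabla>\<^sub>u w\<close>, \<open>Ric(v,w) = tr (u \<mapsto> R(u,v)w)\<close>; the unit sphere has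
  positive scalar curvature.
\<close>

definition christoffel ::
  "('e::euclidean_space \<Rightarrow> 'e \<Rightarrow> 'e \<Rightarrow> real) \<Rightarrow> 'e \<Rightarrow> 'e \<Rightarrow> 'e \<Rightarrow> 'e" where
  "christoffel \<gamma> x v w =
     (1/2) *\<^sub>R (\<Sum>z\<in>Basis.
        (dir_deriv v (\<lambda>y. \<gamma> y w z) x + dir_deriv w (\<lambda>y. \<gamma> y v z) x - dir_deriv z (\<lambda>y. \<gamma> y v w) x)
          *\<^sub>R sharp (\<gamma> x) z)"

definition riemann_curv ::
  "('e::euclidean_space \<Rightarrow> 'e \<Rightarrow> 'e \<Rightarrow> real) \<Rightarrow> 'e \<Rightarrow> 'e \<Rightarrow> 'e \<Rightarrow> 'e \<Rightarrow> 'e" where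
  "riemann_curv \<gamma> x u v w =
     dir_deriv u (\<lambda>y. christoffel \<gamma> y v w) x - dir_deriv v (\<lambda>y. christoffel \<gamma> y u w) x
     + christoffel \<gamma> x u (christoffel \<gamma> x v w) - christoffel \<gamma> x v (christoffel \<gamma> x u w)"

definition ricci_curv ::
  "('e::euclidean_space \<Rightarrow> 'e \<Rightarrow> 'e \<Rightarrow> real) \<Rightarrow> 'e \<Rightarrow> 'e \<Rightarrow> 'e \<Rightarrow> real" where
  "ricci_curv \<gamma> x v w = (\<Sum>i\<in>Basis. riemann_curv \<gamma> x i v w \<bullet> i)"

definition scalar_curv :: "('e::euclidean_space \<Rightarrow> 'e \<Rightarrow> 'e \<Rightarrow> real) \<Rightarrow> 'e \<Rightarrow> real" where
  "scalar_curv \<gamma> x = (\<Sum>i\<in>Basis. ricci_curv \<gamma> x i (sharp (\<gamma> x) i))"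

definition scalar_curvature ::
  "('a, 'e::euclidean_space) atlas \<Rightarrow> ('a, 'e) tensor2 \<Rightarrow> 'a \<Rightarrow> real" where
  "scalar_curvature A g p = (let c = chart_at A p in scalar_curv (g c) (chart_map c p))"


section \<open>Completeness\<close>

definition piecewise_C1_curve ::
  "('a::topological_space, 'e::euclidean_space) atlas \<Rightarrow> (real \<Rightarrow> 'a) \<Rightarrow> bool" where
  "piecewise_C1_curve A \<gamma> \<longleftrightarrow> continuous_on {0..1} \<gamma> \<and>
     (\<forall>c\<in>A. \<forall>a b. 0 \<le> a \<and> a \<le> b \<and> b \<le> 1 \<and> \<gamma> ` {a..b} \<subseteq> chart_dom c \<longrightarrow>
        (chart_map c \<circ> \<gamma>) piecewise_C1_differentiable_on {a..b})"

definition curve_length ::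
  "('a, 'e::euclidean_space) atlas \<Rightarrow> ('a, 'e) tensor2 \<Rightarrow> (real \<Rightarrow> 'a) \<Rightarrow> ennreal" where
  "curve_length A g \<gamma> = (\<integral>\<^sup>+t\<in>{0..1}.
     (let c = chart_at A (\<gamma> t); v = vector_derivative (chart_map c \<circ> \<gamma>) (at t)
      in ennreal (sqrt (g c (chart_map c (\<gamma> t)) v v))) \<partial>lborel)"

definition riemannian_dist ::
  "('a::topological_space, 'e::euclidean_space) atlas \<Rightarrow> ('a, 'e) tensor2 \<Rightarrow> 'a \<Rightarrow> 'a \<Rightarrow> real" where
  "riemannian_dist A g p q =
     enn2real (INF \<gamma>\<in>{\<gamma>. piecewise_C1_curve A \<gamma> \<and> \<gamma> 0 = p \<and> \<gamma> 1 = q}. curve_length A g \<gamma>)"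

text \<open>Only used on connected manifolds, where the distance is finite.\<close>

definition complete_metric ::
  "('a::topological_space, 'e::euclidean_space) atlas \<Rightarrow> ('a, 'e) tensor2 \<Rightarrow> bool" where
  "complete_metric A g \<longleftrightarrow> Metric_space.mcomplete UNIV (riemannian_dist A g)"


section \<open>Tame ends and cylindrical metrics\<close>

text \<open>
  \<open>\<Phi>\<close> is a coordinate system on the end: a diffeomorphism from \<open>Z \<times> [0,\<infinity>)\<close> onto the complement
  of \<open>W\<close>, which takes \<open>Z \<times> {0}\<close> to the boundary of the closure of \<open>W\<close>.
\<close>

definition end_coordinates ::
  "('a::topological_space, 'e::euclidean_space) atlas \<Rightarrow> ('z, 'f::euclidean_space) atlas \<Rightarrow>
    'a set \<Rightarrow> ('z \<times> real \<Rightarrow> 'a) \<Rightarrow> bool" where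
  "end_coordinates A B W \<Phi> \<longleftrightarrow>
     diffeo_on (line_product B) A (UNIV \<times> {0..}) (- W) \<Phi> \<and> \<Phi> ` (UNIV \<times> {0}) = frontier W"

text \<open>
  The components \<open>Z\<^sub>j\<close> of the closed manifold \<open>Z\<close> are not listed: by compactness there are
  finitely many of them, and each is a connected closed manifold.
\<close>

definition open_manifold_tame_ends ::
  "('a::{t2_space, second_countable_topology}, 'e::euclidean_space) atlas \<Rightarrow>
    ('z::{t2_space, second_countable_topology}, 'f::euclidean_space) atlas \<Rightarrow> 'a set \<Rightarrow> bool" where
  "open_manifold_tame_ends A B W \<longleftrightarrow>
     smooth_atlas A \<and> connected (UNIV :: 'a set) \<and> \<not> compact (UNIV :: 'a set) \<and>
     smooth_atlas B \<and> compact (UNIV :: 'z set) \<and> DIM('e) = DIM('f) + 1 \<and>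
     open W \<and> compact (closure W) \<and> (\<exists>\<Phi>. end_coordinates A B W \<Phi>)"

text \<open>\<open>cylindrical_metric A B W g h\<close>: \<open>g\<close> is a cylindrical metric with \<open>\<partial>\<^sub>\<infinity> g = h\<close>.
  The last condition is \<open>\<Phi>\<^sup>* g = h + dt\<^sup>2\<close> on \<open>Z \<times> [1,\<infinity>)\<close>.\<close>

definition cylindrical_metric ::
  "('a::topological_space, 'e::euclidean_space) atlas \<Rightarrow> ('z, 'f::euclidean_space) atlas \<Rightarrow>
    'a set \<Rightarrow> ('a, 'e) tensor2 \<Rightarrow> ('z, 'f) tensor2 \<Rightarrow> bool" where
  "cylindrical_metric A B W g h \<longleftrightarrow>
     riemannian_metric A g \<and> complete_metric A g \<and> riemannian_metric B h \<and>
     (\<exists>\<Phi>. end_coordinates A B W \<Phi> \<and>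
        (\<forall>c\<in>B. \<forall>d\<in>A. \<forall>z\<in>chart_dom c. \<forall>t\<ge>1. \<Phi> (z, t) \<in> chart_dom d \<longrightarrow>
          (let F = (\<lambda>(x, s). chart_map d (\<Phi> (chart_inv c x, s))); y = (chart_map c z, t) in
           \<forall>v w a b.
             g d (F y) (dir_deriv (v, a) F y) (dir_deriv (w, b) F y) = h c (fst y) v w + a * b)))"


section \<open>Volume, Sobolev functions and the Yamabe functional\<close>

definition riemannian_volume ::
  "('a::{t2_space, second_countable_topology}, real^'n) atlas \<Rightarrow> ('a, real^'n) tensor2 \<Rightarrow> 'a measure" where
  "riemannian_volume A g =
     (THE \<mu>. sets \<mu> = sets borel \<and>
        (\<forall>c\<in>A. \<forall>E\<in>sets borel. E \<subseteq> chart_dom c \<longrightarrow>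
           emeasure \<mu> E = (\<integral>\<^sup>+x\<in>chart_map c ` E.
              ennreal (sqrt (det (\<chi> i j. g c x (axis i 1) (axis j 1)))) \<partial>lborel)))"

definition test_function :: "'e::euclidean_space set \<Rightarrow> ('e \<Rightarrow> real) \<Rightarrow> bool" where
  "test_function V \<eta> \<longleftrightarrow>
     smooth_on \<eta> UNIV \<and> compact (closure {x. \<eta> x \<noteq> 0}) \<and> closure {x. \<eta> x \<noteq> 0} \<subseteq> V"

text \<open>
  The transformation law in \<open>covector_field\<close> is required everywhere, not just almost everywhere, so
  that pointwise quantities do not depend on the choice of a chart even for uncountable atlases; each
  weak differential has such a representative.
\<close>

definition weak_differential ::
  "('a, 'e::euclidean_space) atlas \<Rightarrow> ('a \<Rightarrow> real) \<Rightarrow> ('a, 'e) covector \<Rightarrow> bool" where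
  "weak_differential A u \<omega> \<longleftrightarrow> covector_field A \<omega> \<and>
     (\<forall>c\<in>A.
        (\<forall>K. compact K \<and> K \<subseteq> chart_img c \<longrightarrow>
           set_integrable lborel K (u \<circ> chart_inv c) \<and> set_integrable lborel K (\<omega> c)) \<and>
        (\<forall>\<eta> v. test_function (chart_img c) \<eta> \<longrightarrow>
           (LINT x:chart_img c|lborel. u (chart_inv c x) * dir_deriv v \<eta> x) =
           - (LINT x:chart_img c|lborel. (\<omega> c x \<bullet> v) * \<eta> x)))"

text \<open>
  \<open>u\<close> belongs to \<open>L\<^sup>1\<^sup>,\<^sup>2\<^sub>g\<close> and \<open>du\<close> is its weak differential. The latter is determined by \<open>u\<close> only
  up to null sets, so it is a second argument; the integrals below do not depend on its choice.
\<close>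

definition sobolev12 ::
  "('a::{t2_space, second_countable_topology}, real^'n) atlas \<Rightarrow> ('a, real^'n) tensor2 \<Rightarrow>
    ('a \<Rightarrow> real) \<Rightarrow> ('a, real^'n) covector \<Rightarrow> bool" where
  "sobolev12 A g u du \<longleftrightarrow>
     u \<in> borel_measurable borel \<and> weak_differential A u du \<and>
     integrable (riemannian_volume A g) (\<lambda>p. (u p)\<^sup>2) \<and>
     integrable (riemannian_volume A g) (covector_norm2 A g du)"

definition nonzero_ae ::
  "('a::{t2_space, second_countable_topology}, real^'n) atlas \<Rightarrow> ('a, real^'n) tensor2 \<Rightarrow>
    ('a \<Rightarrow> real) \<Rightarrow> bool" where
  "nonzero_ae A g u \<longleftrightarrow> \<not> (AE p in riemannian_volume A g. u p = 0)"

definition conf_coeff :: "nat \<Rightarrow> real" where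
  "conf_coeff n = 4 * (real n - 1) / (real n - 2)"

definition conf_energy ::
  "nat \<Rightarrow> ('a::{t2_space, second_countable_topology}, real^'n) atlas \<Rightarrow> ('a, real^'n) tensor2 \<Rightarrow>
    ('a \<Rightarrow> real) \<Rightarrow> ('a, real^'n) covector \<Rightarrow> real" where
  "conf_energy n A g u du =
     (LINT p|riemannian_volume A g.
        conf_coeff n * covector_norm2 A g du p + scalar_curvature A g p * (u p)\<^sup>2)"

text \<open>
  \<open>first_eigenvalue n B h\<close> is the first eigenvalue of \<open>-\<alpha>\<^sub>n \<Delta>\<^sub>h + R\<^sub>h\<close>. For the slice \<open>Z\<close> of a cylinder,
  \<open>n\<close> is \<open>dim Z + 1\<close>, hence it is a parameter and not \<open>CARD('k)\<close>.
\<close>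

definition first_eigenvalue ::
  "nat \<Rightarrow> ('z::{t2_space, second_countable_topology}, real^'k) atlas \<Rightarrow> ('z, real^'k) tensor2 \<Rightarrow> ereal" where
  "first_eigenvalue n B h =
     Inf {ereal (conf_energy n B h u du / (LINT p|riemannian_volume B h. (u p)\<^sup>2)) | u du.
            sobolev12 B h u du \<and> nonzero_ae B h u}"

text \<open>
  \<open>cylindrical_yamabe A g\<close> is the cylindrical Yamabe constant of the conformal class \<open>[g]\<close>, computed
  from its cylindrical representative \<open>g\<close>. On a cylindrical manifold the integrals are finite, by
  bounded geometry and the Sobolev embedding.
\<close>

definition cylindrical_yamabe ::
  "('a::{t2_space, second_countable_topology}, real^'n) atlas \<Rightarrow> ('a, real^'n) tensor2 \<Rightarrow> ereal" where
  "cylindrical_yamabe A g =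
     (let n = CARD('n) in
      Inf {ereal (conf_energy n A g u du /
                  (LINT p|riemannian_volume A g. \<bar>u p\<bar> powr (2 * n / (real n - 2))) powr ((real n - 2) / n))
           | u du. sobolev12 A g u du \<and> nonzero_ae A g u})"

end

theory Submission
  imports Defs
begin

text \<open>
  Given \<open>u\<close> on \<open>Z\<close> with negative conformal energy \<open>E\<close>, the function \<open>u(z) \<psi>((t - 2) / T)\<close> on the end,
  extended by zero, has conformal energy \<open>T a E + O(1 / T)\<close>, \<open>a = \<integral> \<psi>\<^sup>2\<close>, because the scalar curvature of \<open>h + dt\<^sup>2\<close>
  is that of \<open>h\<close>, while its \<open>L\<^sup>p\<close> norm enters the Yamabe quotient as a constant times \<open>T\<close> to the power
  \<open>(n - 2) / n < 1\<close>. So the quotient tends to \<open>-\<infinity>\<close> as \<open>T\<close> grows. For negative scalar curvature take \<open>u = 1\<close>.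

  Weak differentials are handled as local \<open>L\<^sup>1\<close> limits of classical differentials (\<open>sob_on\<close>), a notion which
  is visibly stable under changes of charts.
\<close>

section \<open>Calculus of smooth maps\<close>

text \<open>Three features of the definitions shape the proof. The Sobolev class is tested chart by
  chart, while the trial function is a product only in the coordinates of the end; so its
  differential must survive a change of coordinates between charts of X and charts of Z times a
  line, and C^1 approximants and cutoffs suffice for that. The volume and \<open>sharp\<close> are
  definite descriptions, and curvature is a coordinate formula read in some chosen chart; existence,
  uniqueness and invariance under isometries must be known before an integral over the end can be
  compared with one over Z. Finally, the integral of a nonintegrable function is 0 by convention, so
  every integral in the quotient has to be shown finite; this is why the function on Z is made
  bounded.

  The trial functions live on t >= 2, whereas the metric is a product from t = 1 on. The geometry of
  W therefore never enters the estimate, and the strip between 1 and 2 makes extension by zero a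
  local matter on open sets.\<close>

lemma dir_deriv_eq: "(f has_derivative f') (at x) \<Longrightarrow> dir_deriv v f x = f' v"
  by (metis dir_deriv_def frechet_derivative_at)

lemma has_derivative_dir_deriv:
  "f differentiable (at x) \<Longrightarrow> (f has_derivative (\<lambda>v. dir_deriv v f x)) (at x)"
  by (simp add: dir_deriv_def[abs_def] frechet_derivative_works[symmetric])

lemma linear_dir_deriv: "f differentiable (at x) \<Longrightarrow> linear (\<lambda>v. dir_deriv v f x)"
  by (rule has_derivative_linear[OF has_derivative_dir_deriv])

lemma dir_deriv_expand:
  fixes f :: "'e::euclidean_space \<Rightarrow> 'f::real_normed_vector"
  assumes "f differentiable (at x)"
  shows "dir_deriv v f x = (\<Sum>i\<in>Basis. (v \<bullet> i) *\<^sub>R dir_deriv i f x)"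
proof -
  interpret linear "\<lambda>v. dir_deriv v f x" by (rule linear_dir_deriv[OF assms])
  have "dir_deriv (\<Sum>i\<in>Basis. (v \<bullet> i) *\<^sub>R i) f x = (\<Sum>i\<in>Basis. (v \<bullet> i) *\<^sub>R dir_deriv i f x)"
    by (simp add: sum scale)
  then show ?thesis by (simp add: euclidean_representation)
qed

lemma dir_deriv_cong:
  assumes "open S" "x \<in> S" "\<And>y. y \<in> S \<Longrightarrow> f y = g y"
  shows "dir_deriv v f x = dir_deriv v g x"
proof -
  have "(f has_derivative D) (at x) \<longleftrightarrow> (g has_derivative D) (at x)" for D
    using has_derivative_transform_within_open[of f D x UNIV S g]
      has_derivative_transform_within_open[of g D x UNIV S f] assms by auto
  then show ?thesis unfolding dir_deriv_def frechet_derivative_def by simp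
qed

lemma differentiable_cong_open:
  assumes "open S" "x \<in> S" "\<And>y. y \<in> S \<Longrightarrow> f y = g y" "f differentiable (at x)"
  shows "g differentiable (at x)"
  using assms has_derivative_transform_within_open[of f _ x UNIV S g] unfolding differentiable_def by blast

section \<open>Functions of class C^k\<close>

lemma Ck_on_cong:
  assumes "open S" "\<And>y. y \<in> S \<Longrightarrow> f y = g y" "Ck_on k f S"
  shows "Ck_on k g S"
  using assms(2,3)
proof (induction k arbitrary: f g)
  case 0 then show ?case by (simp cong: continuous_on_cong)
next
  case (Suc k)
  have "g differentiable (at x)" if "x \<in> S" for x
    using differentiable_cong_open[OF assms(1) that, of f g] Suc.prems that by auto
  moreover have "Ck_on k (dir_deriv v g) S" for v
  proof (rule Suc.IH)
    show "Ck_on k (dir_deriv v f) S" using Suc.prems by simp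
    show "dir_deriv v f y = dir_deriv v g y" if "y \<in> S" for y
      using dir_deriv_cong[OF assms(1) that] Suc.prems by blast
  qed
  ultimately show ?case by simp
qed

lemma Ck_on_subset: "Ck_on k f S \<Longrightarrow> T \<subseteq> S \<Longrightarrow> Ck_on k f T"
  by (induction k arbitrary: f) (auto intro: continuous_on_subset)

lemma Ck_on_local:
  assumes "open S" "\<And>x. x \<in> S \<Longrightarrow> \<exists>N. open N \<and> x \<in> N \<and> Ck_on k f (N \<inter> S)"
  shows "Ck_on k f S"
  using assms(2)
proof (induction k arbitrary: f)
  case 0
  show ?case unfolding Ck_on.simps
  proof (rule continuous_at_imp_continuous_on, rule ballI)
    fix x assume "x \<in> S"
    then obtain N where "open N" "x \<in> N" "continuous_on (N \<inter> S) f" using 0 by force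
    then show "isCont f x"
      using continuous_on_eq_continuous_at[of "N \<inter> S" f] \<open>open S\<close> \<open>x \<in> S\<close> by auto
  qed
next
  case (Suc k)
  show ?case unfolding Ck_on.simps
  proof (intro conjI ballI allI)
    fix x assume "x \<in> S"
    then obtain N where "open N" "x \<in> N" "Ck_on (Suc k) f (N \<inter> S)" using Suc.prems by meson
    then show "f differentiable at x" using \<open>x \<in> S\<close> by simp
  next
    fix v show "Ck_on k (dir_deriv v f) S"
    proof (rule Suc.IH)
      fix x assume "x \<in> S"
      then obtain N where "open N" "x \<in> N" "Ck_on (Suc k) f (N \<inter> S)" using Suc.prems by meson
      then show "\<exists>N. open N \<and> x \<in> N \<and> Ck_on k (dir_deriv v f) (N \<inter> S)" by auto
    qed
  qed
qed

lemma Ck_on_imp_continuous_on: "Ck_on k f S \<Longrightarrow> continuous_on S f"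
  by (cases k) (auto intro!: continuous_at_imp_continuous_on differentiable_imp_continuous_within)

text \<open>The recursion for order k + 1 does not list the lower orders, so monotonicity in k needs
  an induction of its own.\<close>

lemma Ck_on_Suc_imp: "Ck_on (Suc k) f S \<Longrightarrow> Ck_on k f S"
proof (induction k arbitrary: f)
  case 0 then show ?case using Ck_on_imp_continuous_on by fastforce
next
  case (Suc k)
  then have "\<forall>v. Ck_on (Suc k) (dir_deriv v f) S" "\<forall>x\<in>S. f differentiable at x" by auto
  then show ?case using Suc.IH by auto
qed

lemma Ck_on_const: "Ck_on k (\<lambda>x::'e::euclidean_space. a) S"
proof (induction k arbitrary: a)
  case (Suc k)
  have "dir_deriv v (\<lambda>x::'e. a) = (\<lambda>x. 0)" for v
    by (rule ext, rule dir_deriv_eq) simp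
  then show ?case using Suc by simp
qed simp

lemma Ck_on_linear:
  assumes "bounded_linear f" shows "Ck_on k f S"
proof (cases k)
  case 0 then show ?thesis by (simp add: linear_continuous_on assms)
next
  case (Suc k')
  have "(f has_derivative f) (at x)" for x by (rule bounded_linear_imp_has_derivative[OF assms])
  moreover from this have "dir_deriv v f = (\<lambda>x. f v)" for v
    by (intro ext dir_deriv_eq)
  ultimately show ?thesis using Suc by (auto simp: Ck_on_const differentiable_def)
qed

lemma Ck_on_add:
  assumes "open S" "Ck_on k f S" "Ck_on k g S"
  shows "Ck_on k (\<lambda>x. f x + g x) S"
  using assms(2,3)
proof (induction k arbitrary: f g)
  case 0 then show ?case by (auto intro: continuous_on_add)
next
  case (Suc k)
  have "Ck_on k (dir_deriv v (\<lambda>x. f x + g x)) S" for v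
  proof (rule Ck_on_cong[OF assms(1)])
    show "Ck_on k (\<lambda>x. dir_deriv v f x + dir_deriv v g x) S" using Suc by simp
    show "dir_deriv v f y + dir_deriv v g y = dir_deriv v (\<lambda>x. f x + g x) y" if "y \<in> S" for y
      using Suc.prems that
      by (intro dir_deriv_eq[symmetric] has_derivative_add has_derivative_dir_deriv) auto
  qed
  then show ?case using Suc.prems by (auto intro: differentiable_add)
qed

lemma Ck_on_bilinear:
  assumes "bounded_bilinear b" "open S" "Ck_on k f S" "Ck_on k g S"
  shows "Ck_on k (\<lambda>x. b (f x) (g x)) S"
  using assms(3,4)
proof (induction k arbitrary: f g)
  case 0 then show ?case by (auto intro: bounded_bilinear.continuous_on[OF assms(1)])
next
  case (Suc k)
  have D: "((\<lambda>x. b (f x) (g x)) has_derivative (\<lambda>v. b (f y) (dir_deriv v g y) + b (dir_deriv v f y) (g y))) (at y)"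
    if "y \<in> S" for y using Suc.prems that
    by (intro bounded_bilinear.FDERIV[OF assms(1)] has_derivative_dir_deriv) auto
  have "Ck_on k (dir_deriv v (\<lambda>x. b (f x) (g x))) S" for v
  proof (rule Ck_on_cong[OF assms(2)])
    show "Ck_on k (\<lambda>x. b (f x) (dir_deriv v g x) + b (dir_deriv v f x) (g x)) S"
      using Suc.prems Suc.prems[THEN Ck_on_Suc_imp] by (intro Ck_on_add assms(2) Suc.IH) auto
    show "b (f y) (dir_deriv v g y) + b (dir_deriv v f y) (g y) = dir_deriv v (\<lambda>x. b (f x) (g x)) y"
      if "y \<in> S" for y
      by (rule dir_deriv_eq[OF D[OF that], symmetric])
  qed
  then show ?case using D by (auto simp: differentiable_def)
qed

lemma Ck_on_sum:
  assumes "open S" "\<And>i. i \<in> I \<Longrightarrow> Ck_on k (f i) S"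
  shows "Ck_on k (\<lambda>x. \<Sum>i\<in>I. f i x) S"
  using assms(2) by (induction I rule: infinite_finite_induct) (auto intro: Ck_on_add[OF assms(1)] Ck_on_const)

text \<open>By the chain rule f is differentiated in the direction \<open>dir_deriv v g x\<close>,
  which varies with the point, while the induction hypothesis covers constant directions only.
  Expanding that direction in the basis leaves sums of products of functions of class C^k.\<close>

lemma Ck_on_compose:
  fixes f :: "'f::euclidean_space \<Rightarrow> 'g::real_normed_vector" and g :: "'e::euclidean_space \<Rightarrow> 'f"
  assumes "open S" "open T" "g ` S \<subseteq> T" "Ck_on k g S" "Ck_on k f T"
  shows "Ck_on k (\<lambda>x. f (g x)) S"
  using assms(4,5)
proof (induction k arbitrary: f)
  case 0 then show ?case using assms(3) continuous_on_compose2[of T f S g] by simp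
next
  case (Suc k)
  have D: "((\<lambda>x. f (g x)) has_derivative (\<lambda>v. dir_deriv (dir_deriv v g y) f (g y))) (at y)"
    if "y \<in> S" for y
    using Suc.prems that assms(3)
    by (intro has_derivative_compose[of g _ y UNIV f] has_derivative_dir_deriv) auto
  have "Ck_on k (dir_deriv v (\<lambda>x. f (g x))) S" for v
  proof (rule Ck_on_cong[OF assms(1)])
    show "Ck_on k (\<lambda>x. \<Sum>i\<in>Basis. (dir_deriv v g x \<bullet> i) *\<^sub>R dir_deriv i f (g x)) S"
      using Suc.prems Suc.prems(1)[THEN Ck_on_Suc_imp]
      by (intro Ck_on_sum assms(1) Ck_on_bilinear[OF bounded_bilinear_scaleR]
          Ck_on_bilinear[OF bounded_bilinear_inner] Ck_on_const Suc.IH) auto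
    show "(\<Sum>i\<in>Basis. (dir_deriv v g y \<bullet> i) *\<^sub>R dir_deriv i f (g y)) = dir_deriv v (\<lambda>x. f (g x)) y"
      if "y \<in> S" for y
    proof -
      have "f differentiable (at (g y))" using Suc.prems that assms(3) by auto
      then show ?thesis using dir_deriv_eq[OF D[OF that]] dir_deriv_expand by metis
    qed
  qed
  then show ?case using D by (auto simp: differentiable_def)
qed

section \<open>Smooth functions\<close>

lemma smooth_on_Ck: "smooth_on f S \<Longrightarrow> Ck_on k f S"
  by (simp add: smooth_on_def)

lemma smooth_on_differentiable: "smooth_on f S \<Longrightarrow> x \<in> S \<Longrightarrow> f differentiable (at x)"
  using smooth_on_Ck[of f S "Suc 0"] by auto

lemma smooth_on_has_derivative:
  "smooth_on f S \<Longrightarrow> x \<in> S \<Longrightarrow> (f has_derivative (\<lambda>v. dir_deriv v f x)) (at x)"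
  by (rule has_derivative_dir_deriv[OF smooth_on_differentiable])

lemma smooth_on_dir_deriv: "smooth_on f S \<Longrightarrow> smooth_on (dir_deriv v f) S"
  unfolding smooth_on_def by (metis Ck_on.simps(2))

lemma smooth_on_continuous_on: "smooth_on f S \<Longrightarrow> continuous_on S f"
  using smooth_on_Ck Ck_on_imp_continuous_on by blast

lemma smooth_on_subset: "smooth_on f S \<Longrightarrow> T \<subseteq> S \<Longrightarrow> smooth_on f T"
  unfolding smooth_on_def by (blast intro: Ck_on_subset)

lemma smooth_on_cong:
  assumes "open S" "\<And>y. y \<in> S \<Longrightarrow> f y = g y" "smooth_on f S"
  shows "smooth_on g S"
  using assms Ck_on_cong unfolding smooth_on_def by blast

lemma smooth_on_local:
  assumes "open S" "\<And>x. x \<in> S \<Longrightarrow> \<exists>N. open N \<and> x \<in> N \<and> smooth_on f (N \<inter> S)"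
  shows "smooth_on f S"
  using Ck_on_local[OF assms(1)] assms(2) unfolding smooth_on_def by meson

lemma smooth_on_const: "smooth_on (\<lambda>x. a) S"
  by (simp add: smooth_on_def Ck_on_const)

lemma smooth_on_linear: "bounded_linear f \<Longrightarrow> smooth_on f S"
  by (simp add: smooth_on_def Ck_on_linear)

lemma smooth_on_add: "open S \<Longrightarrow> smooth_on f S \<Longrightarrow> smooth_on g S \<Longrightarrow> smooth_on (\<lambda>x. f x + g x) S"
  by (simp add: smooth_on_def Ck_on_add)

lemma smooth_on_bilinear:
  "bounded_bilinear b \<Longrightarrow> open S \<Longrightarrow> smooth_on f S \<Longrightarrow> smooth_on g S \<Longrightarrow> smooth_on (\<lambda>x. b (f x) (g x)) S"
  by (simp add: smooth_on_def Ck_on_bilinear)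

lemmas smooth_on_mult = smooth_on_bilinear[OF bounded_bilinear_mult]
lemmas smooth_on_scaleR = smooth_on_bilinear[OF bounded_bilinear_scaleR]
lemmas smooth_on_inner = smooth_on_bilinear[OF bounded_bilinear_inner]

lemma smooth_on_sum: "open S \<Longrightarrow> (\<And>i. i \<in> I \<Longrightarrow> smooth_on (f i) S) \<Longrightarrow> smooth_on (\<lambda>x. \<Sum>i\<in>I. f i x) S"
  by (simp add: smooth_on_def Ck_on_sum)

lemma smooth_on_compose:
  fixes f :: "'f::euclidean_space \<Rightarrow> 'g::real_normed_vector" and g :: "'e::euclidean_space \<Rightarrow> 'f"
  shows "open S \<Longrightarrow> open T \<Longrightarrow> g ` S \<subseteq> T \<Longrightarrow> smooth_on g S \<Longrightarrow> smooth_on f T \<Longrightarrow> smooth_on (\<lambda>x. f (g x)) S"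
  unfolding smooth_on_def using Ck_on_compose by blast

lemma smooth_on_diff: "open S \<Longrightarrow> smooth_on f S \<Longrightarrow> smooth_on g S \<Longrightarrow> smooth_on (\<lambda>x. f x - g x) S"
  using smooth_on_add[of S f "\<lambda>x. (-1) *\<^sub>R g x"] smooth_on_scaleR[OF _ smooth_on_const, of S g "-1"] by simp

lemma Ck_on_bounded_linear:
  assumes "bounded_linear L" "open S" "Ck_on k h S"
  shows "Ck_on k (\<lambda>x. L (h x)) S"
  using assms(3)
proof (induction k arbitrary: h)
  case 0 then show ?case using assms(1) by (auto intro: bounded_linear.continuous_on)
next
  case (Suc k)
  have D: "((\<lambda>x. L (h x)) has_derivative (\<lambda>v. L (dir_deriv v h y))) (at y)" if "y \<in> S" for y
    using Suc.prems that assms(1)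
    by (intro bounded_linear.has_derivative[OF assms(1)] has_derivative_dir_deriv) auto
  have "Ck_on k (dir_deriv v (\<lambda>x. L (h x))) S" for v
    using Suc.prems by (intro Ck_on_cong[OF assms(2) _ Suc.IH]) (auto simp: dir_deriv_eq[OF D])
  then show ?case using D by (auto simp: differentiable_def)
qed

lemma smooth_on_Pair:
  assumes "open S" "smooth_on f S" "smooth_on g S"
  shows "smooth_on (\<lambda>x. (f x, g x)) S"
proof -
  have l: "bounded_linear (\<lambda>x. (x, 0))" "bounded_linear (\<lambda>x. (0, x))"
    by (auto intro!: bounded_linear_intros)
  have "Ck_on k (\<lambda>x. (f x, 0) + (0, g x)) S" for k
    using assms by (intro Ck_on_add Ck_on_bounded_linear[OF l(1)] Ck_on_bounded_linear[OF l(2)] smooth_on_Ck)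
  then show ?thesis by (simp add: smooth_on_def)
qed

lemma bounded_linear_euclidean:
  fixes L :: "'e::euclidean_space \<Rightarrow> 'f::real_normed_vector"
  shows "linear L \<Longrightarrow> bounded_linear L"
  by (simp add: linear_conv_bounded_linear)

text \<open>
  The mixed difference quotient \<open>(f (x + su + sv) - f (x + su) - f (x + sv) + f x) / s\<^sup>2\<close>
  is symmetric in \<open>u\<close>, \<open>v\<close> and tends to the second derivative.
\<close>

lemma mixed_difference_tendsto:
  fixes f :: "'e::euclidean_space \<Rightarrow> real"
  assumes "open S" "smooth_on f S" "x \<in> S"
  shows "((\<lambda>s. (f (x + s *\<^sub>R u + s *\<^sub>R v) - f (x + s *\<^sub>R u) - f (x + s *\<^sub>R v) + f x) / s\<^sup>2)
      \<longlongrightarrow> dir_deriv v (dir_deriv u f) x) (at_right 0)"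
proof (rule tendstoI)
  fix e :: real assume "e > 0"
  let ?h = "dir_deriv v (dir_deriv u f)"
  have "continuous_on S ?h" by (intro smooth_on_continuous_on smooth_on_dir_deriv assms)
  then have "isCont ?h x" using assms by (simp add: continuous_on_eq_continuous_at)
  then obtain d where d: "d > 0" "\<And>y. dist y x < d \<Longrightarrow> dist (?h y) (?h x) < e"
    using \<open>e > 0\<close> unfolding continuous_at_eps_delta by (metis dist_commute)
  obtain d' where d': "d' > 0" "ball x d' \<subseteq> S" using assms open_contains_ball by blast
  \<comment> \<open>For 0 <= a, b <= s < r the point x + a u + b v stays within
    \<open>min d d'\<close> of x. The summand 1 avoids division by zero when u and v vanish.\<close>
  define r where "r = min d d' / (norm u + norm v + 1)"
  have "r > 0" using d(1) d'(1) by (auto simp: r_def intro!: divide_pos_pos add_nonneg_pos)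
  have near: "dist (x + a *\<^sub>R u + b *\<^sub>R v) x < min d d'" if "0 \<le> a" "a \<le> s" "0 \<le> b" "b \<le> s" "0 < s" "s < r" for a b s
  proof -
    have "dist (x + a *\<^sub>R u + b *\<^sub>R v) x \<le> norm (a *\<^sub>R u) + norm (b *\<^sub>R v)"
      using norm_triangle_ineq[of "a *\<^sub>R u" "b *\<^sub>R v"] by (simp add: dist_norm add.assoc)
    also have "\<dots> \<le> s * norm u + s * norm v"
      using that by (intro add_mono) (auto intro!: mult_right_mono)
    also have "\<dots> < s * (norm u + norm v + 1)" using that by (simp add: algebra_simps)
    also have "\<dots> \<le> r * (norm u + norm v + 1)" using that by (intro mult_right_mono) auto
    also have "\<dots> = min d d'" by (simp add: r_def add_nonneg_eq_0_iff)
    finally show ?thesis .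
  qed
  have inS: "x + a *\<^sub>R u + b *\<^sub>R v \<in> S" if "0 \<le> a" "a \<le> s" "0 \<le> b" "b \<le> s" "0 < s" "s < r" for a b s
    using near[OF that] d'(2) by (auto simp: dist_commute)
  have "dist ((f (x + s *\<^sub>R u + s *\<^sub>R v) - f (x + s *\<^sub>R u) - f (x + s *\<^sub>R v) + f x) / s\<^sup>2) (?h x) < e"
    if s: "0 < s" "s < r" for s
  proof -
    \<comment> \<open>The mean value theorem is applied twice: to g in the direction u, and then,
      with a fixed, to k in the direction v.\<close>
    define g where "g = (\<lambda>a. f (x + a *\<^sub>R u + s *\<^sub>R v) - f (x + a *\<^sub>R u))"
    have dg: "DERIV g a :> dir_deriv u f (x + a *\<^sub>R u + s *\<^sub>R v) - dir_deriv u f (x + a *\<^sub>R u)"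
      if "0 \<le> a" "a \<le> s" for a
    proof -
      have D: "((\<lambda>a. f (x + a *\<^sub>R u + b *\<^sub>R v)) has_derivative (\<lambda>h. dir_deriv (h *\<^sub>R u) f (x + a *\<^sub>R u + b *\<^sub>R v))) (at a)"
        if "b = 0 \<or> b = s" for b
      proof -
        have 1: "((\<lambda>a. x + a *\<^sub>R u + b *\<^sub>R v) has_derivative (\<lambda>h. h *\<^sub>R u)) (at a)"
          by (auto intro!: derivative_eq_intros)
        have 2: "(f has_derivative (\<lambda>v'. dir_deriv v' f (x + a *\<^sub>R u + b *\<^sub>R v))) (at (x + a *\<^sub>R u + b *\<^sub>R v))"
          using inS[of a s b] that s \<open>0 \<le> a\<close> \<open>a \<le> s\<close> by (intro smooth_on_has_derivative[OF assms(2)]) auto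
        show ?thesis by (rule has_derivative_compose[OF 1 2])
      qed
      have L: "dir_deriv (h *\<^sub>R u) f y = h * dir_deriv u f y" if "y \<in> S" for h y
        using linear_scale[OF linear_dir_deriv[OF smooth_on_differentiable[OF assms(2) that]]] by simp
      have "(g has_derivative (\<lambda>h. dir_deriv (h *\<^sub>R u) f (x + a *\<^sub>R u + s *\<^sub>R v) - dir_deriv (h *\<^sub>R u) f (x + a *\<^sub>R u + 0 *\<^sub>R v))) (at a)"
        unfolding g_def using has_derivative_diff[OF D[of s] D[of 0]] by simp
      moreover have "(\<lambda>h. dir_deriv (h *\<^sub>R u) f (x + a *\<^sub>R u + s *\<^sub>R v) - dir_deriv (h *\<^sub>R u) f (x + a *\<^sub>R u + 0 *\<^sub>R v))
         = (\<lambda>h. (dir_deriv u f (x + a *\<^sub>R u + s *\<^sub>R v) - dir_deriv u f (x + a *\<^sub>R u)) * h)"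
        using inS[of a s s] inS[of a s 0] that s by (auto simp: L algebra_simps)
      ultimately show ?thesis by (simp add: has_field_derivative_def)
    qed
    obtain a where a: "0 < a" "a < s"
      "g s - g 0 = (s - 0) * (dir_deriv u f (x + a *\<^sub>R u + s *\<^sub>R v) - dir_deriv u f (x + a *\<^sub>R u))"
      using MVT2[OF s(1) dg] by blast
    define k where "k = (\<lambda>b. dir_deriv u f (x + a *\<^sub>R u + b *\<^sub>R v))"
    have dk: "DERIV k b :> ?h (x + a *\<^sub>R u + b *\<^sub>R v)" if "0 \<le> b" "b \<le> s" for b
    proof -
      have "x + a *\<^sub>R u + b *\<^sub>R v \<in> S" using inS[of a s b] that a s by auto
      note df = smooth_on_differentiable[OF smooth_on_dir_deriv[OF assms(2)] this, of u]
      have "(k has_derivative (\<lambda>h. dir_deriv (h *\<^sub>R v) (dir_deriv u f) (x + a *\<^sub>R u + b *\<^sub>R v))) (at b)"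
        unfolding k_def
      proof -
        have "((\<lambda>b. x + a *\<^sub>R u + b *\<^sub>R v) has_derivative (\<lambda>h. h *\<^sub>R v)) (at b)"
          by (auto intro!: derivative_eq_intros)
        from has_derivative_compose[OF this has_derivative_dir_deriv[OF df]] show "((\<lambda>b. dir_deriv u f (x + a *\<^sub>R u + b *\<^sub>R v)) has_derivative (\<lambda>h. dir_deriv (h *\<^sub>R v) (dir_deriv u f) (x + a *\<^sub>R u + b *\<^sub>R v))) (at b)" .
      qed
      moreover have "(\<lambda>h. dir_deriv (h *\<^sub>R v) (dir_deriv u f) (x + a *\<^sub>R u + b *\<^sub>R v)) = (\<lambda>h. ?h (x + a *\<^sub>R u + b *\<^sub>R v) * h)"
        by (intro ext) (simp add: linear_scale[OF linear_dir_deriv[OF df]])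
      ultimately show ?thesis by (simp add: has_field_derivative_def)
    qed
    obtain b where b: "0 < b" "b < s" "k s - k 0 = (s - 0) * ?h (x + a *\<^sub>R u + b *\<^sub>R v)"
      using MVT2[OF s(1) dk] by blast
    have "f (x + s *\<^sub>R u + s *\<^sub>R v) - f (x + s *\<^sub>R u) - f (x + s *\<^sub>R v) + f x = g s - g 0"
      by (simp add: g_def)
    also have "\<dots> = s\<^sup>2 * ?h (x + a *\<^sub>R u + b *\<^sub>R v)"
      using a(3) b(3) by (simp add: k_def power2_eq_square)
    finally have "(f (x + s *\<^sub>R u + s *\<^sub>R v) - f (x + s *\<^sub>R u) - f (x + s *\<^sub>R v) + f x) / s\<^sup>2 = ?h (x + a *\<^sub>R u + b *\<^sub>R v)"
      using s by simp
    then show ?thesis using d(2) near[of a s b] a b s by simp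
  qed
  then show "\<forall>\<^sub>F s in at_right 0. dist ((f (x + s *\<^sub>R u + s *\<^sub>R v) - f (x + s *\<^sub>R u) - f (x + s *\<^sub>R v) + f x) / s\<^sup>2) (?h x) < e"
    unfolding eventually_at_right_field using \<open>r > 0\<close> by blast
qed

lemma dir_deriv_commute_real:
  fixes f :: "'e::euclidean_space \<Rightarrow> real"
  assumes "open S" "smooth_on f S" "x \<in> S"
  shows "dir_deriv u (dir_deriv v f) x = dir_deriv v (dir_deriv u f) x"
proof (rule tendsto_unique[OF _ _ mixed_difference_tendsto[OF assms, of u v]])
  have "(\<lambda>s. (f (x + s *\<^sub>R v + s *\<^sub>R u) - f (x + s *\<^sub>R v) - f (x + s *\<^sub>R u) + f x) / s\<^sup>2)
     = (\<lambda>s. (f (x + s *\<^sub>R u + s *\<^sub>R v) - f (x + s *\<^sub>R u) - f (x + s *\<^sub>R v) + f x) / s\<^sup>2)"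
    by (auto simp: algebra_simps)
  then show "((\<lambda>s. (f (x + s *\<^sub>R u + s *\<^sub>R v) - f (x + s *\<^sub>R u) - f (x + s *\<^sub>R v) + f x) / s\<^sup>2)
    \<longlongrightarrow> dir_deriv u (dir_deriv v f) x) (at_right 0)"
    using mixed_difference_tendsto[OF assms, of v u] by simp
qed simp

lemma dir_deriv_inner:
  assumes "f differentiable (at x)"
  shows "dir_deriv v (\<lambda>x. f x \<bullet> a) x = dir_deriv v f x \<bullet> a"
  by (rule dir_deriv_eq) (rule has_derivative_inner_left[OF has_derivative_dir_deriv[OF assms]])

lemma dir_deriv_commute:
  fixes f :: "'e::euclidean_space \<Rightarrow> 'f::euclidean_space"
  assumes "open S" "smooth_on f S" "x \<in> S"
  shows "dir_deriv u (dir_deriv v f) x = dir_deriv v (dir_deriv u f) x"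
proof (rule euclidean_eqI)
  fix a :: 'f
  have *: "dir_deriv u (dir_deriv v f) x \<bullet> a = dir_deriv u (dir_deriv v (\<lambda>x. f x \<bullet> a)) x" for u v
  proof -
    have "dir_deriv u (dir_deriv v f) x \<bullet> a = dir_deriv u (\<lambda>y. dir_deriv v f y \<bullet> a) x"
      using smooth_on_differentiable[OF smooth_on_dir_deriv[OF assms(2)] assms(3)] by (simp add: dir_deriv_inner)
    also have "\<dots> = dir_deriv u (dir_deriv v (\<lambda>x. f x \<bullet> a)) x"
      using smooth_on_differentiable[OF assms(2)]
      by (intro dir_deriv_cong[OF assms(1,3)]) (simp add: dir_deriv_inner)
    finally show ?thesis .
  qed
  have "smooth_on (\<lambda>x. f x \<bullet> a) S"
    by (intro smooth_on_inner assms smooth_on_const)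
  from dir_deriv_commute_real[OF assms(1) this assms(3)]
  show "dir_deriv u (dir_deriv v f) x \<bullet> a = dir_deriv v (dir_deriv u f) x \<bullet> a"
    by (simp add: *)
qed

subsection \<open>A smooth bump function\<close>

text \<open>The power in the denominator closes the family under differentiation up to linear
  combinations; \<open>flat_exp 0\<close> is the standard flat function exp (-1/s).\<close>

definition flat_exp :: "nat \<Rightarrow> real \<Rightarrow> real" where
  "flat_exp j s = (if s \<le> 0 then 0 else exp (- (1 / s)) / s ^ j)"

lemma flat_exp_tendsto_0: "(flat_exp j \<longlongrightarrow> 0) (at_right 0)"
proof -
  have "((\<lambda>s::real. (1 / s) ^ j / exp (1 / s)) \<longlongrightarrow> 0) (at_right 0)"
    using filterlim_compose[OF tendsto_power_div_exp_0[of j] filterlim_inverse_at_top_right]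
    by (simp add: inverse_eq_divide)
  then show ?thesis
    by (rule Lim_transform_eventually)
      (auto simp: eventually_at_right_field flat_exp_def power_divide exp_minus field_simps intro!: exI[of _ 1])
qed

lemma flat_exp_deriv:
  "(flat_exp j has_real_derivative (flat_exp (j + 2) s - real j * flat_exp (j + 1) s)) (at s)"
proof -
  consider "s < 0" | "s = 0" | "s > 0" by linarith
  then show ?thesis
  proof cases
    case 1
    have "((\<lambda>_. 0) has_real_derivative 0) (at s)" by simp
    then have "(flat_exp j has_real_derivative 0) (at s)"
      by (rule has_field_derivative_transform_within_open[where S="{..<0}"]) (use 1 in \<open>auto simp: flat_exp_def\<close>)
    then show ?thesis using 1 by (simp add: flat_exp_def)
  next
    case 2
    \<comment> \<open>At 0 the right difference quotient is \<open>flat_exp (Suc j)\<close> itself,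
      so the limit just established for all exponents applies.\<close>
    have "((\<lambda>h. flat_exp j h / h) \<longlongrightarrow> 0) (at_right 0)"
      by (rule Lim_transform_eventually[OF flat_exp_tendsto_0[of "Suc j"]])
        (auto simp: eventually_at_right_field flat_exp_def field_simps intro!: exI[of _ 1])
    moreover have "((\<lambda>h. flat_exp j h / h) \<longlongrightarrow> 0) (at_left 0)"
      by (rule Lim_transform_eventually[OF tendsto_const])
        (auto simp: eventually_at_left_field flat_exp_def intro!: exI[of _ "-1"])
    ultimately have "((\<lambda>h. flat_exp j h / h) \<longlongrightarrow> 0) (at 0)" by (simp add: filterlim_at_split)
    then show ?thesis using 2 by (simp add: DERIV_def flat_exp_def)
  next
    case 3
    have "((\<lambda>s. exp (- (1 / s)) / s ^ j) has_real_derivative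
       (exp (- (1 / s)) * (1 / s^2) * s ^ j - exp (- (1 / s)) * (real j * s ^ (j - 1))) / (s ^ j * s ^ j)) (at s)"
      using 3 by (auto intro!: derivative_eq_intros simp: power2_eq_square)
    moreover have "(exp (- (1 / s)) * (1 / s^2) * s ^ j - exp (- (1 / s)) * (real j * s ^ (j - 1))) / (s ^ j * s ^ j)
      = flat_exp (j + 2) s - real j * flat_exp (j + 1) s"
      using 3 by (cases j) (auto simp: flat_exp_def field_simps power2_eq_square)
    ultimately have "((\<lambda>s. exp (- (1 / s)) / s ^ j) has_real_derivative flat_exp (j + 2) s - real j * flat_exp (j + 1) s) (at s)"
      by simp
    then show ?thesis
      by (rule has_field_derivative_transform_within_open[where S="{0<..}"]) (use 3 in \<open>auto simp: flat_exp_def\<close>)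
  qed
qed

text \<open>A class of differentiable functions that contains the bump and is closed under
  directional derivatives. Membership gives smoothness by induction on the order, with no formula
  for higher derivatives.\<close>

inductive bump_algebra :: "('e::euclidean_space \<Rightarrow> real) \<Rightarrow> bool" where
  flat: "bump_algebra (\<lambda>x. flat_exp j (1 - x \<bullet> x))"
| inner: "bump_algebra (\<lambda>x. x \<bullet> v)"
| const: "bump_algebra (\<lambda>x. a)"
| add: "bump_algebra f \<Longrightarrow> bump_algebra g \<Longrightarrow> bump_algebra (\<lambda>x. f x + g x)"
| mult: "bump_algebra f \<Longrightarrow> bump_algebra g \<Longrightarrow> bump_algebra (\<lambda>x. f x * g x)"

lemma bump_algebra_deriv:
  "bump_algebra f \<Longrightarrow> (\<forall>x. f differentiable (at x)) \<and> (\<forall>v. bump_algebra (dir_deriv v f))"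
proof (induction rule: bump_algebra.induct)
  case (flat j)
  have D: "((\<lambda>x. flat_exp j (1 - x \<bullet> x)) has_derivative
     (\<lambda>v. (flat_exp (j+2) (1 - x \<bullet> x) + (- real j) * flat_exp (j+1) (1 - x \<bullet> x)) * ((-2) * (x \<bullet> v)))) (at x)" for x :: 'a
    by (rule has_derivative_eq_rhs)
      (rule has_derivative_compose[OF _ has_field_derivative_imp_has_derivative[OF flat_exp_deriv]],
       auto intro!: derivative_eq_intros simp: inner_commute)
  have "dir_deriv v (\<lambda>x::'a. flat_exp j (1 - x \<bullet> x)) =
     (\<lambda>x. (flat_exp (j+2) (1 - x \<bullet> x) + (- real j) * flat_exp (j+1) (1 - x \<bullet> x)) * ((-2) * (x \<bullet> v)))" for v
    by (intro ext dir_deriv_eq[OF D])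
  moreover have "bump_algebra (\<lambda>x::'a. (flat_exp (j+2) (1 - x \<bullet> x) + (- real j) * flat_exp (j+1) (1 - x \<bullet> x)) * ((-2) * (x \<bullet> v)))" for v
    by (intro bump_algebra.intros)
  ultimately have "bump_algebra (dir_deriv v (\<lambda>x::'a. flat_exp j (1 - x \<bullet> x)))" for v by simp
  moreover have "(\<lambda>x. flat_exp j (1 - x \<bullet> x)) differentiable (at x)" for x :: 'a
    unfolding differentiable_def using D by blast
  ultimately show ?case by blast
next
  case (inner v)
  have D: "((\<lambda>x::'a. x \<bullet> v) has_derivative (\<lambda>w. w \<bullet> v)) (at x)" for x
    by (auto intro!: derivative_eq_intros)
  have "dir_deriv w (\<lambda>x::'a. x \<bullet> v) = (\<lambda>x. w \<bullet> v)" for w by (intro ext dir_deriv_eq[OF D])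
  then show ?case using D by (auto simp: differentiable_def intro!: bump_algebra.intros)
next
  case (const a)
  have "dir_deriv w (\<lambda>x::'a. a) = (\<lambda>x. 0)" for w by (intro ext dir_deriv_eq) simp
  then show ?case by (auto intro!: bump_algebra.intros)
next
  case (add f g)
  then have "dir_deriv w (\<lambda>x. f x + g x) = (\<lambda>x. dir_deriv w f x + dir_deriv w g x)" for w
    by (intro ext dir_deriv_eq has_derivative_add has_derivative_dir_deriv) auto
  then show ?case using add by (auto intro!: bump_algebra.intros differentiable_add)
next
  case (mult f g)
  then have "dir_deriv w (\<lambda>x. f x * g x) = (\<lambda>x. f x * dir_deriv w g x + dir_deriv w f x * g x)" for w
    by (intro ext dir_deriv_eq has_derivative_mult has_derivative_dir_deriv) auto
  then show ?case using mult by (auto intro!: bump_algebra.intros differentiable_mult)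
qed

definition bump :: "'e::euclidean_space \<Rightarrow> real" where
  "bump x = flat_exp 0 (1 - x \<bullet> x)"

lemma smooth_on_bump: "smooth_on (bump :: 'e::euclidean_space \<Rightarrow> real) S"
proof -
  have "bump_algebra f \<Longrightarrow> Ck_on k f S" for k and f :: "'e \<Rightarrow> real"
  proof (induction k arbitrary: f)
    case 0
    then show ?case using bump_algebra_deriv[of f]
      by (auto intro!: continuous_at_imp_continuous_on differentiable_imp_continuous_within)
  next
    case (Suc k) then show ?case using bump_algebra_deriv[of f] by auto
  qed
  moreover have "bump_algebra (bump :: 'e \<Rightarrow> real)"
    unfolding bump_def[abs_def] by (rule bump_algebra.flat)
  ultimately show ?thesis by (simp add: smooth_on_def)
qed

lemma bump_nonneg: "bump x \<ge> 0"
  by (simp add: bump_def flat_exp_def)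

lemma bump_pos_iff: "bump x > 0 \<longleftrightarrow> norm x < 1"
proof -
  have "x \<bullet> x < 1 \<longleftrightarrow> norm x < 1"
    using power2_less_imp_less[of "norm x" 1] power_strict_mono[of "norm x" 1 2]
    by (auto simp: power2_norm_eq_inner[symmetric] abs_square_less_1)
  then show ?thesis by (auto simp: bump_def flat_exp_def)
qed

lemma bump_eq_0: "norm x \<ge> 1 \<Longrightarrow> bump x = 0"
  using bump_pos_iff[of x] bump_nonneg[of x] by linarith

lemma bump_le_1: "bump x \<le> 1"
  by (auto simp: bump_def flat_exp_def)

section \<open>Change of variables between Euclidean spaces\<close>

text \<open>
  The change of variables theorem of the library is restricted to vectors indexed by a well-ordered
  type; every finite index type is transported to the following well-ordered copy.
\<close>

typedef (overloaded) 'n widx = "{..<CARD('n::finite)}"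
  by (rule exI[of _ 0]) simp

instantiation widx :: (finite) wellorder
begin

definition less_eq_widx :: "'a widx \<Rightarrow> 'a widx \<Rightarrow> bool" where "x \<le> y \<longleftrightarrow> Rep_widx x \<le> Rep_widx y"
definition less_widx :: "'a widx \<Rightarrow> 'a widx \<Rightarrow> bool" where "x < y \<longleftrightarrow> Rep_widx x < Rep_widx y"

instance
proof
  fix P :: "'a widx \<Rightarrow> bool" and a
  assume step: "\<And>x. (\<And>y. y < x \<Longrightarrow> P y) \<Longrightarrow> P x"
  show "P a"
    by (induction a rule: measure_induct_rule[of Rep_widx]) (rule step, simp add: less_widx_def)
qed (auto simp: less_eq_widx_def less_widx_def Rep_widx_inject)

end

instance widx :: (finite) finite
proof
  have "(UNIV :: 'a widx set) = Abs_widx ` {..<CARD('a)}"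
    using type_definition.Abs_image[OF type_definition_widx] by auto
  then show "finite (UNIV :: 'a widx set)" by (metis finite_imageI finite_lessThan)
qed

lemma ex_bij_widx: "\<exists>\<kappa> :: 'n widx \<Rightarrow> 'n::finite. bij \<kappa>"
proof -
  have "card (UNIV :: 'n widx set) = CARD('n)"
    by (simp add: type_definition.card[OF type_definition_widx])
  then show ?thesis using finite_same_card_bij[of "UNIV :: 'n widx set" "UNIV :: 'n set"] by auto
qed

subsection \<open>Determinants over finite index sets\<close>

text \<open>The Leibniz formula over a set of indices instead of a type: the indices can then be
  basis vectors, and a single one can be split off.\<close>

definition det_on :: "'b set \<Rightarrow> ('b \<Rightarrow> 'b \<Rightarrow> real) \<Rightarrow> real" where
  "det_on S M = (\<Sum>p | p permutes S. of_int (sign p) * (\<Prod>b\<in>S. M b (p b)))"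

lemma det_eq_det_on: "det (\<chi> i j. M i j) = det_on UNIV M"
  by (simp add: det_def det_on_def)

text \<open>Conjugation with \<phi> matches the permutations of the two index sets and preserves
  their signs.\<close>

lemma det_on_image:
  assumes "inj_on \<phi> S" "finite S"
  shows "det_on (\<phi> ` S) M = det_on S (\<lambda>a b. M (\<phi> a) (\<phi> b))"
proof -
  have b: "bij_betw \<phi> S (\<phi> ` S)" using assms by (simp add: bij_betw_def)
  have bi: "bij_betw (inv_into S \<phi>) (\<phi> ` S) S" using b by (rule bij_betw_inv_into)
  have "bij_betw (map_permutation S \<phi>) {p. p permutes S} {p. p permutes \<phi> ` S}"
  proof (rule bij_betw_byWitness[where f' = "map_permutation (\<phi> ` S) (inv_into S \<phi>)"])
    show "\<forall>p\<in>{p. p permutes S}. map_permutation (\<phi> ` S) (inv_into S \<phi>) (map_permutation S \<phi> p) = p"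
      using map_permutation_compose_inv[OF b] assms by simp
    show "\<forall>p\<in>{p. p permutes \<phi> ` S}. map_permutation S \<phi> (map_permutation (\<phi> ` S) (inv_into S \<phi>) p) = p"
      using map_permutation_compose_inv[OF bi] by (simp add: f_inv_into_f)
    show "map_permutation S \<phi> ` {p. p permutes S} \<subseteq> {p. p permutes \<phi> ` S}"
      using map_permutation_permutes[OF b] by auto
    show "map_permutation (\<phi> ` S) (inv_into S \<phi>) ` {p. p permutes \<phi> ` S} \<subseteq> {p. p permutes S}"
      using map_permutation_permutes[OF bi] by auto
  qed
  then have "det_on (\<phi> ` S) M = (\<Sum>p | p permutes S. of_int (sign (map_permutation S \<phi> p)) *
       (\<Prod>b\<in>\<phi> ` S. M b (map_permutation S \<phi> p b)))"
    unfolding det_on_def by (rule sum.reindex_bij_betw[symmetric])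
  also have "\<dots> = det_on S (\<lambda>a b. M (\<phi> a) (\<phi> b))"
    unfolding det_on_def
  proof (rule sum.cong[OF refl])
    fix p assume "p \<in> {p. p permutes S}"
    then have p: "p permutes S" by simp
    have "(\<Prod>b\<in>\<phi> ` S. M b (map_permutation S \<phi> p b)) = (\<Prod>a\<in>S. M (\<phi> a) (\<phi> (p a)))"
      using assms by (simp add: prod.reindex map_permutation_apply)
    then show "of_int (sign (map_permutation S \<phi> p)) * (\<Prod>b\<in>\<phi> ` S. M b (map_permutation S \<phi> p b))
       = of_int (sign p) * (\<Prod>b\<in>S. M (\<phi> b) (\<phi> (p b)))"
      using sign_map_permutation[OF assms(1) p assms(2)] by simp
  qed
  finally show ?thesis .
qed

text \<open>A permutation that moves s meets a zero entry in row s, so only the permutations of S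
  contribute.\<close>

lemma det_on_insert:
  assumes "finite S" "s \<notin> S" "M s s = 1" "\<And>b. b \<in> S \<Longrightarrow> M s b = 0"
  shows "det_on (insert s S) M = det_on S M"
proof -
  have sub: "{p. p permutes S} \<subseteq> {p. p permutes insert s S}"
    by (auto intro: permutes_subset)
  have "det_on (insert s S) M = (\<Sum>p | p permutes S. of_int (sign p) * (\<Prod>b\<in>insert s S. M b (p b)))"
    unfolding det_on_def
  proof (rule sum.mono_neutral_right[OF _ sub])
    show "finite {p. p permutes insert s S}" using assms by (simp add: finite_permutations)
    show "\<forall>p\<in>{p. p permutes insert s S} - {p. p permutes S}. of_int (sign p) * (\<Prod>b\<in>insert s S. M b (p b)) = 0"
    proof
      fix p assume p: "p \<in> {p. p permutes insert s S} - {p. p permutes S}"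
      then have "p s \<noteq> s" using permutes_superset[of p "insert s S" S] by auto
      moreover have "p s \<in> insert s S" using p permutes_in_image[of p "insert s S" s] by auto
      ultimately have "M s (p s) = 0" using assms by auto
      then show "of_int (sign p) * (\<Prod>b\<in>insert s S. M b (p b)) = 0" using assms by simp
    qed
  qed
  also have "\<dots> = det_on S M"
    unfolding det_on_def using assms by (intro sum.cong) (auto simp: permutes_not_in)
  finally show ?thesis .
qed

lemma det_reindex:
  fixes \<kappa> :: "'m::finite \<Rightarrow> 'n::finite" and M :: "'n \<Rightarrow> 'n \<Rightarrow> real"
  shows "bij \<kappa> \<Longrightarrow> det (\<chi> i j. M (\<kappa> i) (\<kappa> j)) = det (\<chi> i j. M i j)"
  using det_on_image[of \<kappa> UNIV M] by (simp add: det_eq_det_on bij_def)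

section \<open>Gram determinants\<close>

definition gram :: "('n::finite \<Rightarrow> 'e) \<Rightarrow> ('e \<Rightarrow> 'e \<Rightarrow> real) \<Rightarrow> real" where
  "gram \<beta> \<gamma> = det (\<chi> i j. \<gamma> (\<beta> i) (\<beta> j))"

lemma gram_det_on: "inj \<beta> \<Longrightarrow> gram \<beta> \<gamma> = det_on (range \<beta>) \<gamma>"
  unfolding gram_def det_eq_det_on by (rule det_on_image[symmetric]) auto

lemma basis_expand:
  fixes \<beta> :: "'n::finite \<Rightarrow> 'e::euclidean_space"
  assumes "bij_betw \<beta> UNIV Basis"
  shows "(\<Sum>i\<in>UNIV. (x \<bullet> \<beta> i) *\<^sub>R \<beta> i) = x"
  using sum.reindex_bij_betw[OF assms, of "\<lambda>b. (x \<bullet> b) *\<^sub>R b"] by (simp add: euclidean_representation)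

lemma bilinear_expand:
  fixes b :: "'e::real_vector \<Rightarrow> 'f::real_vector \<Rightarrow> real" and x :: "'i \<Rightarrow> 'e" and y :: "'j \<Rightarrow> 'f"
  assumes "bilinear b"
  shows "b (\<Sum>i\<in>I. a i *\<^sub>R x i) (\<Sum>j\<in>J. c j *\<^sub>R y j) = (\<Sum>i\<in>I. \<Sum>j\<in>J. a i * (c j * b (x i) (y j)))"
proof -
  have l: "b (\<Sum>i\<in>I. f i) w = (\<Sum>i\<in>I. b (f i) w)" for f :: "'i \<Rightarrow> 'e" and w
    using linear_sum[of "\<lambda>v. b v w" f I] assms by (simp add: bilinear_def)
  have r: "b v (\<Sum>i\<in>J. f i) = (\<Sum>i\<in>J. b v (f i))" for f :: "'j \<Rightarrow> 'f" and v
    using linear_sum[of "b v" f J] assms by (simp add: bilinear_def)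
  show ?thesis unfolding l by (simp add: r bilinear_lmul[OF assms] bilinear_rmul[OF assms] sum_distrib_left ac_simps)
qed

text \<open>If the columns of M are the coordinates of the vectors D (\<alpha> j), the Gram matrix
  of the pulled back form is M^T G M. The common index type lets M be a square matrix although D
  maps between different spaces.\<close>

lemma gram_pullback:
  fixes \<beta> :: "'n::finite \<Rightarrow> 'f::euclidean_space" and \<alpha> :: "'n \<Rightarrow> 'e::euclidean_space"
  assumes "bij_betw \<beta> UNIV Basis" "bilinear \<gamma>'" "\<And>v w. \<gamma> v w = \<gamma>' (D v) (D w)"
  shows "gram \<alpha> \<gamma> = (det (\<chi> i j. D (\<alpha> j) \<bullet> \<beta> i))\<^sup>2 * gram \<beta> \<gamma>'"
proof -
  define M :: "real^'n^'n" where "M = (\<chi> i j. D (\<alpha> j) \<bullet> \<beta> i)"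
  define G :: "real^'n^'n" where "G = (\<chi> i j. \<gamma>' (\<beta> i) (\<beta> j))"
  have "(\<chi> i j. \<gamma> (\<alpha> i) (\<alpha> j)) = transpose M ** (G ** M)"
  proof (simp add: vec_eq_iff matrix_matrix_mult_def transpose_def, intro allI)
    fix i j
    have "\<gamma> (\<alpha> i) (\<alpha> j) = \<gamma>' (\<Sum>k\<in>UNIV. (D (\<alpha> i) \<bullet> \<beta> k) *\<^sub>R \<beta> k) (\<Sum>l\<in>UNIV. (D (\<alpha> j) \<bullet> \<beta> l) *\<^sub>R \<beta> l)"
      by (simp add: basis_expand[OF assms(1)] assms(3))
    also have "\<dots> = (\<Sum>k\<in>UNIV. M $ k $ i * (\<Sum>l\<in>UNIV. G $ k $ l * M $ l $ j))"
      by (simp add: bilinear_expand[OF assms(2)] M_def G_def sum_distrib_left ac_simps)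
    finally show "\<gamma> (\<alpha> i) (\<alpha> j) = (\<Sum>k\<in>UNIV. M $ k $ i * (\<Sum>l\<in>UNIV. G $ k $ l * M $ l $ j))" .
  qed
  then have "gram \<alpha> \<gamma> = det M * (det G * det M)"
    unfolding gram_def by (simp add: det_mul)
  then show ?thesis by (simp add: M_def G_def gram_def power2_eq_square ac_simps)
qed

lemma bij_axis: "bij_betw (\<lambda>i::'n::finite. axis i (1::real)) UNIV Basis"
  by (auto simp: bij_betw_def inj_on_def axis_eq_axis Basis_vec_def)

text \<open>In the product basis the row of the line direction is a unit vector, which
  \<open>det_on_insert\<close> removes. Hence h + dt^2 and h have the same volume density.\<close>

lemma gram_product:
  fixes \<beta> :: "'n::finite \<Rightarrow> (real^'k) \<times> real"
  assumes "bij_betw \<beta> UNIV Basis" "bilinear h"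
  shows "gram \<beta> (\<lambda>v w. h (fst v) (fst w) + snd v * snd w) = gram (\<lambda>i. axis i 1) h"
proof -
  let ?\<gamma> = "\<lambda>v w :: (real^'k) \<times> real. h (fst v) (fst w) + snd v * snd w"
  have "gram \<beta> ?\<gamma> = det_on Basis ?\<gamma>"
    using assms(1) gram_det_on[of \<beta> ?\<gamma>] by (simp add: bij_betw_def)
  also have "Basis = insert (0, 1) ((\<lambda>b::real^'k. (b, 0::real)) ` Basis)"
    by (auto simp: Basis_prod_def)
  also have "det_on \<dots> ?\<gamma> = det_on ((\<lambda>b::real^'k. (b, 0::real)) ` Basis) ?\<gamma>"
    by (rule det_on_insert) (auto simp: bilinear_lzero[OF assms(2)])
  also have "\<dots> = det_on Basis h"
    by (subst det_on_image) (auto simp: inj_on_def)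
  also have "\<dots> = gram (\<lambda>i. axis i 1) h"
    using gram_det_on[of "\<lambda>i. axis i 1" h] bij_axis[where ?'n='k] by (simp add: bij_betw_def)
  finally show ?thesis .
qed

text \<open>On the segment from the identity to A all matrices have a positive quadratic form and
  hence trivial kernel. The determinant is 1 at the start and cannot change sign without
  vanishing.\<close>

lemma det_pos_of_quadratic_form_pos:
  fixes A :: "real^'n^'n"
  assumes "\<And>x. x \<noteq> 0 \<Longrightarrow> x \<bullet> (A *v x) > 0"
  shows "det A > 0"
proof (rule ccontr)
  assume neg: "\<not> det A > 0"
  define B where "B = (\<lambda>s::real. (1 - s) *\<^sub>R mat 1 + s *\<^sub>R A)"
  have nz: "det (B s) \<noteq> 0" if "0 \<le> s" "s \<le> 1" for s
  proof
    assume "det (B s) = 0"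
    then obtain x where x: "x \<noteq> 0" "B s *v x = 0"
      by (metis invertible_det_nz invertible_left_inverse matrix_left_invertible_ker)
    have "0 < x \<bullet> x" using x by simp
    have "0 = x \<bullet> (B s *v x)" using x by simp
    also have "\<dots> = (1 - s) * (x \<bullet> x) + s * (x \<bullet> (A *v x))"
      by (simp add: B_def matrix_vector_mult_add_rdistrib scaleR_matrix_vector_assoc[symmetric] inner_add_right)
    also have "\<dots> > 0"
    proof (cases "s = 0")
      case False
      then show ?thesis using that assms[OF x(1)] \<open>0 < x \<bullet> x\<close>
        by (intro add_nonneg_pos mult_nonneg_nonneg mult_pos_pos) auto
    qed (use \<open>0 < x \<bullet> x\<close> in simp)
    finally show False by simp
  qed
  have "continuous_on {0..1} (\<lambda>s. det (B s))"
    unfolding det_def B_def by (simp, intro continuous_intros)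
  moreover have "det (B 0) = 1" "det (B 1) \<le> 0" using neg by (auto simp: B_def)
  ultimately obtain s where "0 \<le> s" "s \<le> 1" "det (B s) = 0"
    using IVT2'[of "\<lambda>s. det (B s)" 1 0 0] by force
  then show False using nz by blast
qed

lemma gram_pos:
  fixes h :: "real^'n \<Rightarrow> real^'n \<Rightarrow> real"
  assumes "bilinear h" "\<And>v. v \<noteq> 0 \<Longrightarrow> 0 < h v v"
  shows "gram (\<lambda>i. axis i 1) h > 0"
  unfolding gram_def
proof (rule det_pos_of_quadratic_form_pos)
  fix x :: "real^'n" assume "x \<noteq> 0"
  have "x = (\<Sum>i\<in>UNIV. (x $ i) *\<^sub>R axis i 1)"
    using basis_expand[OF bij_axis, of x] by (simp add: inner_axis)
  then have "h x x = h (\<Sum>i\<in>UNIV. (x $ i) *\<^sub>R axis i 1) (\<Sum>i\<in>UNIV. (x $ i) *\<^sub>R axis i 1)" by simp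
  also have "\<dots> = x \<bullet> ((\<chi> i j. h (axis i 1) (axis j 1)) *v x)"
    by (simp add: bilinear_expand[OF assms(1)] inner_vec_def matrix_vector_mult_def sum_distrib_left ac_simps)
  finally show "x \<bullet> ((\<chi> i j. h (axis i 1) (axis j 1)) *v x) > 0" using assms(2)[OF \<open>x \<noteq> 0\<close>] by simp
qed

subsection \<open>Coordinates\<close>

definition coords :: "('n::finite \<Rightarrow> 'e::euclidean_space) \<Rightarrow> 'e \<Rightarrow> real^'n" where
  "coords \<beta> x = (\<chi> i. x \<bullet> \<beta> i)"

definition uncoords :: "('n::finite \<Rightarrow> 'e::euclidean_space) \<Rightarrow> real^'n \<Rightarrow> 'e" where
  "uncoords \<beta> y = (\<Sum>i\<in>UNIV. (y $ i) *\<^sub>R \<beta> i)"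

lemma linear_coords: "linear (coords \<beta>)"
  by (rule linearI) (auto simp: coords_def vec_eq_iff inner_add_left)

lemma linear_uncoords: "linear (uncoords \<beta>)"
  by (rule linearI) (auto simp: uncoords_def algebra_simps sum.distrib scaleR_sum_right)

lemma uncoords_coords: "bij_betw \<beta> UNIV Basis \<Longrightarrow> uncoords \<beta> (coords \<beta> x) = x"
  by (simp add: uncoords_def coords_def basis_expand)

lemma coords_uncoords:
  assumes "bij_betw \<beta> UNIV Basis" shows "coords \<beta> (uncoords \<beta> y) = y"
proof -
  have "\<beta> i \<bullet> \<beta> j = (if i = j then 1 else 0)" for i j
  proof -
    have "\<beta> i \<in> Basis" "\<beta> j \<in> Basis" "\<beta> i = \<beta> j \<longleftrightarrow> i = j"
      using assms by (auto simp: bij_betw_def inj_on_def)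
    then show ?thesis by (auto simp: inner_not_same_Basis)
  qed
  then show ?thesis
    by (simp add: uncoords_def coords_def vec_eq_iff inner_sum_left if_distrib[of "\<lambda>x. _ * x"] cong: if_cong)
qed

lemma uncoords_axis: "uncoords \<beta> (axis j 1) = \<beta> j"
  by (simp add: uncoords_def axis_def if_distrib[of "\<lambda>x. x *\<^sub>R _"] cong: if_cong)

lemma coords_measurable [measurable]: "coords \<beta> \<in> borel_measurable borel"
  by (intro borel_measurable_continuous_onI linear_continuous_on bounded_linear_euclidean linear_coords)

lemma uncoords_measurable [measurable]: "uncoords \<beta> \<in> borel_measurable borel"
  by (intro borel_measurable_continuous_onI linear_continuous_on bounded_linear_euclidean linear_uncoords)

text \<open>Orthonormal coordinates turn boxes into boxes with the same side lengths, and boxes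
  determine Lebesgue measure.\<close>

lemma distr_coords:
  fixes \<beta> :: "'n::finite \<Rightarrow> 'e::euclidean_space"
  assumes "bij_betw \<beta> UNIV Basis"
  shows "distr lborel borel (coords \<beta>) = lborel"
proof (rule lborel_eqI[symmetric])
  fix l u :: "real^'n" assume lu: "\<And>b. b \<in> Basis \<Longrightarrow> l \<bullet> b \<le> u \<bullet> b"
  have lu': "l $ i \<le> u $ i" for i using lu[of "axis i 1"] by (auto simp: inner_axis Basis_vec_def)
  have c: "x $ i = uncoords \<beta> x \<bullet> \<beta> i" for x i
    using coords_uncoords[OF assms, of x] unfolding coords_def vec_eq_iff by simp
  have B: "Basis = range \<beta>" using assms by (simp add: bij_betw_def)
  have "coords \<beta> -` box l u = box (uncoords \<beta> l) (uncoords \<beta> u)"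
    by (auto simp: box_def B Basis_vec_def inner_axis c[symmetric]) (auto simp: coords_def)
  then have "emeasure (distr lborel borel (coords \<beta>)) (box l u) = emeasure lborel (box (uncoords \<beta> l) (uncoords \<beta> u))"
    by (subst emeasure_distr) auto
  also have "\<dots> = (\<Prod>b\<in>Basis. (uncoords \<beta> u - uncoords \<beta> l) \<bullet> b)"
    by (rule emeasure_lborel_box) (auto simp: B c[symmetric] lu')
  also have "(\<Prod>b\<in>Basis. (uncoords \<beta> u - uncoords \<beta> l) \<bullet> b) = (\<Prod>i\<in>UNIV. u $ i - l $ i)"
    using prod.reindex_bij_betw[OF assms, of "\<lambda>b. (uncoords \<beta> u - uncoords \<beta> l) \<bullet> b"]
    by (simp add: inner_diff_left c[symmetric])
  also have "\<dots> = (\<Prod>b\<in>Basis. (u - l) \<bullet> b)"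
    using prod.reindex_bij_betw[OF bij_axis, of "\<lambda>b. (u - l) \<bullet> b"] by (simp add: inner_axis)
  finally show "emeasure (distr lborel borel (coords \<beta>)) (box l u) = (\<Prod>b\<in>Basis. (u - l) \<bullet> b)" .
qed simp

lemma distr_uncoords:
  fixes \<beta> :: "'n::finite \<Rightarrow> 'e::euclidean_space"
  assumes "bij_betw \<beta> UNIV Basis"
  shows "distr lborel borel (uncoords \<beta>) = lborel"
proof -
  have "distr lborel borel (uncoords \<beta>) = distr (distr lborel borel (coords \<beta>)) borel (uncoords \<beta>)"
    by (simp add: distr_coords[OF assms])
  also have "\<dots> = distr lborel borel (uncoords \<beta> \<circ> coords \<beta>)"
    by (rule distr_distr) auto
  also have "uncoords \<beta> \<circ> coords \<beta> = (\<lambda>x. x)" by (auto simp: uncoords_coords[OF assms])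
  also have "distr lborel borel (\<lambda>x. x) = lborel" by (simp add: distr_id2)
  finally show ?thesis .
qed

section \<open>The change of variables formula\<close>

lemma emeasure_image_wellorder:
  fixes T :: "real^'m::{finite,wellorder} \<Rightarrow> real^'m::_"
  assumes A: "A \<in> sets borel" and TA: "T ` A \<in> sets borel"
    and der: "\<And>x. x \<in> A \<Longrightarrow> (T has_derivative T' x) (at x within A)"
    and inj: "inj_on T A"
    and D: "(\<lambda>x. indicator A x * \<bar>det (matrix (T' x))\<bar>) \<in> borel_measurable borel"
  shows "emeasure lborel (T ` A) = (\<integral>\<^sup>+x. ennreal (indicator A x * \<bar>det (matrix (T' x))\<bar>) \<partial>lborel)"
proof -
  let ?D = "\<lambda>x. \<bar>det (matrix (T' x))\<bar>"
  have Al: "A \<in> sets lebesgue" "T ` A \<in> sets lebesgue" using A TA by auto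
  \<comment> \<open>The theorem for integrable functions is applied to the constant 1 with values in
    \<open>real^1\<close>. Its integrability equivalence also settles the case in which both sides
    are infinite.\<close>
  note cv1 = absolutely_integrable_change_of_variables[OF Al(1) der inj, of "\<lambda>_. (vec 1 :: real^1)"]
  have lift: "(\<lambda>x. ?D x *\<^sub>R (vec 1 :: real^1)) absolutely_integrable_on A \<longleftrightarrow> ?D absolutely_integrable_on A"
    by (subst absolutely_integrable_componentwise_iff) (auto simp: Basis_vec_def inner_axis)
  have lift1: "(\<lambda>x. (vec 1 :: real^1)) absolutely_integrable_on S \<longleftrightarrow> (\<lambda>x. 1 :: real) absolutely_integrable_on S" for S :: "(real^'m::_) set"
    by (subst absolutely_integrable_componentwise_iff) (auto simp: Basis_vec_def inner_axis)
  have ai: "?D absolutely_integrable_on A \<longleftrightarrow> (\<lambda>x. 1 :: real) absolutely_integrable_on (T ` A)"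
    using cv1 lift lift1 by metis
  have i1: "(\<lambda>x. 1 :: real) absolutely_integrable_on (T ` A) \<longleftrightarrow> emeasure lborel (T ` A) < \<infinity>"
  proof -
    have "(\<lambda>x. 1 :: real) absolutely_integrable_on (T ` A) \<longleftrightarrow> integrable lebesgue (indicat_real (T ` A))"
      by (simp add: set_integrable_def)
    also have "\<dots> \<longleftrightarrow> emeasure lebesgue (T ` A) < \<infinity>" using Al by (simp add: integrable_indicator_iff)
    finally show ?thesis using TA by simp
  qed
  have i2: "?D absolutely_integrable_on A \<longleftrightarrow> (\<integral>\<^sup>+x. ennreal (indicator A x * ?D x) \<partial>lborel) < \<infinity>"
  proof -
    have "?D absolutely_integrable_on A \<longleftrightarrow> integrable lebesgue (\<lambda>x. indicator A x * ?D x)"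
      by (simp add: set_integrable_def)
    also have "\<dots> \<longleftrightarrow> integrable lborel (\<lambda>x. indicator A x * ?D x)"
      using D by (intro integrable_completion) simp
    also have "\<dots> \<longleftrightarrow> (\<integral>\<^sup>+x. ennreal (indicator A x * ?D x) \<partial>lborel) < \<infinity>"
      using D by (simp add: integrable_iff_bounded abs_mult)
    finally show ?thesis .
  qed
  show ?thesis
  proof (cases "?D absolutely_integrable_on A")
    case True
    then have fin: "emeasure lborel (T ` A) < \<infinity>" using ai i1 by simp
    have intD: "integrable lborel (\<lambda>x. indicator A x * ?D x)"
      using True D integrable_completion[of "\<lambda>x. indicator A x * ?D x" lborel] by (simp add: set_integrable_def)
    have "integral (T ` A) (\<lambda>_. vec 1 :: real^1) = integral A (\<lambda>x. ?D x *\<^sub>R vec 1)"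
      by (rule integral_change_of_variables[OF Al(1) der inj]) (use True lift in auto)
    moreover have "integral (T ` A) (\<lambda>_. vec 1 :: real^1) \<bullet> axis 1 1 = integral (T ` A) (\<lambda>_. 1 :: real)"
      using True ai lift1 integral_component_eq[of "\<lambda>_. vec 1 :: real^1" "T ` A" "axis 1 1"]
      by (simp add: inner_axis set_lebesgue_integral_eq_integral(1))
    moreover have "integral A (\<lambda>x. ?D x *\<^sub>R vec 1 :: real^1) \<bullet> axis 1 1 = integral A ?D"
      using True lift integral_component_eq[of "\<lambda>x. ?D x *\<^sub>R vec 1 :: real^1" A "axis 1 1"]
      by (simp add: inner_axis set_lebesgue_integral_eq_integral(1))
    ultimately have eq: "integral (T ` A) (\<lambda>_. 1 :: real) = integral A ?D" by simp
    have "integral (T ` A) (\<lambda>_. 1 :: real) = measure lborel (T ` A)"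
      using lmeasure_integral[of "T ` A"] fin TA by (simp add: fmeasurable_def)
    moreover have "integral A ?D = (\<integral>x. indicator A x * ?D x \<partial>lborel)"
    proof -
      have "integral A ?D = (LINT x:A|lebesgue. ?D x)"
        using set_lebesgue_integral_eq_integral(2)[OF True] by simp
      also have "\<dots> = (\<integral>x. indicator A x * ?D x \<partial>lborel)"
        using D by (simp add: set_lebesgue_integral_def integral_completion)
      finally show ?thesis .
    qed
    moreover have "(\<integral>\<^sup>+x. ennreal (indicator A x * ?D x) \<partial>lborel) = ennreal (\<integral>x. indicator A x * ?D x \<partial>lborel)"
      by (rule nn_integral_eq_integral[OF intD]) auto
    ultimately show ?thesis using eq fin by (simp add: emeasure_eq_ennreal_measure less_top)
  next
    case False
    then have "\<not> emeasure lborel (T ` A) < \<infinity>" "\<not> (\<integral>\<^sup>+x. ennreal (indicator A x * ?D x) \<partial>lborel) < \<infinity>"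
      using ai i1 i2 by auto
    then show ?thesis by (simp add: less_top[symmetric])
  qed
qed

text \<open>Orthonormal coordinates on both sides, indexed by the well-ordered copy, give the
  formula for the image of every suitable Borel subset of S. This says that two measures on the
  target agree, and equality of measures extends to all nonnegative Borel integrands.\<close>

lemma nn_integral_change_of_variables:
  fixes T :: "'e::euclidean_space \<Rightarrow> 'f::euclidean_space"
    and \<alpha> :: "'n::finite \<Rightarrow> 'e" and \<beta> :: "'n \<Rightarrow> 'f"
  assumes \<alpha>: "bij_betw \<alpha> UNIV Basis" and \<beta>: "bij_betw \<beta> UNIV Basis"
    and S: "S \<in> sets borel" and TS: "T ` S \<in> sets borel"
    and der: "\<And>x. x \<in> S \<Longrightarrow> (T has_derivative T' x) (at x within S)"
    and inj: "inj_on T S"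
    and cont: "\<And>v. continuous_on S (\<lambda>x. T' x v)"
    and f: "f \<in> borel_measurable borel"
  shows "(\<integral>\<^sup>+y\<in>T ` S. f y \<partial>lborel) = (\<integral>\<^sup>+x\<in>S. ennreal \<bar>det (\<chi> i j. T' x (\<alpha> j) \<bullet> \<beta> i)\<bar> * f (T x) \<partial>lborel)"
proof -
  let ?D = "\<lambda>x. \<bar>det (\<chi> i j. T' x (\<alpha> j) \<bullet> \<beta> i)\<bar>"
  have cT: "continuous_on S T" using der by (rule has_derivative_continuous_on)
  have cD: "continuous_on S ?D"
    unfolding det_def by (simp, intro continuous_intros cont)
  have D: "(\<lambda>x. indicator A x * ?D x) \<in> borel_measurable borel" if "A \<in> sets borel" "A \<subseteq> S" for A
    using borel_measurable_continuous_on_indicator[OF that(1) continuous_on_subset[OF cD that(2)]] by simp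
  obtain \<kappa> :: "'n widx \<Rightarrow> 'n" where \<kappa>: "bij \<kappa>" using ex_bij_widx by blast
  define \<alpha>' where "\<alpha>' = \<alpha> \<circ> \<kappa>"
  define \<beta>' where "\<beta>' = \<beta> \<circ> \<kappa>"
  have \<alpha>': "bij_betw \<alpha>' UNIV Basis" and \<beta>': "bij_betw \<beta>' UNIV Basis"
    using \<alpha> \<beta> \<kappa> by (auto simp: \<alpha>'_def \<beta>'_def intro: bij_betw_trans)
  have em: "emeasure lborel (T ` A) = (\<integral>\<^sup>+x. ennreal (indicator A x * ?D x) \<partial>lborel)"
    if A: "A \<in> sets borel" "A \<subseteq> S" "T ` A \<in> sets borel" for A
  proof -
    define A' where "A' = uncoords \<alpha>' -` A"
    define U where "U = coords \<beta>' \<circ> T \<circ> uncoords \<alpha>'"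
    define U' where "U' = (\<lambda>y. coords \<beta>' \<circ> T' (uncoords \<alpha>' y) \<circ> uncoords \<alpha>')"
    have A'_eq: "A' = coords \<alpha>' ` A"
      unfolding A'_def by (force simp: uncoords_coords[OF \<alpha>'] coords_uncoords[OF \<alpha>'])
    have UA: "U ` A' = uncoords \<beta>' -` (T ` A)"
    proof -
      have "U ` A' = coords \<beta>' ` (T ` A)"
        by (simp add: A'_eq U_def image_image uncoords_coords[OF \<alpha>'])
      also have "\<dots> = uncoords \<beta>' -` (T ` A)"
      proof (intro equalityI subsetI)
        fix y assume "y \<in> uncoords \<beta>' -` (T ` A)"
        then show "y \<in> coords \<beta>' ` (T ` A)"
          using coords_uncoords[OF \<beta>', of y] by (metis imageI vimageD)
      qed (auto simp: uncoords_coords[OF \<beta>'])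
      finally show ?thesis .
    qed
    \<comment> \<open>Rows and columns are relabelled by the same \<kappa>, which leaves the
      determinant unchanged.\<close>
    have mat: "det (matrix (U' y)) = det (\<chi> i j. T' (uncoords \<alpha>' y) (\<alpha> j) \<bullet> \<beta> i)" for y
    proof -
      have "matrix (U' y) = (\<chi> i j. T' (uncoords \<alpha>' y) (\<alpha> (\<kappa> j)) \<bullet> \<beta> (\<kappa> i))"
        by (simp add: matrix_def U'_def uncoords_axis vec_eq_iff coords_def \<alpha>'_def \<beta>'_def)
      then show ?thesis using det_reindex[OF \<kappa>, of "\<lambda>i j. T' (uncoords \<alpha>' y) (\<alpha> j) \<bullet> \<beta> i"] by simp
    qed
    have A'b: "A' \<in> sets borel" "U ` A' \<in> sets borel"
      using measurable_sets[OF uncoords_measurable[of \<alpha>'] A(1)] measurable_sets[OF uncoords_measurable[of \<beta>'] A(3)]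
      unfolding UA by (auto simp: A'_def)
    have "emeasure lborel (U ` A') = (\<integral>\<^sup>+y. ennreal (indicator A' y * \<bar>det (matrix (U' y))\<bar>) \<partial>lborel)"
    proof (rule emeasure_image_wellorder[OF A'b])
      fix y assume y: "y \<in> A'"
      have lu: "bounded_linear (uncoords \<alpha>')" "bounded_linear (coords \<beta>')"
        by (auto intro: bounded_linear_euclidean linear_uncoords linear_coords)
      have "(T has_derivative T' (uncoords \<alpha>' y)) (at (uncoords \<alpha>' y) within uncoords \<alpha>' ` A')"
        using der[of "uncoords \<alpha>' y"] y A(2) by (auto simp: A'_def intro: has_derivative_subset)
      from has_derivative_in_compose[OF bounded_linear_imp_has_derivative[OF lu(1)] this]
      have "((\<lambda>y. T (uncoords \<alpha>' y)) has_derivative (\<lambda>h. T' (uncoords \<alpha>' y) (uncoords \<alpha>' h))) (at y within A')" .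
      from bounded_linear.has_derivative[OF lu(2) this]
      show "(U has_derivative U' y) (at y within A')" by (simp add: U_def U'_def o_def)
    next
      show "inj_on U A'"
      proof (rule inj_onI)
        fix x y assume "x \<in> A'" "y \<in> A'" "U x = U y"
        then have "T (uncoords \<alpha>' x) = T (uncoords \<alpha>' y)"
          by (metis U_def comp_apply uncoords_coords[OF \<beta>'])
        then have "uncoords \<alpha>' x = uncoords \<alpha>' y"
          using inj \<open>x \<in> A'\<close> \<open>y \<in> A'\<close> A(2) by (auto simp: A'_def dest: inj_onD)
        then show "x = y" by (metis coords_uncoords[OF \<alpha>'])
      qed
      have "(\<lambda>y. indicator A' y * \<bar>det (matrix (U' y))\<bar>) = (\<lambda>x. indicator A x * ?D x) \<circ> uncoords \<alpha>'"
        by (auto simp: mat A'_def indicator_def)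
      then show "(\<lambda>y. indicator A' y * \<bar>det (matrix (U' y))\<bar>) \<in> borel_measurable borel"
        using measurable_comp[OF uncoords_measurable D[OF A(1,2)], of \<alpha>'] by simp
    qed
    also have "\<dots> = (\<integral>\<^sup>+y. ennreal (indicator A (uncoords \<alpha>' y) * ?D (uncoords \<alpha>' y)) \<partial>lborel)"
      by (intro nn_integral_cong) (auto simp: mat A'_def indicator_def)
    also have "\<dots> = (\<integral>\<^sup>+x. ennreal (indicator A x * ?D x) \<partial>distr lborel borel (uncoords \<alpha>'))"
      using D[OF A(1,2)] by (intro nn_integral_distr[symmetric]) auto
    also have "\<dots> = (\<integral>\<^sup>+x. ennreal (indicator A x * ?D x) \<partial>lborel)"
      by (simp add: distr_uncoords[OF \<alpha>'])
    also have "emeasure lborel (U ` A') = emeasure (distr lborel borel (uncoords \<beta>')) (T ` A)"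
      using A(3) by (subst emeasure_distr) (auto simp: UA)
    also have "\<dots> = emeasure lborel (T ` A)" by (simp add: distr_uncoords[OF \<beta>'])
    finally show ?thesis .
  qed
  \<comment> \<open>\<open>M1\<close> is Lebesgue measure on the image of S, and \<open>M2\<close>
    is the image under T of Lebesgue measure on S weighted by the Jacobian.\<close>
  define M1 where "M1 = density lborel (indicator (T ` S) :: 'f \<Rightarrow> ennreal)"
  define M2 where "M2 = distr (density (restrict_space lborel S) (\<lambda>x. ennreal (?D x))) borel T"
  have mT: "T \<in> measurable (restrict_space lborel S) borel"
    using borel_measurable_continuous_on_restrict[OF cT] by (simp add: measurable_def space_restrict_space sets_restrict_space)
  have mD: "(\<lambda>x. ennreal (?D x)) \<in> borel_measurable (restrict_space lborel S)"
    using borel_measurable_continuous_on_restrict[OF cD]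
    by (intro measurable_compose[OF _ measurable_ennreal]) (simp add: measurable_def space_restrict_space sets_restrict_space)
  have "M1 = M2"
  proof (rule measure_eqI)
    show "sets M1 = sets M2" by (simp add: M1_def M2_def)
    fix E assume "E \<in> sets M1"
    then have E: "E \<in> sets borel" by (simp add: M1_def)
    define A where "A = T -` E \<inter> S"
    have "A \<in> sets borel"
      using measurable_sets[OF mT E] S by (simp add: A_def space_restrict_space sets_restrict_space_iff)
    have TA: "T ` A = E \<inter> T ` S" by (auto simp: A_def)
    have "emeasure M1 E = emeasure lborel (E \<inter> T ` S)"
      using E TS by (simp add: M1_def emeasure_density Int_commute indicator_inter_arith[symmetric])
    also have "\<dots> = (\<integral>\<^sup>+x. ennreal (indicator A x * ?D x) \<partial>lborel)"
      using em[OF \<open>A \<in> sets borel\<close>] TS E by (simp add: TA[symmetric]) (metis A_def Int_lower2 TA sets.Int)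
    also have "\<dots> = (\<integral>\<^sup>+x. ennreal (?D x) * indicator (T -` E) x * indicator S x \<partial>lborel)"
      by (intro nn_integral_cong) (auto simp: A_def indicator_def)
    also have "\<dots> = (\<integral>\<^sup>+x. ennreal (?D x) * indicator (T -` E) x \<partial>restrict_space lborel S)"
      using S by (subst nn_integral_restrict_space) auto
    also have "\<dots> = (\<integral>\<^sup>+x. ennreal (?D x) * indicator (T -` E \<inter> S) x \<partial>restrict_space lborel S)"
      by (intro nn_integral_cong) (auto simp: indicator_def space_restrict_space)
    also have "\<dots> = emeasure M2 E"
      using E mT mD measurable_sets[OF mT E] unfolding M2_def
      by (subst emeasure_distr) (auto simp: emeasure_density space_restrict_space)
    finally show "emeasure M1 E = emeasure M2 E" .
  qed
  have "(\<integral>\<^sup>+y\<in>T ` S. f y \<partial>lborel) = (\<integral>\<^sup>+y. f y \<partial>M1)"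
    unfolding M1_def using f TS by (subst nn_integral_density) (auto simp: mult.commute)
  also have "\<dots> = (\<integral>\<^sup>+x. f (T x) \<partial>density (restrict_space lborel S) (\<lambda>x. ennreal (?D x)))"
    unfolding \<open>M1 = M2\<close> M2_def using mT f by (subst nn_integral_distr) auto
  also have "\<dots> = (\<integral>\<^sup>+x. ennreal (?D x) * f (T x) \<partial>restrict_space lborel S)"
    using mD measurable_compose[OF mT f] by (intro nn_integral_density) auto
  also have "\<dots> = (\<integral>\<^sup>+x\<in>S. ennreal (?D x) * f (T x) \<partial>lborel)"
    using S by (subst nn_integral_restrict_space) auto
  finally show ?thesis .
qed

section \<open>Mollification\<close>

lemma tendsto_0_le_ennreal: "(\<And>n. f n \<le> g n) \<Longrightarrow> g \<longlonglongrightarrow> 0 \<Longrightarrow> (f :: nat \<Rightarrow> ennreal) \<longlonglongrightarrow> 0"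
  by (rule tendsto_sandwich[OF _ _ tendsto_const, of _ _ _ g]) auto

section \<open>Lebesgue measure under reflections and translations\<close>

lemma distr_lborel_reflect: "distr lborel borel (\<lambda>y. x - y) = (lborel :: 'e::euclidean_space measure)"
  using lborel_affine[of "-1" x] by (simp add: density_1)

lemma distr_lborel_minus: "distr lborel borel (\<lambda>y. y - h) = (lborel :: 'e::euclidean_space measure)"
proof -
  have "(\<lambda>y. y - h) = (+) (- h)" by auto
  then show ?thesis using lborel_distr_plus[of "-h"] by simp
qed

lemma nn_integral_lborel_minus:
  fixes f :: "'e::euclidean_space \<Rightarrow> ennreal"
  assumes "f \<in> borel_measurable borel"
  shows "(\<integral>\<^sup>+y. f (y - h) \<partial>lborel) = (\<integral>\<^sup>+y. f y \<partial>lborel)"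
proof -
  have "(\<integral>\<^sup>+y. f y \<partial>distr lborel borel (\<lambda>y. y - h)) = (\<integral>\<^sup>+y. f (y - h) \<partial>lborel)"
    using assms by (intro nn_integral_distr) auto
  then show ?thesis by (simp add: distr_lborel_minus)
qed

lemma integral_lborel_reflect:
  fixes f :: "'e::euclidean_space \<Rightarrow> 'b::{banach, second_countable_topology}"
  assumes "f \<in> borel_measurable borel"
  shows "(\<integral>y. f (x - y) \<partial>lborel) = (\<integral>y. f y \<partial>lborel)"
proof -
  have "(\<integral>y. f y \<partial>distr lborel borel (\<lambda>y. x - y)) = (\<integral>y. f (x - y) \<partial>lborel)"
    using assms by (intro integral_distr) auto
  then show ?thesis by (simp add: distr_lborel_reflect)
qed

lemma integral_lborel_minus:
  fixes f :: "'e::euclidean_space \<Rightarrow> 'b::{banach, second_countable_topology}"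
  assumes "f \<in> borel_measurable borel"
  shows "(\<integral>y. f (y - h) \<partial>lborel) = (\<integral>y. f y \<partial>lborel)"
proof -
  have "(\<integral>y. f y \<partial>distr lborel borel (\<lambda>y. y - h)) = (\<integral>y. f (y - h) \<partial>lborel)"
    using assms by (intro integral_distr) auto
  then show ?thesis by (simp add: distr_lborel_minus)
qed

lemma integrable_lborel_reflect:
  fixes f :: "'e::euclidean_space \<Rightarrow> 'b::{banach, second_countable_topology}"
  assumes "integrable lborel f"
  shows "integrable lborel (\<lambda>y. f (x - y))"
proof -
  have "integrable (distr lborel borel (\<lambda>y. x - y)) f" using assms by (simp add: distr_lborel_reflect)
  then show ?thesis using assms by (subst (asm) integrable_distr_eq) auto
qed

lemma integrable_lborel_minus:
  fixes f :: "'e::euclidean_space \<Rightarrow> 'b::{banach, second_countable_topology}"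
  assumes "integrable lborel f"
  shows "integrable lborel (\<lambda>y. f (y - h))"
proof -
  have "integrable (distr lborel borel (\<lambda>y. y - h)) f" using assms by (simp add: distr_lborel_minus)
  then show ?thesis using assms by (subst (asm) integrable_distr_eq) auto
qed

subsection \<open>Continuity of translations in the mean\<close>

definition shift_dist :: "('e::euclidean_space \<Rightarrow> 'b::euclidean_space) \<Rightarrow> 'e \<Rightarrow> ennreal" where
  "shift_dist F h = (\<integral>\<^sup>+x. ennreal (norm (F (x - h) - F x)) \<partial>lborel)"

text \<open>The L^1 distance of F and G enters twice, once for the functions and once for their
  translates, where translation invariance gives the same value.\<close>

lemma shift_dist_perturb:
  assumes [measurable]: "F \<in> borel_measurable borel" "G \<in> borel_measurable borel"
  shows "shift_dist F h \<le> shift_dist G h + 2 * (\<integral>\<^sup>+x. ennreal (norm (F x - G x)) \<partial>lborel)"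
proof -
  have "shift_dist F h \<le> (\<integral>\<^sup>+x. ennreal (norm (F (x - h) - G (x - h))) + (ennreal (norm (G (x - h) - G x)) + ennreal (norm (F x - G x))) \<partial>lborel)"
    unfolding shift_dist_def
  proof (rule nn_integral_mono)
    fix x
    have "norm (F (x - h) - F x) \<le> norm (F (x - h) - G (x - h)) + (norm (G (x - h) - G x) + norm (F x - G x))"
      by (smt (verit, ccfv_threshold) diff_add_cancel add_diff_eq diff_diff_eq2 norm_minus_commute norm_triangle_ineq)
    then show "ennreal (norm (F (x - h) - F x)) \<le> ennreal (norm (F (x - h) - G (x - h))) + (ennreal (norm (G (x - h) - G x)) + ennreal (norm (F x - G x)))"
      by (simp add: ennreal_plus[symmetric] del: ennreal_plus)
  qed
  also have "\<dots> = (\<integral>\<^sup>+x. ennreal (norm (F (x - h) - G (x - h))) \<partial>lborel) + (shift_dist G h + (\<integral>\<^sup>+x. ennreal (norm (F x - G x)) \<partial>lborel))"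
    unfolding shift_dist_def by (subst nn_integral_add; simp)+
  also have "(\<integral>\<^sup>+x. ennreal (norm (F (x - h) - G (x - h))) \<partial>lborel) = (\<integral>\<^sup>+x. ennreal (norm (F x - G x)) \<partial>lborel)"
    using nn_integral_lborel_minus[of "\<lambda>x. ennreal (norm (F x - G x))" h] by simp
  finally show ?thesis by (simp add: mult_2 ac_simps)
qed

text \<open>The set of functions with this property is closed in L^1: the perturbation estimate
  bounds the upper limit by e for an approximation within e / 2.\<close>

lemma shift_dist_tendsto_of_approx:
  assumes F: "F \<in> borel_measurable borel" and H: "H \<longlonglongrightarrow> 0"
    and ap: "\<And>e. e > 0 \<Longrightarrow> \<exists>G. G \<in> borel_measurable borel \<and> (\<lambda>n. shift_dist G (H n)) \<longlonglongrightarrow> 0 \<and>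
       (\<integral>\<^sup>+x. ennreal (norm (F x - G x)) \<partial>lborel) \<le> ennreal e"
  shows "(\<lambda>n. shift_dist F (H n :: 'e::euclidean_space)) \<longlonglongrightarrow> 0"
proof (rule tendsto_0_if_Limsup_eq_0_ennreal)
  have "Limsup sequentially (\<lambda>n. shift_dist F (H n)) \<le> 0"
  proof (rule ennreal_le_epsilon)
    fix e :: real assume "e > 0"
    then obtain G where G: "G \<in> borel_measurable borel" "(\<lambda>n. shift_dist G (H n)) \<longlonglongrightarrow> 0"
      "(\<integral>\<^sup>+x. ennreal (norm (F x - G x)) \<partial>lborel) \<le> ennreal (e/2)"
      using ap[of "e/2"] by auto
    have "shift_dist F (H n) \<le> shift_dist G (H n) + ennreal e" for n
    proof -
      have "2 * (\<integral>\<^sup>+x. ennreal (norm (F x - G x)) \<partial>lborel) \<le> 2 * ennreal (e/2)"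
        using G(3) by (intro mult_left_mono) auto
      also have "\<dots> = ennreal e"
        using \<open>e > 0\<close> ennreal_mult[of 2 "e/2"] by simp
      finally show ?thesis using shift_dist_perturb[OF F G(1), of "H n"] by (meson add_left_mono order_trans)
    qed
    then have "Limsup sequentially (\<lambda>n. shift_dist F (H n)) \<le> Limsup sequentially (\<lambda>n. shift_dist G (H n) + ennreal e)"
      by (intro Limsup_mono) auto
    also have "\<dots> = ennreal e"
      using G(2) by (intro lim_imp_Limsup) (auto intro!: tendsto_eq_intros)
    finally show "Limsup sequentially (\<lambda>n. shift_dist F (H n)) \<le> 0 + ennreal e" by simp
  qed
  then show "Limsup sequentially (\<lambda>n. shift_dist F (H n)) = 0" by simp
qed

text \<open>A point of V remains in V under small translations, so the part of V outside its
  translate shrinks to measure zero by dominated convergence. The part of the translate outside V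
  has the same measure, because V and its translate have equal finite measure; that equality is
  \<open>eq\<close>.\<close>

lemma shift_dist_open:
  fixes V :: "'e::euclidean_space set" and c :: "'b::euclidean_space"
  assumes "open V" "emeasure lborel V < \<infinity>" "H \<longlonglongrightarrow> 0"
  shows "(\<lambda>n. shift_dist (\<lambda>x. indicator V x *\<^sub>R c) (H n)) \<longlonglongrightarrow> 0"
proof -
  have V[measurable]: "V \<in> sets borel" using assms by simp
  let ?d = "\<lambda>n x. indicator V x * (1 - indicator V (x - H n)) :: ennreal"
  have le: "shift_dist (\<lambda>x. indicator V x *\<^sub>R c) (H n) \<le> 2 * ennreal (norm c) * (\<integral>\<^sup>+x. ?d n x \<partial>lborel)" for n
  proof -
    let ?e = "\<lambda>x. indicator V (x - H n) * (1 - indicator V x) :: ennreal"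
    have "(\<integral>\<^sup>+x. ?d n x \<partial>lborel) + (\<integral>\<^sup>+x. indicator V x * indicator V (x - H n) \<partial>lborel) = (\<integral>\<^sup>+x. indicator V x \<partial>lborel)"
      by (subst nn_integral_add[symmetric], simp, simp, rule nn_integral_cong) (auto simp: indicator_def)
    moreover have "(\<integral>\<^sup>+x. ?e x \<partial>lborel) + (\<integral>\<^sup>+x. indicator V x * indicator V (x - H n) \<partial>lborel) = (\<integral>\<^sup>+x. indicator V (x - H n) \<partial>lborel)"
      by (subst nn_integral_add[symmetric], simp, simp, rule nn_integral_cong) (auto simp: indicator_def)
    moreover have "(\<integral>\<^sup>+x. indicator V (x - H n) \<partial>lborel) = (\<integral>\<^sup>+x. indicator V x \<partial>lborel)"
      by (rule nn_integral_lborel_minus) simp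
    moreover have "(\<integral>\<^sup>+x. indicator V x * indicator V (x - H n) \<partial>lborel) < \<infinity>"
    proof -
      have "(\<integral>\<^sup>+x. indicator V x * indicator V (x - H n) \<partial>lborel) \<le> (\<integral>\<^sup>+x. indicator V x \<partial>lborel)"
        by (intro nn_integral_mono) (auto simp: indicator_def)
      then show ?thesis using assms(2) by (simp add: le_less_trans)
    qed
    ultimately have eq: "(\<integral>\<^sup>+x. ?e x \<partial>lborel) = (\<integral>\<^sup>+x. ?d n x \<partial>lborel)"
      using ennreal_add_left_cancel[of "\<integral>\<^sup>+x. indicator V x * indicator V (x - H n) \<partial>lborel" "\<integral>\<^sup>+x. ?e x \<partial>lborel" "\<integral>\<^sup>+x. ?d n x \<partial>lborel"]
      unfolding add.commute[of "\<integral>\<^sup>+x. indicator V x * indicator V (x - H n) \<partial>lborel"] by (auto simp only: less_irrefl)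
    have "shift_dist (\<lambda>x. indicator V x *\<^sub>R c) (H n) \<le> (\<integral>\<^sup>+x. ennreal (norm c) * (?d n x + ?e x) \<partial>lborel)"
      unfolding shift_dist_def by (intro nn_integral_mono) (auto simp: indicator_def)
    also have "\<dots> = ennreal (norm c) * ((\<integral>\<^sup>+x. ?d n x \<partial>lborel) + (\<integral>\<^sup>+x. ?e x \<partial>lborel))"
      by (simp add: nn_integral_cmult nn_integral_add)
    finally show ?thesis by (simp only: eq mult_2 distrib_left distrib_right)
  qed
  have "(\<lambda>n. \<integral>\<^sup>+x. ?d n x \<partial>lborel) \<longlonglongrightarrow> (\<integral>\<^sup>+(x::'e). 0 \<partial>lborel)"
  proof (rule nn_integral_dominated_convergence[where w = "indicator V"])
    show "AE x in lborel. (\<lambda>n. ?d n x) \<longlonglongrightarrow> 0"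
    proof (rule AE_I2)
      fix x :: 'e
      show "(\<lambda>n. ?d n x) \<longlonglongrightarrow> 0"
      proof (cases "x \<in> V")
        case True
        have "(\<lambda>n. x - H n) \<longlonglongrightarrow> x" using tendsto_diff[OF tendsto_const assms(3), of x] by simp
        then have "\<forall>\<^sub>F n in sequentially. x - H n \<in> V" using topological_tendstoD assms(1) True by blast
        then have "\<forall>\<^sub>F n in sequentially. ?d n x = 0" by eventually_elim (simp add: indicator_def)
        then show ?thesis by (rule tendsto_eventually)
      qed simp
    qed
  qed (use assms(2) in \<open>auto split: split_indicator\<close>)
  then have "(\<lambda>n. 2 * ennreal (norm c) * (\<integral>\<^sup>+x. ?d n x \<partial>lborel)) \<longlonglongrightarrow> 2 * ennreal (norm c) * 0"
    by (intro ennreal_tendsto_cmult) (auto simp: ennreal_mult_less_top)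
  then show ?thesis
    by (intro tendsto_0_le_ennreal[OF le]) simp
qed

text \<open>Translations are continuous in L^1. In the induction over integrable functions, the
  indicator of a Borel set is compared with that of an open superset given by outer regularity, and
  the limit case is the closedness shown above.\<close>

lemma shift_dist_tendsto:
  fixes F :: "'e::euclidean_space \<Rightarrow> 'b::euclidean_space"
  assumes "integrable lborel F" and H: "H \<longlonglongrightarrow> 0"
  shows "(\<lambda>n. shift_dist F (H n)) \<longlonglongrightarrow> 0"
  using assms(1)
proof (induction rule: integrable_induct)
  case (base A c)
  have [measurable]: "A \<in> sets borel" using base by simp
  show ?case
  proof (rule shift_dist_tendsto_of_approx[OF _ H])
    fix e :: real assume "e > 0"
    \<comment> \<open>The summand 1 covers c = 0; after multiplication with \<open>norm c\<close>
      the error is at most e.\<close>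
    define e' where "e' = e / (norm c + 1)"
    have "e' > 0" using \<open>e > 0\<close> by (auto simp: e'_def intro!: divide_pos_pos add_nonneg_pos)
    obtain V where V: "open V" "A \<subseteq> V" "V - A \<in> lmeasurable" "emeasure lebesgue (V - A) < ennreal e'"
      using sets_lebesgue_outer_open[of A e'] \<open>e' > 0\<close> by auto
    have [measurable]: "V \<in> sets borel" using V by simp
    have lt: "emeasure lborel (V - A) < ennreal e'" using V(4) by simp
    have "emeasure lborel V \<le> emeasure lborel A + emeasure lborel (V - A)"
      using emeasure_subadditive[of A lborel "V - A"] V(2) by (simp add: Un_absorb1)
    also have "\<dots> < \<infinity>" using base lt by (auto simp: less_top[symmetric])
    finally have fin: "emeasure lborel V < \<infinity>" .
    show "\<exists>G. G \<in> borel_measurable borel \<and> (\<lambda>n. shift_dist G (H n)) \<longlonglongrightarrow> 0 \<and>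
       (\<integral>\<^sup>+x. ennreal (norm (indicator A x *\<^sub>R c - G x)) \<partial>lborel) \<le> ennreal e"
    proof (intro exI[of _ "\<lambda>x. indicator V x *\<^sub>R c"] conjI)
      show "(\<lambda>n. shift_dist (\<lambda>x. indicator V x *\<^sub>R c) (H n)) \<longlonglongrightarrow> 0" by (rule shift_dist_open[OF V(1) fin H])
      have "(\<integral>\<^sup>+x. ennreal (norm (indicator A x *\<^sub>R c - indicator V x *\<^sub>R c)) \<partial>lborel) = (\<integral>\<^sup>+x. ennreal (norm c) * indicator (V - A) x \<partial>lborel)"
        using V(2) by (intro nn_integral_cong) (auto simp: indicator_def)
      also have "\<dots> = ennreal (norm c) * emeasure lborel (V - A)" by (simp add: nn_integral_cmult)
      also have "\<dots> \<le> ennreal (norm c) * ennreal e'" using lt by (intro mult_left_mono) auto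
      also have "\<dots> \<le> ennreal e"
      proof -
        have "norm c * e' \<le> (norm c + 1) * e'" using \<open>e' > 0\<close> by simp
        also have "\<dots> = e" by (simp add: e'_def add_nonneg_eq_0_iff)
        finally show ?thesis using \<open>e' > 0\<close> by (simp add: ennreal_mult[symmetric] ennreal_leI)
      qed
      finally show "(\<integral>\<^sup>+x. ennreal (norm (indicator A x *\<^sub>R c - indicator V x *\<^sub>R c)) \<partial>lborel) \<le> ennreal e" .
    qed simp
  qed simp
next
  case (add f g)
  have [measurable]: "f \<in> borel_measurable borel" "g \<in> borel_measurable borel" using add by auto
  have "shift_dist (\<lambda>x. f x + g x) h \<le> shift_dist f h + shift_dist g h" for h
    unfolding shift_dist_def
  proof (subst nn_integral_add[symmetric]; (rule nn_integral_mono)?)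
    fix x
    show "ennreal (norm (f (x - h) + g (x - h) - (f x + g x))) \<le> ennreal (norm (f (x - h) - f x)) + ennreal (norm (g (x - h) - g x))"
      using norm_triangle_ineq[of "f (x - h) - f x" "g (x - h) - g x"]
      by (simp add: ennreal_plus[symmetric] algebra_simps del: ennreal_plus)
  qed auto
  moreover have "(\<lambda>n. shift_dist f (H n) + shift_dist g (H n)) \<longlonglongrightarrow> 0 + 0"
    using add by (intro tendsto_add) auto
  ultimately show ?case
    using tendsto_0_le_ennreal[of "\<lambda>n. shift_dist (\<lambda>x. f x + g x) (H n)" "\<lambda>n. shift_dist f (H n) + shift_dist g (H n)"] by simp
next
  case (lim f s)
  have [measurable]: "f \<in> borel_measurable borel" "\<And>i. s i \<in> borel_measurable borel" using lim by auto
  show ?case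
  proof (rule shift_dist_tendsto_of_approx[OF _ H])
    fix e :: real assume "e > 0"
    have "(\<lambda>i. \<integral>\<^sup>+x. ennreal (norm (f x - s i x)) \<partial>lborel) \<longlonglongrightarrow> 0"
      by (rule nn_integral_dominated_convergence_norm[where w = "\<lambda>x. 2 * norm (f x)"])
        (use lim in \<open>auto simp: integrable_iff_bounded ennreal_mult nn_integral_cmult ennreal_mult_less_top\<close>)
    then have "\<forall>\<^sub>F i in sequentially. (\<integral>\<^sup>+x. ennreal (norm (f x - s i x)) \<partial>lborel) < ennreal e"
      using \<open>e > 0\<close> by (intro order_tendstoD) auto
    then obtain i where "(\<integral>\<^sup>+x. ennreal (norm (f x - s i x)) \<partial>lborel) < ennreal e"
      by (auto simp: eventually_sequentially)
    then show "\<exists>G. G \<in> borel_measurable borel \<and> (\<lambda>n. shift_dist G (H n)) \<longlonglongrightarrow> 0 \<and>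
       (\<integral>\<^sup>+x. ennreal (norm (f x - G x)) \<partial>lborel) \<le> ennreal e"
      using lim by (intro exI[of _ "s i"]) auto
  qed simp
qed

lemma shift_dist_small:
  fixes F :: "'e::euclidean_space \<Rightarrow> 'b::euclidean_space"
  assumes "integrable lborel F" "e > 0"
  shows "\<exists>d>0. \<forall>h. norm h < d \<longrightarrow> shift_dist F h \<le> ennreal e"
proof (rule ccontr)
  assume "\<not> ?thesis"
  then have "\<forall>n. \<exists>h. norm h < inverse (real (Suc n)) \<and> \<not> shift_dist F h \<le> ennreal e"
    by (metis inverse_positive_iff_positive of_nat_0_less_iff zero_less_Suc)
  then obtain H where H: "\<And>n. norm (H n) < inverse (real (Suc n))" "\<And>n. \<not> shift_dist F (H n) \<le> ennreal e"
    by metis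
  have "H \<longlonglongrightarrow> 0"
    by (rule tendsto_norm_zero_cancel, rule tendsto_sandwich[OF _ _ tendsto_const LIMSEQ_inverse_real_of_nat])
      (use less_imp_le[OF H(1)] in \<open>auto intro!: always_eventually\<close>)
  from shift_dist_tendsto[OF assms(1) this] have "\<forall>\<^sub>F n in sequentially. shift_dist F (H n) < ennreal e"
    using assms(2) by (intro order_tendstoD) auto
  then obtain N where "shift_dist F (H N) < ennreal e" by (auto simp: eventually_sequentially)
  then show False using H(2)[of N] by simp
qed

text \<open>The error at x is the mean of F (x - h) - F x with weight \<rho> h. Exchanging the
  integrals bounds its L^1 norm by the \<rho>-mean of \<open>shift_dist F\<close>, which is at most
  e on the support of \<rho>.\<close>

lemma mollify_bound:
  fixes F :: "'e::euclidean_space \<Rightarrow> 'b::euclidean_space" and \<rho> :: "'e \<Rightarrow> real"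
  assumes F: "integrable lborel F" and \<rho>: "continuous_on UNIV \<rho>" "\<And>x. 0 \<le> \<rho> x" "\<And>x. \<rho> x \<le> C"
    "integrable lborel \<rho>" "(\<integral>x. \<rho> x \<partial>lborel) = 1"
    and sm: "\<And>h. \<rho> h \<noteq> 0 \<Longrightarrow> shift_dist F h \<le> e"
  shows "(\<integral>\<^sup>+x. ennreal (norm ((\<integral>y. \<rho> (x - y) *\<^sub>R F y \<partial>lborel) - F x)) \<partial>lborel) \<le> e"
proof -
  have [measurable]: "F \<in> borel_measurable borel" using F by auto
  have [measurable]: "\<rho> \<in> borel_measurable borel" using \<rho>(1) by (rule borel_measurable_continuous_onI)
  have pt: "ennreal (norm ((\<integral>y. \<rho> (x - y) *\<^sub>R F y \<partial>lborel) - F x)) \<le> (\<integral>\<^sup>+h. ennreal (\<rho> h) * ennreal (norm (F (x - h) - F x)) \<partial>lborel)" for x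
  proof -
    have i1: "integrable lborel (\<lambda>h. \<rho> h *\<^sub>R F (x - h))"
      by (rule Bochner_Integration.integrable_bound[OF integrable_scaleR_right[OF integrable_norm[OF integrable_lborel_reflect[OF F, of x]], of C]])
        (use \<rho> in \<open>auto intro!: AE_I2 order_trans[OF mult_right_mono abs_ge_self]\<close>)
    have "(\<integral>y. \<rho> (x - y) *\<^sub>R F y \<partial>lborel) = (\<integral>h. \<rho> h *\<^sub>R F (x - h) \<partial>lborel)"
      using integral_lborel_reflect[of "\<lambda>h. \<rho> h *\<^sub>R F (x - h)" x] by simp
    moreover have "F x = (\<integral>h. \<rho> h *\<^sub>R F x \<partial>lborel)" using \<rho> by simp
    ultimately have "(\<integral>y. \<rho> (x - y) *\<^sub>R F y \<partial>lborel) - F x = (\<integral>h. \<rho> h *\<^sub>R (F (x - h) - F x) \<partial>lborel)"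
      using i1 \<rho> by (simp add: scaleR_diff_right)
    moreover have "integrable lborel (\<lambda>h. \<rho> h *\<^sub>R (F (x - h) - F x))"
      using i1 \<rho> by (simp add: scaleR_diff_right)
    ultimately have "ennreal (norm ((\<integral>y. \<rho> (x - y) *\<^sub>R F y \<partial>lborel) - F x)) \<le> (\<integral>\<^sup>+h. ennreal (norm (\<rho> h *\<^sub>R (F (x - h) - F x))) \<partial>lborel)"
      using integral_norm_bound_ennreal[of lborel "\<lambda>h. \<rho> h *\<^sub>R (F (x - h) - F x)"] by simp
    then show ?thesis by (simp add: \<rho>(2) ennreal_mult)
  qed
  have "(\<integral>\<^sup>+x. ennreal (norm ((\<integral>y. \<rho> (x - y) *\<^sub>R F y \<partial>lborel) - F x)) \<partial>lborel)
      \<le> (\<integral>\<^sup>+x. (\<integral>\<^sup>+h. ennreal (\<rho> h) * ennreal (norm (F (x - h) - F x)) \<partial>lborel) \<partial>lborel)"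
    by (intro nn_integral_mono pt)
  also have "\<dots> = (\<integral>\<^sup>+h. (\<integral>\<^sup>+x. ennreal (\<rho> h) * ennreal (norm (F (x - h) - F x)) \<partial>lborel) \<partial>lborel)"
    by (rule lborel_pair.Fubini') simp
  also have "\<dots> = (\<integral>\<^sup>+h. ennreal (\<rho> h) * shift_dist F h \<partial>lborel)"
    unfolding shift_dist_def by (simp add: nn_integral_cmult)
  also have "\<dots> \<le> (\<integral>\<^sup>+h. ennreal (\<rho> h) * e \<partial>lborel)"
  proof (intro nn_integral_mono)
    fix h show "ennreal (\<rho> h) * shift_dist F h \<le> ennreal (\<rho> h) * e"
      using sm[of h] by (cases "\<rho> h = 0") (auto intro: mult_left_mono)
  qed
  also have "\<dots> = (\<integral>\<^sup>+h. ennreal (\<rho> h) \<partial>lborel) * e" by (simp add: nn_integral_multc)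
  also have "(\<integral>\<^sup>+h. ennreal (\<rho> h) \<partial>lborel) = 1"
    using \<rho> by (simp add: nn_integral_eq_integral)
  finally show ?thesis by simp
qed

subsection \<open>Continuously differentiable functions with compact support\<close>

text \<open>C^1 functions with an explicit gradient. One continuous derivative is all that
  approximants, cutoffs and integration by parts need.\<close>

definition has_gradient_on :: "('e::euclidean_space \<Rightarrow> real) \<Rightarrow> ('e \<Rightarrow> 'e) \<Rightarrow> 'e set \<Rightarrow> bool" where
  "has_gradient_on f g S \<longleftrightarrow> (\<forall>x\<in>S. (f has_derivative (\<lambda>w. g x \<bullet> w)) (at x)) \<and> continuous_on S g"

lemma has_gradient_on_continuous: "has_gradient_on f g S \<Longrightarrow> continuous_on S f"
  unfolding has_gradient_on_def
  by (auto intro!: continuous_at_imp_continuous_on dest: has_derivative_continuous)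

definition grad :: "('e::euclidean_space \<Rightarrow> real) \<Rightarrow> 'e \<Rightarrow> 'e" where
  "grad f x = (\<Sum>i\<in>Basis. dir_deriv i f x *\<^sub>R i)"

lemma grad_inner: "f differentiable (at x) \<Longrightarrow> grad f x \<bullet> w = dir_deriv w f x"
  using dir_deriv_expand[of f x w] by (simp add: grad_def inner_sum_left inner_commute[of w] mult.commute)

lemma smooth_on_has_gradient_on:
  assumes "smooth_on f S"
  shows "has_gradient_on f (grad f) S"
  unfolding has_gradient_on_def
proof (intro conjI ballI)
  fix x assume "x \<in> S"
  then show "(f has_derivative (\<lambda>w. grad f x \<bullet> w)) (at x)"
    using smooth_on_has_derivative[OF assms] by (simp add: grad_inner smooth_on_differentiable[OF assms])
next
  show "continuous_on S (grad f)"
    unfolding grad_def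
    by (intro continuous_intros smooth_on_continuous_on smooth_on_dir_deriv assms)
qed

lemma gradient_zero_outside:
  assumes g: "has_gradient_on f g UNIV" and K: "closed K" "\<And>x. x \<notin> K \<Longrightarrow> f x = 0" and x: "x \<notin> K"
  shows "g x = 0"
proof -
  have "((\<lambda>_. 0) has_derivative (\<lambda>w. 0)) (at x)" by simp
  then have "(f has_derivative (\<lambda>w. 0)) (at x)"
    by (rule has_derivative_transform_within_open[of _ _ x UNIV "- K"]) (use K x in auto)
  moreover have "(f has_derivative (\<lambda>w. g x \<bullet> w)) (at x)" using g by (simp add: has_gradient_on_def)
  ultimately have "g x \<bullet> w = 0" for w by (metis has_derivative_unique)
  then show ?thesis by (metis inner_eq_zero_iff)
qed

lemma gradient_compact_support_bound:
  assumes g: "has_gradient_on f g UNIV" and K: "compact K" "\<And>x. x \<notin> K \<Longrightarrow> f x = 0"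
  obtains L where "L \<ge> 0" "\<And>x. norm (g x) \<le> L" "\<And>x y. \<bar>f x - f y\<bar> \<le> L * norm (x - y)" "\<And>x. \<bar>f x\<bar> \<le> L"
proof -
  have "bounded (g ` K)"
    using g K by (intro compact_imp_bounded compact_continuous_image) (auto simp: has_gradient_on_def intro: continuous_on_subset)
  then obtain L where L: "\<And>x. x \<in> K \<Longrightarrow> norm (g x) \<le> L" by (auto simp: bounded_iff)
  have "bounded (f ` K)"
    using has_gradient_on_continuous[OF g] K by (intro compact_imp_bounded compact_continuous_image) (auto intro: continuous_on_subset)
  then obtain L' where L': "\<And>x. x \<in> K \<Longrightarrow> \<bar>f x\<bar> \<le> L'" by (auto simp: bounded_iff)
  define M where "M = max (max L L') 0"
  have gM: "norm (g x) \<le> M" for x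
    using L[of x] gradient_zero_outside[OF g compact_imp_closed[OF K(1)] K(2), of x] by (cases "x \<in> K") (auto simp: M_def)
  have "norm (f x - f y) \<le> M * norm (x - y)" for x y
  proof (rule differentiable_bound[of UNIV])
    fix z show "(f has_derivative (\<lambda>w. g z \<bullet> w)) (at z within UNIV)" using g by (simp add: has_gradient_on_def)
    show "onorm (\<lambda>w. g z \<bullet> w) \<le> M"
    proof (rule onorm_bound)
      show "norm (g z \<bullet> w) \<le> M * norm w" for w
        using order_trans[OF Cauchy_Schwarz_ineq2 mult_right_mono[OF gM norm_ge_zero]] by simp
    qed (simp add: M_def)
  qed auto
  moreover have "\<bar>f x\<bar> \<le> M" for x using L'[of x] K(2)[of x] by (cases "x \<in> K") (auto simp: M_def)
  ultimately show thesis using gM by (intro that[of M]) (auto simp: M_def)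
qed

lemma integrable_compact_support:
  fixes f :: "'e::euclidean_space \<Rightarrow> 'b::euclidean_space"
  assumes "continuous_on UNIV f" "compact K" "\<And>x. x \<notin> K \<Longrightarrow> f x = 0"
  shows "integrable lborel f"
proof -
  have "integrable lborel (\<lambda>x. indicator K x *\<^sub>R f x)"
    using assms by (intro borel_integrable_compact) (auto intro: continuous_on_subset)
  also have "(\<lambda>x. indicator K x *\<^sub>R f x) = f" using assms(3) by (auto simp: indicator_def)
  finally show ?thesis .
qed

text \<open>Translation invariance makes the integral of every difference quotient vanish.\<close>

lemma integral_gradient_eq_0:
  assumes g: "has_gradient_on f g UNIV" and K: "compact K" "\<And>x. x \<notin> K \<Longrightarrow> f x = 0"
  shows "(\<integral>x. g x \<bullet> w \<partial>lborel) = 0"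
proof -
  obtain L where L: "L \<ge> 0" "\<And>x. norm (g x) \<le> L" "\<And>x y. \<bar>f x - f y\<bar> \<le> L * norm (x - y)"
    using gradient_compact_support_bound[OF g K] by metis
  obtain R where R: "\<And>x. x \<in> K \<Longrightarrow> norm x \<le> R" using compact_imp_bounded[OF K(1)] by (auto simp: bounded_iff)
  define t where "t = (\<lambda>n. inverse (real (Suc n)))"
  have t: "t n > 0" "t n \<le> 1" for n by (auto simp: t_def inverse_le_1_iff)
  have tl: "t \<longlonglongrightarrow> 0" unfolding t_def by (rule LIMSEQ_inverse_real_of_nat)
  have cf: "continuous_on UNIV f" by (rule has_gradient_on_continuous[OF g])
  have [measurable]: "f \<in> borel_measurable borel" using cf by (rule borel_measurable_continuous_onI)
  have [measurable]: "g \<in> borel_measurable borel" using g by (auto simp: has_gradient_on_def intro: borel_measurable_continuous_onI)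
  have fi: "integrable lborel f" by (rule integrable_compact_support[OF cf K])
  define q where "q = (\<lambda>n x. (f (x + t n *\<^sub>R w) - f x) / t n)"
  \<comment> \<open>Since \<open>t n <= 1\<close>, this ball contains the supports of all difference
    quotients and carries a common integrable bound.\<close>
  define B where "B = cball (0::'a) (R + norm w)"
  have q0: "(\<integral>x. q n x \<partial>lborel) = 0" for n
    using integral_lborel_minus[of f "- (t n *\<^sub>R w)"] fi integrable_lborel_minus[OF fi, of "- (t n *\<^sub>R w)"]
    by (simp add: q_def)
  have "(\<lambda>n. \<integral>x. q n x \<partial>lborel) \<longlonglongrightarrow> (\<integral>x. g x \<bullet> w \<partial>lborel)"
  proof (rule integral_dominated_convergence[where w = "\<lambda>x. indicator B x *\<^sub>R (L * norm w)"])
    show "integrable lborel (\<lambda>x. indicator B x *\<^sub>R (L * norm w))"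
      by (rule borel_integrable_compact) (auto simp: B_def)
    show "AE x in lborel. (\<lambda>n. q n x) \<longlonglongrightarrow> g x \<bullet> w"
    proof (rule AE_I2)
      fix x
      have "(f has_derivative (\<lambda>w. g x \<bullet> w)) (at x)" using g by (simp add: has_gradient_on_def)
      moreover have "((\<lambda>s. x + s *\<^sub>R w) has_derivative (\<lambda>h. h *\<^sub>R w)) (at 0)" by (auto intro!: derivative_eq_intros)
      ultimately have "((\<lambda>s. f (x + s *\<^sub>R w)) has_derivative (\<lambda>h. g x \<bullet> (h *\<^sub>R w))) (at 0)"
        using has_derivative_compose[of "\<lambda>s. x + s *\<^sub>R w" "\<lambda>h. h *\<^sub>R w" 0 UNIV f "\<lambda>w. g x \<bullet> w"] by simp
      then have "((\<lambda>s. f (x + s *\<^sub>R w)) has_real_derivative (g x \<bullet> w)) (at 0)"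
        by (simp add: has_field_derivative_def mult_commute_abs)
      then have "((\<lambda>h. (f (x + h *\<^sub>R w) - f x) / h) \<longlongrightarrow> g x \<bullet> w) (at 0)" by (simp add: DERIV_def)
      moreover have "filterlim t (at 0) sequentially"
        using tl t(1) by (intro filterlim_atI) (auto simp: less_imp_neq[symmetric])
      ultimately show "(\<lambda>n. q n x) \<longlonglongrightarrow> g x \<bullet> w" unfolding q_def by (rule filterlim_compose)
    qed
    show "AE x in lborel. norm (q n x) \<le> indicator B x *\<^sub>R (L * norm w)" for n
    proof (rule AE_I2)
      fix x
      show "norm (q n x) \<le> indicator B x *\<^sub>R (L * norm w)"
      proof (cases "x \<in> B")
        case True
        have "\<bar>f (x + t n *\<^sub>R w) - f x\<bar> \<le> L * norm (t n *\<^sub>R w)" using L(3)[of "x + t n *\<^sub>R w" x] by simp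
        then show ?thesis using True t[of n] by (simp add: q_def field_simps abs_divide)
      next
        case False
        have "x \<notin> K" using False R[of x] norm_ge_zero[of w] unfolding B_def by (smt (verit) mem_cball_0)
        moreover have "x + t n *\<^sub>R w \<notin> K"
        proof
          assume "x + t n *\<^sub>R w \<in> K"
          then have "norm (x + t n *\<^sub>R w) \<le> R" by (rule R)
          moreover have "norm (t n *\<^sub>R w) \<le> norm w" using t[of n] by (simp add: mult_left_le_one_le)
          ultimately have "norm x \<le> R + norm w" using norm_triangle_ineq4[of "x + t n *\<^sub>R w" "t n *\<^sub>R w"] by simp
          then show False using False by (simp add: B_def)
        qed
        ultimately show ?thesis using K(2) False by (simp add: q_def)
      qed
    qed
  qed (auto simp: q_def)
  then show ?thesis using q0 by (simp add: LIMSEQ_const_iff)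
qed

text \<open>Differentiation under the integral sign: a C^1 function with compact support is
  Lipschitz, so the remainder quotients of \<rho> are bounded by 2 L and the integrable function V
  supplies the domination.\<close>

lemma convolution_gradient:
  fixes V :: "'e::euclidean_space \<Rightarrow> real"
  assumes V: "integrable lborel V"
    and g: "has_gradient_on \<rho> g UNIV" and K: "compact K" "\<And>x. x \<notin> K \<Longrightarrow> \<rho> x = 0"
  shows "has_gradient_on (\<lambda>x. \<integral>y. V y * \<rho> (x - y) \<partial>lborel) (\<lambda>x. \<integral>y. V y *\<^sub>R g (x - y) \<partial>lborel) UNIV"
proof -
  obtain L where L: "L \<ge> 0" "\<And>x. norm (g x) \<le> L" "\<And>x y. \<bar>\<rho> x - \<rho> y\<bar> \<le> L * norm (x - y)" "\<And>x. \<bar>\<rho> x\<bar> \<le> L"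
    using gradient_compact_support_bound[OF g K] by metis
  have [measurable]: "V \<in> borel_measurable borel" using V by auto
  have cg: "continuous_on UNIV g" using g by (simp add: has_gradient_on_def)
  have [measurable]: "\<rho> \<in> borel_measurable borel" "g \<in> borel_measurable borel"
    using has_gradient_on_continuous[OF g] cg by (auto intro: borel_measurable_continuous_onI)
  have iV: "integrable lborel (\<lambda>y. C * \<bar>V y\<bar>)" for C using V by simp
  have i1: "integrable lborel (\<lambda>y. V y * \<rho> (x - y))" for x
    by (rule Bochner_Integration.integrable_bound[OF iV[of L]])
      (auto simp: abs_mult mult.commute[of L] L(1) intro!: mult_left_mono L(4))
  have i2: "integrable lborel (\<lambda>y. V y *\<^sub>R g (x - y))" for x
    by (rule Bochner_Integration.integrable_bound[OF iV[of L]])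
      (auto simp: abs_mult mult.commute[of L] L(1) intro!: mult_left_mono L(2))
  show ?thesis unfolding has_gradient_on_def
  proof (intro conjI ballI)
    show "continuous_on UNIV (\<lambda>x. \<integral>y. V y *\<^sub>R g (x - y) \<partial>lborel)"
    proof (rule continuous_at_imp_continuous_on, intro ballI continuous_within_sequentiallyI)
      fix x and X :: "nat \<Rightarrow> 'e" assume X: "X \<longlonglongrightarrow> x"
      show "(\<lambda>n. \<integral>y. V y *\<^sub>R g (X n - y) \<partial>lborel) \<longlonglongrightarrow> (\<integral>y. V y *\<^sub>R g (x - y) \<partial>lborel)"
      proof (rule integral_dominated_convergence[where w = "\<lambda>y. L * \<bar>V y\<bar>"])
        show "AE y in lborel. (\<lambda>n. V y *\<^sub>R g (X n - y)) \<longlonglongrightarrow> V y *\<^sub>R g (x - y)"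
          by (intro AE_I2 tendsto_intros continuous_on_tendsto_compose[OF cg]) (use X in auto)
        show "AE y in lborel. norm (V y *\<^sub>R g (X n - y)) \<le> L * \<bar>V y\<bar>" for n
          using L(2) by (auto simp: mult.commute[of L] intro!: mult_left_mono)
      qed (use iV in auto)
    qed
  next
    fix x :: 'e
    let ?F = "\<lambda>x. \<integral>y. V y * \<rho> (x - y) \<partial>lborel"
    let ?G = "\<integral>y. V y *\<^sub>R g (x - y) \<partial>lborel"
    have "((\<lambda>z. norm (?F z - ?F x - ?G \<bullet> (z - x)) / norm (z - x)) \<longlongrightarrow> 0) (at x)"
      unfolding tendsto_at_iff_sequentially
    proof (intro allI impI, unfold o_def)
      fix X :: "nat \<Rightarrow> 'e" assume X': "\<forall>i. X i \<in> UNIV - {x}" and X: "X \<longlonglongrightarrow> x"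
      define q where "q = (\<lambda>n y. (\<rho> (X n - y) - \<rho> (x - y) - g (x - y) \<bullet> (X n - x)) / norm (X n - x))"
      have nz: "norm (X n - x) > 0" for n using X' by auto
      have eq: "(?F (X n) - ?F x - ?G \<bullet> (X n - x)) / norm (X n - x) = (\<integral>y. V y * q n y \<partial>lborel)" for n
      proof -
        have i3: "integrable lborel (\<lambda>y. V y * (g (x - y) \<bullet> (X n - x)))"
          using integrable_inner_left[OF i2[of x], of "X n - x"] by simp
        have "?G \<bullet> (X n - x) = (\<integral>y. V y * (g (x - y) \<bullet> (X n - x)) \<partial>lborel)"
          using integral_inner_left[OF i2[of x], of "X n - x"] by simp
        then have "?F (X n) - ?F x - ?G \<bullet> (X n - x) = (\<integral>y. V y * \<rho> (X n - y) - V y * \<rho> (x - y) - V y * (g (x - y) \<bullet> (X n - x)) \<partial>lborel)"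
          using i1 i3 by simp
        also have "\<dots> / norm (X n - x) = (\<integral>y. V y * q n y \<partial>lborel)"
          unfolding integral_divide_zero[symmetric] q_def
          by (intro Bochner_Integration.integral_cong) (auto simp: field_simps)
        finally show ?thesis .
      qed
      have "(\<lambda>n. \<integral>y. V y * q n y \<partial>lborel) \<longlonglongrightarrow> (\<integral>y. 0 \<partial>(lborel :: 'e measure))"
      proof (rule integral_dominated_convergence[where w = "\<lambda>y. (2 * L) * \<bar>V y\<bar>"])
        show "AE y in lborel. (\<lambda>n. V y * q n y) \<longlonglongrightarrow> 0"
        proof (rule AE_I2)
          fix y
          have "(\<rho> has_derivative (\<lambda>w. g (x - y) \<bullet> w)) (at (x - y))" using g by (simp add: has_gradient_on_def)
          then have "((\<lambda>z. (\<rho> z - \<rho> (x - y) - g (x - y) \<bullet> (z - (x - y))) /\<^sub>R norm (z - (x - y))) \<longlongrightarrow> 0) (at (x - y))"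
            unfolding has_derivative_def by (simp add: Lim_ident_at)
          moreover have "filterlim (\<lambda>n. X n - y) (at (x - y)) sequentially"
            using X X' by (intro filterlim_atI) (auto intro: tendsto_diff)
          ultimately have "(\<lambda>n. (\<rho> (X n - y) - \<rho> (x - y) - g (x - y) \<bullet> (X n - y - (x - y))) /\<^sub>R norm (X n - y - (x - y))) \<longlonglongrightarrow> 0"
            by (rule filterlim_compose)
          then have "(\<lambda>n. q n y) \<longlonglongrightarrow> 0" by (simp add: q_def divide_inverse mult.commute)
          then show "(\<lambda>n. V y * q n y) \<longlonglongrightarrow> 0" by (rule tendsto_mult_right_zero)
        qed
        show "AE y in lborel. norm (V y * q n y) \<le> (2 * L) * \<bar>V y\<bar>" for n
        proof (rule AE_I2)
          fix y
          have "\<bar>\<rho> (X n - y) - \<rho> (x - y) - g (x - y) \<bullet> (X n - x)\<bar> \<le> L * norm (X n - x) + L * norm (X n - x)"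
          proof -
            have "\<bar>\<rho> (X n - y) - \<rho> (x - y)\<bar> \<le> L * norm (X n - x)" using L(3)[of "X n - y" "x - y"] by simp
            moreover have "\<bar>g (x - y) \<bullet> (X n - x)\<bar> \<le> L * norm (X n - x)"
              by (rule order_trans[OF Cauchy_Schwarz_ineq2 mult_right_mono[OF L(2) norm_ge_zero]])
            ultimately show ?thesis by linarith
          qed
          then have "\<bar>q n y\<bar> \<le> 2 * L" using nz[of n] by (simp add: q_def abs_divide divide_le_eq)
          then show "norm (V y * q n y) \<le> (2 * L) * \<bar>V y\<bar>" by (simp add: abs_mult mult.commute[of "2 * L"] mult_left_mono)
        qed
      qed (use iV in \<open>auto simp: q_def\<close>)
      then have "(\<lambda>n. (?F (X n) - ?F x - ?G \<bullet> (X n - x)) / norm (X n - x)) \<longlonglongrightarrow> 0" by (simp add: eq)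
      then have "(\<lambda>n. norm ((?F (X n) - ?F x - ?G \<bullet> (X n - x)) / norm (X n - x))) \<longlonglongrightarrow> 0" by (rule tendsto_norm_zero)
      then show "(\<lambda>n. norm (?F (X n) - ?F x - ?G \<bullet> (X n - x)) / norm (X n - x)) \<longlonglongrightarrow> 0" by simp
    qed
    then show "(?F has_derivative (\<lambda>w. ?G \<bullet> w)) (at x)"
      by (simp add: has_derivative_iff_norm bounded_linear_inner_right)
  qed
qed

section \<open>Local approximation of weakly differentiable functions\<close>

text \<open>The closure of C^1 functions in the Sobolev norm of L^1 type on N. The L^1 norm is
  chosen because weak differentials are only assumed locally integrable in charts, and approximants
  are required on N alone, so that no cutoff is involved.\<close>

definition sob_on :: "'e::euclidean_space set \<Rightarrow> ('e \<Rightarrow> real) \<Rightarrow> ('e \<Rightarrow> 'e) \<Rightarrow> bool" where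
  "sob_on N v \<omega> \<longleftrightarrow> open N \<and> set_integrable lborel N v \<and> set_integrable lborel N \<omega> \<and>
     (\<exists>f g. (\<forall>j. has_gradient_on (f j) (g j) N) \<and>
       (\<lambda>j. \<integral>\<^sup>+x\<in>N. ennreal (\<bar>f j x - v x\<bar> + norm (g j x - \<omega> x)) \<partial>lborel) \<longlonglongrightarrow> 0)"

lemma has_gradient_on_subset: "has_gradient_on f g S \<Longrightarrow> T \<subseteq> S \<Longrightarrow> has_gradient_on f g T"
  unfolding has_gradient_on_def by (auto intro: continuous_on_subset)

lemma sob_on_subset:
  assumes "sob_on N v \<omega>" "open M" "M \<subseteq> N"
  shows "sob_on M v \<omega>"
proof -
  obtain f g where fg: "\<And>j. has_gradient_on (f j) (g j) N"
    "(\<lambda>j. \<integral>\<^sup>+x\<in>N. ennreal (\<bar>f j x - v x\<bar> + norm (g j x - \<omega> x)) \<partial>lborel) \<longlonglongrightarrow> 0"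
    using assms(1) unfolding sob_on_def by blast
  have "(\<lambda>j. \<integral>\<^sup>+x\<in>M. ennreal (\<bar>f j x - v x\<bar> + norm (g j x - \<omega> x)) \<partial>lborel) \<longlonglongrightarrow> 0"
    by (rule tendsto_0_le_ennreal[OF nn_integral_mono fg(2)]) (use assms(3) in \<open>auto simp: indicator_def\<close>)
  moreover have "set_integrable lborel M v" "set_integrable lborel M \<omega>"
    using assms unfolding sob_on_def by (auto intro: set_integrable_subset)
  ultimately show ?thesis
    using assms(2) has_gradient_on_subset[OF fg(1) assms(3)] unfolding sob_on_def by blast
qed

lemma set_integrable_cong_on:
  assumes "\<And>x. x \<in> N \<Longrightarrow> v x = v' x"
  shows "set_integrable M N v \<longleftrightarrow> set_integrable M N v'"
proof -
  have "(\<lambda>x. indicator N x *\<^sub>R v x) = (\<lambda>x. indicator N x *\<^sub>R v' x)"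
    by (rule ext) (auto simp: indicator_def assms)
  then show ?thesis by (simp add: set_integrable_def)
qed

lemma sob_on_cong:
  assumes "\<And>x. x \<in> N \<Longrightarrow> v x = v' x" "\<And>x. x \<in> N \<Longrightarrow> \<omega> x = \<omega>' x" "sob_on N v \<omega>"
  shows "sob_on N v' \<omega>'"
proof -
  have "(\<integral>\<^sup>+x\<in>N. ennreal (\<bar>f x - v x\<bar> + norm (g x - \<omega> x)) \<partial>lborel) =
     (\<integral>\<^sup>+x\<in>N. ennreal (\<bar>f x - v' x\<bar> + norm (g x - \<omega>' x)) \<partial>lborel)" for f g
    by (intro nn_integral_cong) (auto simp: indicator_def assms)
  then show ?thesis
    using assms(3) set_integrable_cong_on[of N v v'] set_integrable_cong_on[of N \<omega> \<omega>'] assms(1,2)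
    unfolding sob_on_def by simp
qed

lemma sob_on_C1:
  assumes "open N" "has_gradient_on v \<omega> N" "set_integrable lborel N v" "set_integrable lborel N \<omega>"
  shows "sob_on N v \<omega>"
  unfolding sob_on_def using assms by (intro conjI exI[of _ "\<lambda>_. v"] exI[of _ "\<lambda>_. \<omega>"]) auto

lemma sob_on_zero: "open N \<Longrightarrow> sob_on N (\<lambda>_. 0) (\<lambda>_. 0)"
  by (rule sob_on_C1) (auto simp: has_gradient_on_def set_integrable_def)

lemma set_integrable_local:
  fixes v :: "'e::euclidean_space \<Rightarrow> 'b::{banach, second_countable_topology}"
  assumes loc: "\<And>x. x \<in> K \<Longrightarrow> \<exists>N. open N \<and> x \<in> N \<and> set_integrable lborel N v" and K: "compact K"
  shows "set_integrable lborel K v"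
proof -
  obtain N where N: "\<And>x. x \<in> K \<Longrightarrow> open (N x)" "\<And>x. x \<in> K \<Longrightarrow> x \<in> N x" "\<And>x. x \<in> K \<Longrightarrow> set_integrable lborel (N x) v"
    using loc by metis
  obtain I where I: "I \<subseteq> K" "finite I" "K \<subseteq> (\<Union>x\<in>I. N x)"
    by (rule compactE_image[OF K, of K N]) (use N in auto)
  have "set_integrable lborel (\<Union>x\<in>I. N x) v" using I(2,1)
  proof (induction I rule: finite_induct)
    case (insert a I)
    have "open (\<Union>x\<in>I. N x)" by (intro open_UN) (use insert N in auto)
    then show ?case using insert N by (auto intro!: set_integrable_Un)
  qed (simp add: set_integrable_def)
  then show ?thesis
    by (rule set_integrable_subset) (use I(3) borel_compact[OF K] in auto)
qed

subsection \<open>Weakly differentiable functions are approximable\<close>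

text \<open>Friedrichs mollification. For x near x0 the translated kernel is an admissible test
  function; testing with it moves the derivative from the kernel to \<omega>. The gradient of the
  mollified function is thus the mollified \<omega>, and both converge in L^1.\<close>

lemma weak_derivative_imp_sob_on:
  fixes v :: "'e::euclidean_space \<Rightarrow> real"
  assumes U: "open U"
    and int: "\<And>K. compact K \<Longrightarrow> K \<subseteq> U \<Longrightarrow> set_integrable lborel K v \<and> set_integrable lborel K \<omega>"
    and weak: "\<And>\<eta> w. test_function U \<eta> \<Longrightarrow>
       (LINT x:U|lborel. v x * dir_deriv w \<eta> x) = - (LINT x:U|lborel. (\<omega> x \<bullet> w) * \<eta> x)"
    and x0: "x0 \<in> U"
  shows "\<exists>N. x0 \<in> N \<and> sob_on N v \<omega>"
proof -
  obtain R where R: "R > 0" "cball x0 R \<subseteq> U" using U x0 open_contains_cball by blast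
  \<comment> \<open>Kernels of radius less than r centred in the ball of radius r stay inside the
    compact ball of radius 2 r.\<close>
  define r where "r = R / 2"
  have r: "r > 0" "cball x0 (2 * r) \<subseteq> U" using R by (auto simp: r_def)
  define K where "K = cball x0 (2 * r)"
  define V where "V = (\<lambda>x. indicator K x *\<^sub>R v x)"
  define W where "W = (\<lambda>x. indicator K x *\<^sub>R \<omega> x)"
  have K: "compact K" "K \<subseteq> U" using r by (auto simp: K_def)
  have V: "integrable lborel V" and W: "integrable lborel W"
    using int[OF K] by (auto simp: V_def W_def set_integrable_def)
  \<comment> \<open>Two successors, so that the radius is strictly below r already for j =
    0.\<close>
  define \<epsilon> where "\<epsilon> = (\<lambda>j. r * inverse (real (Suc (Suc j))))"
  have \<epsilon>: "\<epsilon> j > 0" "\<epsilon> j < r" for j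
    using r(1) inverse_less_1_iff[of "real (Suc (Suc j))"] by (auto simp: \<epsilon>_def)
  have "\<epsilon> \<longlonglongrightarrow> r * 0"
    unfolding \<epsilon>_def by (intro tendsto_mult tendsto_const LIMSEQ_Suc[OF LIMSEQ_inverse_real_of_nat])
  then have \<epsilon>0: "\<epsilon> \<longlonglongrightarrow> 0" by simp
  define \<beta> where "\<beta> = (\<lambda>j (x::'e). bump ((1 / \<epsilon> j) *\<^sub>R x) :: real)"
  have lin: "bounded_linear (\<lambda>x::'e. a *\<^sub>R x)" for a by (rule bounded_linear_scaleR_right)
  have sm\<beta>: "smooth_on (\<beta> j) UNIV" for j
    unfolding \<beta>_def
    by (rule smooth_on_compose[where f=bump and g="\<lambda>x. (1 / \<epsilon> j) *\<^sub>R x" and T=UNIV])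
      (use smooth_on_linear[OF lin, of "1 / \<epsilon> j" UNIV] smooth_on_bump[of UNIV] in auto)
  have \<beta>0: "\<beta> j x = 0" if "norm x \<ge> \<epsilon> j" for j x
    using that \<epsilon>(1)[of j] unfolding \<beta>_def by (intro bump_eq_0) (simp add: field_simps)
  have c\<beta>: "continuous_on UNIV (\<beta> j)" for j by (rule smooth_on_continuous_on[OF sm\<beta>])
  have i\<beta>: "integrable lborel (\<beta> j)" for j
    by (rule integrable_compact_support[OF c\<beta>, of "cball 0 (\<epsilon> j)"]) (auto simp: \<beta>0)
  define m where "m = (\<lambda>j. \<integral>x. \<beta> j x \<partial>lborel)"
  have mpos: "m j > 0" for j
  proof -
    have "m j \<ge> 0" unfolding m_def by (rule Bochner_Integration.integral_nonneg) (simp add: \<beta>_def bump_nonneg)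
    moreover have "m j \<noteq> 0"
    proof
      assume "m j = 0"
      then have "AE x in lborel. \<beta> j x = 0"
        using integral_nonneg_eq_0_iff_AE[OF i\<beta>] by (simp add: m_def \<beta>_def bump_nonneg)
      then have "AE x in lborel. x \<notin> ball (0::'e) (\<epsilon> j)"
      proof eventually_elim
        case (elim x)
        then have "\<not> norm ((1 / \<epsilon> j) *\<^sub>R x) < 1" unfolding \<beta>_def using bump_pos_iff[of "(1 / \<epsilon> j) *\<^sub>R x"] by simp
        then show ?case using \<epsilon>(1)[of j] by (simp add: field_simps)
      qed
      then have "emeasure lborel (ball (0::'e) (\<epsilon> j)) = 0"
        by (subst (asm) AE_iff_measurable[of "ball 0 (\<epsilon> j)"]) auto
      then show False using content_ball_pos[OF \<epsilon>(1)[of j], of "0::'e"] by (simp add: measure_def)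
    qed
    ultimately show ?thesis by simp
  qed
  define \<rho> where "\<rho> = (\<lambda>j x. (1 / m j) * \<beta> j x)"
  have sm\<rho>: "smooth_on (\<rho> j) UNIV" for j
    unfolding \<rho>_def by (rule smooth_on_mult[OF _ smooth_on_const sm\<beta>]) simp
  have g\<rho>: "has_gradient_on (\<rho> j) (grad (\<rho> j)) UNIV" for j by (rule smooth_on_has_gradient_on[OF sm\<rho>])
  have c\<rho>: "continuous_on UNIV (\<rho> j)" for j by (rule smooth_on_continuous_on[OF sm\<rho>])
  have \<rho>0: "\<rho> j x = 0" if "norm x \<ge> \<epsilon> j" for j x using \<beta>0[OF that] by (simp add: \<rho>_def)
  have \<rho>0': "\<rho> j x = 0" if "x \<notin> cball 0 (\<epsilon> j)" for j x using \<rho>0[of j x] that by auto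
  have \<rho>pos: "0 \<le> \<rho> j x" for j x using mpos[of j] by (simp add: \<rho>_def \<beta>_def bump_nonneg)
  have \<rho>le: "\<rho> j x \<le> 1 / m j" for j x
    using mpos[of j] divide_right_mono[OF bump_le_1, of "m j"] by (simp add: \<rho>_def \<beta>_def)
  have i\<rho>: "integrable lborel (\<rho> j)" for j unfolding \<rho>_def using i\<beta> by simp
  have \<rho>1: "(\<integral>x. \<rho> j x \<partial>lborel) = 1" for j unfolding \<rho>_def using mpos[of j] by (simp add: m_def)
  have grad\<rho>0: "grad (\<rho> j) x = 0" if "norm x > \<epsilon> j" for j x
    by (rule gradient_zero_outside[OF g\<rho> _ \<rho>0', of "cball 0 (\<epsilon> j)" ]) (use that in auto)
  have conv: "(\<lambda>j. \<integral>\<^sup>+x. ennreal (norm ((\<integral>y. \<rho> j (x - y) *\<^sub>R F y \<partial>lborel) - F x)) \<partial>lborel) \<longlonglongrightarrow> 0"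
    if F: "integrable lborel F" for F :: "'e \<Rightarrow> 'c::euclidean_space"
  proof (rule order_tendstoI)
    fix a :: ennreal assume "a < 0" then show "\<forall>\<^sub>F j in sequentially. a < (\<integral>\<^sup>+x. ennreal (norm ((\<integral>y. \<rho> j (x - y) *\<^sub>R F y \<partial>lborel) - F x)) \<partial>lborel)"
      by simp
  next
    fix a :: ennreal assume "0 < a"
    then obtain e where e: "0 < e" "e < a" using dense by blast
    then have "e < \<infinity>" by (auto simp: less_top[symmetric] intro: le_neq_trans)
    then obtain e' where e': "e = ennreal e'" "e' > 0" using e(1) by (cases e) auto
    obtain d where d: "d > 0" "\<And>h. norm h < d \<Longrightarrow> shift_dist F h \<le> ennreal e'"
      using shift_dist_small[OF F e'(2)] by blast
    have "\<forall>\<^sub>F j in sequentially. \<epsilon> j < d" using \<epsilon>0 d(1) by (rule order_tendstoD(2))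
    then show "\<forall>\<^sub>F j in sequentially. (\<integral>\<^sup>+x. ennreal (norm ((\<integral>y. \<rho> j (x - y) *\<^sub>R F y \<partial>lborel) - F x)) \<partial>lborel) < a"
    proof eventually_elim
      case (elim j)
      have "(\<integral>\<^sup>+x. ennreal (norm ((\<integral>y. \<rho> j (x - y) *\<^sub>R F y \<partial>lborel) - F x)) \<partial>lborel) \<le> ennreal e'"
      proof (rule mollify_bound[OF F c\<rho> \<rho>pos \<rho>le i\<rho> \<rho>1])
        fix h assume "\<rho> j h \<noteq> 0"
        then have "norm h < \<epsilon> j" using \<rho>0[of j h] by force
        then show "shift_dist F h \<le> ennreal e'" using d(2) elim by simp
      qed
      then show ?case using e e' by simp
    qed
  qed
  define f where "f = (\<lambda>j x. \<integral>y. V y * \<rho> j (x - y) \<partial>lborel)"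
  define g where "g = (\<lambda>j x. \<integral>y. V y *\<^sub>R grad (\<rho> j) (x - y) \<partial>lborel)"
  have fg: "has_gradient_on (f j) (g j) UNIV" for j
    unfolding f_def g_def by (rule convolution_gradient[OF V g\<rho>, of "cball 0 (\<epsilon> j)"]) (auto simp: \<rho>0')
  define N where "N = ball x0 r"
  have gW: "g j x = (\<integral>y. \<rho> j (x - y) *\<^sub>R W y \<partial>lborel)" if x: "x \<in> N" for j x
  proof (rule euclidean_eqI)
    fix w :: 'e
    define \<eta> where "\<eta> = (\<lambda>y. \<rho> j (x - y))"
    have sm\<eta>: "smooth_on \<eta> UNIV"
      unfolding \<eta>_def
      by (rule smooth_on_compose[OF _ _ _ smooth_on_diff[OF _ smooth_on_const smooth_on_linear[OF bounded_linear_ident]] sm\<rho>]) auto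
    have sub: "cball x (\<epsilon> j) \<subseteq> K"
    proof
      fix y assume "y \<in> cball x (\<epsilon> j)"
      then show "y \<in> K" using x \<epsilon>(2)[of j] dist_triangle[of x0 y x] by (simp add: K_def N_def)
    qed
    have sup: "{y. \<eta> y \<noteq> 0} \<subseteq> cball x (\<epsilon> j)" using \<rho>0 by (force simp: \<eta>_def dist_norm)
    then have clos: "closure {y. \<eta> y \<noteq> 0} \<subseteq> cball x (\<epsilon> j)" by (simp add: closure_minimal)
    then have "compact (closure {y. \<eta> y \<noteq> 0})"
      by (meson bounded_cball bounded_subset closed_closure compact_eq_bounded_closed)
    then have "test_function U \<eta>" using sm\<eta> clos sub K unfolding test_function_def by blast
    note wk = weak[OF this, of w]
    have D\<eta>: "dir_deriv w \<eta> y = - (grad (\<rho> j) (x - y) \<bullet> w)" for y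
    proof (rule dir_deriv_eq)
      have "((\<lambda>y. x - y) has_derivative (\<lambda>h. - h)) (at y)" by (auto intro!: derivative_eq_intros)
      moreover have "(\<rho> j has_derivative (\<lambda>w. grad (\<rho> j) (x - y) \<bullet> w)) (at (x - y))"
        using g\<rho> by (simp add: has_gradient_on_def)
      ultimately show "(\<eta> has_derivative (\<lambda>w. - (grad (\<rho> j) (x - y) \<bullet> w))) (at y)"
        using has_derivative_compose[of "\<lambda>y. x - y" "\<lambda>h. - h" y UNIV "\<rho> j" "\<lambda>w. grad (\<rho> j) (x - y) \<bullet> w"]
        by (simp add: \<eta>_def)
    qed
    obtain L where L: "L \<ge> 0" "\<And>z. norm (grad (\<rho> j) z) \<le> L" "\<And>z. \<bar>\<rho> j z\<bar> \<le> L"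
      using gradient_compact_support_bound[OF g\<rho>[of j], of "cball 0 (\<epsilon> j)"] \<rho>0' by (metis compact_cball)
    have [measurable]: "grad (\<rho> j) \<in> borel_measurable borel" "\<rho> j \<in> borel_measurable borel"
      using g\<rho>[of j] c\<rho>[of j] by (auto simp: has_gradient_on_def intro: borel_measurable_continuous_onI)
    have [measurable]: "V \<in> borel_measurable borel" "W \<in> borel_measurable borel" using V W by auto
    have i1: "integrable lborel (\<lambda>y. V y *\<^sub>R grad (\<rho> j) (x - y))"
      by (rule Bochner_Integration.integrable_bound[OF integrable_mult_left[OF integrable_norm[OF V], of L]])
        (auto simp: abs_mult L(1) intro!: mult_left_mono L(2))
    have i2: "integrable lborel (\<lambda>y. \<rho> j (x - y) *\<^sub>R W y)"
      by (rule Bochner_Integration.integrable_bound[OF integrable_mult_right[OF integrable_norm[OF W], of L]])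
        (auto simp: abs_mult L(1) intro!: mult_right_mono L(3))
    have "g j x \<bullet> w = (\<integral>y. V y * (grad (\<rho> j) (x - y) \<bullet> w) \<partial>lborel)"
      unfolding g_def using integral_inner_left[OF i1, of w] by simp
    also have "\<dots> = - (LINT y:U|lborel. v y * dir_deriv w \<eta> y)"
    proof -
      have "indicator U y *\<^sub>R (v y * dir_deriv w \<eta> y) = - (V y * (grad (\<rho> j) (x - y) \<bullet> w))" for y
      proof (cases "y \<in> K")
        case True then show ?thesis using K(2) by (auto simp: V_def D\<eta>)
      next
        case False
        then have "y \<notin> cball x (\<epsilon> j)" using sub by blast
        then have "norm (x - y) > \<epsilon> j" by (simp add: dist_norm)
        then show ?thesis using False by (simp add: V_def D\<eta> grad\<rho>0)
      qed
      then show ?thesis by (simp add: set_lebesgue_integral_def)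
    qed
    also have "\<dots> = (LINT y:U|lborel. (\<omega> y \<bullet> w) * \<eta> y)" using wk by simp
    also have "\<dots> = (\<integral>y. (\<rho> j (x - y) *\<^sub>R W y) \<bullet> w \<partial>lborel)"
    proof -
      have "indicator U y *\<^sub>R ((\<omega> y \<bullet> w) * \<eta> y) = (\<rho> j (x - y) *\<^sub>R W y) \<bullet> w" for y
      proof (cases "y \<in> K")
        case True then show ?thesis using K(2) by (auto simp: W_def \<eta>_def)
      next
        case False
        then have "y \<notin> cball x (\<epsilon> j)" using sub by blast
        then have "norm (x - y) > \<epsilon> j" by (simp add: dist_norm)
        then show ?thesis using False by (simp add: W_def \<eta>_def \<rho>0)
      qed
      then show ?thesis by (simp add: set_lebesgue_integral_def)
    qed
    also have "\<dots> = (\<integral>y. \<rho> j (x - y) *\<^sub>R W y \<partial>lborel) \<bullet> w" by (rule integral_inner_left) (rule i2)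
    finally show "g j x \<bullet> w = (\<integral>y. \<rho> j (x - y) *\<^sub>R W y \<partial>lborel) \<bullet> w" .
  qed
  have NK: "N \<subseteq> K" using r by (auto simp: N_def K_def)
  have "(\<lambda>j. \<integral>\<^sup>+x\<in>N. ennreal (\<bar>f j x - v x\<bar> + norm (g j x - \<omega> x)) \<partial>lborel) \<longlonglongrightarrow> 0"
  proof (rule tendsto_0_le_ennreal)
    have [measurable]: "V \<in> borel_measurable borel" "W \<in> borel_measurable borel" using V W by auto
    have [measurable]: "f j \<in> borel_measurable borel" "\<rho> j \<in> borel_measurable borel" for j
      using has_gradient_on_continuous[OF fg[of j]] c\<rho>[of j] by (auto intro: borel_measurable_continuous_onI)
    show "(\<integral>\<^sup>+x\<in>N. ennreal (\<bar>f j x - v x\<bar> + norm (g j x - \<omega> x)) \<partial>lborel) \<le>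
      (\<integral>\<^sup>+x. ennreal (norm ((\<integral>y. \<rho> j (x - y) *\<^sub>R V y \<partial>lborel) - V x)) \<partial>lborel)
       + (\<integral>\<^sup>+x. ennreal (norm ((\<integral>y. \<rho> j (x - y) *\<^sub>R W y \<partial>lborel) - W x)) \<partial>lborel)" for j
    proof (subst nn_integral_add[symmetric])
      show "(\<integral>\<^sup>+x\<in>N. ennreal (\<bar>f j x - v x\<bar> + norm (g j x - \<omega> x)) \<partial>lborel) \<le> (\<integral>\<^sup>+x. ennreal (norm ((\<integral>y. \<rho> j (x - y) *\<^sub>R V y \<partial>lborel) - V x))
       + ennreal (norm ((\<integral>y. \<rho> j (x - y) *\<^sub>R W y \<partial>lborel) - W x)) \<partial>lborel)"
      proof (rule nn_integral_mono)
        fix x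
        show "ennreal (\<bar>f j x - v x\<bar> + norm (g j x - \<omega> x)) * indicator N x \<le> ennreal (norm ((\<integral>y. \<rho> j (x - y) *\<^sub>R V y \<partial>lborel) - V x))
       + ennreal (norm ((\<integral>y. \<rho> j (x - y) *\<^sub>R W y \<partial>lborel) - W x))"
          using NK by (cases "x \<in> N") (auto simp: gW f_def V_def[of] W_def[of] mult.commute subset_iff ennreal_plus)
      qed
    qed auto
    show "(\<lambda>j. (\<integral>\<^sup>+x. ennreal (norm ((\<integral>y. \<rho> j (x - y) *\<^sub>R V y \<partial>lborel) - V x)) \<partial>lborel)
       + (\<integral>\<^sup>+x. ennreal (norm ((\<integral>y. \<rho> j (x - y) *\<^sub>R W y \<partial>lborel) - W x)) \<partial>lborel)) \<longlonglongrightarrow> 0"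
      using tendsto_add[OF conv[OF V] conv[OF W]] by simp
  qed
  moreover have "set_integrable lborel N v" "set_integrable lborel N \<omega>"
    using int[OF K] NK by (auto intro: set_integrable_subset simp: N_def)
  moreover have "has_gradient_on (f j) (g j) N" for j using fg has_gradient_on_subset by blast
  ultimately have "sob_on N v \<omega>" unfolding sob_on_def by (auto simp: N_def)
  then show ?thesis using r(1) by (intro exI[of _ N]) (auto simp: N_def)
qed

subsection \<open>Approximable functions are weakly differentiable\<close>

text \<open>For an approximant f the product f \<eta> is C^1 with compact support, so its gradient
  has integral zero. Boundedness of \<eta> and its gradient lets the identity pass to the L^1
  limit.\<close>

lemma sob_on_integration_by_parts:
  fixes v :: "'e::euclidean_space \<Rightarrow> real"
  assumes s: "sob_on N v \<omega>" and \<eta>: "has_gradient_on \<eta> g\<eta> UNIV" and K: "compact K" "K \<subseteq> N" "\<And>x. x \<notin> K \<Longrightarrow> \<eta> x = 0"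
  shows "(\<integral>x. indicator N x * (v x * (g\<eta> x \<bullet> w)) \<partial>lborel) = - (\<integral>x. indicator N x * ((\<omega> x \<bullet> w) * \<eta> x) \<partial>lborel)"
    "integrable lborel (\<lambda>x. indicator N x * (v x * (g\<eta> x \<bullet> w)))"
    "integrable lborel (\<lambda>x. indicator N x * ((\<omega> x \<bullet> w) * \<eta> x))"
proof -
  obtain f g where fg: "\<And>j. has_gradient_on (f j) (g j) N"
    "(\<lambda>j. \<integral>\<^sup>+x\<in>N. ennreal (\<bar>f j x - v x\<bar> + norm (g j x - \<omega> x)) \<partial>lborel) \<longlonglongrightarrow> 0"
    using s unfolding sob_on_def by blast
  have N: "open N" and iv: "integrable lborel (\<lambda>x. indicator N x *\<^sub>R v x)" and i\<omega>: "integrable lborel (\<lambda>x. indicator N x *\<^sub>R \<omega> x)"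
    using s by (auto simp: sob_on_def set_integrable_def)
  have [measurable]: "N \<in> sets borel" using N by simp
  obtain L where L: "L \<ge> 0" "\<And>x. norm (g\<eta> x) \<le> L" "\<And>x. \<bar>\<eta> x\<bar> \<le> L"
    using gradient_compact_support_bound[OF \<eta> K(1,3)] by metis
  have g\<eta>0: "g\<eta> x = 0" if "x \<notin> K" for x by (rule gradient_zero_outside[OF \<eta> compact_imp_closed[OF K(1)] K(3) that])
  have [measurable]: "\<eta> \<in> borel_measurable borel" "g\<eta> \<in> borel_measurable borel"
    using has_gradient_on_continuous[OF \<eta>] \<eta> by (auto simp: has_gradient_on_def intro: borel_measurable_continuous_onI)
  have gw: "\<bar>g\<eta> x \<bullet> w\<bar> \<le> L * norm w" for x
    by (rule order_trans[OF Cauchy_Schwarz_ineq2 mult_right_mono[OF L(2) norm_ge_zero]])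
  have mv: "(\<lambda>x. indicator N x * v x) \<in> borel_measurable borel" using borel_measurable_integrable[OF iv] by simp
  have m\<omega>: "(\<lambda>x. indicator N x *\<^sub>R \<omega> x) \<in> borel_measurable borel" using borel_measurable_integrable[OF i\<omega>] by simp
  have e1: "indicator N x * (v x * (g\<eta> x \<bullet> w)) = (indicator N x * v x) * (g\<eta> x \<bullet> w)" for x by simp
  have e2: "indicator N x * ((\<omega> x \<bullet> w) * \<eta> x) = ((indicator N x *\<^sub>R \<omega> x) \<bullet> w) * \<eta> x" for x by simp
  show i1: "integrable lborel (\<lambda>x. indicator N x * (v x * (g\<eta> x \<bullet> w)))" unfolding e1
    by (rule Bochner_Integration.integrable_bound[OF integrable_mult_left[OF integrable_norm[OF iv], of "L * norm w"]])
      (use mv in \<open>auto simp: abs_mult L(1) intro!: mult_left_mono gw\<close>)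
  show i2: "integrable lborel (\<lambda>x. indicator N x * ((\<omega> x \<bullet> w) * \<eta> x))" unfolding e2
  proof (rule Bochner_Integration.integrable_bound[OF integrable_mult_left[OF integrable_norm[OF i\<omega>], of "L * norm w"]])
    show "AE x in lborel. norm ((indicator N x *\<^sub>R \<omega> x) \<bullet> w * \<eta> x) \<le> norm (norm (indicator N x *\<^sub>R \<omega> x) * (L * norm w))"
    proof (rule AE_I2)
      fix x
      have "\<bar>(indicator N x *\<^sub>R \<omega> x) \<bullet> w\<bar> * \<bar>\<eta> x\<bar> \<le> (norm (indicator N x *\<^sub>R \<omega> x) * norm w) * L"
        by (intro mult_mono Cauchy_Schwarz_ineq2 L) (auto simp: L(1))
      then show "norm ((indicator N x *\<^sub>R \<omega> x) \<bullet> w * \<eta> x) \<le> norm (norm (indicator N x *\<^sub>R \<omega> x) * (L * norm w))"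
        using L(1) by (simp add: abs_mult ac_simps)
    qed
  qed (simp only: measurable_lborel2, rule borel_measurable_times[OF borel_measurable_inner[OF m\<omega> borel_measurable_const]], simp)
  have z: "(\<integral>x. f j x * (g\<eta> x \<bullet> w) + (g j x \<bullet> w) * \<eta> x \<partial>lborel) = 0"
    and i3: "integrable lborel (\<lambda>x. f j x * (g\<eta> x \<bullet> w) + (g j x \<bullet> w) * \<eta> x)" for j
  proof -
    \<comment> \<open>The product extended by zero. N and the complement of K form an open cover on
      whose members C^1 regularity is evident.\<close>
    define h where "h = (\<lambda>x. if x \<in> N then f j x * \<eta> x else 0)"
    define gh where "gh = (\<lambda>x. if x \<in> N then f j x *\<^sub>R g\<eta> x + \<eta> x *\<^sub>R g j x else 0)"
    have cover: "UNIV = N \<union> - K" using K(2) by auto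
    have oK: "open (- K)" using K(1) compact_imp_closed by auto
    have gh: "has_gradient_on h gh UNIV" unfolding has_gradient_on_def
    proof (intro conjI ballI)
      show "continuous_on UNIV gh" unfolding cover
      proof (rule continuous_on_open_Un[OF N oK])
        have "continuous_on N (\<lambda>x. f j x *\<^sub>R g\<eta> x + \<eta> x *\<^sub>R g j x)"
          using has_gradient_on_continuous[OF fg(1)] fg(1) has_gradient_on_continuous[OF \<eta>] \<eta>
          by (auto intro!: continuous_intros simp: has_gradient_on_def intro: continuous_on_subset)
        then show "continuous_on N gh" by (rule continuous_on_eq) (simp add: gh_def)
        show "continuous_on (- K) gh"
          by (rule continuous_on_eq[OF continuous_on_const[of _ 0]]) (auto simp: gh_def g\<eta>0 K(3))
      qed
      fix x
      show "(h has_derivative (\<lambda>w. gh x \<bullet> w)) (at x)"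
      proof (cases "x \<in> N")
        case True
        have "((\<lambda>x. f j x * \<eta> x) has_derivative (\<lambda>w. f j x * (g\<eta> x \<bullet> w) + (g j x \<bullet> w) * \<eta> x)) (at x)"
          using fg(1)[of j] \<eta> True by (intro has_derivative_mult) (auto simp: has_gradient_on_def)
        then have "(h has_derivative (\<lambda>w. f j x * (g\<eta> x \<bullet> w) + (g j x \<bullet> w) * \<eta> x)) (at x)"
          by (rule has_derivative_transform_within_open[of _ _ x UNIV N]) (use N True in \<open>auto simp: h_def\<close>)
        then show ?thesis using True by (simp add: gh_def inner_add_left mult.commute)
      next
        case False
        have "((\<lambda>x. 0) has_derivative (\<lambda>w. 0)) (at x)" by simp
        then have "(h has_derivative (\<lambda>w. 0)) (at x)"
          by (rule has_derivative_transform_within_open[of _ _ x UNIV "- K"]) (use oK False K in \<open>auto simp: h_def\<close>)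
        then show ?thesis using False by (simp add: gh_def)
      qed
    qed
    have ghw: "gh x \<bullet> w = f j x * (g\<eta> x \<bullet> w) + (g j x \<bullet> w) * \<eta> x" for x
      using K(2) by (cases "x \<in> K") (auto simp: gh_def g\<eta>0 K(3) inner_add_left mult.commute subset_iff)
    show "(\<integral>x. f j x * (g\<eta> x \<bullet> w) + (g j x \<bullet> w) * \<eta> x \<partial>lborel) = 0"
      unfolding ghw[symmetric] by (rule integral_gradient_eq_0[OF gh K(1)]) (auto simp: h_def K(3))
    show "integrable lborel (\<lambda>x. f j x * (g\<eta> x \<bullet> w) + (g j x \<bullet> w) * \<eta> x)"
      unfolding ghw[symmetric]
      by (rule integrable_compact_support[OF _ K(1)])
        (use gh in \<open>auto simp: has_gradient_on_def gh_def g\<eta>0 K(3) intro!: continuous_intros\<close>)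
  qed
  \<comment> \<open>I is the defect of the identity. It does not depend on j, yet it is bounded by C
    times the approximation error of every index j.\<close>
  define I where "I = (\<integral>x. indicator N x * (v x * (g\<eta> x \<bullet> w)) + indicator N x * ((\<omega> x \<bullet> w) * \<eta> x) \<partial>lborel)"
  define C where "C = L * norm w"
  have C: "C \<ge> 0" using L by (simp add: C_def)
  have bd: "ennreal \<bar>I\<bar> \<le> ennreal C * (\<integral>\<^sup>+x\<in>N. ennreal (\<bar>f j x - v x\<bar> + norm (g j x - \<omega> x)) \<partial>lborel)" for j
  proof -
    let ?d = "\<lambda>x. (indicator N x * (v x * (g\<eta> x \<bullet> w)) + indicator N x * ((\<omega> x \<bullet> w) * \<eta> x)) - (f j x * (g\<eta> x \<bullet> w) + (g j x \<bullet> w) * \<eta> x)"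
    have "I = (\<integral>x. ?d x \<partial>lborel)" unfolding I_def using z i3 i1 i2 by simp
    moreover have "integrable lborel ?d" using i1 i2 i3 by simp
    ultimately have "ennreal \<bar>I\<bar> \<le> (\<integral>\<^sup>+x. ennreal (norm (?d x)) \<partial>lborel)"
      using integral_norm_bound_ennreal[of lborel ?d] by simp
    also have "\<dots> \<le> (\<integral>\<^sup>+x. ennreal C * (ennreal (\<bar>f j x - v x\<bar> + norm (g j x - \<omega> x)) * indicator N x) \<partial>lborel)"
    proof (rule nn_integral_mono)
      fix x
      show "ennreal (norm (?d x)) \<le> ennreal C * (ennreal (\<bar>f j x - v x\<bar> + norm (g j x - \<omega> x)) * indicator N x)"
      proof (cases "x \<in> N")
        case True
        have "?d x = (v x - f j x) * (g\<eta> x \<bullet> w) + ((\<omega> x - g j x) \<bullet> w) * \<eta> x"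
          using True by (simp add: algebra_simps inner_diff_left)
        also have "norm \<dots> \<le> \<bar>v x - f j x\<bar> * \<bar>g\<eta> x \<bullet> w\<bar> + \<bar>(\<omega> x - g j x) \<bullet> w\<bar> * \<bar>\<eta> x\<bar>"
          by (simp add: abs_mult[symmetric] abs_triangle_ineq)
        also have "\<dots> \<le> \<bar>v x - f j x\<bar> * C + (norm (\<omega> x - g j x) * norm w) * L"
          unfolding C_def by (intro add_mono mult_mono gw Cauchy_Schwarz_ineq2 L) (auto simp: L(1))
        also have "\<dots> = C * (\<bar>f j x - v x\<bar> + norm (g j x - \<omega> x))"
          by (simp add: C_def algebra_simps norm_minus_commute abs_minus_commute)
        finally show ?thesis using True C by (simp add: ennreal_mult'[symmetric] ennreal_leI del: ennreal_plus)
      next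
        case False
        then have "x \<notin> K" using K(2) by auto
        then show ?thesis using False by (simp add: g\<eta>0 K(3))
      qed
    qed
    also have "\<dots> = ennreal C * (\<integral>\<^sup>+x\<in>N. ennreal (\<bar>f j x - v x\<bar> + norm (g j x - \<omega> x)) \<partial>lborel)"
    proof (rule nn_integral_cmult)
      have fj: "(\<lambda>x. indicator N x * f j x) \<in> borel_measurable borel" "(\<lambda>x. indicator N x *\<^sub>R g j x) \<in> borel_measurable borel"
        using borel_measurable_continuous_on_indicator[of N "f j"] has_gradient_on_continuous[OF fg(1)]
          borel_measurable_continuous_on_indicator[of N "g j"] fg(1)[of j] by (auto simp: has_gradient_on_def)
      have "(\<lambda>x. ennreal (\<bar>indicator N x * f j x - indicator N x * v x\<bar> + norm (indicator N x *\<^sub>R g j x - indicator N x *\<^sub>R \<omega> x)) * indicator N x) \<in> borel_measurable borel"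
        using fj mv m\<omega> by measurable
      also have "(\<lambda>x. ennreal (\<bar>indicator N x * f j x - indicator N x * v x\<bar> + norm (indicator N x *\<^sub>R g j x - indicator N x *\<^sub>R \<omega> x)) * indicator N x)
        = (\<lambda>x. ennreal (\<bar>f j x - v x\<bar> + norm (g j x - \<omega> x)) * indicator N x)"
        by (auto simp: indicator_def)
      finally show "(\<lambda>x. ennreal (\<bar>f j x - v x\<bar> + norm (g j x - \<omega> x)) * indicator N x) \<in> borel_measurable lborel" by simp
    qed
    finally show ?thesis .
  qed
  have "(\<lambda>j. ennreal C * (\<integral>\<^sup>+x\<in>N. ennreal (\<bar>f j x - v x\<bar> + norm (g j x - \<omega> x)) \<partial>lborel)) \<longlonglongrightarrow> ennreal C * 0"
    by (intro ennreal_tendsto_cmult fg(2)) simp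
  then have "ennreal \<bar>I\<bar> \<le> ennreal C * 0" using bd by (intro LIMSEQ_le_const) auto
  then have "I = 0" by simp
  moreover have "I = (\<integral>x. indicator N x * (v x * (g\<eta> x \<bullet> w)) \<partial>lborel) + (\<integral>x. indicator N x * ((\<omega> x \<bullet> w) * \<eta> x) \<partial>lborel)"
    unfolding I_def using i1 i2 by simp
  ultimately show "(\<integral>x. indicator N x * (v x * (g\<eta> x \<bullet> w)) \<partial>lborel) = - (\<integral>x. indicator N x * ((\<omega> x \<bullet> w) * \<eta> x) \<partial>lborel)" by simp
qed

section \<open>C^1 partitions of unity\<close>

lemma has_real_derivative_max_0_power2: "((\<lambda>s::real. (max 0 s)\<^sup>2) has_real_derivative 2 * max 0 s) (at s)"
proof -
  consider "s < 0" | "s = 0" | "s > 0" by linarith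
  then show ?thesis
  proof cases
    case 1
    have "((\<lambda>_. 0) has_real_derivative 0) (at s)" by simp
    then have "((\<lambda>s::real. (max 0 s)\<^sup>2) has_real_derivative 0) (at s)"
      by (rule has_field_derivative_transform_within_open[where S="{..<0}"]) (use 1 in auto)
    then show ?thesis using 1 by simp
  next
    case 2
    have "((\<lambda>h::real. max 0 h) \<longlongrightarrow> max 0 0) (at 0)" by (intro tendsto_intros)
    then have "((\<lambda>h::real. max 0 h) \<longlongrightarrow> 0) (at 0)" by simp
    then have "((\<lambda>h::real. (max 0 h)\<^sup>2 / h) \<longlongrightarrow> 0) (at 0)"
      by (rule Lim_transform_eventually) (auto simp: eventually_at power2_eq_square max_def intro!: exI[of _ 1])
    then show ?thesis using 2 by (simp add: DERIV_def)
  next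
    case 3
    have "((\<lambda>s. s\<^sup>2) has_real_derivative 2 * s) (at s)" by (auto intro!: derivative_eq_intros)
    then have "((\<lambda>s::real. (max 0 s)\<^sup>2) has_real_derivative 2 * s) (at s)"
      by (rule has_field_derivative_transform_within_open[where S="{0<..}"]) (use 3 in auto)
    then show ?thesis using 3 by simp
  qed
qed

text \<open>For r > 0 the square of the positive part of r^2 - |x - a|^2 works, since squaring
  smooths the kink at the sphere to C^1; otherwise the ball is empty and 0 works.\<close>

lemma ex_C1_ball_function:
  fixes a :: "'e::euclidean_space"
  obtains b gb where "has_gradient_on b gb UNIV" "\<And>x. 0 \<le> b x" "\<And>x. b x > 0 \<longleftrightarrow> dist a x < r"
proof (cases "r > 0")
  case True
  define q where "q = (\<lambda>x. r\<^sup>2 - (x - a) \<bullet> (x - a))"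
  define b where "b = (\<lambda>x. (max 0 (q x))\<^sup>2)"
  define gb where "gb = (\<lambda>x. (- 4 * max 0 (q x)) *\<^sub>R (x - a))"
  have "has_gradient_on b gb UNIV" unfolding has_gradient_on_def
  proof (intro conjI ballI)
    show "continuous_on UNIV gb" unfolding gb_def q_def by (intro continuous_intros)
    fix x
    have "(q has_derivative (\<lambda>w. - 2 * ((x - a) \<bullet> w))) (at x)"
      unfolding q_def by (auto intro!: derivative_eq_intros simp: inner_commute)
    from has_derivative_compose[OF this has_field_derivative_imp_has_derivative[OF has_real_derivative_max_0_power2]]
    show "(b has_derivative (\<lambda>w. gb x \<bullet> w)) (at x)" unfolding b_def gb_def by (simp add: mult.assoc)
  qed
  moreover have "b x > 0 \<longleftrightarrow> dist a x < r" for x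
  proof -
    have "b x > 0 \<longleftrightarrow> q x > 0" by (auto simp: b_def max_def)
    also have "\<dots> \<longleftrightarrow> (norm (x - a))\<^sup>2 < r\<^sup>2" by (simp add: q_def power2_norm_eq_inner)
    also have "\<dots> \<longleftrightarrow> norm (x - a) < r"
      using True by (metis abs_norm_cancel abs_of_pos power2_less_imp_less power_strict_mono less_imp_le norm_ge_zero zero_less_numeral)
    finally show ?thesis by (simp add: dist_norm norm_minus_commute)
  qed
  ultimately show thesis by (intro that[of b gb]) (auto simp: b_def)
next
  case False
  then have "\<not> dist a x < r" for x using zero_le_dist[of a x] by linarith
  then show thesis
    by (intro that[of "\<lambda>_. 0" "\<lambda>_. 0"]) (auto simp: has_gradient_on_def)
qed

text \<open>A C^1 partition of unity subordinate to finitely many balls splits \<eta> into pieces,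
  each of which is supported where one approximating sequence is available. Integration by parts for
  the pieces adds up to the claim.\<close>

lemma sob_local_imp_weak:
  fixes v :: "'e::euclidean_space \<Rightarrow> real"
  assumes U: "open U" and loc: "\<And>x. x \<in> U \<Longrightarrow> \<exists>N. x \<in> N \<and> sob_on N v \<omega>"
    and \<eta>: "has_gradient_on \<eta> g\<eta> UNIV" and K: "compact K" "K \<subseteq> U" "\<And>x. x \<notin> K \<Longrightarrow> \<eta> x = 0"
  shows "(LINT x:U|lborel. v x * (g\<eta> x \<bullet> w)) = - (LINT x:U|lborel. (\<omega> x \<bullet> w) * \<eta> x)"
proof -
  \<comment> \<open>Approximation is arranged on the doubled ball, so that a piece supported in the
    closed ball of radius r has compact support in an open set.\<close>
  have "\<exists>r>0. sob_on (ball x (2 * r)) v \<omega>" if "x \<in> K" for x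
  proof -
    obtain N where N: "x \<in> N" "sob_on N v \<omega>" using loc K(2) \<open>x \<in> K\<close> by blast
    then have "open N" by (simp add: sob_on_def)
    then obtain s where "s > 0" "ball x s \<subseteq> N" using N(1) open_contains_ball by blast
    then show ?thesis using sob_on_subset[OF N(2), of "ball x s"] by (intro exI[of _ "s/2"]) auto
  qed
  then obtain r where r: "\<And>x. x \<in> K \<Longrightarrow> r x > 0" "\<And>x. x \<in> K \<Longrightarrow> sob_on (ball x (2 * r x)) v \<omega>" by metis
  obtain I where I': "I \<subseteq> K" "finite I" "K \<subseteq> (\<Union>x\<in>I. ball x (r x))"
    by (rule compactE_image[OF K(1), of K "\<lambda>x. ball x (r x)"]) (use r(1) in auto)
  then have I: "finite I" "I \<subseteq> K" "K \<subseteq> (\<Union>x\<in>I. ball x (r x))" by auto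
  have "\<exists>b gb. has_gradient_on b gb UNIV \<and> (\<forall>x. 0 \<le> b x) \<and> (\<forall>x. b x > 0 \<longleftrightarrow> dist a x < r a)" for a
    using ex_C1_ball_function[of a "r a"] by metis
  then obtain b gb where b: "\<And>a. has_gradient_on (b a) (gb a) UNIV" "\<And>a x. 0 \<le> b a x" "\<And>a x. b a x > 0 \<longleftrightarrow> dist a x < r a"
    by metis
  define S where "S = (\<lambda>x. \<Sum>a\<in>I. b a x)"
  define gS where "gS = (\<lambda>x. \<Sum>a\<in>I. gb a x)"
  have gS: "has_gradient_on S gS UNIV"
    using b(1) unfolding has_gradient_on_def S_def gS_def inner_sum_left
    by (auto intro!: continuous_intros has_derivative_sum)
  have cont: "continuous_on UNIV S" "continuous_on UNIV gS" "continuous_on UNIV \<eta>" "continuous_on UNIV g\<eta>"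
    "continuous_on UNIV (b a)" "continuous_on UNIV (gb a)" for a
    using has_gradient_on_continuous[OF gS] gS has_gradient_on_continuous[OF \<eta>] \<eta> has_gradient_on_continuous[OF b(1)] b(1)
    by (auto simp: has_gradient_on_def)
  have SK: "S x > 0" if x: "x \<in> K" for x
  proof -
    obtain a where a: "a \<in> I" "x \<in> ball a (r a)" using I(3) x by blast
    then have "b a x > 0" using b(3) by simp
    then show ?thesis unfolding S_def using I(1) a(1) b(2) by (intro sum_pos2) auto
  qed
  have g\<eta>0: "g\<eta> x = 0" if "x \<notin> K" for x by (rule gradient_zero_outside[OF \<eta> compact_imp_closed[OF K(1)] K(3) that])
  define P where "P = {x. S x > 0}"
  have oP: "open P" unfolding P_def using cont(1) by (intro open_Collect_less) auto
  have oK: "open (- K)" using K(1) compact_imp_closed by auto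
  have cover: "UNIV = P \<union> - K" using SK by (auto simp: P_def)
  \<comment> \<open>The sum S may vanish off K, but there \<eta> vanishes too, so the quotient is 0.
    Regularity is checked on the cover by the set where S is positive and the complement of
    K.\<close>
  define \<eta>' where "\<eta>' = (\<lambda>a x. \<eta> x * b a x / S x)"
  define g' where "g' = (\<lambda>a x. (b a x / S x) *\<^sub>R g\<eta> x + (\<eta> x / S x) *\<^sub>R gb a x - (\<eta> x * b a x / (S x)\<^sup>2) *\<^sub>R gS x)"
  have g': "has_gradient_on (\<eta>' a) (g' a) UNIV" for a unfolding has_gradient_on_def
  proof (intro conjI ballI)
    show "continuous_on UNIV (g' a)" unfolding cover
    proof (rule continuous_on_open_Un[OF oP oK])
      show "continuous_on P (g' a)" unfolding g'_def
        by (intro continuous_intros; (rule continuous_on_subset[OF _ subset_UNIV], rule cont)?) (auto simp: P_def)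
      show "continuous_on (- K) (g' a)"
        by (rule continuous_on_eq[OF continuous_on_const[of _ 0]]) (auto simp: g'_def g\<eta>0 K(3))
    qed
    fix x
    show "(\<eta>' a has_derivative (\<lambda>w. g' a x \<bullet> w)) (at x)"
    proof (cases "x \<in> P")
      case True
      then have "S x \<noteq> 0" by (simp add: P_def)
      have d1: "((\<lambda>x. \<eta> x * b a x) has_derivative (\<lambda>w. \<eta> x * (gb a x \<bullet> w) + (g\<eta> x \<bullet> w) * b a x)) (at x)"
        using \<eta> b(1)[of a] by (intro has_derivative_mult) (auto simp: has_gradient_on_def)
      have d2: "(S has_derivative (\<lambda>w. gS x \<bullet> w)) (at x)" using gS by (simp add: has_gradient_on_def)
      have "(\<eta>' a has_derivative (\<lambda>w. ((\<eta> x * (gb a x \<bullet> w) + (g\<eta> x \<bullet> w) * b a x) * S x - (\<eta> x * b a x) * (gS x \<bullet> w)) / (S x * S x))) (at x)"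
        unfolding \<eta>'_def by (rule has_derivative_divide'[OF d1 d2 \<open>S x \<noteq> 0\<close>])
      moreover have "((\<eta> x * (gb a x \<bullet> w) + (g\<eta> x \<bullet> w) * b a x) * S x - (\<eta> x * b a x) * (gS x \<bullet> w)) / (S x * S x) = g' a x \<bullet> w" for w
        using \<open>S x \<noteq> 0\<close> by (simp add: g'_def inner_add_left inner_diff_left field_simps power2_eq_square)
      ultimately show ?thesis by simp
    next
      case False
      then have "x \<in> - K" using cover by auto
      have "((\<lambda>x. 0) has_derivative (\<lambda>w. 0)) (at x)" by simp
      then have "(\<eta>' a has_derivative (\<lambda>w. 0)) (at x)"
        by (rule has_derivative_transform_within_open[of _ _ x UNIV "- K"]) (use oK \<open>x \<in> - K\<close> K in \<open>auto simp: \<eta>'_def\<close>)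
      then show ?thesis using \<open>x \<in> - K\<close> by (simp add: g'_def g\<eta>0 K(3))
    qed
  qed
  have sum1: "(\<Sum>a\<in>I. \<eta>' a x) = \<eta> x" for x
  proof (cases "x \<in> K")
    case True
    then have "S x > 0" by (rule SK)
    have "(\<Sum>a\<in>I. \<eta>' a x) = \<eta> x * S x / S x"
      unfolding \<eta>'_def by (simp add: S_def sum_distrib_left sum_divide_distrib)
    then show ?thesis using \<open>S x > 0\<close> by simp
  qed (simp add: \<eta>'_def K(3))
  \<comment> \<open>Uniqueness of the derivative of the identity \<open>sum1\<close> avoids summing
    the quotient rule.\<close>
  have sum2: "(\<Sum>a\<in>I. g' a x) = g\<eta> x" for x
  proof -
    have "((\<lambda>x. \<Sum>a\<in>I. \<eta>' a x) has_derivative (\<lambda>w. \<Sum>a\<in>I. g' a x \<bullet> w)) (at x)"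
      using g' by (intro has_derivative_sum) (auto simp: has_gradient_on_def)
    moreover have "(\<eta> has_derivative (\<lambda>w. g\<eta> x \<bullet> w)) (at x)" using \<eta> by (simp add: has_gradient_on_def)
    ultimately have "(\<Sum>a\<in>I. g' a x \<bullet> w) = g\<eta> x \<bullet> w" for w
      unfolding sum1 by (metis has_derivative_unique)
    then have "((\<Sum>a\<in>I. g' a x) - g\<eta> x) \<bullet> w = 0" for w by (simp add: inner_diff_left inner_sum_left)
    then show ?thesis by (metis eq_iff_diff_eq_0 inner_eq_zero_iff)
  qed
  define Ka where "Ka = (\<lambda>a. K \<inter> cball a (r a))"
  have part: "(\<integral>x. indicator U x * (v x * (g' a x \<bullet> w)) \<partial>lborel) = - (\<integral>x. indicator U x * ((\<omega> x \<bullet> w) * \<eta>' a x) \<partial>lborel) \<and>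
      integrable lborel (\<lambda>x. indicator U x * (v x * (g' a x \<bullet> w))) \<and> integrable lborel (\<lambda>x. indicator U x * ((\<omega> x \<bullet> w) * \<eta>' a x))"
    if a: "a \<in> I" for a
  proof -
    have aK: "a \<in> K" using a I(2) by auto
    have Ka: "compact (Ka a)" "Ka a \<subseteq> ball a (2 * r a)" using K(1) r(1)[OF aK] by (auto simp: Ka_def compact_Int)
    have out: "\<eta>' a x = 0" if "x \<notin> Ka a" for x
    proof (cases "x \<in> K")
      case True
      then have "\<not> dist a x < r a" using that by (auto simp: Ka_def)
      then have "b a x = 0" using b(2)[of a x] b(3)[of a x] by linarith
      then show ?thesis by (simp add: \<eta>'_def)
    qed (simp add: \<eta>'_def K(3))
    have gout: "g' a x = 0" if "x \<notin> Ka a" for x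
      by (rule gradient_zero_outside[OF g' compact_imp_closed[OF Ka(1)] out that])
    note ibp = sob_on_integration_by_parts[OF r(2)[OF aK] g' Ka out, of w]
    have eq: "indicator U x * (v x * (g' a x \<bullet> w)) = indicator (ball a (2 * r a)) x * (v x * (g' a x \<bullet> w))"
      "indicator U x * ((\<omega> x \<bullet> w) * \<eta>' a x) = indicator (ball a (2 * r a)) x * ((\<omega> x \<bullet> w) * \<eta>' a x)" for x
      using Ka(2) K(2) by (cases "x \<in> Ka a"; auto simp: out gout Ka_def indicator_def subset_iff)+
    show ?thesis unfolding eq using ibp by blast
  qed
  have "(LINT x:U|lborel. v x * (g\<eta> x \<bullet> w)) = (\<integral>x. (\<Sum>a\<in>I. indicator U x * (v x * (g' a x \<bullet> w))) \<partial>lborel)"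
    unfolding set_lebesgue_integral_def sum2[symmetric]
    by (simp add: inner_sum_left sum_distrib_left)
  also have "\<dots> = (\<Sum>a\<in>I. \<integral>x. indicator U x * (v x * (g' a x \<bullet> w)) \<partial>lborel)"
    using part by (intro Bochner_Integration.integral_sum) auto
  also have "\<dots> = - (\<Sum>a\<in>I. \<integral>x. indicator U x * ((\<omega> x \<bullet> w) * \<eta>' a x) \<partial>lborel)"
    using part by (simp add: sum_negf)
  also have "(\<Sum>a\<in>I. \<integral>x. indicator U x * ((\<omega> x \<bullet> w) * \<eta>' a x) \<partial>lborel) = (\<integral>x. (\<Sum>a\<in>I. indicator U x * ((\<omega> x \<bullet> w) * \<eta>' a x)) \<partial>lborel)"
    using part by (intro Bochner_Integration.integral_sum[symmetric]) auto
  also have "\<dots> = (LINT x:U|lborel. (\<omega> x \<bullet> w) * \<eta> x)"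
    unfolding set_lebesgue_integral_def sum1[symmetric] by (simp add: sum_distrib_left)
  finally show ?thesis .
qed

subsection \<open>Chain rule, products and pullbacks\<close>

lemma sob_integrand_measurable:
  assumes N: "N \<in> sets borel" and fg: "has_gradient_on f g N"
    and int: "set_integrable lborel N v" "set_integrable lborel N \<omega>"
  shows "(\<lambda>x. ennreal (\<bar>f x - v x\<bar> + norm (g x - \<omega> x)) * indicator N x) \<in> borel_measurable borel"
proof -
  have fj: "(\<lambda>x. indicator N x * f x) \<in> borel_measurable borel" "(\<lambda>x. indicator N x *\<^sub>R g x) \<in> borel_measurable borel"
    using borel_measurable_continuous_on_indicator[of N f] has_gradient_on_continuous[OF fg]
      borel_measurable_continuous_on_indicator[of N g] fg N by (auto simp: has_gradient_on_def)
  have mv: "(\<lambda>x. indicator N x * v x) \<in> borel_measurable borel" "(\<lambda>x. indicator N x *\<^sub>R \<omega> x) \<in> borel_measurable borel"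
    using int borel_measurable_integrable unfolding set_integrable_def by fastforce+
  have "(\<lambda>x. ennreal (\<bar>indicator N x * f x - indicator N x * v x\<bar> + norm (indicator N x *\<^sub>R g x - indicator N x *\<^sub>R \<omega> x)) * indicator N x) \<in> borel_measurable borel"
    using fj mv N by measurable
  also have "(\<lambda>x. ennreal (\<bar>indicator N x * f x - indicator N x * v x\<bar> + norm (indicator N x *\<^sub>R g x - indicator N x *\<^sub>R \<omega> x)) * indicator N x)
    = (\<lambda>x. ennreal (\<bar>f x - v x\<bar> + norm (g x - \<omega> x)) * indicator N x)"
    by (auto simp: indicator_def)
  finally show ?thesis .
qed

text \<open>The gradient error splits as F'(f) (g - \<omega>) + (F'(f) - F'(v)) \<omega>. The first
  part is bounded by the given error; the second tends to zero by dominated convergence along a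
  subsequence that converges almost everywhere.\<close>

lemma sob_on_chain:
  assumes s: "sob_on N v \<omega>" and F: "\<And>s. (F has_real_derivative F' s) (at s)"
    and cF: "continuous_on UNIV F'" and bd: "\<And>s. \<bar>F' s\<bar> \<le> 1" and F0: "F 0 = 0"
  shows "sob_on N (\<lambda>x. F (v x)) (\<lambda>x. F' (v x) *\<^sub>R \<omega> x)"
proof -
  obtain f g where fg: "\<And>j. has_gradient_on (f j) (g j) N"
    and lim: "(\<lambda>j. \<integral>\<^sup>+x\<in>N. ennreal (\<bar>f j x - v x\<bar> + norm (g j x - \<omega> x)) \<partial>lborel) \<longlonglongrightarrow> 0"
    using s unfolding sob_on_def by blast
  define E where "E = (\<lambda>j. \<integral>\<^sup>+x\<in>N. ennreal (\<bar>f j x - v x\<bar> + norm (g j x - \<omega> x)) \<partial>lborel)"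
  have N: "open N" and sv: "set_integrable lborel N v" and s\<omega>: "set_integrable lborel N \<omega>"
    using s by (auto simp: sob_on_def)
  have iv: "integrable lborel (\<lambda>x. indicator N x *\<^sub>R v x)" and i\<omega>: "integrable lborel (\<lambda>x. indicator N x *\<^sub>R \<omega> x)"
    using sv s\<omega> by (auto simp: set_integrable_def)
  have Nb[measurable]: "N \<in> sets borel" using N by simp
  have lip: "\<bar>F s - F t\<bar> \<le> \<bar>s - t\<bar>" for s t
    using field_differentiable_bound[of UNIV F F' 1 s t] F bd by simp
  have [measurable]: "F \<in> borel_measurable borel" "F' \<in> borel_measurable borel"
    using cF DERIV_isCont[OF F] by (auto intro!: borel_measurable_continuous_onI continuous_at_imp_continuous_on)
  have mv[measurable]: "(\<lambda>x. indicator N x * v x) \<in> borel_measurable borel" using borel_measurable_integrable[OF iv] by simp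
  have m\<omega>[measurable]: "(\<lambda>x. indicator N x *\<^sub>R \<omega> x) \<in> borel_measurable borel" using borel_measurable_integrable[OF i\<omega>] by simp
  have mf[measurable]: "(\<lambda>x. indicator N x * f j x) \<in> borel_measurable borel" for j
    using borel_measurable_continuous_on_indicator[OF Nb has_gradient_on_continuous[OF fg]] by simp
  have e1: "indicator N x *\<^sub>R F (v x) = F (indicator N x * v x)" for x by (simp add: indicator_def F0)
  have i1: "set_integrable lborel N (\<lambda>x. F (v x))" unfolding set_integrable_def e1
    by (rule Bochner_Integration.integrable_bound[OF integrable_norm[OF iv]]) (use lip[of _ 0] in \<open>auto simp: F0\<close>)
  have e2: "indicator N x *\<^sub>R (F' (v x) *\<^sub>R \<omega> x) = F' (indicator N x * v x) *\<^sub>R (indicator N x *\<^sub>R \<omega> x)" for x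
    by (simp add: indicator_def)
  have i2: "set_integrable lborel N (\<lambda>x. F' (v x) *\<^sub>R \<omega> x)" unfolding set_integrable_def e2
  proof (rule Bochner_Integration.integrable_bound[OF integrable_norm[OF i\<omega>]])
    show "(\<lambda>x. F' (indicator N x * v x) *\<^sub>R (indicator N x *\<^sub>R \<omega> x)) \<in> borel_measurable lborel"
      by (simp only: measurable_lborel2, rule borel_measurable_scaleR[OF measurable_compose[OF mv] m\<omega>]) measurable
    show "AE x in lborel. norm (F' (indicator N x * v x) *\<^sub>R (indicator N x *\<^sub>R \<omega> x)) \<le> norm (norm (indicator N x *\<^sub>R \<omega> x))"
    proof (rule AE_I2)
      fix x
      show "norm (F' (indicator N x * v x) *\<^sub>R (indicator N x *\<^sub>R \<omega> x)) \<le> norm (norm (indicator N x *\<^sub>R \<omega> x))"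
        using mult_right_mono[OF bd norm_ge_zero, of "indicator N x * v x" "indicator N x *\<^sub>R \<omega> x"]
        by (simp only: norm_scaleR[of "F' _"] norm_ge_zero abs_of_nonneg real_norm_def mult_1)
    qed
  qed
  have "\<forall>\<^sub>F j in sequentially. E j < 1" using lim unfolding E_def by (intro order_tendstoD(2)) auto
  then obtain j0 where j0: "\<And>j. j \<ge> j0 \<Longrightarrow> E j < 1" by (auto simp: eventually_sequentially)
  \<comment> \<open>The error may be infinite for early indices. From \<open>j0\<close> on it is
    below 1, which makes these differences integrable and an almost everywhere convergent
    subsequence available.\<close>
  define u where "u = (\<lambda>n x. indicator N x * (f (n + j0) x - v x))"
  have mu: "u n \<in> borel_measurable borel" for n
  proof -
    have "(\<lambda>x. indicator N x * f (n + j0) x - indicator N x * v x) \<in> borel_measurable borel" by measurable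
    then show ?thesis by (simp add: u_def[abs_def] right_diff_distrib)
  qed
  have uE: "(\<integral>\<^sup>+x. ennreal (norm (u n x)) \<partial>lborel) \<le> E (n + j0)" for n
    unfolding E_def by (intro nn_integral_mono) (auto simp: u_def indicator_def ennreal_leI simp del: ennreal_plus)
  have iu: "integrable lborel (u n)" for n
    using mu uE[of n] j0[of "n + j0"] by (intro integrableI_bounded) (auto simp: less_top[symmetric] top_unique)
  have "(\<lambda>n. ennreal (\<integral>x. norm (u n x) \<partial>lborel)) \<longlonglongrightarrow> 0"
  proof (rule tendsto_0_le_ennreal)
    show "ennreal (\<integral>x. norm (u n x) \<partial>lborel) \<le> E (n + j0)" for n
      using uE[of n] nn_integral_eq_integral[OF integrable_norm[OF iu[of n]]] by simp
    show "(\<lambda>n. E (n + j0)) \<longlonglongrightarrow> 0" using lim unfolding E_def by (rule LIMSEQ_ignore_initial_segment)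
  qed
  then have "(\<lambda>n. ennreal (\<integral>x. norm (u n x) \<partial>lborel)) \<longlonglongrightarrow> ennreal 0" by simp
  then have "(\<lambda>n. \<integral>x. norm (u n x) \<partial>lborel) \<longlonglongrightarrow> 0" by (rule tendsto_ennrealD) auto
  from tendsto_L1_AE_subseq[OF iu this] obtain r :: "nat \<Rightarrow> nat" where r: "strict_mono r" "AE x in lborel. (\<lambda>n. u (r n) x) \<longlonglongrightarrow> 0"
    by blast
  define k where "k = (\<lambda>n. r n + j0)"
  have "filterlim k sequentially sequentially"
    unfolding k_def using filterlim_compose[OF filterlim_add_const_nat_at_top filterlim_subseq[OF r(1)]] .
  then have Ek: "(\<lambda>n. E (k n)) \<longlonglongrightarrow> 0" using lim unfolding E_def by (rule filterlim_compose[rotated])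
  define d where "d = (\<lambda>n x. ennreal (\<bar>F' (f (k n) x) - F' (v x)\<bar> * norm (\<omega> x)) * indicator N x)"
  have md: "d n \<in> borel_measurable borel" for n
  proof -
    have "(\<lambda>x. ennreal (\<bar>F' (indicator N x * f (k n) x) - F' (indicator N x * v x)\<bar> * norm (indicator N x *\<^sub>R \<omega> x))) \<in> borel_measurable borel"
      by measurable
    also have "(\<lambda>x. ennreal (\<bar>F' (indicator N x * f (k n) x) - F' (indicator N x * v x)\<bar> * norm (indicator N x *\<^sub>R \<omega> x))) = d n"
      by (auto simp: d_def indicator_def)
    finally show ?thesis .
  qed
  have mw: "(\<lambda>x. ennreal (2 * norm (indicator N x *\<^sub>R \<omega> x))) \<in> borel_measurable borel" by measurable
  have "(\<lambda>n. \<integral>\<^sup>+x. d n x \<partial>lborel) \<longlonglongrightarrow> (\<integral>\<^sup>+(x::'a). 0 \<partial>lborel)"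
  proof (rule nn_integral_dominated_convergence[where w = "\<lambda>x. ennreal (2 * norm (indicator N x *\<^sub>R \<omega> x))"])
    show "AE x in lborel. d n x \<le> ennreal (2 * norm (indicator N x *\<^sub>R \<omega> x))" for n
    proof (rule AE_I2)
      fix x
      have "\<bar>F' (f (k n) x) - F' (v x)\<bar> \<le> 2" using bd[of "f (k n) x"] bd[of "v x"] by linarith
      then show "d n x \<le> ennreal (2 * norm (indicator N x *\<^sub>R \<omega> x))"
        by (auto simp: d_def indicator_def intro!: ennreal_leI mult_right_mono)
    qed
    show "(\<integral>\<^sup>+x. ennreal (2 * norm (indicator N x *\<^sub>R \<omega> x)) \<partial>lborel) < \<infinity>"
    proof -
      have "integrable lborel (\<lambda>x. 2 * norm (indicator N x *\<^sub>R \<omega> x))"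
        by (intro integrable_mult_right integrable_norm i\<omega>)
      then show ?thesis by (subst nn_integral_eq_integral) auto
    qed
    show "AE x in lborel. (\<lambda>n. d n x) \<longlonglongrightarrow> 0" using r(2)
    proof eventually_elim
      case (elim x)
      show ?case
      proof (cases "x \<in> N")
        case True
        then have "(\<lambda>n. f (k n) x - v x) \<longlonglongrightarrow> 0" using elim by (simp add: u_def k_def)
        then have "(\<lambda>n. f (k n) x) \<longlonglongrightarrow> v x" by (simp add: LIM_zero_iff)
        then have "(\<lambda>n. F' (f (k n) x)) \<longlonglongrightarrow> F' (v x)" by (rule continuous_on_tendsto_compose[OF cF]) auto
        then have "(\<lambda>n. \<bar>F' (f (k n) x) - F' (v x)\<bar> * norm (\<omega> x)) \<longlonglongrightarrow> \<bar>F' (v x) - F' (v x)\<bar> * norm (\<omega> x)"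
          by (intro tendsto_intros)
        then have "(\<lambda>n. ennreal (\<bar>F' (f (k n) x) - F' (v x)\<bar> * norm (\<omega> x))) \<longlonglongrightarrow> ennreal 0"
          by (intro tendsto_ennrealI) simp
        then show ?thesis using True by (simp add: d_def)
      qed (simp add: d_def)
    qed
  qed (use md mw in \<open>simp_all del: norm_scaleR\<close>)
  then have dlim: "(\<lambda>n. \<integral>\<^sup>+x. d n x \<partial>lborel) \<longlonglongrightarrow> 0" by simp
  have grad': "has_gradient_on (\<lambda>x. F (f j x)) (\<lambda>x. F' (f j x) *\<^sub>R g j x) N" for j
    unfolding has_gradient_on_def
  proof (intro conjI ballI)
    show "continuous_on N (\<lambda>x. F' (f j x) *\<^sub>R g j x)"
      using fg[of j] has_gradient_on_continuous[OF fg[of j]]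
      by (auto intro!: continuous_intros continuous_on_compose2[OF cF] simp: has_gradient_on_def)
    fix x assume "x \<in> N"
    then have "(f j has_derivative (\<lambda>w. g j x \<bullet> w)) (at x)" using fg by (simp add: has_gradient_on_def)
    from has_derivative_compose[OF this has_field_derivative_imp_has_derivative[OF F]]
    show "((\<lambda>x. F (f j x)) has_derivative (\<lambda>w. F' (f j x) *\<^sub>R g j x \<bullet> w)) (at x)" by simp
  qed
  have "(\<lambda>n. \<integral>\<^sup>+x\<in>N. ennreal (\<bar>F (f (k n) x) - F (v x)\<bar> + norm (F' (f (k n) x) *\<^sub>R g (k n) x - F' (v x) *\<^sub>R \<omega> x)) \<partial>lborel) \<longlonglongrightarrow> 0"
  proof (rule tendsto_0_le_ennreal)
    show "(\<lambda>n. E (k n) + (\<integral>\<^sup>+x. d n x \<partial>lborel)) \<longlonglongrightarrow> 0" using tendsto_add[OF Ek dlim] by simp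
    fix n
    have "E (k n) + (\<integral>\<^sup>+x. d n x \<partial>lborel) = (\<integral>\<^sup>+x. ennreal (\<bar>f (k n) x - v x\<bar> + norm (g (k n) x - \<omega> x)) * indicator N x + d n x \<partial>lborel)"
      unfolding E_def using md sob_integrand_measurable[OF Nb fg sv s\<omega>] by (intro nn_integral_add[symmetric]) auto
    also have "\<dots> \<ge> (\<integral>\<^sup>+x\<in>N. ennreal (\<bar>F (f (k n) x) - F (v x)\<bar> + norm (F' (f (k n) x) *\<^sub>R g (k n) x - F' (v x) *\<^sub>R \<omega> x)) \<partial>lborel)"
    proof (rule nn_integral_mono)
      fix x
      have "F' (f (k n) x) *\<^sub>R g (k n) x - F' (v x) *\<^sub>R \<omega> x = F' (f (k n) x) *\<^sub>R (g (k n) x - \<omega> x) + (F' (f (k n) x) - F' (v x)) *\<^sub>R \<omega> x"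
        by (simp add: algebra_simps)
      also have "norm \<dots> \<le> \<bar>F' (f (k n) x)\<bar> * norm (g (k n) x - \<omega> x) + \<bar>F' (f (k n) x) - F' (v x)\<bar> * norm (\<omega> x)"
        by (rule order_trans[OF norm_triangle_ineq]) simp
      also have "\<dots> \<le> norm (g (k n) x - \<omega> x) + \<bar>F' (f (k n) x) - F' (v x)\<bar> * norm (\<omega> x)"
        using mult_right_mono[OF bd norm_ge_zero, of "f (k n) x" "g (k n) x - \<omega> x"] by simp
      finally have "\<bar>F (f (k n) x) - F (v x)\<bar> + norm (F' (f (k n) x) *\<^sub>R g (k n) x - F' (v x) *\<^sub>R \<omega> x)
        \<le> (\<bar>f (k n) x - v x\<bar> + norm (g (k n) x - \<omega> x)) + \<bar>F' (f (k n) x) - F' (v x)\<bar> * norm (\<omega> x)"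
        using lip[of "f (k n) x" "v x"] by linarith
      then have "ennreal (\<bar>F (f (k n) x) - F (v x)\<bar> + norm (F' (f (k n) x) *\<^sub>R g (k n) x - F' (v x) *\<^sub>R \<omega> x))
        \<le> ennreal (\<bar>f (k n) x - v x\<bar> + norm (g (k n) x - \<omega> x)) + ennreal (\<bar>F' (f (k n) x) - F' (v x)\<bar> * norm (\<omega> x))"
        by (subst ennreal_plus[symmetric]) (auto intro!: ennreal_leI simp del: ennreal_plus)
      then show "ennreal (\<bar>F (f (k n) x) - F (v x)\<bar> + norm (F' (f (k n) x) *\<^sub>R g (k n) x - F' (v x) *\<^sub>R \<omega> x)) * indicator N x
        \<le> ennreal (\<bar>f (k n) x - v x\<bar> + norm (g (k n) x - \<omega> x)) * indicator N x + d n x"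
        by (cases "x \<in> N") (auto simp: d_def simp del: ennreal_plus)
    qed
    finally show "(\<integral>\<^sup>+x\<in>N. ennreal (\<bar>F (f (k n) x) - F (v x)\<bar> + norm (F' (f (k n) x) *\<^sub>R g (k n) x - F' (v x) *\<^sub>R \<omega> x)) \<partial>lborel) \<le> E (k n) + (\<integral>\<^sup>+x. d n x \<partial>lborel)" .
  qed
  then show ?thesis
    unfolding sob_on_def using N i1 i2 grad'
    by (intro conjI exI[of _ "\<lambda>n x. F (f (k n) x)"] exI[of _ "\<lambda>n x. F' (f (k n) x) *\<^sub>R g (k n) x"]) auto
qed

section \<open>Products with a function of one further variable\<close>

lemma nn_integral_cylinder:
  fixes G :: "'e::euclidean_space \<Rightarrow> ennreal"
  assumes "G \<in> borel_measurable borel" "a \<le> b"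
  shows "(\<integral>\<^sup>+p. G (fst p) * indicator {a<..<b} (snd p) \<partial>(lborel :: ('e \<times> real) measure)) = (\<integral>\<^sup>+x. G x \<partial>lborel) * ennreal (b - a)"
proof -
  have [measurable]: "G \<in> borel_measurable borel" by fact
  have "(\<integral>\<^sup>+p. G (fst p) * indicator {a<..<b} (snd p) \<partial>(lborel :: ('e \<times> real) measure))
     = (\<integral>\<^sup>+p. G (fst p) * indicator {a<..<b} (snd p) \<partial>((lborel :: 'e measure) \<Otimes>\<^sub>M (lborel :: real measure)))"
    by (simp add: lborel_prod)
  also have "\<dots> = (\<integral>\<^sup>+x. \<integral>\<^sup>+t. G x * indicator {a<..<b} t \<partial>(lborel :: real measure) \<partial>lborel)"
    by (subst lborel.nn_integral_fst[symmetric]) auto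
  also have "\<dots> = (\<integral>\<^sup>+x. G x * ennreal (b - a) \<partial>lborel)"
    using assms(2) by (intro nn_integral_cong) (simp add: nn_integral_cmult)
  also have "\<dots> = (\<integral>\<^sup>+x. G x \<partial>lborel) * ennreal (b - a)" by (rule nn_integral_multc) simp
  finally show ?thesis .
qed

text \<open>The products f(x) \<phi>(t) of the approximants with \<phi> work: \<phi> and its
  derivative are bounded, and integrating over the bounded interval merely multiplies the error on N
  by its length.\<close>

lemma sob_on_cylinder:
  assumes s: "sob_on N v \<omega>" and \<phi>: "\<And>t. (\<phi> has_real_derivative \<phi>' t) (at t)"
    and c\<phi>: "continuous_on UNIV \<phi>'" and bd: "\<And>t. \<bar>\<phi> t\<bar> \<le> C" "\<And>t. \<bar>\<phi>' t\<bar> \<le> C" and ab: "a < b"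
  shows "sob_on (N \<times> {a<..<b}) (\<lambda>p. v (fst p) * \<phi> (snd p)) (\<lambda>p. (\<phi> (snd p) *\<^sub>R \<omega> (fst p), v (fst p) * \<phi>' (snd p)))"
proof -
  obtain f g where fg: "\<And>j. has_gradient_on (f j) (g j) N"
    and lim: "(\<lambda>j. \<integral>\<^sup>+x\<in>N. ennreal (\<bar>f j x - v x\<bar> + norm (g j x - \<omega> x)) \<partial>lborel) \<longlonglongrightarrow> 0"
    using s unfolding sob_on_def by blast
  have N: "open N" and sv: "set_integrable lborel N v" and s\<omega>: "set_integrable lborel N \<omega>"
    using s by (auto simp: sob_on_def)
  have iv: "integrable lborel (\<lambda>x. indicator N x *\<^sub>R v x)" and i\<omega>: "integrable lborel (\<lambda>x. indicator N x *\<^sub>R \<omega> x)"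
    using sv s\<omega> by (auto simp: set_integrable_def)
  have C0: "C \<ge> 0" using bd(1)[of 0] by linarith
  have Nb[measurable]: "N \<in> sets borel" using N by simp
  let ?I = "{a<..<b}"
  let ?M = "N \<times> ?I"
  have M: "open ?M" using N by (intro open_Times) auto
  have c\<phi>0: "continuous_on UNIV \<phi>" using DERIV_isCont[OF \<phi>] by (auto intro: continuous_at_imp_continuous_on)
  have [measurable]: "\<phi> \<in> borel_measurable borel" "\<phi>' \<in> borel_measurable borel"
    using c\<phi> c\<phi>0 by (auto intro: borel_measurable_continuous_onI)
  have mv[measurable]: "(\<lambda>x. indicator N x * v x) \<in> borel_measurable borel" using borel_measurable_integrable[OF iv] by simp
  have m\<omega>[measurable]: "(\<lambda>x. indicator N x *\<^sub>R \<omega> x) \<in> borel_measurable borel" using borel_measurable_integrable[OF i\<omega>] by simp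
  \<comment> \<open>The common integrability argument for all three terms: an integrable function of
    x multiplied by a factor depending on t and bounded by C.\<close>
  have cyl: "set_integrable lborel ?M (\<lambda>p. F (fst p) (snd p))"
    if F: "(\<lambda>p. F (fst p) (snd p) :: 'c::euclidean_space) = (\<lambda>p. L (snd p) (H (fst p)))"
      and H: "set_integrable lborel N H" and L: "\<And>t x. norm (L t x) \<le> C * norm x"
      and m: "(\<lambda>p. indicator ?M p *\<^sub>R F (fst p) (snd p)) \<in> borel_measurable borel"
    for F and H :: "'a \<Rightarrow> 'd::euclidean_space" and L
  proof -
    have Hi: "integrable lborel (\<lambda>x. indicator N x *\<^sub>R H x)" using H by (simp add: set_integrable_def)
    have Hm: "(\<lambda>x. indicator N x *\<^sub>R H x) \<in> borel_measurable borel" using borel_measurable_integrable[OF Hi] by simp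
    have "(\<integral>\<^sup>+p. ennreal (norm (indicator ?M p *\<^sub>R F (fst p) (snd p))) \<partial>lborel) \<le>
      (\<integral>\<^sup>+p. ennreal (C * norm (indicator N (fst p) *\<^sub>R H (fst p))) * indicator ?I (snd p) \<partial>lborel)"
    proof (rule nn_integral_mono)
      fix p :: "'a \<times> real"
      have "F (fst p) (snd p) = L (snd p) (H (fst p))" using F by meson
      then show "ennreal (norm (indicator ?M p *\<^sub>R F (fst p) (snd p))) \<le> ennreal (C * norm (indicator N (fst p) *\<^sub>R H (fst p))) * indicator ?I (snd p)"
        using L[of "snd p" "H (fst p)"] by (cases p) (auto simp: indicator_def intro: ennreal_leI)
    qed
    also have "\<dots> = (\<integral>\<^sup>+x. ennreal (C * norm (indicator N x *\<^sub>R H x)) \<partial>lborel) * ennreal (b - a)"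
      using borel_measurable_integrable[OF Hi] ab
      by (intro nn_integral_cylinder measurable_compose[OF _ measurable_ennreal] borel_measurable_times
          borel_measurable_const measurable_compose[OF Hm borel_measurable_norm]) auto
    also have "\<dots> < \<infinity>"
    proof -
      have "integrable lborel (\<lambda>x. C * norm (indicator N x *\<^sub>R H x))"
        by (intro integrable_mult_right integrable_norm Hi)
      then show ?thesis using C0 by (subst nn_integral_eq_integral) (auto simp: ennreal_mult_less_top)
    qed
    finally show ?thesis unfolding set_integrable_def using m by (intro integrableI_bounded) auto
  qed
  have m1: "(\<lambda>p. indicator ?M p *\<^sub>R (v (fst p) * \<phi> (snd p))) \<in> borel_measurable borel"
  proof -
    have "(\<lambda>p. (indicator N (fst p) * v (fst p)) * (indicator ?I (snd p) * \<phi> (snd p))) \<in> borel_measurable (borel \<Otimes>\<^sub>M borel)" by measurable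
    also have "(\<lambda>p. (indicator N (fst p) * v (fst p)) * (indicator ?I (snd p) * \<phi> (snd p))) = (\<lambda>p. indicator ?M p *\<^sub>R (v (fst p) * \<phi> (snd p)))"
      by (auto simp: indicator_def)
    finally show ?thesis by (simp add: borel_prod)
  qed
  have m3: "(\<lambda>p. indicator ?M p *\<^sub>R (\<phi> (snd p) *\<^sub>R \<omega> (fst p))) \<in> borel_measurable borel"
  proof -
    have "(\<lambda>p. (indicator ?I (snd p) * \<phi> (snd p)) *\<^sub>R (indicator N (fst p) *\<^sub>R \<omega> (fst p))) \<in> borel_measurable (borel \<Otimes>\<^sub>M borel)" by measurable
    also have "(\<lambda>p. (indicator ?I (snd p) * \<phi> (snd p)) *\<^sub>R (indicator N (fst p) *\<^sub>R \<omega> (fst p))) = (\<lambda>p. indicator ?M p *\<^sub>R (\<phi> (snd p) *\<^sub>R \<omega> (fst p)))"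
      by (auto simp: indicator_def)
    finally show ?thesis by (simp add: borel_prod)
  qed
  have m4: "(\<lambda>p. indicator ?M p *\<^sub>R (v (fst p) * \<phi>' (snd p))) \<in> borel_measurable borel"
  proof -
    have "(\<lambda>p. (indicator N (fst p) * v (fst p)) * (indicator ?I (snd p) * \<phi>' (snd p))) \<in> borel_measurable (borel \<Otimes>\<^sub>M borel)" by measurable
    also have "(\<lambda>p. (indicator N (fst p) * v (fst p)) * (indicator ?I (snd p) * \<phi>' (snd p))) = (\<lambda>p. indicator ?M p *\<^sub>R (v (fst p) * \<phi>' (snd p)))"
      by (auto simp: indicator_def)
    finally show ?thesis by (simp add: borel_prod)
  qed
  have i1: "set_integrable lborel ?M (\<lambda>p. v (fst p) * \<phi> (snd p))"
    by (rule cyl[of "\<lambda>x t. v x * \<phi> t" "\<lambda>t y. y * \<phi> t" v]) (use sv m1 mult_left_mono[OF bd(1) abs_ge_zero] in \<open>auto simp: abs_mult mult.commute[of C]\<close>)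
  have i3: "set_integrable lborel ?M (\<lambda>p. \<phi> (snd p) *\<^sub>R \<omega> (fst p))"
    by (rule cyl[of "\<lambda>x t. \<phi> t *\<^sub>R \<omega> x" "\<lambda>t y. \<phi> t *\<^sub>R y" \<omega>]) (use s\<omega> m3 mult_right_mono[OF bd(1) norm_ge_zero] in auto)
  have i4: "set_integrable lborel ?M (\<lambda>p. v (fst p) * \<phi>' (snd p))"
    by (rule cyl[of "\<lambda>x t. v x * \<phi>' t" "\<lambda>t y. y * \<phi>' t" v]) (use sv m4 mult_left_mono[OF bd(2) abs_ge_zero] in \<open>auto simp: abs_mult mult.commute[of C]\<close>)
  have i2: "set_integrable lborel ?M (\<lambda>p. (\<phi> (snd p) *\<^sub>R \<omega> (fst p), v (fst p) * \<phi>' (snd p)))"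
  proof -
    have "integrable lborel (\<lambda>p. ((indicator ?M p *\<^sub>R (\<phi> (snd p) *\<^sub>R \<omega> (fst p)), 0 :: real) :: 'a \<times> real))"
      using i3 unfolding set_integrable_def
      by (rule integrable_bounded_linear[of "\<lambda>x. (x, 0 :: real)", rotated]) (auto intro!: bounded_linear_intros)
    moreover have "integrable lborel (\<lambda>p. ((0, indicator ?M p *\<^sub>R (v (fst p) * \<phi>' (snd p))) :: 'a \<times> real))"
      using i4 unfolding set_integrable_def
      by (rule integrable_bounded_linear[of "\<lambda>x. (0 :: 'a, x)", rotated]) (auto intro!: bounded_linear_intros)
    ultimately have "integrable lborel (\<lambda>p. ((indicator ?M p *\<^sub>R (\<phi> (snd p) *\<^sub>R \<omega> (fst p)), 0 :: real) :: 'a \<times> real)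
       + ((0, indicator ?M p *\<^sub>R (v (fst p) * \<phi>' (snd p))) :: 'a \<times> real))"
      by (rule Bochner_Integration.integrable_add)
    then show ?thesis by (simp add: set_integrable_def)
  qed
  have gr: "has_gradient_on (\<lambda>p. f j (fst p) * \<phi> (snd p)) (\<lambda>p. (\<phi> (snd p) *\<^sub>R g j (fst p), f j (fst p) * \<phi>' (snd p))) ?M" for j
    unfolding has_gradient_on_def
  proof (intro conjI ballI)
    have c: "continuous_on ?M (\<lambda>p. f j (fst p))" "continuous_on ?M (\<lambda>p. g j (fst p))"
      using has_gradient_on_continuous[OF fg[of j]] fg[of j]
      by (auto intro!: continuous_on_compose2[of N _ ?M fst] continuous_intros simp: has_gradient_on_def)
    show "continuous_on ?M (\<lambda>p. (\<phi> (snd p) *\<^sub>R g j (fst p), f j (fst p) * \<phi>' (snd p)))"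
      by (intro continuous_intros c continuous_on_compose2[OF c\<phi>] continuous_on_compose2[OF c\<phi>0]) auto
    fix p assume "p \<in> ?M"
    then have "(f j has_derivative (\<lambda>w. g j (fst p) \<bullet> w)) (at (fst p))" using fg[of j] by (auto simp: has_gradient_on_def)
    from has_derivative_compose[OF has_derivative_fst[OF has_derivative_ident] this]
    have 1: "((\<lambda>p. f j (fst p)) has_derivative (\<lambda>w. g j (fst p) \<bullet> fst w)) (at p)" .
    from has_derivative_compose[OF has_derivative_snd[OF has_derivative_ident] has_field_derivative_imp_has_derivative[OF \<phi>], of p UNIV]
    have 2: "((\<lambda>p. \<phi> (snd p)) has_derivative (\<lambda>w. \<phi>' (snd p) * snd w)) (at p)" .
    show "((\<lambda>p. f j (fst p) * \<phi> (snd p)) has_derivative (\<lambda>w. (\<phi> (snd p) *\<^sub>R g j (fst p), f j (fst p) * \<phi>' (snd p)) \<bullet> w)) (at p)"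
      using has_derivative_mult[OF 1 2]
      by (rule has_derivative_eq_rhs) (auto simp: inner_prod_def algebra_simps)
  qed
  have "(\<lambda>j. \<integral>\<^sup>+p\<in>?M. ennreal (\<bar>f j (fst p) * \<phi> (snd p) - v (fst p) * \<phi> (snd p)\<bar>
      + norm ((\<phi> (snd p) *\<^sub>R g j (fst p), f j (fst p) * \<phi>' (snd p)) - (\<phi> (snd p) *\<^sub>R \<omega> (fst p), v (fst p) * \<phi>' (snd p)))) \<partial>lborel) \<longlonglongrightarrow> 0"
  proof (rule tendsto_0_le_ennreal)
    let ?e = "\<lambda>j x. ennreal (\<bar>f j x - v x\<bar> + norm (g j x - \<omega> x)) * indicator N x"
    show "(\<lambda>j. (ennreal (2 * C) * (\<integral>\<^sup>+x. ?e j x \<partial>lborel)) * ennreal (b - a)) \<longlonglongrightarrow> 0"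
    proof -
      have "(\<lambda>j. (ennreal (2 * C) * ennreal (b - a)) * (\<integral>\<^sup>+x. ?e j x \<partial>lborel)) \<longlonglongrightarrow> (ennreal (2 * C) * ennreal (b - a)) * 0"
        by (rule ennreal_tendsto_cmult[OF _ lim]) (simp add: ennreal_mult_less_top)
      then show ?thesis by (simp add: ac_simps)
    qed
    fix j
    have "(\<integral>\<^sup>+p\<in>?M. ennreal (\<bar>f j (fst p) * \<phi> (snd p) - v (fst p) * \<phi> (snd p)\<bar>
      + norm ((\<phi> (snd p) *\<^sub>R g j (fst p), f j (fst p) * \<phi>' (snd p)) - (\<phi> (snd p) *\<^sub>R \<omega> (fst p), v (fst p) * \<phi>' (snd p)))) \<partial>lborel)
      \<le> (\<integral>\<^sup>+p. (ennreal (2 * C) * ?e j (fst p)) * indicator ?I (snd p) \<partial>lborel)"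
    proof (rule nn_integral_mono)
      fix p :: "'a \<times> real"
      obtain x t where p: "p = (x, t)" by (cases p)
      have a1: "\<bar>f j x * \<phi> t - v x * \<phi> t\<bar> \<le> C * \<bar>f j x - v x\<bar>"
        using mult_left_mono[OF bd(1)[of t] abs_ge_zero[of "f j x - v x"]]
      proof -
        have "f j x * \<phi> t - v x * \<phi> t = (f j x - v x) * \<phi> t" by (simp add: algebra_simps)
        then show ?thesis using mult_left_mono[OF bd(1)[of t] abs_ge_zero[of "f j x - v x"]]
          by (simp only: abs_mult mult.commute[of C])
      qed
      have "norm ((\<phi> t *\<^sub>R g j x, f j x * \<phi>' t) - (\<phi> t *\<^sub>R \<omega> x, v x * \<phi>' t)) = norm (\<phi> t *\<^sub>R (g j x - \<omega> x), (f j x - v x) * \<phi>' t)"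
        by (simp add: algebra_simps)
      also have "\<dots> \<le> norm (\<phi> t *\<^sub>R (g j x - \<omega> x)) + norm ((f j x - v x) * \<phi>' t)" by (rule norm_Pair_le)
      also have "\<dots> \<le> C * norm (g j x - \<omega> x) + C * \<bar>f j x - v x\<bar>"
        using mult_right_mono[OF bd(1)[of t] norm_ge_zero[of "g j x - \<omega> x"]] mult_left_mono[OF bd(2)[of t] abs_ge_zero[of "f j x - v x"]]
        by (intro add_mono) (auto simp: abs_mult mult.commute)
      finally have "\<bar>f j x * \<phi> t - v x * \<phi> t\<bar> + norm ((\<phi> t *\<^sub>R g j x, f j x * \<phi>' t) - (\<phi> t *\<^sub>R \<omega> x, v x * \<phi>' t))
         \<le> 2 * C * (\<bar>f j x - v x\<bar> + norm (g j x - \<omega> x))"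
        using a1 mult_nonneg_nonneg[OF C0 norm_ge_zero[of "g j x - \<omega> x"]] by (simp add: algebra_simps)
      then show "ennreal (\<bar>f j (fst p) * \<phi> (snd p) - v (fst p) * \<phi> (snd p)\<bar>
      + norm ((\<phi> (snd p) *\<^sub>R g j (fst p), f j (fst p) * \<phi>' (snd p)) - (\<phi> (snd p) *\<^sub>R \<omega> (fst p), v (fst p) * \<phi>' (snd p)))) * indicator ?M p
       \<le> (ennreal (2 * C) * ?e j (fst p)) * indicator ?I (snd p)"
        using C0 by (auto simp: p indicator_def ennreal_mult'[symmetric] simp del: ennreal_plus intro!: ennreal_leI)
    qed
    also have "\<dots> = (\<integral>\<^sup>+x. ennreal (2 * C) * ?e j x \<partial>lborel) * ennreal (b - a)"
      using sob_integrand_measurable[OF Nb fg sv s\<omega>] ab by (intro nn_integral_cylinder) auto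
    also have "(\<integral>\<^sup>+x. ennreal (2 * C) * ?e j x \<partial>lborel) = ennreal (2 * C) * (\<integral>\<^sup>+x. ?e j x \<partial>lborel)"
      using sob_integrand_measurable[OF Nb fg sv s\<omega>] by (intro nn_integral_cmult) auto
    finally show "(\<integral>\<^sup>+p\<in>?M. ennreal (\<bar>f j (fst p) * \<phi> (snd p) - v (fst p) * \<phi> (snd p)\<bar>
      + norm ((\<phi> (snd p) *\<^sub>R g j (fst p), f j (fst p) * \<phi>' (snd p)) - (\<phi> (snd p) *\<^sub>R \<omega> (fst p), v (fst p) * \<phi>' (snd p)))) \<partial>lborel)
      \<le> (ennreal (2 * C) * (\<integral>\<^sup>+x. ?e j x \<partial>lborel)) * ennreal (b - a)" .
  qed
  then show ?thesis unfolding sob_on_def using M i1 i2 gr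
    by (intro conjI exI[of _ "\<lambda>j p. f j (fst p) * \<phi> (snd p)"] exI[of _ "\<lambda>j p. (\<phi> (snd p) *\<^sub>R g j (fst p), f j (fst p) * \<phi>' (snd p))"]) auto
qed

section \<open>Pullback by a coordinate change\<close>

lemma borel_measurable_indicator_compose:
  fixes h :: "'f::topological_space \<Rightarrow> 'b::{real_normed_vector, second_countable_topology}"
    and T :: "'e::topological_space \<Rightarrow> 'f"
  assumes "h \<in> borel_measurable borel" "continuous_on M T" "M \<in> sets borel"
  shows "(\<lambda>x. indicator M x *\<^sub>R h (T x)) \<in> borel_measurable borel"
proof -
  have "(\<lambda>x. h (T x)) \<in> borel_measurable (restrict_space borel M)"
    using measurable_compose[OF borel_measurable_continuous_on_restrict[OF assms(2)] assms(1)] .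
  then show ?thesis using assms(3) by (subst (asm) borel_measurable_restrict_space_iff) auto
qed

text \<open>The Jacobian bound says that T shrinks volume at most by the factor C, so composing with
  T enlarges L^1 norms at most by C (this is \<open>cv\<close>). The bound B on the derivative
  controls the transformed gradients.\<close>

lemma sob_on_pullback:
  fixes T :: "'e::euclidean_space \<Rightarrow> 'f::euclidean_space"
    and \<alpha> :: "'n::finite \<Rightarrow> 'e" and \<beta> :: "'n \<Rightarrow> 'f"
  assumes bij: "bij_betw \<alpha> UNIV Basis" "bij_betw \<beta> UNIV Basis"
    and M: "open M" "T ` M \<in> sets borel" "T ` M \<subseteq> N"
    and der: "\<And>x. x \<in> M \<Longrightarrow> (T has_derivative T' x) (at x)"
    and inj: "inj_on T M" and cont: "\<And>v. continuous_on M (\<lambda>x. T' x v)"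
    and jac: "\<And>x. x \<in> M \<Longrightarrow> 1 \<le> C * \<bar>det (\<chi> i j. T' x (\<alpha> j) \<bullet> \<beta> i)\<bar>"
    and bnd: "\<And>x i. x \<in> M \<Longrightarrow> i \<in> Basis \<Longrightarrow> norm (T' x i) \<le> B" "B \<ge> 0" "C \<ge> 0"
    and s: "sob_on N v \<omega>"
  shows "sob_on M (\<lambda>x. v (T x)) (\<lambda>x. \<Sum>i\<in>Basis. (\<omega> (T x) \<bullet> T' x i) *\<^sub>R i)"
proof -
  obtain f g where fg: "\<And>j. has_gradient_on (f j) (g j) N"
    and lim: "(\<lambda>j. \<integral>\<^sup>+x\<in>N. ennreal (\<bar>f j x - v x\<bar> + norm (g j x - \<omega> x)) \<partial>lborel) \<longlonglongrightarrow> 0"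
    using s unfolding sob_on_def by blast
  have N: "open N" and sv: "set_integrable lborel N v" and s\<omega>: "set_integrable lborel N \<omega>"
    using s by (auto simp: sob_on_def)
  have iv: "integrable lborel (\<lambda>x. indicator N x *\<^sub>R v x)" and i\<omega>: "integrable lborel (\<lambda>x. indicator N x *\<^sub>R \<omega> x)"
    using sv s\<omega> by (auto simp: set_integrable_def)
  have Nb[measurable]: "N \<in> sets borel" and Mb[measurable]: "M \<in> sets borel" using N M by auto
  have cT: "continuous_on M T" using der by (auto intro!: continuous_at_imp_continuous_on dest: has_derivative_continuous)
  have TN: "T x \<in> N" if "x \<in> M" for x using M(3) that by auto
  have cv: "(\<integral>\<^sup>+x\<in>M. G (T x) \<partial>lborel) \<le> ennreal C * (\<integral>\<^sup>+y. G y \<partial>lborel)" if G: "G \<in> borel_measurable borel" for G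
  proof -
    have "(\<integral>\<^sup>+x\<in>M. G (T x) \<partial>lborel) \<le> (\<integral>\<^sup>+x\<in>M. ennreal C * (ennreal \<bar>det (\<chi> i j. T' x (\<alpha> j) \<bullet> \<beta> i)\<bar> * G (T x)) \<partial>lborel)"
    proof (rule nn_integral_mono)
      fix x
      show "G (T x) * indicator M x \<le> ennreal C * (ennreal \<bar>det (\<chi> i j. T' x (\<alpha> j) \<bullet> \<beta> i)\<bar> * G (T x)) * indicator M x"
      proof (cases "x \<in> M")
        case True
        have "1 \<le> ennreal C * ennreal \<bar>det (\<chi> i j. T' x (\<alpha> j) \<bullet> \<beta> i)\<bar>"
          using jac[OF True] bnd(3) ennreal_leI[OF jac[OF True]] by (simp add: ennreal_mult'[symmetric])
        from mult_right_mono[OF this, of "G (T x)"] show ?thesis using True by (simp add: mult.assoc)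
      qed simp
    qed
    also have "\<dots> = ennreal C * (\<integral>\<^sup>+x\<in>M. ennreal \<bar>det (\<chi> i j. T' x (\<alpha> j) \<bullet> \<beta> i)\<bar> * G (T x) \<partial>lborel)"
    proof -
      have c: "continuous_on M (\<lambda>x. \<bar>det (\<chi> i j. T' x (\<alpha> j) \<bullet> \<beta> i)\<bar>)"
        unfolding det_def by (simp, intro continuous_intros cont)
      have "(\<lambda>x. ennreal \<bar>det (\<chi> i j. T' x (\<alpha> j) \<bullet> \<beta> i)\<bar> * G (T x)) \<in> borel_measurable (restrict_space borel M)"
        using measurable_compose[OF borel_measurable_continuous_on_restrict[OF cT] G]
          measurable_compose[OF borel_measurable_continuous_on_restrict[OF c] measurable_ennreal]
        by (intro borel_measurable_times_ennreal)
      then have "(\<lambda>x. ennreal \<bar>det (\<chi> i j. T' x (\<alpha> j) \<bullet> \<beta> i)\<bar> * G (T x) * indicator M x) \<in> borel_measurable borel"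
        by (subst (asm) borel_measurable_restrict_space_iff_ennreal) auto
      then show ?thesis by (subst nn_integral_cmult[symmetric]) (auto simp: mult.assoc)
    qed
    also have "(\<integral>\<^sup>+x\<in>M. ennreal \<bar>det (\<chi> i j. T' x (\<alpha> j) \<bullet> \<beta> i)\<bar> * G (T x) \<partial>lborel) = (\<integral>\<^sup>+y\<in>T ` M. G y \<partial>lborel)"
      by (rule nn_integral_change_of_variables[OF bij Mb M(2) _ inj cont G, symmetric]) (use der in \<open>auto intro: has_derivative_at_withinI\<close>)
    also have "(\<integral>\<^sup>+y\<in>T ` M. G y \<partial>lborel) \<le> (\<integral>\<^sup>+y. G y \<partial>lborel)"
      by (intro nn_integral_mono) (auto simp: indicator_def)
    finally show ?thesis by (simp add: mult_left_mono)
  qed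
  define D where "D = real DIM('e) * B"
  have D0: "D \<ge> 0" using bnd by (simp add: D_def)
  have nrm: "norm (\<Sum>i\<in>Basis. (z \<bullet> T' x i) *\<^sub>R i) \<le> D * norm z" if x: "x \<in> M" for x z
  proof -
    have "norm (\<Sum>i\<in>Basis. (z \<bullet> T' x i) *\<^sub>R i) \<le> (\<Sum>i\<in>(Basis :: 'e set). norm z * B)"
    proof (rule order_trans[OF norm_sum sum_mono])
      fix i :: 'e assume "i \<in> Basis"
      then show "norm ((z \<bullet> T' x i) *\<^sub>R i) \<le> norm z * B"
        using order_trans[OF Cauchy_Schwarz_ineq2 mult_left_mono[OF bnd(1)[OF x] norm_ge_zero]] by simp
    qed
    then show ?thesis by (simp add: D_def ac_simps)
  qed
  have set_int: "set_integrable lborel M (\<lambda>x. L x (H (T x)))"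
    if H: "set_integrable lborel N H" and L: "\<And>x y. x \<in> M \<Longrightarrow> norm (L x y) \<le> (1 + D) * norm y"
      and m: "(\<lambda>x. indicator M x *\<^sub>R L x (H (T x))) \<in> borel_measurable borel"
    for H :: "'f \<Rightarrow> 'd::euclidean_space" and L :: "'e \<Rightarrow> 'd \<Rightarrow> 'c::euclidean_space"
  proof -
    have Hi: "integrable lborel (\<lambda>x. indicator N x *\<^sub>R H x)" using H by (simp add: set_integrable_def)
    have Hm: "(\<lambda>x. indicator N x *\<^sub>R H x) \<in> borel_measurable borel" using borel_measurable_integrable[OF Hi] by simp
    have "(\<integral>\<^sup>+x. ennreal (norm (indicator M x *\<^sub>R L x (H (T x)))) \<partial>lborel) \<le>
        (\<integral>\<^sup>+x\<in>M. ennreal ((1 + D) * norm (indicator N (T x) *\<^sub>R H (T x))) \<partial>lborel)"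
      using L TN by (intro nn_integral_mono) (auto simp: indicator_def intro: ennreal_leI)
    also have "\<dots> \<le> ennreal C * (\<integral>\<^sup>+y. ennreal ((1 + D) * norm (indicator N y *\<^sub>R H y)) \<partial>lborel)"
      using borel_measurable_integrable[OF Hi]
      by (intro cv[of "\<lambda>y. ennreal ((1 + D) * norm (indicator N y *\<^sub>R H y))"] measurable_compose[OF _ measurable_ennreal]
          borel_measurable_times borel_measurable_const measurable_compose[OF Hm borel_measurable_norm])
    also have "\<dots> < \<infinity>"
    proof -
      have "integrable lborel (\<lambda>x. (1 + D) * norm (indicator N x *\<^sub>R H x))"
        by (intro integrable_mult_right integrable_norm Hi)
      then show ?thesis using D0 by (subst nn_integral_eq_integral) (auto simp: ennreal_mult_less_top)
    qed
    finally show ?thesis unfolding set_integrable_def using m by (intro integrableI_bounded) auto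
  qed
  have mv: "(\<lambda>x. indicator M x *\<^sub>R v (T x)) \<in> borel_measurable borel"
  proof -
    have "(\<lambda>x. indicator M x *\<^sub>R (indicator N (T x) *\<^sub>R v (T x))) \<in> borel_measurable borel"
      using borel_measurable_integrable[OF iv] by (intro borel_measurable_indicator_compose[OF _ cT Mb, of "\<lambda>y. indicator N y *\<^sub>R v y"]) simp
    also have "(\<lambda>x. indicator M x *\<^sub>R (indicator N (T x) *\<^sub>R v (T x))) = (\<lambda>x. indicator M x *\<^sub>R v (T x))"
      using TN by (auto simp: indicator_def)
    finally show ?thesis .
  qed
  have m\<omega>: "(\<lambda>x. indicator M x *\<^sub>R \<omega> (T x)) \<in> borel_measurable borel"
  proof -
    have "(\<lambda>x. indicator M x *\<^sub>R (indicator N (T x) *\<^sub>R \<omega> (T x))) \<in> borel_measurable borel"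
      using borel_measurable_integrable[OF i\<omega>] by (intro borel_measurable_indicator_compose[OF _ cT Mb, of "\<lambda>y. indicator N y *\<^sub>R \<omega> y"]) simp
    also have "(\<lambda>x. indicator M x *\<^sub>R (indicator N (T x) *\<^sub>R \<omega> (T x))) = (\<lambda>x. indicator M x *\<^sub>R \<omega> (T x))"
      using TN by (auto simp: indicator_def fun_eq_iff)
    finally show ?thesis .
  qed
  have mT: "(\<lambda>x. indicator M x *\<^sub>R T' x i) \<in> borel_measurable borel" for i
    by (rule borel_measurable_continuous_on_indicator[OF Mb cont])
  have m2: "(\<lambda>x. indicator M x *\<^sub>R (\<Sum>i\<in>Basis. (\<omega> (T x) \<bullet> T' x i) *\<^sub>R i)) \<in> borel_measurable borel"
  proof -
    have "(\<lambda>x. \<Sum>i\<in>Basis. ((indicator M x *\<^sub>R \<omega> (T x)) \<bullet> (indicator M x *\<^sub>R T' x i)) *\<^sub>R i) \<in> borel_measurable borel"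
      by (intro borel_measurable_sum borel_measurable_scaleR borel_measurable_inner m\<omega> mT borel_measurable_const)
    also have "(\<lambda>x. \<Sum>i\<in>Basis. ((indicator M x *\<^sub>R \<omega> (T x)) \<bullet> (indicator M x *\<^sub>R T' x i)) *\<^sub>R i) = (\<lambda>x. indicator M x *\<^sub>R (\<Sum>i\<in>Basis. (\<omega> (T x) \<bullet> T' x i) *\<^sub>R i))"
      by (auto simp: indicator_def fun_eq_iff)
    finally show ?thesis .
  qed
  have i1: "set_integrable lborel M (\<lambda>x. v (T x))"
    using set_int[of v "\<lambda>x y. y"] sv mv mult_right_mono[of 1 "1 + D"] D0 by simp
  have i2: "set_integrable lborel M (\<lambda>x. \<Sum>i\<in>Basis. (\<omega> (T x) \<bullet> T' x i) *\<^sub>R i)"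
  proof (rule set_int[of \<omega> "\<lambda>x y. \<Sum>i\<in>Basis. (y \<bullet> T' x i) *\<^sub>R i"])
    show "norm (\<Sum>i\<in>Basis. (y \<bullet> T' x i) *\<^sub>R i) \<le> (1 + D) * norm y" if "x \<in> M" for x y
      using nrm[OF that, of y] by (simp add: distrib_right add_increasing)
  qed (use s\<omega> m2 in auto)
  have gr: "has_gradient_on (\<lambda>x. f j (T x)) (\<lambda>x. \<Sum>i\<in>Basis. (g j (T x) \<bullet> T' x i) *\<^sub>R i) M" for j
    unfolding has_gradient_on_def
  proof (intro conjI ballI)
    have "continuous_on M (\<lambda>x. g j (T x))"
      using fg[of j] M(3) by (intro continuous_on_compose2[OF _ cT]) (auto simp: has_gradient_on_def)
    then show "continuous_on M (\<lambda>x. \<Sum>i\<in>Basis. (g j (T x) \<bullet> T' x i) *\<^sub>R i)"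
      by (intro continuous_intros cont)
    fix x assume x: "x \<in> M"
    have "(f j has_derivative (\<lambda>w. g j (T x) \<bullet> w)) (at (T x))" using fg[of j] TN[OF x] by (simp add: has_gradient_on_def)
    from has_derivative_compose[OF der[OF x] this]
    have D: "((\<lambda>x. f j (T x)) has_derivative (\<lambda>w. g j (T x) \<bullet> T' x w)) (at x)" .
    have "g j (T x) \<bullet> T' x w = (\<Sum>i\<in>Basis. (g j (T x) \<bullet> T' x i) *\<^sub>R i) \<bullet> w" for w
    proof -
      have l: "linear (T' x)" using der[OF x] has_derivative_linear by blast
      have "T' x w = (\<Sum>i\<in>Basis. (w \<bullet> i) *\<^sub>R T' x i)"
        using linear_sum[OF l, of "\<lambda>i. (w \<bullet> i) *\<^sub>R i" Basis] by (simp add: euclidean_representation linear_scale[OF l])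
      then show ?thesis by (simp add: inner_sum_left inner_sum_right inner_commute[of w] mult.commute)
    qed
    then show "((\<lambda>x. f j (T x)) has_derivative (\<lambda>w. (\<Sum>i\<in>Basis. (g j (T x) \<bullet> T' x i) *\<^sub>R i) \<bullet> w)) (at x)"
      by (intro has_derivative_eq_rhs[OF D] ext)
  qed
  have "(\<lambda>j. \<integral>\<^sup>+x\<in>M. ennreal (\<bar>f j (T x) - v (T x)\<bar> + norm ((\<Sum>i\<in>Basis. (g j (T x) \<bullet> T' x i) *\<^sub>R i) - (\<Sum>i\<in>Basis. (\<omega> (T x) \<bullet> T' x i) *\<^sub>R i))) \<partial>lborel) \<longlonglongrightarrow> 0"
  proof (rule tendsto_0_le_ennreal)
    let ?e = "\<lambda>j x. ennreal (\<bar>f j x - v x\<bar> + norm (g j x - \<omega> x)) * indicator N x"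
    show "(\<lambda>j. (ennreal C * ennreal (1 + D)) * (\<integral>\<^sup>+x. ?e j x \<partial>lborel)) \<longlonglongrightarrow> 0"
      using ennreal_tendsto_cmult[OF _ lim, of "ennreal C * ennreal (1 + D)"] by (simp add: ennreal_mult_less_top del: ennreal_plus)
    fix j
    have "(\<integral>\<^sup>+x\<in>M. ennreal (\<bar>f j (T x) - v (T x)\<bar> + norm ((\<Sum>i\<in>Basis. (g j (T x) \<bullet> T' x i) *\<^sub>R i) - (\<Sum>i\<in>Basis. (\<omega> (T x) \<bullet> T' x i) *\<^sub>R i))) \<partial>lborel)
      \<le> (\<integral>\<^sup>+x\<in>M. ennreal (1 + D) * ?e j (T x) \<partial>lborel)"
    proof (rule nn_integral_mono)
      fix x
      show "ennreal (\<bar>f j (T x) - v (T x)\<bar> + norm ((\<Sum>i\<in>Basis. (g j (T x) \<bullet> T' x i) *\<^sub>R i) - (\<Sum>i\<in>Basis. (\<omega> (T x) \<bullet> T' x i) *\<^sub>R i))) * indicator M x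
        \<le> ennreal (1 + D) * ?e j (T x) * indicator M x"
      proof (cases "x \<in> M")
        case True
        have "(\<Sum>i\<in>Basis. (g j (T x) \<bullet> T' x i) *\<^sub>R i) - (\<Sum>i\<in>Basis. (\<omega> (T x) \<bullet> T' x i) *\<^sub>R i) = (\<Sum>i\<in>Basis. ((g j (T x) - \<omega> (T x)) \<bullet> T' x i) *\<^sub>R i)"
          by (simp add: sum_subtractf[symmetric] inner_diff_left scaleR_diff_left)
        then have "\<bar>f j (T x) - v (T x)\<bar> + norm ((\<Sum>i\<in>Basis. (g j (T x) \<bullet> T' x i) *\<^sub>R i) - (\<Sum>i\<in>Basis. (\<omega> (T x) \<bullet> T' x i) *\<^sub>R i))
          \<le> (1 + D) * (\<bar>f j (T x) - v (T x)\<bar> + norm (g j (T x) - \<omega> (T x)))"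
        proof -
          assume eq: "(\<Sum>i\<in>Basis. (g j (T x) \<bullet> T' x i) *\<^sub>R i) - (\<Sum>i\<in>Basis. (\<omega> (T x) \<bullet> T' x i) *\<^sub>R i) = (\<Sum>i\<in>Basis. ((g j (T x) - \<omega> (T x)) \<bullet> T' x i) *\<^sub>R i)"
          have aux: "p + r \<le> (1 + D) * (p + q)" if "r \<le> D * q" "0 \<le> D * p" "0 \<le> q" for p q r
            using that by (simp add: algebra_simps)
          show ?thesis unfolding eq by (rule aux[OF nrm[OF True]]) (auto simp: D0)
        qed
        then show ?thesis using True TN[OF True] D0
          by (simp add: ennreal_mult'[symmetric] ennreal_leI del: ennreal_plus)
      qed simp
    qed
    also have "\<dots> \<le> ennreal C * (\<integral>\<^sup>+y. ennreal (1 + D) * ?e j y \<partial>lborel)"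
      using sob_integrand_measurable[OF Nb fg sv s\<omega>] by (intro cv[of "\<lambda>y. ennreal (1 + D) * ?e j y"]) auto
    also have "(\<integral>\<^sup>+y. ennreal (1 + D) * ?e j y \<partial>lborel) = ennreal (1 + D) * (\<integral>\<^sup>+y. ?e j y \<partial>lborel)"
      using sob_integrand_measurable[OF Nb fg sv s\<omega>] by (intro nn_integral_cmult) auto
    finally show "(\<integral>\<^sup>+x\<in>M. ennreal (\<bar>f j (T x) - v (T x)\<bar> + norm ((\<Sum>i\<in>Basis. (g j (T x) \<bullet> T' x i) *\<^sub>R i) - (\<Sum>i\<in>Basis. (\<omega> (T x) \<bullet> T' x i) *\<^sub>R i))) \<partial>lborel)
      \<le> (ennreal C * ennreal (1 + D)) * (\<integral>\<^sup>+x. ?e j x \<partial>lborel)" by (simp only: mult.assoc)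
  qed
  then show ?thesis unfolding sob_on_def using M(1) i1 i2 gr
    by (intro conjI exI[of _ "\<lambda>j x. f j (T x)"] exI[of _ "\<lambda>j x. \<Sum>i\<in>Basis. (g j (T x) \<bullet> T' x i) *\<^sub>R i"]) auto
qed

section \<open>Manifolds\<close>

locale smooth_manifold =
  fixes A :: "('a::{t2_space, second_countable_topology}, 'e::euclidean_space) atlas"
  assumes smooth_atlas: "smooth_atlas A"
begin

lemma open_dom: "c \<in> A \<Longrightarrow> open (chart_dom c)"
  and open_img: "c \<in> A \<Longrightarrow> open (chart_img c)"
  and homeo: "c \<in> A \<Longrightarrow> homeomorphism (chart_dom c) (chart_img c) (chart_map c) (chart_inv c)"
  and cover: "(\<Union>c\<in>A. chart_dom c) = UNIV"
  and smooth_transition: "c \<in> A \<Longrightarrow> d \<in> A \<Longrightarrow> smooth_on (transition c d) (overlap c d)"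
  using smooth_atlas by (auto simp: smooth_atlas_def)

lemma map_inv: "c \<in> A \<Longrightarrow> x \<in> chart_img c \<Longrightarrow> chart_map c (chart_inv c x) = x"
  and inv_dom: "c \<in> A \<Longrightarrow> x \<in> chart_img c \<Longrightarrow> chart_inv c x \<in> chart_dom c"
  and inv_map: "c \<in> A \<Longrightarrow> p \<in> chart_dom c \<Longrightarrow> chart_inv c (chart_map c p) = p"
  and map_img: "c \<in> A \<Longrightarrow> p \<in> chart_dom c \<Longrightarrow> chart_map c p \<in> chart_img c"
  and cont_map: "c \<in> A \<Longrightarrow> continuous_on (chart_dom c) (chart_map c)"
  and cont_inv: "c \<in> A \<Longrightarrow> continuous_on (chart_img c) (chart_inv c)"
  using homeo unfolding homeomorphism_def by blast+

lemma image_eq_preimage: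
  assumes "c \<in> A" shows "chart_map c ` (chart_dom c \<inter> S) = chart_img c \<inter> chart_inv c -` S"
proof (intro equalityI subsetI)
  fix x assume "x \<in> chart_img c \<inter> chart_inv c -` S"
  then show "x \<in> chart_map c ` (chart_dom c \<inter> S)"
    using inv_dom[OF assms, of x] map_inv[OF assms, of x] by (intro image_eqI[of _ _ "chart_inv c x"]) auto
qed (use assms in \<open>auto simp: map_img inv_map\<close>)

lemma open_image: "c \<in> A \<Longrightarrow> open S \<Longrightarrow> open (chart_map c ` (chart_dom c \<inter> S))"
  unfolding image_eq_preimage by (intro continuous_open_preimage cont_inv open_img)

lemma borel_image:
  assumes "c \<in> A" "E \<in> sets borel" "E \<subseteq> chart_dom c"
  shows "chart_map c ` E \<in> sets borel"
proof -
  have "chart_map c ` E = chart_img c \<inter> chart_inv c -` E"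
    using image_eq_preimage[OF assms(1), of E] assms(3) by (simp add: Int_absorb1)
  also have "\<dots> \<in> sets borel"
    using measurable_sets[OF borel_measurable_continuous_on_restrict[OF cont_inv[OF assms(1)]] assms(2)] open_img[OF assms(1)]
    by (simp add: space_restrict_space sets_restrict_space_iff Int_commute)
  finally show ?thesis .
qed

lemma open_preimage: "c \<in> A \<Longrightarrow> open S \<Longrightarrow> open (chart_dom c \<inter> chart_map c -` S)"
  by (intro continuous_open_preimage cont_map open_dom)

lemma chart_at: "chart_at A p \<in> A" "p \<in> chart_dom (chart_at A p)"
proof -
  have "\<exists>c. c \<in> A \<and> p \<in> chart_dom c" using cover by blast
  then have "chart_at A p \<in> A \<and> p \<in> chart_dom (chart_at A p)" unfolding chart_at_def by (rule someI_ex)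
  then show "chart_at A p \<in> A" "p \<in> chart_dom (chart_at A p)" by auto
qed

text \<open>Lindelof's argument: the members of a countable basis that fit into some chart domain
  still cover, and one chart is chosen for each. Atlases may be uncountable, but measures are glued
  over countably many pieces.\<close>

lemma ex_countable_cover: "\<exists>C :: nat \<Rightarrow> ('a, 'e) chart. (\<forall>i. C i \<in> A) \<and> (\<Union>i. chart_dom (C i)) = UNIV"
proof -
  obtain BB :: "'a set set" where BB: "countable BB" "topological_basis BB" using ex_countable_basis by blast
  define G where "G = {U \<in> BB. \<exists>c\<in>A. U \<subseteq> chart_dom c}"
  have "\<exists>U\<in>G. p \<in> U" for p
  proof -
    obtain U where "U \<in> BB" "p \<in> U" "U \<subseteq> chart_dom (chart_at A p)"
      by (rule topological_basisE[OF BB(2) open_dom[OF chart_at(1)] chart_at(2)])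
    then show ?thesis using chart_at(1) by (auto simp: G_def)
  qed
  then have UG: "\<Union>G = UNIV" by auto
  then have "G \<noteq> {}" by auto
  have "countable G" using BB(1) by (auto simp: G_def)
  define U where "U = from_nat_into G"
  have rU: "range U = G" unfolding U_def  by (rule range_from_nat_into[OF \<open>G \<noteq> {}\<close> \<open>countable G\<close>])
  have "\<exists>c. c \<in> A \<and> U i \<subseteq> chart_dom c" for i
  proof -
    have "U i \<in> G" using rU by auto
    then show ?thesis unfolding G_def by blast
  qed
  then obtain C where C: "\<And>i. C i \<in> A" "\<And>i. U i \<subseteq> chart_dom (C i)" by metis
  have "(\<Union>i. chart_dom (C i)) = UNIV"
  proof -
    have "UNIV = (\<Union>i. U i)" using UG rU by simp
    also have "\<dots> \<subseteq> (\<Union>i. chart_dom (C i))" using C(2) by blast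
    finally show ?thesis by auto
  qed
  then show ?thesis using C(1) by blast
qed

lemma overlap_eq: "c \<in> A \<Longrightarrow> overlap c d = chart_img c \<inter> chart_inv c -` chart_dom d"
  unfolding overlap_def by (rule image_eq_preimage)

lemma open_overlap: "c \<in> A \<Longrightarrow> d \<in> A \<Longrightarrow> open (overlap c d)"
  unfolding overlap_def by (intro open_image open_dom)

lemma transition_overlap: "c \<in> A \<Longrightarrow> d \<in> A \<Longrightarrow> x \<in> overlap c d \<Longrightarrow> transition c d x \<in> overlap d c"
  by (auto simp: overlap_def transition_def inv_map)

lemma transition_inverse: "c \<in> A \<Longrightarrow> d \<in> A \<Longrightarrow> x \<in> overlap c d \<Longrightarrow> transition d c (transition c d x) = x"
  by (auto simp: overlap_def transition_def inv_map)

lemma transition_inj: "c \<in> A \<Longrightarrow> d \<in> A \<Longrightarrow> inj_on (transition c d) (overlap c d)"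
  by (metis inj_on_def transition_inverse)

end

text \<open>Making the cover disjoint cuts every set into countably many pieces on which the two
  measures agree.\<close>

lemma measure_eqI_cover:
  fixes U :: "nat \<Rightarrow> 'a set"
  assumes sets: "sets M = sets N" and U: "\<And>i. U i \<in> sets M" "(\<Union>i. U i) = space M"
    and eq: "\<And>i E. E \<in> sets M \<Longrightarrow> E \<subseteq> U i \<Longrightarrow> emeasure M E = emeasure N E"
  shows "M = N"
proof (rule measure_eqI[OF sets])
  fix E assume E: "E \<in> sets M"
  define D where "D = (\<lambda>i. E \<inter> disjointed U i)"
  have dU: "range (disjointed U) \<subseteq> sets M" using U(1) by (intro sets.range_disjointed_sets) auto
  have D: "range D \<subseteq> sets M" using dU E by (auto simp: D_def)
  have dis: "disjoint_family D"
    unfolding D_def using disjoint_family_disjointed[of U] by (auto simp: disjoint_family_on_def)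
  have un: "(\<Union>i. D i) = E"
    using UN_disjointed_eq[of U] U(2) sets.sets_into_space[OF E] by (auto simp: D_def)
  have "emeasure M (\<Union>i. D i) = (\<Sum>i. emeasure M (D i))" by (rule suminf_emeasure[OF D dis, symmetric])
  also have "\<dots> = (\<Sum>i. emeasure N (D i))"
    by (intro suminf_cong eq[of "D _"]) (use D disjointed_subset[of U] in \<open>auto simp: D_def\<close>)
  also have "\<dots> = emeasure N (\<Union>i. D i)" using D sets by (intro suminf_emeasure dis) auto
  finally show "emeasure M E = emeasure N E" by (simp add: un)
qed

subsection \<open>The Riemannian volume\<close>

definition vol_density :: "('a, real^'n) tensor2 \<Rightarrow> ('a, real^'n) chart \<Rightarrow> real^'n \<Rightarrow> real" where
  "vol_density g c x = sqrt (gram (\<lambda>i. axis i 1) (g c x))"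

locale riemannian_manifold = smooth_manifold A
  for A :: "('a::{t2_space, second_countable_topology}, 'e::euclidean_space) atlas" +
  fixes g :: "('a, 'e) tensor2"
  assumes metric: "riemannian_metric A g"
begin

lemma bilinear_metric: "c \<in> A \<Longrightarrow> x \<in> chart_img c \<Longrightarrow> bilinear (g c x)"
  and metric_sym: "c \<in> A \<Longrightarrow> x \<in> chart_img c \<Longrightarrow> g c x v w = g c x w v"
  and metric_pos: "c \<in> A \<Longrightarrow> x \<in> chart_img c \<Longrightarrow> v \<noteq> 0 \<Longrightarrow> 0 < g c x v v"
  and smooth_metric: "c \<in> A \<Longrightarrow> smooth_on (\<lambda>x. g c x v w) (chart_img c)"
  and metric_transition: "c \<in> A \<Longrightarrow> d \<in> A \<Longrightarrow> x \<in> overlap c d \<Longrightarrow>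
    g c x v w = g d (transition c d x) (dir_deriv v (transition c d) x) (dir_deriv w (transition c d) x)"
  using metric unfolding riemannian_metric_def by blast+

end

locale riemannian_vec_manifold = riemannian_manifold A g
  for A :: "('a::{t2_space, second_countable_topology}, real^'n) atlas" and g
begin

lemma continuous_vol_density: "c \<in> A \<Longrightarrow> continuous_on (chart_img c) (vol_density g c)"
  unfolding vol_density_def gram_def det_def
  by (simp, intro continuous_intros smooth_on_continuous_on[OF smooth_metric])

lemma vol_density_pos: "c \<in> A \<Longrightarrow> x \<in> chart_img c \<Longrightarrow> vol_density g c x > 0"
  unfolding vol_density_def using gram_pos[OF bilinear_metric] metric_pos by simp

definition chart_volume :: "('a, real^'n) chart \<Rightarrow> 'a set \<Rightarrow> ennreal" where
  "chart_volume c E = (\<integral>\<^sup>+x\<in>chart_map c ` E. ennreal (vol_density g c x) \<partial>lborel)"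

lemma vol_density_measurable:
  assumes "c \<in> A"
  shows "(\<lambda>x. ennreal (vol_density g c x) * indicator (chart_img c) x) \<in> borel_measurable borel"
  using measurable_compose[OF borel_measurable_continuous_on_restrict[OF continuous_vol_density[OF assms]] measurable_ennreal]
  by (subst (asm) borel_measurable_restrict_space_iff_ennreal) (use open_img[OF assms] in auto)

lemma vol_density_measurable_subset:
  assumes "c \<in> A" "S \<in> sets borel" "S \<subseteq> chart_img c"
  shows "(\<lambda>x. ennreal (vol_density g c x) * indicator S x) \<in> borel_measurable borel"
proof -
  have "(\<lambda>x. (ennreal (vol_density g c x) * indicator (chart_img c) x) * indicator S x) \<in> borel_measurable borel"
    using vol_density_measurable[OF assms(1)] assms(2) by measurable
  also have "(\<lambda>x. (ennreal (vol_density g c x) * indicator (chart_img c) x) * indicator S x) = (\<lambda>x. ennreal (vol_density g c x) * indicator S x)"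
    using assms(3) by (auto simp: indicator_def fun_eq_iff)
  finally show ?thesis .
qed

text \<open>By \<open>gram_pullback\<close> the Jacobian of the transition map is exactly the
  quotient of the two densities, so the change of variables formula identifies the
  integrals.\<close>

lemma chart_volume_eq:
  assumes cd: "c \<in> A" "d \<in> A" and E: "E \<in> sets borel" "E \<subseteq> chart_dom c" "E \<subseteq> chart_dom d"
  shows "chart_volume c E = chart_volume d E"
proof -
  let ?T = "transition c d"
  define S where "S = chart_map c ` E"
  have SO: "S \<subseteq> overlap c d" using E by (auto simp: S_def overlap_def)
  have TS: "?T ` S = chart_map d ` E" using E(2) inv_map[OF cd(1)] by (force simp: S_def transition_def image_image)
  \<comment> \<open>The indicator of the chart image makes the integrand Borel on the whole space;
    outside the image nothing is known about the density.\<close>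
  have "chart_volume d E = (\<integral>\<^sup>+y\<in>?T ` S. ennreal (vol_density g d y) * indicator (chart_img d) y \<partial>lborel)"
    unfolding chart_volume_def TS using E(3) map_img[OF cd(2)] by (intro nn_integral_cong) (auto simp: indicator_def)
  also have "\<dots> = (\<integral>\<^sup>+x\<in>S. ennreal \<bar>det (\<chi> i j. dir_deriv (axis j 1) ?T x \<bullet> axis i 1)\<bar>
      * (ennreal (vol_density g d (?T x)) * indicator (chart_img d) (?T x)) \<partial>lborel)"
  proof (rule nn_integral_change_of_variables[OF bij_axis bij_axis])
    show "S \<in> sets borel" "?T ` S \<in> sets borel" unfolding TS unfolding S_def using cd E by (auto intro: borel_image)
    show "(?T has_derivative (\<lambda>v. dir_deriv v ?T x)) (at x within S)" if "x \<in> S" for x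
      using smooth_on_has_derivative[OF smooth_transition[OF cd]] that SO by (auto intro: has_derivative_at_withinI)
    show "inj_on ?T S" by (rule inj_on_subset[OF transition_inj[OF cd] SO])
    show "continuous_on S (\<lambda>x. dir_deriv v ?T x)" for v
      using smooth_on_continuous_on[OF smooth_on_dir_deriv[OF smooth_transition[OF cd], of v]] SO by (auto intro: continuous_on_subset)
  qed (rule vol_density_measurable[OF cd(2)])
  also have "\<dots> = (\<integral>\<^sup>+x\<in>S. ennreal (vol_density g c x) \<partial>lborel)"
  proof (rule nn_integral_cong)
    fix x
    show "ennreal \<bar>det (\<chi> i j. dir_deriv (axis j 1) ?T x \<bullet> axis i 1)\<bar> * (ennreal (vol_density g d (?T x)) * indicator (chart_img d) (?T x)) * indicator S x
      = ennreal (vol_density g c x) * indicator S x"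
    proof (cases "x \<in> S")
      case True
      then have x: "x \<in> overlap c d" using SO by auto
      then have Tx: "?T x \<in> chart_img d" using transition_overlap[OF cd x] overlap_eq[OF cd(2)] by auto
      have "gram (\<lambda>i. axis i 1) (g c x) = (det (\<chi> i j. dir_deriv (axis j 1) ?T x \<bullet> axis i 1))\<^sup>2 * gram (\<lambda>i. axis i 1) (g d (?T x))"
        by (rule gram_pullback[OF bij_axis bilinear_metric[OF cd(2) Tx]]) (rule metric_transition[OF cd x])
      then have "vol_density g c x = \<bar>det (\<chi> i j. dir_deriv (axis j 1) ?T x \<bullet> axis i 1)\<bar> * vol_density g d (?T x)"
        by (simp add: vol_density_def real_sqrt_mult)
      then show ?thesis using Tx True by (simp add: ennreal_mult')
    qed simp
  qed
  finally show ?thesis by (simp add: chart_volume_def S_def)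
qed

lemma chart_volume_union:
  fixes F :: "nat \<Rightarrow> 'a set"
  assumes c: "c \<in> A" and F: "range F \<subseteq> sets borel" "disjoint_family F"
    and sub: "\<And>k. F k \<subseteq> chart_dom c"
  shows "chart_volume c (\<Union>k. F k) = (\<Sum>k. chart_volume c (F k))"
proof -
  have inj: "inj_on (chart_map c) (chart_dom c)" by (metis inj_onI inv_map[OF c])
  have dis: "disjoint_family (\<lambda>k. chart_map c ` F k)"
    unfolding disjoint_family_on_def
  proof (intro ballI impI)
    fix m n :: nat assume "m \<noteq> n"
    then have "F m \<inter> F n = {}" using F(2) by (auto simp: disjoint_family_on_def)
    then show "chart_map c ` F m \<inter> chart_map c ` F n = {}"
      using inj_on_image_Int[OF inj sub sub, of m n] by auto
  qed
  have "chart_volume c (\<Union>k. F k) = (\<integral>\<^sup>+x. (\<Sum>k. ennreal (vol_density g c x) * indicator (chart_map c ` F k) x) \<partial>lborel)"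
    unfolding chart_volume_def image_UN
    by (intro nn_integral_cong) (simp add: suminf_indicator[OF dis, symmetric])
  also have "\<dots> = (\<Sum>k. chart_volume c (F k))"
    unfolding chart_volume_def
  proof (rule nn_integral_suminf)
    fix k
    have "chart_map c ` F k \<subseteq> chart_img c" using sub map_img[OF c] by blast
    then show "(\<lambda>x. ennreal (vol_density g c x) * indicator (chart_map c ` F k) x) \<in> borel_measurable lborel"
      using vol_density_measurable_subset[OF c, of "chart_map c ` F k"] borel_image[OF c _ sub[of k]] F(1) by auto
  qed
  finally show ?thesis .
qed

text \<open>The chart volumes are summed over a countable disjoint decomposition subordinate to
  charts. Their agreement on overlaps shows that the sum has the prescribed value in every chart of
  the atlas.\<close>

lemma ex_volume:
  "\<exists>\<mu>. sets \<mu> = sets borel \<and> (\<forall>c\<in>A. \<forall>E\<in>sets borel. E \<subseteq> chart_dom c \<longrightarrow> emeasure \<mu> E = chart_volume c E)"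
proof -
  obtain C where C: "\<And>i :: nat. C i \<in> A" "(\<Union>i. chart_dom (C i)) = UNIV" using ex_countable_cover by blast
  define D where "D = disjointed (\<lambda>i. chart_dom (C i))"
  have "range (\<lambda>i. chart_dom (C i)) \<subseteq> sets borel" using open_dom[OF C(1)] by auto
  then have Db: "D i \<in> sets borel" for i
    using sets.range_disjointed_sets[of "\<lambda>i. chart_dom (C i)" borel] unfolding D_def by blast
  have Dsub: "D i \<subseteq> chart_dom (C i)" for i unfolding D_def by (rule disjointed_subset)
  have Ddis: "disjoint_family D" unfolding D_def by (rule disjoint_family_disjointed)
  have DU: "(\<Union>i. D i) = UNIV" using C(2) UN_disjointed_eq[of "\<lambda>i. chart_dom (C i)"] by (simp add: D_def)
  \<comment> \<open>The sum over the pieces is written as an integral over counting measure, so that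
    countable additivity is an exchange of sum and integral.\<close>
  define \<nu> where "\<nu> = (\<lambda>E. \<integral>\<^sup>+i. chart_volume (C i) (E \<inter> D i) \<partial>count_space UNIV)"
  define \<mu> where "\<mu> = measure_of UNIV (sets borel) \<nu>"
  have sa: "sigma_algebra UNIV (sets (borel :: 'a measure))" using sets.sigma_algebra_axioms[of "borel :: 'a measure"] by simp
  have sets: "sets \<mu> = sets borel" unfolding \<mu>_def using sigma_algebra.sets_measure_of_eq[OF sa] by simp
  have em: "emeasure \<mu> E = \<nu> E" if "E \<in> sets borel" for E
    unfolding \<mu>_def
  proof (rule emeasure_measure_of_sigma[OF sa _ _ that])
    show "positive (sets borel) \<nu>" by (simp add: positive_def \<nu>_def chart_volume_def)
    show "countably_additive (sets borel) \<nu>"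
    proof (rule countably_additiveI)
      fix F :: "nat \<Rightarrow> 'a set" assume F: "range F \<subseteq> sets borel" "disjoint_family F"
      have "\<nu> (\<Union>k. F k) = (\<integral>\<^sup>+i. (\<Sum>k. chart_volume (C i) (F k \<inter> D i)) \<partial>count_space UNIV)"
        unfolding \<nu>_def
      proof (rule nn_integral_cong)
        fix i
        have "chart_volume (C i) (\<Union>k. F k \<inter> D i) = (\<Sum>k. chart_volume (C i) (F k \<inter> D i))"
        proof (rule chart_volume_union[OF C(1)])
          show "F k \<inter> D i \<subseteq> chart_dom (C i)" for k using Dsub[of i] by blast
        qed (use F Db in \<open>auto simp: disjoint_family_on_def\<close>)
        then show "chart_volume (C i) ((\<Union>k. F k) \<inter> D i) = (\<Sum>k. chart_volume (C i) (F k \<inter> D i))" by simp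
      qed
      also have "\<dots> = (\<Sum>k. \<nu> (F k))" unfolding \<nu>_def by (rule nn_integral_suminf) simp
      finally show "(\<Sum>k. \<nu> (F k)) = \<nu> (\<Union>k. F k)" by simp
    qed
  qed
  have "emeasure \<mu> E = chart_volume c E" if c: "c \<in> A" and E: "E \<in> sets borel" "E \<subseteq> chart_dom c" for c E
  proof -
    have "emeasure \<mu> E = (\<Sum>i. chart_volume (C i) (E \<inter> D i))"
      using em[OF E(1)] by (simp add: \<nu>_def nn_integral_count_space_nat)
    also have "\<dots> = (\<Sum>i. chart_volume c (E \<inter> D i))"
    proof (intro suminf_cong chart_volume_eq)
      show "E \<inter> D i \<subseteq> chart_dom (C i)" for i using Dsub[of i] by blast
    qed (use C(1) c E Db in auto)
    also have "\<dots> = chart_volume c (\<Union>i. E \<inter> D i)"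
    proof (rule chart_volume_union[OF c, symmetric])
      show "disjoint_family (\<lambda>i. E \<inter> D i)" using Ddis unfolding disjoint_family_on_def by blast
      show "E \<inter> D k \<subseteq> chart_dom c" for k using E(2) by blast
    qed (use E Db in auto)
    also have "(\<Union>i. E \<inter> D i) = E" using DU by auto
    finally show ?thesis .
  qed
  then show ?thesis using sets by blast
qed

abbreviation "vol \<equiv> riemannian_volume A g"

text \<open>\<open>riemannian_volume\<close> is a definite description: existence comes from gluing,
  uniqueness from the values on a countable cover by charts.\<close>

lemma volume_spec: "sets vol = sets borel \<and> (\<forall>c\<in>A. \<forall>E\<in>sets borel. E \<subseteq> chart_dom c \<longrightarrow> emeasure vol E = chart_volume c E)"
proof -
  let ?P = "\<lambda>\<mu>. sets \<mu> = sets borel \<and> (\<forall>c\<in>A. \<forall>E\<in>sets borel. E \<subseteq> chart_dom c \<longrightarrow> emeasure \<mu> E = chart_volume c E)"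
  have P: "riemannian_volume A g = (THE \<mu>. ?P \<mu>)"
    by (simp add: riemannian_volume_def chart_volume_def vol_density_def gram_def)
  have "\<exists>!\<mu>. ?P \<mu>"
  proof (rule ex_ex1I[OF ex_volume])
    fix \<mu> \<mu>' assume P: "?P \<mu>" "?P \<mu>'"
    obtain C where C: "\<And>i :: nat. C i \<in> A" "(\<Union>i. chart_dom (C i)) = UNIV" using ex_countable_cover by blast
    show "\<mu> = \<mu>'"
    proof (rule measure_eqI_cover[where U = "\<lambda>i. chart_dom (C i)"])
      show "sets \<mu> = sets \<mu>'" using P by simp
      show "chart_dom (C i) \<in> sets \<mu>" for i using P open_dom[OF C(1)] by simp
      have "space \<mu> = UNIV" using P sets_eq_imp_space_eq[of \<mu> borel] by simp
      then show "(\<Union>i. chart_dom (C i)) = space \<mu>" using C(2) by simp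
      show "emeasure \<mu> E = emeasure \<mu>' E" if "E \<in> sets \<mu>" "E \<subseteq> chart_dom (C i)" for i E
      proof -
        have "E \<in> sets borel" using that(1) P by simp
        then have "emeasure \<mu> E = chart_volume (C i) E" "emeasure \<mu>' E = chart_volume (C i) E"
          using P C(1)[of i] that(2) by blast+
        then show ?thesis by simp
      qed
    qed
  qed
  then show ?thesis unfolding P by (rule theI')
qed

lemma sets_vol [simp, measurable_cong]: "sets vol = sets borel" using volume_spec by blast

lemma space_vol [simp]: "space vol = UNIV" using sets_eq_imp_space_eq[OF sets_vol] by simp

lemma emeasure_vol: "c \<in> A \<Longrightarrow> E \<in> sets borel \<Longrightarrow> E \<subseteq> chart_dom c \<Longrightarrow> emeasure vol E = chart_volume c E"
  using volume_spec by blast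

text \<open>Around each point the preimage of a small coordinate ball has finite volume, because the
  density is integrable over a closed ball; finitely many such sets cover. Finiteness on Z is what
  makes the product with Lebesgue measure sigma-finite.\<close>

lemma finite_volume:
  assumes "compact (UNIV :: 'a set)"
  shows "finite_measure vol"
proof
  have "\<exists>U. open U \<and> p \<in> U \<and> emeasure vol U < \<infinity>" for p
  proof -
    define c where "c = chart_at A p"
    have c: "c \<in> A" "p \<in> chart_dom c" using chart_at by (auto simp: c_def)
    obtain r where r: "r > 0" "cball (chart_map c p) r \<subseteq> chart_img c"
      using open_img[OF c(1)] map_img[OF c] open_contains_cball by blast
    define U where "U = chart_dom c \<inter> chart_map c -` ball (chart_map c p) r"
    have U: "open U" unfolding U_def by (rule open_preimage[OF c(1)]) simp
    have "emeasure vol U = chart_volume c U" using U by (intro emeasure_vol c) (auto simp: U_def)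
    also have "\<dots> \<le> (\<integral>\<^sup>+x. ennreal (indicator (cball (chart_map c p) r) x *\<^sub>R vol_density g c x) \<partial>lborel)"
      unfolding chart_volume_def by (intro nn_integral_mono) (auto simp: U_def indicator_def)
    also have "\<dots> < \<infinity>"
    proof -
      have "integrable lborel (\<lambda>x. indicator (cball (chart_map c p) r) x *\<^sub>R vol_density g c x)"
        by (rule borel_integrable_compact) (use continuous_vol_density[OF c(1)] r in \<open>auto intro: continuous_on_subset\<close>)
      moreover have "0 \<le> indicator (cball (chart_map c p) r) x *\<^sub>R vol_density g c x" for x
        using vol_density_pos[OF c(1), of x] r(2) by (auto simp: indicator_def dest: less_imp_le)
      ultimately show ?thesis by (subst nn_integral_eq_integral) auto
    qed
    finally show ?thesis using U r(1) c(2) by (intro exI[of _ U]) (auto simp: U_def)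
  qed
  then obtain U where U: "\<And>p. open (U p)" "\<And>p. p \<in> U p" "\<And>p. emeasure vol (U p) < \<infinity>" by metis
  obtain I where I: "I \<subseteq> UNIV" "finite I" "UNIV \<subseteq> (\<Union>p\<in>I. U p)"
    by (rule compactE_image[OF assms, of UNIV U]) (use U in auto)
  have "emeasure vol UNIV \<le> emeasure vol (\<Union>p\<in>I. U p)" using I(3) U(1) by (intro emeasure_mono) (auto intro!: borel_open)
  also have "\<dots> \<le> (\<Sum>p\<in>I. emeasure vol (U p))" using U(1) I(2) by (intro emeasure_subadditive_finite) auto
  also have "\<dots> < \<infinity>" using U(3) I(2) by (simp add: ennreal_sum_less_top)
  finally show "emeasure vol (space vol) \<noteq> \<infinity>" by simp
qed

lemma volume_nonzero: "emeasure vol UNIV \<noteq> 0"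
proof
  assume z: "emeasure vol UNIV = 0"
  \<comment> \<open>Types are inhabited, so \<open>undefined\<close> serves as some point of the
    manifold.\<close>
  define c where "c = chart_at A undefined"
  have c: "c \<in> A" "undefined \<in> chart_dom c" using chart_at by (auto simp: c_def)
  have "emeasure vol (chart_dom c) = 0"
    using emeasure_mono[of "chart_dom c" UNIV vol] z open_dom[OF c(1)] by simp
  then have "(\<integral>\<^sup>+x. ennreal (vol_density g c x) * indicator (chart_img c) x \<partial>lborel) = 0"
    using emeasure_vol[OF c(1), of "chart_dom c"] open_dom[OF c(1)] by (simp add: chart_volume_def chart_img_def)
  then have "AE x in lborel. ennreal (vol_density g c x) * indicator (chart_img c) x = 0"
    by (subst (asm) nn_integral_0_iff_AE) (use vol_density_measurable[OF c(1)] in auto)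
  then have "AE x in lborel. x \<notin> chart_img c"
  proof eventually_elim
    case (elim x) then show ?case using vol_density_pos[OF c(1), of x] by (auto simp: indicator_def)
  qed
  then have n: "emeasure lborel (chart_img c) = 0"
    by (subst (asm) AE_iff_measurable[of "chart_img c"]) (use open_img[OF c(1)] in auto)
  obtain r where r: "r > 0" "cball (chart_map c undefined) r \<subseteq> chart_img c"
    using open_img[OF c(1)] map_img[OF c] open_contains_cball by blast
  have "emeasure lborel (ball (chart_map c undefined) r) \<le> emeasure lborel (chart_img c)"
    using r(2) open_img[OF c(1)] by (intro emeasure_mono) auto
  then have "emeasure lborel (ball (chart_map c undefined) r) = 0" using n by simp
  then show False using content_ball_pos[OF r(1), of "chart_map c undefined"] by (simp add: measure_def)
qed

end

section \<open>Cylindrical ends\<close>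

subsection \<open>Smooth maps in charts\<close>

definition line_chart :: "('z, 'e) chart \<Rightarrow> ('z \<times> real, 'e \<times> real) chart" where
  "line_chart c = (chart_dom c \<times> UNIV, map_prod (chart_map c) id)"

context smooth_manifold
begin

lemma map_prod_id_image: "map_prod f id ` (S \<times> UNIV) = f ` S \<times> UNIV"
  by force

lemma line_chart_simps [simp]:
  "chart_dom (line_chart c) = chart_dom c \<times> UNIV"
  "chart_map (line_chart c) = map_prod (chart_map c) id"
  "chart_img (line_chart c) = chart_img c \<times> UNIV"
  by (simp_all add: line_chart_def chart_img_def map_prod_id_image)

lemma line_chart_inv:
  assumes "c \<in> A" "fst p \<in> chart_img c"
  shows "chart_inv (line_chart c) p = (chart_inv c (fst p), snd p)"
proof -
  have "inj_on (map_prod (chart_map c) (id :: real \<Rightarrow> real)) (chart_dom c \<times> UNIV)"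
    by (rule inj_onI) (auto, metis inv_map[OF assms(1)])
  then show ?thesis
    unfolding chart_inv_def[of "line_chart c"]
    using inv_dom[OF assms] map_inv[OF assms] by (intro inv_into_f_eq) (auto simp: prod_eq_iff)
qed

lemma smooth_manifold_line_product: "smooth_manifold (line_product A)"
proof
  have lp: "line_product A = line_chart ` A" by (auto simp: line_product_def line_chart_def)
  have ov: "overlap (line_chart c) (line_chart d) = overlap c d \<times> UNIV" for c d
  proof -
    have "(chart_dom c \<times> UNIV) \<inter> (chart_dom d \<times> UNIV) = (chart_dom c \<inter> chart_dom d) \<times> (UNIV :: real set)" by auto
    then show ?thesis by (simp add: overlap_def map_prod_id_image)
  qed
  show "smooth_atlas (line_product A)"
    unfolding smooth_atlas_def lp ball_simps
  proof (intro conjI ballI)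
    fix c assume c: "c \<in> A"
    show "open (chart_dom (line_chart c))" "open (chart_img (line_chart c))"
      using open_dom[OF c] open_img[OF c] by (auto intro: open_Times)
    have ci: "continuous_on (chart_img c \<times> (UNIV :: real set)) (chart_inv (line_chart c))"
    proof (rule continuous_on_eq)
      show "continuous_on (chart_img c \<times> (UNIV :: real set)) (\<lambda>p. (chart_inv c (fst p), snd p))"
        by (intro continuous_intros continuous_on_compose2[OF cont_inv[OF c]]) auto
    qed (use line_chart_inv[OF c] in auto)
    have cm: "continuous_on (chart_dom c \<times> (UNIV :: real set)) (map_prod (chart_map c) id)"
      unfolding map_prod_def split_beta
      by (simp, intro continuous_intros continuous_on_compose2[OF cont_map[OF c]]) auto
    show "homeomorphism (chart_dom (line_chart c)) (chart_img (line_chart c)) (chart_map (line_chart c)) (chart_inv (line_chart c))"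
      unfolding homeomorphism_def
    proof (intro conjI ballI)
      show "chart_map (line_chart c) ` chart_dom (line_chart c) = chart_img (line_chart c)" by (simp add: chart_img_def)
      show "continuous_on (chart_img (line_chart c)) (chart_inv (line_chart c))" using ci by simp
      show "continuous_on (chart_dom (line_chart c)) (chart_map (line_chart c))" using cm by simp
      show "chart_inv (line_chart c) (chart_map (line_chart c) p) = p" if "p \<in> chart_dom (line_chart c)" for p
        using that c by (auto simp: line_chart_inv map_img inv_map prod_eq_iff)
      show "chart_map (line_chart c) (chart_inv (line_chart c) q) = q" if "q \<in> chart_img (line_chart c)" for q
        using that c by (auto simp: line_chart_inv map_inv prod_eq_iff)
      show "chart_inv (line_chart c) ` chart_img (line_chart c) = chart_dom (line_chart c)"
      proof (intro equalityI subsetI)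
        fix p assume "p \<in> chart_dom (line_chart c)"
        then show "p \<in> chart_inv (line_chart c) ` chart_img (line_chart c)"
          using c by (intro image_eqI[of _ _ "(chart_map c (fst p), snd p)"]) (auto simp: line_chart_inv map_img inv_map)
      qed (use c in \<open>auto simp: line_chart_inv inv_dom\<close>)
    qed
  next
    have "p \<in> (\<Union>c\<in>A. chart_dom (line_chart c))" for p :: "'a \<times> real"
      using chart_at[of "fst p"] by (auto intro!: bexI[of _ "chart_at A (fst p)"] simp: mem_Times_iff)
    then show "(\<Union>c\<in>line_chart ` A. chart_dom c) = UNIV" by blast
  next
    fix c d assume c: "c \<in> A" and d: "d \<in> A"
    have "smooth_on (\<lambda>p :: 'e \<times> real. (transition c d (fst p), snd p)) (overlap c d \<times> UNIV)"
    proof (rule smooth_on_Pair)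
      show o: "open (overlap c d \<times> (UNIV :: real set))" using open_overlap[OF c d] by (intro open_Times) auto
      show "smooth_on (\<lambda>p :: 'e \<times> real. transition c d (fst p)) (overlap c d \<times> UNIV)"
        by (rule smooth_on_compose[OF o open_overlap[OF c d] _ smooth_on_linear[OF bounded_linear_fst] smooth_transition[OF c d]]) auto
      show "smooth_on (snd :: 'e \<times> real \<Rightarrow> real) (overlap c d \<times> UNIV)" by (rule smooth_on_linear[OF bounded_linear_snd])
    qed
    then show "smooth_on (transition (line_chart c) (line_chart d)) (overlap (line_chart c) (line_chart d))"
      unfolding ov
    proof (rule smooth_on_cong[rotated 2])
      show "open (overlap c d \<times> (UNIV :: real set))" using open_overlap[OF c d] by (intro open_Times) auto
      show "(transition c d (fst p), snd p) = transition (line_chart c) (line_chart d) p" if "p \<in> overlap c d \<times> UNIV" for p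
        using that c by (auto simp: transition_def line_chart_inv overlap_eq)
    qed
  qed
qed

end

lemma smooth_map_continuous:
  assumes "smooth_manifold A" "smooth_manifold B" "smooth_map_on A B S f"
  shows "continuous_on S f"
  unfolding continuous_on_eq_continuous_within
proof
  interpret A: smooth_manifold A by fact
  interpret B: smooth_manifold B by fact
  fix p assume p: "p \<in> S"
  then obtain c d N F where cd: "c \<in> A" "d \<in> B" "p \<in> chart_dom c" "f p \<in> chart_dom d" "open N" "chart_map c p \<in> N"
    "smooth_on F N" and F: "\<And>q. q \<in> S \<Longrightarrow> q \<in> chart_dom c \<Longrightarrow> chart_map c q \<in> N \<Longrightarrow> f q \<in> chart_dom d \<and> chart_map d (f q) = F (chart_map c q)"
    using assms(3) unfolding smooth_map_on_def by (metis IntI)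
  define O' where "O' = chart_dom c \<inter> chart_map c -` N"
  have oO: "open O'" unfolding O'_def by (rule A.open_preimage[OF cd(1,5)])
  have "continuous_on (S \<inter> O') (\<lambda>q. chart_inv d (F (chart_map c q)))"
  proof (rule continuous_on_compose2[OF B.cont_inv[OF cd(2)]])
    show "continuous_on (S \<inter> O') (\<lambda>q. F (chart_map c q))"
      by (rule continuous_on_compose2[OF smooth_on_continuous_on[OF cd(7)]])
        (use A.cont_map[OF cd(1)] in \<open>auto simp: O'_def intro: continuous_on_subset\<close>)
    show "(\<lambda>q. F (chart_map c q)) ` (S \<inter> O') \<subseteq> chart_img d"
    proof
      fix y assume "y \<in> (\<lambda>q. F (chart_map c q)) ` (S \<inter> O')"
      then obtain q where q: "q \<in> S" "q \<in> chart_dom c" "chart_map c q \<in> N" "y = F (chart_map c q)" by (auto simp: O'_def)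
      then show "y \<in> chart_img d" using F[OF q(1-3)] B.map_img[OF cd(2), of "f q"] by simp
    qed
  qed
  then have "continuous_on (S \<inter> O') f"
  proof (rule continuous_on_eq)
    fix q assume "q \<in> S \<inter> O'"
    then have q: "q \<in> S" "q \<in> chart_dom c" "chart_map c q \<in> N" by (auto simp: O'_def)
    show "chart_inv d (F (chart_map c q)) = f q" using F[OF q] B.inv_map[OF cd(2), of "f q"] by simp
  qed
  then have "continuous (at p within (S \<inter> O')) f"
    using p cd by (auto simp: continuous_on_eq_continuous_within O'_def)
  moreover have "at p within S = at p within (S \<inter> O')"
    using oO cd by (intro at_within_nhd[of p O']) (auto simp: O'_def)
  ultimately show "continuous (at p within S) f" by simp
qed

text \<open>The definition of smoothness only offers, at each point, some pair of charts and a local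
  smooth extension F. In prescribed charts the map is locally F between two transition maps, and
  smoothness on an open set is a local property.\<close>

lemma smooth_map_rep:
  assumes "smooth_manifold A" "smooth_manifold B" "smooth_map_on A B S f"
    and S': "open S'" "S' \<subseteq> S" and c: "c \<in> A" and d: "d \<in> B"
    and R: "R = {x \<in> chart_img c. chart_inv c x \<in> S' \<and> f (chart_inv c x) \<in> chart_dom d}"
  shows "open R \<and> smooth_on (\<lambda>x. chart_map d (f (chart_inv c x))) R"
proof -
  interpret A: smooth_manifold A by fact
  interpret B: smooth_manifold B by fact
  have cf: "continuous_on S' f" using smooth_map_continuous[OF assms(1-3)] S'(2) by (rule continuous_on_subset)
  have "open (S' \<inter> f -` chart_dom d)" by (rule continuous_open_preimage[OF cf S'(1) B.open_dom[OF d]])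
  then have "open (chart_img c \<inter> chart_inv c -` (S' \<inter> f -` chart_dom d))"
    by (rule continuous_open_preimage[OF A.cont_inv[OF c] A.open_img[OF c]])
  also have "chart_img c \<inter> chart_inv c -` (S' \<inter> f -` chart_dom d) = R" by (auto simp: R)
  finally have oR: "open R" .
  moreover have "smooth_on (\<lambda>x. chart_map d (f (chart_inv c x))) R"
  proof (rule smooth_on_local[OF oR])
    fix x assume x: "x \<in> R"
    define p where "p = chart_inv c x"
    have p: "p \<in> S" "p \<in> S'" "f p \<in> chart_dom d" "p \<in> chart_dom c" using x S'(2) A.inv_dom[OF c] by (auto simp: R p_def)
    from p(1) obtain c' d' N F where cd: "c' \<in> A" "d' \<in> B" "p \<in> chart_dom c'" "f p \<in> chart_dom d'" "open N" "chart_map c' p \<in> N"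
      "smooth_on F N" and F: "\<And>q. q \<in> S \<Longrightarrow> q \<in> chart_dom c' \<Longrightarrow> chart_map c' q \<in> N \<Longrightarrow> f q \<in> chart_dom d' \<and> chart_map d' (f q) = F (chart_map c' q)"
      using assms(3) unfolding smooth_map_on_def by (metis IntI)
    define Q where "Q = R \<inter> (overlap c c' \<inter> transition c c' -` N)"
    have ct: "continuous_on (overlap c c') (transition c c')"
      by (rule smooth_on_continuous_on[OF A.smooth_transition[OF c cd(1)]])
    have oQ: "open Q" unfolding Q_def
      by (intro open_Int oR continuous_open_preimage[OF ct A.open_overlap[OF c cd(1)] cd(5)])
    have xQ: "x \<in> Q" using x p cd c by (auto simp: Q_def A.overlap_eq transition_def p_def R)
    define T1 where "T1 = N \<inter> F -` overlap d' d"
    have oT1: "open T1" unfolding T1_def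
      by (intro continuous_open_preimage[OF smooth_on_continuous_on[OF cd(7)] cd(5)] B.open_overlap cd d)
    have key: "transition c c' y \<in> T1 \<and> chart_map d (f (chart_inv c y)) = transition d' d (F (transition c c' y))" if "y \<in> Q" for y
    proof -
      define q where "q = chart_inv c y"
      have q: "q \<in> S" "q \<in> chart_dom c'" "chart_map c' q \<in> N" "f q \<in> chart_dom d"
        using that S'(2) c by (auto simp: Q_def q_def R A.overlap_eq transition_def)
      note Fq = F[OF q(1-3)]
      have t: "transition c c' y = chart_map c' q" by (simp add: transition_def q_def)
      have "chart_map d' (f q) \<in> overlap d' d" unfolding overlap_def using Fq q(4) by (intro imageI) simp
      then have "transition c c' y \<in> T1" using q(3) Fq by (simp add: T1_def t)
      moreover have "chart_map d (f q) = transition d' d (chart_map d' (f q))"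
        using B.inv_map[OF cd(2) conjunct1[OF Fq]] by (simp add: transition_def)
      ultimately show ?thesis using Fq by (simp add: t q_def)
    qed
    have s1: "smooth_on (transition c c') Q"
      by (rule smooth_on_subset[OF A.smooth_transition[OF c cd(1)]]) (auto simp: Q_def)
    have s2: "smooth_on F T1" by (rule smooth_on_subset[OF cd(7)]) (auto simp: T1_def)
    have s3: "smooth_on (\<lambda>y. transition d' d (F y)) T1"
      by (rule smooth_on_compose[OF oT1 B.open_overlap[OF cd(2) d] _ s2 B.smooth_transition[OF cd(2) d]]) (auto simp: T1_def)
    have "smooth_on (\<lambda>y. transition d' d (F (transition c c' y))) Q"
      by (rule smooth_on_compose[OF oQ oT1 _ s1 s3]) (use key in auto)
    then have "smooth_on (\<lambda>x. chart_map d (f (chart_inv c x))) Q"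
      using smooth_on_cong[OF oQ] key by metis
    moreover have "Q \<inter> R = Q" by (auto simp: Q_def)
    ultimately show "\<exists>N. open N \<and> x \<in> N \<and> smooth_on (\<lambda>x. chart_map d (f (chart_inv c x))) (N \<inter> R)"
      using oQ xQ by (intro exI[of _ Q]) simp
  qed
  ultimately show ?thesis by blast
qed

subsection \<open>Coordinates on the end\<close>

locale cyl_end = X: riemannian_vec_manifold A g + Z: riemannian_vec_manifold B h
  for A :: "('a::{t2_space, second_countable_topology}, real^'n) atlas" and g
    and B :: "('z::{t2_space, second_countable_topology}, real^'k) atlas" and h +
  fixes W :: "'a set" and \<Phi> :: "'z \<times> real \<Rightarrow> 'a"
  assumes open_W: "open W" and compact_Z: "compact (UNIV :: 'z set)"
    and card_eq: "CARD('n) = CARD('k) + 1"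
    and end_coords: "end_coordinates A B W \<Phi>"
    and cyl: "\<And>c d z t. c \<in> B \<Longrightarrow> d \<in> A \<Longrightarrow> z \<in> chart_dom c \<Longrightarrow> t \<ge> 1 \<Longrightarrow> \<Phi> (z, t) \<in> chart_dom d \<Longrightarrow>
      (let F = (\<lambda>(x, s). chart_map d (\<Phi> (chart_inv c x, s))); y = (chart_map c z, t) in
           \<forall>v w a b. g d (F y) (dir_deriv (v, a) F y) (dir_deriv (w, b) F y) = h c (fst y) v w + a * b)"
begin

definition \<Psi> :: "'a \<Rightarrow> 'z \<times> real" where "\<Psi> = inv_into (UNIV \<times> {0..}) \<Phi>"

text \<open>The strict inequality makes this set open in X; the end itself is only closed. The
  metric is a product on all of it.\<close>

definition cyl_part :: "'a set" where "cyl_part = \<Phi> ` (UNIV \<times> {1<..})"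

lemma \<Phi>_bij: "bij_betw \<Phi> (UNIV \<times> {0..}) (- W)"
  and \<Phi>_smooth: "smooth_map_on (line_product B) A (UNIV \<times> {0..}) \<Phi>"
  and \<Psi>_smooth: "smooth_map_on A (line_product B) (- W) \<Psi>"
  and \<Phi>_frontier: "\<Phi> ` (UNIV \<times> {0}) = frontier W"
  using end_coords by (auto simp: end_coordinates_def diffeo_on_def \<Psi>_def)

lemma \<Psi>\<Phi>: "0 \<le> snd q \<Longrightarrow> \<Psi> (\<Phi> q) = q"
  unfolding \<Psi>_def by (rule bij_betw_inv_into_left[OF \<Phi>_bij]) (simp add: mem_Times_iff)

lemma \<Phi>\<Psi>: "p \<in> - W \<Longrightarrow> \<Phi> (\<Psi> p) = p"
  unfolding \<Psi>_def by (rule bij_betw_inv_into_right[OF \<Phi>_bij])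

lemma \<Phi>_notin: "0 \<le> snd q \<Longrightarrow> \<Phi> q \<in> - W"
  using bij_betw_apply[OF \<Phi>_bij, of q] by (simp add: mem_Times_iff)

lemma cont_\<Phi>: "continuous_on (UNIV \<times> {0..}) \<Phi>"
  by (rule smooth_map_continuous[OF Z.smooth_manifold_line_product X.smooth_manifold_axioms \<Phi>_smooth])

lemma cont_\<Psi>: "continuous_on (- W) \<Psi>"
  by (rule smooth_map_continuous[OF X.smooth_manifold_axioms Z.smooth_manifold_line_product \<Psi>_smooth])

lemma cyl_part_iff: "p \<in> cyl_part \<longleftrightarrow> p \<in> - W \<and> 1 < snd (\<Psi> p)"
proof
  assume "p \<in> cyl_part"
  then obtain q where "p = \<Phi> q" "1 < snd q" by (auto simp: cyl_part_def)
  then show "p \<in> - W \<and> 1 < snd (\<Psi> p)" using \<Phi>_notin[of q] \<Psi>\<Phi>[of q] by simp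
next
  assume "p \<in> - W \<and> 1 < snd (\<Psi> p)"
  then show "p \<in> cyl_part" using \<Phi>\<Psi>[of p] unfolding cyl_part_def
    by (intro image_eqI[of _ _ "\<Psi> p"]) (auto simp: mem_Times_iff)
qed

text \<open>The complement of W is not open, but its only critical points are those of the frontier,
  which is the slice t = 0. Thus a point with t > 1 lies off the closure of W, and on that open set
  \<Psi> is continuous.\<close>

lemma open_cyl_part: "open cyl_part"
proof -
  have "p \<notin> closure W" if "p \<in> - W" "1 < snd (\<Psi> p)" for p
  proof
    assume "p \<in> closure W"
    then have "p \<in> frontier W" using that(1) open_W by (simp add: frontier_def interior_open)
    then obtain z where "p = \<Phi> (z, 0)" unfolding \<Phi>_frontier[symmetric] by auto
    then show False using that(2) \<Psi>\<Phi>[of "(z, 0)"] by simp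
  qed
  then have "cyl_part = (- closure W) \<inter> \<Psi> -` (UNIV \<times> {1<..})"
    using closure_subset[of W] by (auto simp: cyl_part_iff mem_Times_iff)
  moreover have "open ((- closure W) \<inter> \<Psi> -` (UNIV \<times> {1<..}))"
    by (rule continuous_open_preimage) (use cont_\<Psi> closure_subset[of W] in \<open>auto intro!: open_Times elim: continuous_on_subset\<close>)
  ultimately show ?thesis by simp
qed

lemma closed_end:
  assumes "0 \<le> s" shows "closed (\<Phi> ` (UNIV \<times> {s..}))"
proof -
  have "\<Phi> ` (UNIV \<times> {s..}) = (- W) \<inter> \<Psi> -` (UNIV \<times> {s..})"
  proof (intro equalityI subsetI)
    fix p assume "p \<in> \<Phi> ` (UNIV \<times> {s..})"
    then obtain q where "p = \<Phi> q" "s \<le> snd q" by auto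
    then show "p \<in> (- W) \<inter> \<Psi> -` (UNIV \<times> {s..})" using assms \<Phi>_notin[of q] \<Psi>\<Phi>[of q] by (simp add: mem_Times_iff)
  next
    fix p assume "p \<in> (- W) \<inter> \<Psi> -` (UNIV \<times> {s..})"
    then show "p \<in> \<Phi> ` (UNIV \<times> {s..})" using \<Phi>\<Psi>[of p] by (metis IntD1 IntD2 image_eqI vimageD)
  qed
  moreover have "closed ((- W) \<inter> \<Psi> -` (UNIV \<times> {s..}))"
    by (rule continuous_closed_preimage[OF cont_\<Psi>]) (use open_W in \<open>auto intro: closed_Times\<close>)
  ultimately show ?thesis by simp
qed

text \<open>\<open>cmap\<close> on \<open>cdom\<close> is \<Phi> over t > 1 read in a chart of Z and
  a chart of X; \<open>nmap\<close> on \<open>ndom\<close> is its inverse. All comparisons of the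
  end with the cylinder go through this pair.\<close>

definition cdom :: "('z, real^'k) chart \<Rightarrow> ('a, real^'n) chart \<Rightarrow> ((real^'k) \<times> real) set" where
  "cdom c d = {q. fst q \<in> chart_img c \<and> 1 < snd q \<and> \<Phi> (chart_inv c (fst q), snd q) \<in> chart_dom d}"

definition cmap :: "('z, real^'k) chart \<Rightarrow> ('a, real^'n) chart \<Rightarrow> (real^'k) \<times> real \<Rightarrow> real^'n" where
  "cmap c d = (\<lambda>(x, s). chart_map d (\<Phi> (chart_inv c x, s)))"

definition ndom :: "('z, real^'k) chart \<Rightarrow> ('a, real^'n) chart \<Rightarrow> (real^'n) set" where
  "ndom c d = {y \<in> chart_img d. chart_inv d y \<in> cyl_part \<and> fst (\<Psi> (chart_inv d y)) \<in> chart_dom c}"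

definition nmap :: "('z, real^'k) chart \<Rightarrow> ('a, real^'n) chart \<Rightarrow> real^'n \<Rightarrow> (real^'k) \<times> real" where
  "nmap c d y = map_prod (chart_map c) id (\<Psi> (chart_inv d y))"

lemma
  assumes c: "c \<in> B" and d: "d \<in> A"
  shows open_cdom: "open (cdom c d)" and smooth_cmap: "smooth_on (cmap c d) (cdom c d)"
proof -
  have lc: "line_chart c \<in> line_product B" using c by (auto simp: line_product_def line_chart_def)
  have "open (cdom c d) \<and> smooth_on (\<lambda>q. chart_map d (\<Phi> (chart_inv (line_chart c) q))) (cdom c d)"
  proof (rule smooth_map_rep[OF Z.smooth_manifold_line_product X.smooth_manifold_axioms \<Phi>_smooth _ _ lc d])
    show "open (UNIV \<times> {1<..} :: ('z \<times> real) set)" by (intro open_Times) auto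
    show "cdom c d = {q \<in> chart_img (line_chart c). chart_inv (line_chart c) q \<in> UNIV \<times> {1<..} \<and> \<Phi> (chart_inv (line_chart c) q) \<in> chart_dom d}"
      using c by (auto simp: cdom_def Z.line_chart_inv)
  qed auto
  moreover have "chart_map d (\<Phi> (chart_inv (line_chart c) q)) = cmap c d q" if "q \<in> cdom c d" for q
    using that c by (auto simp: cdom_def cmap_def Z.line_chart_inv split_beta)
  ultimately show "open (cdom c d)" "smooth_on (cmap c d) (cdom c d)"
    using smooth_on_cong[of "cdom c d" "\<lambda>q. chart_map d (\<Phi> (chart_inv (line_chart c) q))" "cmap c d"] by auto
qed

lemma
  assumes c: "c \<in> B" and d: "d \<in> A"
  shows open_ndom: "open (ndom c d)" and smooth_nmap: "smooth_on (nmap c d) (ndom c d)"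
proof -
  have lc: "line_chart c \<in> line_product B" using c by (auto simp: line_product_def line_chart_def)
  have "open (ndom c d) \<and> smooth_on (\<lambda>q. chart_map (line_chart c) (\<Psi> (chart_inv d q))) (ndom c d)"
  proof (rule smooth_map_rep[OF X.smooth_manifold_axioms Z.smooth_manifold_line_product \<Psi>_smooth open_cyl_part _ d lc])
    show "cyl_part \<subseteq> - W" by (auto simp: cyl_part_iff)
    show "ndom c d = {x \<in> chart_img d. chart_inv d x \<in> cyl_part \<and> \<Psi> (chart_inv d x) \<in> chart_dom (line_chart c)}"
      by (auto simp: ndom_def mem_Times_iff)
  qed
  then show "open (ndom c d)" "smooth_on (nmap c d) (ndom c d)"
    by (auto simp: nmap_def[abs_def])
qed

lemma nmap_cdom:
  assumes "c \<in> B" "d \<in> A" "y \<in> ndom c d"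
  shows "nmap c d y \<in> cdom c d" "cmap c d (nmap c d y) = y"
proof -
  have p: "chart_inv d y \<in> - W" "1 < snd (\<Psi> (chart_inv d y))" "fst (\<Psi> (chart_inv d y)) \<in> chart_dom c" "y \<in> chart_img d"
    using assms(3) by (auto simp: ndom_def cyl_part_iff)
  show "nmap c d y \<in> cdom c d"
    using p assms(1,2) by (auto simp: nmap_def cdom_def Z.map_img Z.inv_map \<Phi>\<Psi> X.inv_dom)
  show "cmap c d (nmap c d y) = y"
    using p assms(1,2) by (auto simp: nmap_def cmap_def split_beta Z.inv_map \<Phi>\<Psi> X.map_inv)
qed

lemma cmap_ndom:
  assumes "c \<in> B" "d \<in> A" "q \<in> cdom c d"
  shows "cmap c d q \<in> ndom c d" "nmap c d (cmap c d q) = q"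
proof -
  have p: "fst q \<in> chart_img c" "1 < snd q" "\<Phi> (chart_inv c (fst q), snd q) \<in> chart_dom d" using assms(3) by (auto simp: cdom_def)
  have ps: "\<Psi> (\<Phi> (chart_inv c (fst q), snd q)) = (chart_inv c (fst q), snd q)" using p by (intro \<Psi>\<Phi>) simp
  have cp: "\<Phi> (chart_inv c (fst q), snd q) \<in> cyl_part" using p by (auto simp: cyl_part_def)
  show "cmap c d q \<in> ndom c d"
    using p cp assms(1,2) by (simp add: ndom_def cmap_def split_beta X.map_img X.inv_map ps Z.inv_dom)
  show "nmap c d (cmap c d q) = q"
    using p assms(1,2) by (simp add: nmap_def cmap_def split_beta X.inv_map ps Z.map_inv prod_eq_iff)
qed

lemma nmap_at: "d \<in> A \<Longrightarrow> c \<in> B \<Longrightarrow> p \<in> cyl_part \<Longrightarrow> p \<in> chart_dom d \<Longrightarrow> fst (\<Psi> p) \<in> chart_dom c \<Longrightarrow> chart_map d p \<in> ndom c d"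
  by (simp add: ndom_def X.map_img X.inv_map)

lemma nmap_inj: "c \<in> B \<Longrightarrow> d \<in> A \<Longrightarrow> inj_on (nmap c d) (ndom c d)"
  by (metis inj_onI nmap_cdom(2))

lemma nmap_image:
  assumes "c \<in> B" "d \<in> A" "S \<subseteq> ndom c d"
  shows "nmap c d ` S = cdom c d \<inter> cmap c d -` S"
proof (intro equalityI subsetI)
  fix q assume "q \<in> cdom c d \<inter> cmap c d -` S"
  then show "q \<in> nmap c d ` S" using cmap_ndom(2)[OF assms(1,2), of q] by (intro image_eqI[of _ _ "cmap c d q"]) auto
next
  fix q assume "q \<in> nmap c d ` S"
  then obtain y where "y \<in> S" "q = nmap c d y" by blast
  then show "q \<in> cdom c d \<inter> cmap c d -` S" using nmap_cdom[OF assms(1,2), of y] assms(3) by auto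
qed

lemma nmap_image_borel:
  assumes "c \<in> B" "d \<in> A" "S \<subseteq> ndom c d" "S \<in> sets borel"
  shows "nmap c d ` S \<in> sets borel"
  unfolding nmap_image[OF assms(1-3)]
  using measurable_sets[OF borel_measurable_continuous_on_restrict[OF smooth_on_continuous_on[OF smooth_cmap[OF assms(1,2)]]] assms(4)]
    open_cdom[OF assms(1,2)]
  by (simp add: space_restrict_space sets_restrict_space_iff Int_commute)

section \<open>The metric in end coordinates\<close>

lemma nmap_has_derivative:
  "c \<in> B \<Longrightarrow> d \<in> A \<Longrightarrow> y \<in> ndom c d \<Longrightarrow> (nmap c d has_derivative (\<lambda>v. dir_deriv v (nmap c d) y)) (at y)"
  by (rule smooth_on_has_derivative[OF smooth_nmap])

lemma dir_deriv_cmap_nmap: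
  assumes c: "c \<in> B" and d: "d \<in> A" and y: "y \<in> ndom c d"
  shows "dir_deriv (dir_deriv v (nmap c d) y) (cmap c d) (nmap c d y) = v"
proof -
  have "((\<lambda>y. cmap c d (nmap c d y)) has_derivative (\<lambda>v. dir_deriv (dir_deriv v (nmap c d) y) (cmap c d) (nmap c d y))) (at y)"
    by (rule has_derivative_compose[OF nmap_has_derivative[OF assms] smooth_on_has_derivative[OF smooth_cmap[OF c d] nmap_cdom(1)[OF assms]]])
  moreover have "((\<lambda>y. cmap c d (nmap c d y)) has_derivative (\<lambda>v. v)) (at y)"
    by (rule has_derivative_transform_within_open[OF has_derivative_ident open_ndom[OF c d] y]) (use nmap_cdom[OF c d] in auto)
  ultimately show ?thesis by (metis has_derivative_unique)
qed

lemma cyl_cmap: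
  assumes c: "c \<in> B" and d: "d \<in> A" and q: "q \<in> cdom c d"
  shows "g d (cmap c d q) (dir_deriv V (cmap c d) q) (dir_deriv V' (cmap c d) q) = h c (fst q) (fst V) (fst V') + snd V * snd V'"
proof -
  have p: "fst q \<in> chart_img c" "1 \<le> snd q" "\<Phi> (chart_inv c (fst q), snd q) \<in> chart_dom d" using q by (auto simp: cdom_def)
  note * = cyl[OF c d Z.inv_dom[OF c p(1)] p(2,3), unfolded Let_def, folded cmap_def]
  show ?thesis using *[rule_format, of "fst V" "snd V" "fst V'" "snd V'"] by (simp add: Z.map_inv[OF c p(1)])
qed

text \<open>The product condition is stated for the pullback of g by \<Phi>. Inserting the
  directions that the derivative of \<open>cmap\<close> carries back to v and w turns it into a
  formula for g itself.\<close>

lemma metric_nmap: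
  assumes c: "c \<in> B" and d: "d \<in> A" and y: "y \<in> ndom c d"
  shows "g d y v w = h c (fst (nmap c d y)) (fst (dir_deriv v (nmap c d) y)) (fst (dir_deriv w (nmap c d) y))
     + snd (dir_deriv v (nmap c d) y) * snd (dir_deriv w (nmap c d) y)"
  using cyl_cmap[OF c d nmap_cdom(1)[OF assms], of "dir_deriv v (nmap c d) y" "dir_deriv w (nmap c d) y"]
  by (simp add: dir_deriv_cmap_nmap[OF assms] nmap_cdom(2)[OF assms])

subsection \<open>The volume of the end\<close>

text \<open>Indexing the basis of the cylinder's model space by \<open>'n\<close> makes the Jacobian
  of \<open>nmap\<close> a determinant over \<open>'n\<close>. The order of the basis is arbitrary,
  because only the absolute value of that determinant and Gram determinants are used.\<close>

definition cbasis :: "'n \<Rightarrow> (real^'k) \<times> real" where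
  "cbasis = (SOME b. bij_betw b UNIV Basis)"

lemma bij_cbasis: "bij_betw cbasis UNIV Basis"
proof -
  have "card (UNIV :: 'n set) = card (Basis :: ((real^'k) \<times> real) set)" using card_eq by simp
  then have "\<exists>b :: 'n \<Rightarrow> (real^'k) \<times> real. bij_betw b UNIV Basis" by (intro finite_same_card_bij) auto
  then show ?thesis unfolding cbasis_def by (rule someI_ex)
qed

definition jac :: "('z, real^'k) chart \<Rightarrow> ('a, real^'n) chart \<Rightarrow> real^'n \<Rightarrow> real" where
  "jac c d y = \<bar>det (\<chi> i j. dir_deriv (axis j 1) (nmap c d) y \<bullet> cbasis i)\<bar>"

text \<open>g is the pullback of h + dt^2, whose density is that of h by
  \<open>gram_product\<close>; only the Jacobian remains.\<close>

lemma vol_density_nmap: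
  assumes c: "c \<in> B" and d: "d \<in> A" and y: "y \<in> ndom c d"
  shows "vol_density g d y = jac c d y * vol_density h c (fst (nmap c d y))"
proof -
  have x: "fst (nmap c d y) \<in> chart_img c" using nmap_cdom(1)[OF assms] by (simp add: cdom_def)
  note bl = Z.bilinear_metric[OF c x]
  let ?\<gamma> = "\<lambda>v w. h c (fst (nmap c d y)) (fst v) (fst w) + snd v * snd w"
  have bi: "bilinear ?\<gamma>" unfolding bilinear_def
    by (intro conjI allI linearI)
      (auto simp: bilinear_ladd[OF bl] bilinear_radd[OF bl] bilinear_lmul[OF bl] bilinear_rmul[OF bl] algebra_simps)
  have "gram (\<lambda>i. axis i 1) (g d y) = (det (\<chi> i j. dir_deriv (axis j 1) (nmap c d) y \<bullet> cbasis i))\<^sup>2 * gram cbasis ?\<gamma>"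
    by (rule gram_pullback[OF bij_cbasis bi]) (rule metric_nmap[OF assms])
  also have "gram cbasis ?\<gamma> = gram (\<lambda>i. axis i 1) (h c (fst (nmap c d y)))" by (rule gram_product[OF bij_cbasis bl])
  finally show ?thesis by (simp add: vol_density_def jac_def real_sqrt_mult)
qed

text \<open>The Jacobian is nonnegative and is a factor of the positive density of g.\<close>

lemma jac_pos: "c \<in> B \<Longrightarrow> d \<in> A \<Longrightarrow> y \<in> ndom c d \<Longrightarrow> jac c d y > 0"
  using vol_density_nmap[of c d y] X.vol_density_pos[of d y]
  by (auto simp: jac_def ndom_def)

lemma finite_measure_Z: "finite_measure Z.vol" by (rule Z.finite_volume[OF compact_Z])

lemma sets_Z_line [simp, measurable_cong]: "sets (Z.vol \<Otimes>\<^sub>M (lborel :: real measure)) = sets borel"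
proof -
  have "sets (Z.vol \<Otimes>\<^sub>M (lborel :: real measure)) = sets (borel \<Otimes>\<^sub>M (borel :: real measure))"
    by (rule sets_pair_measure_cong[OF Z.sets_vol sets_lborel])
  also have "borel \<Otimes>\<^sub>M (borel :: real measure) = (borel :: ('z \<times> real) measure)" by (rule borel_prod)
  finally show ?thesis .
qed

text \<open>A constant value off the cylinder gives a total Borel function, since \<Phi> is only
  controlled for t >= 0.\<close>

lemma \<Phi>_measurable: "(\<lambda>q. if q \<in> UNIV \<times> {1<..} then \<Phi> q else undefined) \<in> borel_measurable borel"
  by (rule borel_measurable_continuous_on_if) (use cont_\<Phi> in \<open>auto intro!: open_Times borel_open elim: continuous_on_subset\<close>)

text \<open>Within one pair of charts the change of variables \<open>nmap\<close> turns the density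
  of g into that of h, which does not involve t. Integrating slice by slice over t then gives the
  product measure.\<close>

lemma emeasure_end_chart:
  assumes c: "c \<in> B" and d: "d \<in> A" and Q: "Q \<in> sets borel" "Q \<subseteq> cyl_part" "Q \<subseteq> chart_dom d" "\<And>p. p \<in> Q \<Longrightarrow> fst (\<Psi> p) \<in> chart_dom c"
    and P: "P = {q. 1 < snd q \<and> \<Phi> q \<in> Q}" "P \<in> sets borel"
  shows "emeasure X.vol Q = emeasure (Z.vol \<Otimes>\<^sub>M lborel) P"
proof -
  interpret finite_measure Z.vol by (rule finite_measure_Z)
  interpret pair_sigma_finite Z.vol "lborel :: real measure" ..
  define S where "S = chart_map d ` Q"
  have SN: "S \<subseteq> ndom c d" unfolding S_def using Q nmap_at[OF d c] by blast
  have Sb: "S \<in> sets borel" unfolding S_def using Q by (intro X.borel_image[OF d])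
  have TS: "nmap c d ` S \<in> sets borel" by (rule nmap_image_borel[OF c d SN Sb])
  define f where "f = (\<lambda>q :: (real^'k) \<times> real. ennreal (vol_density h c (fst q)) * indicator (chart_img c) (fst q))"
  have f: "f \<in> borel_measurable borel" unfolding f_def
    by (rule measurable_compose[OF _ Z.vol_density_measurable[OF c]])
      (intro borel_measurable_continuous_onI continuous_intros)
  have "emeasure X.vol Q = (\<integral>\<^sup>+y\<in>S. ennreal (vol_density g d y) \<partial>lborel)"
    using X.emeasure_vol[OF d Q(1,3)] by (simp add: X.chart_volume_def S_def)
  also have "\<dots> = (\<integral>\<^sup>+y\<in>S. ennreal (jac c d y) * f (nmap c d y) \<partial>lborel)"
  proof (rule nn_integral_cong)
    fix y
    show "ennreal (vol_density g d y) * indicator S y = ennreal (jac c d y) * f (nmap c d y) * indicator S y"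
    proof (cases "y \<in> S")
      case True
      then have y: "y \<in> ndom c d" using SN by auto
      then have "fst (nmap c d y) \<in> chart_img c" using nmap_cdom(1)[OF c d] by (simp add: cdom_def)
      then show ?thesis using True vol_density_nmap[OF c d y] by (simp add: f_def jac_def ennreal_mult')
    qed simp
  qed
  also have "\<dots> = (\<integral>\<^sup>+q\<in>nmap c d ` S. f q \<partial>lborel)"
    unfolding jac_def
  proof (rule nn_integral_change_of_variables[OF bij_axis bij_cbasis Sb TS _ _ _ f, symmetric])
    show "(nmap c d has_derivative (\<lambda>v. dir_deriv v (nmap c d) y)) (at y within S)" if "y \<in> S" for y
      using nmap_has_derivative[OF c d] SN that by (auto intro: has_derivative_at_withinI)
    show "inj_on (nmap c d) S" by (rule inj_on_subset[OF nmap_inj[OF c d] SN])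
    show "continuous_on S (\<lambda>x. dir_deriv v (nmap c d) x)" for v
      using smooth_on_continuous_on[OF smooth_on_dir_deriv[OF smooth_nmap[OF c d], of v]] SN by (rule continuous_on_subset)
  qed
  also have "\<dots> = (\<integral>\<^sup>+q\<in>nmap c d ` S. f q \<partial>((lborel :: (real^'k) measure) \<Otimes>\<^sub>M (lborel :: real measure)))"
    by (simp add: lborel_prod)
  also have "\<dots> = (\<integral>\<^sup>+t. \<integral>\<^sup>+x. f (x, t) * indicator (nmap c d ` S) (x, t) \<partial>lborel \<partial>lborel)"
  proof (rule lborel_pair.nn_integral_snd[symmetric])
    show "(\<lambda>q. f q * indicator (nmap c d ` S) q) \<in> borel_measurable (lborel \<Otimes>\<^sub>M lborel)"
      using f TS by (simp add: lborel_prod)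
  qed
  also have "\<dots> = (\<integral>\<^sup>+t. emeasure Z.vol ((\<lambda>z. (z, t)) -` P) \<partial>lborel)"
  proof (rule nn_integral_cong)
    fix t :: real
    define R where "R = (\<lambda>z. (z, t)) -` P"
    have Rb: "R \<in> sets borel"
    proof -
      have "(\<lambda>z :: 'z. (z, t)) \<in> borel_measurable borel" by (intro borel_measurable_continuous_onI continuous_intros)
      from measurable_sets[OF this P(2)] show ?thesis by (simp add: R_def)
    qed
    have Rc: "R \<subseteq> chart_dom c"
    proof
      fix z assume "z \<in> R"
      then have "1 < t" "\<Phi> (z, t) \<in> Q" by (auto simp: R_def P)
      then show "z \<in> chart_dom c" using Q(4)[of "\<Phi> (z, t)"] \<Psi>\<Phi>[of "(z, t)"] by simp
    qed
    \<comment> \<open>The slice at height t of the coordinate image is the chart image of the slice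
      R of P; this needs \<Psi> to invert \<Phi> there.\<close>
    have img: "(x, t) \<in> nmap c d ` S \<longleftrightarrow> x \<in> chart_map c ` R" for x
    proof
      assume "(x, t) \<in> nmap c d ` S"
      then obtain p where p: "p \<in> Q" "(x, t) = nmap c d (chart_map d p)" by (auto simp: S_def)
      then have "(x, t) = map_prod (chart_map c) id (\<Psi> p)" using X.inv_map[OF d, of p] Q(3) by (auto simp: nmap_def)
      then have xt: "x = chart_map c (fst (\<Psi> p))" "t = snd (\<Psi> p)" by (auto simp: map_prod_def split_beta)
      have "1 < snd (\<Psi> p)" "\<Phi> (\<Psi> p) = p" using p(1) Q(2) cyl_part_iff \<Phi>\<Psi> by auto
      then have "fst (\<Psi> p) \<in> R" using p(1) by (simp add: R_def P xt(2))
      then show "x \<in> chart_map c ` R" using xt(1) by blast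
    next
      assume "x \<in> chart_map c ` R"
      then obtain z where z: "x = chart_map c z" "1 < t" "\<Phi> (z, t) \<in> Q" by (auto simp: R_def P)
      have "nmap c d (chart_map d (\<Phi> (z, t))) = (x, t)"
        using X.inv_map[OF d, of "\<Phi> (z, t)"] Q(3) z \<Psi>\<Phi>[of "(z, t)"] by (auto simp: nmap_def)
      then show "(x, t) \<in> nmap c d ` S" using z(3) unfolding S_def by (metis image_eqI)
    qed
    have "emeasure Z.vol R = (\<integral>\<^sup>+x\<in>chart_map c ` R. ennreal (vol_density h c x) \<partial>lborel)"
      using Z.emeasure_vol[OF c Rb Rc] by (simp add: Z.chart_volume_def)
    also have "\<dots> = (\<integral>\<^sup>+x. f (x, t) * indicator (nmap c d ` S) (x, t) \<partial>lborel)"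
      using Rc Z.map_img[OF c] by (intro nn_integral_cong) (auto simp: f_def indicator_def img)
    finally show "(\<integral>\<^sup>+x. f (x, t) * indicator (nmap c d ` S) (x, t) \<partial>lborel) = emeasure Z.vol ((\<lambda>z. (z, t)) -` P)"
      by (simp add: R_def)
  qed
  also have "\<dots> = emeasure (Z.vol \<Otimes>\<^sub>M lborel) P"
    by (rule emeasure_pair_measure_alt2[symmetric]) (unfold sets_Z_line, rule P(2))
  finally show ?thesis .
qed

text \<open>The identity of the chart pairs, patched over a countable cover. Writing it as an
  equality of measures yields the transfer of integrability and of integrals at once.\<close>

lemma end_measure_eq:
  "density X.vol (indicator cyl_part) =
   distr (density (Z.vol \<Otimes>\<^sub>M lborel) (indicator (UNIV \<times> {1<..}))) borel (\<lambda>q. if q \<in> UNIV \<times> {1<..} then \<Phi> q else undefined)"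
  (is "?M1 = ?M2")
proof -
  obtain C where C: "\<And>i :: nat. C i \<in> A" "(\<Union>i. chart_dom (C i)) = UNIV" using X.ex_countable_cover by blast
  obtain D where D: "\<And>i :: nat. D i \<in> B" "(\<Union>i. chart_dom (D i)) = UNIV" using Z.ex_countable_cover by blast
  have cp[measurable]: "cyl_part \<in> sets borel" using open_cyl_part by simp
  have ub[measurable]: "UNIV \<times> {1<..} \<in> sets (borel :: ('z \<times> real) measure)" by (auto intro!: open_Times borel_open)
  let ?\<Phi> = "\<lambda>q. if q \<in> UNIV \<times> {1<..} then \<Phi> q else undefined"
  define V where "V = (\<lambda>i j. cyl_part \<inter> chart_dom (C i) \<inter> \<Psi> -` (chart_dom (D j) \<times> UNIV))"
  have oV: "open (V i j)" for i j
  proof -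
    have "open (cyl_part \<inter> \<Psi> -` (chart_dom (D j) \<times> UNIV))"
      by (rule continuous_open_preimage[OF continuous_on_subset[OF cont_\<Psi>] open_cyl_part])
        (use Z.open_dom[OF D(1)] in \<open>auto simp: cyl_part_iff intro!: open_Times\<close>)
    moreover have "V i j = (cyl_part \<inter> \<Psi> -` (chart_dom (D j) \<times> UNIV)) \<inter> chart_dom (C i)" by (auto simp: V_def)
    ultimately show ?thesis using X.open_dom[OF C(1)] by (simp add: open_Int)
  qed
  \<comment> \<open>Index 0 is the complement of the cylinder, where both measures vanish; the other
    indices enumerate all pairs of charts of X and Z.\<close>
  define U where "U = (\<lambda>n. case n of 0 \<Rightarrow> - cyl_part | Suc m \<Rightarrow> case prod_decode m of (i, j) \<Rightarrow> V i j)"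
  have em1: "emeasure ?M1 E = emeasure X.vol (E \<inter> cyl_part)" if "E \<in> sets borel" for E
    using that by (subst emeasure_density) (auto simp: indicator_inter_arith[symmetric] Int_commute)
  have em2: "emeasure ?M2 E = emeasure (Z.vol \<Otimes>\<^sub>M lborel) {q. 1 < snd q \<and> \<Phi> q \<in> E}"
    and bP: "{q. 1 < snd q \<and> \<Phi> q \<in> E} \<in> sets borel" if E: "E \<in> sets borel" for E
  proof -
    have pre: "?\<Phi> -` E \<in> sets borel" using measurable_sets[OF \<Phi>_measurable E] by simp
    have eq: "(?\<Phi> -` E) \<inter> (UNIV \<times> {1<..}) = {q. 1 < snd q \<and> \<Phi> q \<in> E}" by (auto simp: mem_Times_iff)
    have "(?\<Phi> -` E) \<inter> (UNIV \<times> {1<..}) \<in> sets borel" using pre ub by (rule sets.Int)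
    then show "{q. 1 < snd q \<and> \<Phi> q \<in> E} \<in> sets borel" by (simp only: eq)
    have "emeasure ?M2 E = emeasure (density (Z.vol \<Otimes>\<^sub>M lborel) (indicator (UNIV \<times> {1<..}))) (?\<Phi> -` E)"
    proof (subst emeasure_distr[OF _ E])
      show "?\<Phi> \<in> measurable (density (Z.vol \<Otimes>\<^sub>M lborel) (indicator (UNIV \<times> {1<..}))) borel"
        unfolding measurable_cong_sets[OF trans[OF sets_density sets_Z_line] refl] by (rule \<Phi>_measurable)
    qed (simp add: space_pair_measure)
    also have "\<dots> = emeasure (Z.vol \<Otimes>\<^sub>M lborel) ((?\<Phi> -` E) \<inter> (UNIV \<times> {1<..}))"
      unfolding Int_commute[of "?\<Phi> -` E"] by (rule emeasure_restricted; unfold sets_Z_line; fact)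
    finally show "emeasure ?M2 E = emeasure (Z.vol \<Otimes>\<^sub>M lborel) {q. 1 < snd q \<and> \<Phi> q \<in> E}" by (simp only: eq)
  qed
  show ?thesis
  proof (rule measure_eqI_cover[where U = U])
    show "sets ?M1 = sets ?M2" by simp
    show "U n \<in> sets ?M1" for n using oV cp by (auto simp: U_def split: nat.split prod.split)
    show "(\<Union>n. U n) = space ?M1"
    proof -
      have "\<exists>n. p \<in> U n" for p
      proof (cases "p \<in> cyl_part")
        case True
        obtain i where "p \<in> chart_dom (C i)" using C(2) by blast
        moreover obtain j where "fst (\<Psi> p) \<in> chart_dom (D j)" using D(2) by blast
        ultimately have "p \<in> V i j" using True by (simp add: V_def mem_Times_iff)
        then show ?thesis by (intro exI[of _ "Suc (prod_encode (i, j))"]) (simp add: U_def)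
      next
        case False then show ?thesis by (intro exI[of _ 0]) (simp add: U_def)
      qed
      then show ?thesis by auto
    qed
  next
    fix n E assume "E \<in> sets ?M1" "E \<subseteq> U n"
    then have E: "E \<in> sets borel" by simp
    show "emeasure ?M1 E = emeasure ?M2 E"
    proof (cases n)
      case 0
      then have "E \<inter> cyl_part = {}" using \<open>E \<subseteq> U n\<close> by (auto simp: U_def)
      moreover have "{q. 1 < snd q \<and> \<Phi> q \<in> E} = {}" using calculation by (force simp: cyl_part_def)
      ultimately show ?thesis unfolding em1[OF E] em2[OF E] by (simp only: emeasure_empty)
    next
      case (Suc m)
      obtain i j where "prod_decode m = (i, j)" by fastforce
      then have EV: "E \<subseteq> V i j" using \<open>E \<subseteq> U n\<close> Suc by (simp add: U_def)
      then have "E \<inter> cyl_part = E" by (auto simp: V_def)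
      then have "emeasure ?M1 E = emeasure X.vol E" using em1[OF E] by simp
      also have "\<dots> = emeasure (Z.vol \<Otimes>\<^sub>M lborel) {q. 1 < snd q \<and> \<Phi> q \<in> E}"
      proof (rule emeasure_end_chart[OF D(1)[of j] C(1)[of i] E])
        show "fst (\<Psi> p) \<in> chart_dom (D j)" if "p \<in> E" for p using EV that by (auto simp: V_def)
        show "E \<subseteq> cyl_part" "E \<subseteq> chart_dom (C i)" using EV by (auto simp: V_def)
      qed (use bP[OF E] in auto)
      finally show ?thesis using em2[OF E] by simp
    qed
  qed
qed

end

section \<open>Curvature\<close>

lemma linear_expand:
  fixes L :: "'e::euclidean_space \<Rightarrow> 'f::real_vector"
  assumes "linear L"
  shows "L v = (\<Sum>i\<in>Basis. (v \<bullet> i) *\<^sub>R L i)"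
proof -
  have "L (\<Sum>i\<in>Basis. (v \<bullet> i) *\<^sub>R i) = (\<Sum>i\<in>Basis. (v \<bullet> i) *\<^sub>R L i)"
    by (simp add: linear_sum[OF assms] linear_scale[OF assms])
  then show ?thesis by (simp add: euclidean_representation)
qed

subsection \<open>The musical isomorphism\<close>

definition inner_form :: "('e::euclidean_space \<Rightarrow> 'e \<Rightarrow> real) \<Rightarrow> bool" where
  "inner_form b \<longleftrightarrow> bilinear b \<and> (\<forall>v. v \<noteq> 0 \<longrightarrow> 0 < b v v)"

lemma inner_form_eqI:
  assumes "inner_form b" "\<And>w. b v w = b v' w" shows "v = v'"
proof (rule ccontr)
  assume "v \<noteq> v'"
  then have "0 < b (v - v') (v - v')" using assms(1) by (simp add: inner_form_def)
  moreover have "b (v - v') (v - v') = b v (v - v') - b v' (v - v')"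
    using assms(1) by (simp add: inner_form_def bilinear_lsub)
  ultimately show False using assms(2) by simp
qed

text \<open>Positivity makes v \<mapsto> b v injective, hence surjective onto the linear forms in
  finite dimension. So the definite description in \<open>sharp\<close> denotes.\<close>

lemma inner_form_sharp:
  assumes "inner_form b" shows "b (sharp b a) w = a \<bullet> w"
proof -
  have bl: "bilinear b" using assms by (simp add: inner_form_def)
  define L where "L = (\<lambda>v. \<Sum>i\<in>Basis. b v i *\<^sub>R i)"
  have L: "linear L"
    by (rule linearI)
      (simp_all add: L_def bilinear_ladd[OF bl] bilinear_lmul[OF bl] algebra_simps sum.distrib scaleR_sum_right)
  have Lw: "L v \<bullet> w = b v w" for v w
  proof -
    have "linear (b v)" using bl by (simp add: bilinear_def)
    then show ?thesis using linear_expand[of "b v" w] by (simp add: L_def inner_sum_left inner_commute[of w] mult.commute)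
  qed
  have "inj L"
  proof (rule injI)
    fix v v' assume "L v = L v'"
    then have "b v w = b v' w" for w using Lw by metis
    then show "v = v'" by (rule inner_form_eqI[OF assms])
  qed
  then have "surj L" by (rule linear_injective_imp_surjective[OF L]) simp
  then obtain v where v: "L v = a" by (metis surjD)
  have "\<forall>w. b (sharp b a) w = a \<bullet> w" unfolding sharp_def
  proof (rule theI)
    show "\<forall>w. b v w = a \<bullet> w" using Lw v by metis
    show "v' = v" if "\<forall>w. b v' w = a \<bullet> w" for v'
      using inner_form_eqI[OF assms, of v' v] that Lw v by metis
  qed
  then show ?thesis by blast
qed

lemma sharp_eqI:
  assumes "inner_form b" "\<And>w. b v w = a \<bullet> w" shows "sharp b a = v"
  by (rule inner_form_eqI[OF assms(1)]) (simp add: inner_form_sharp[OF assms(1)] assms(2))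

lemma linear_sharp:
  assumes "inner_form b" shows "linear (sharp b)"
proof -
  have bl: "bilinear b" using assms by (simp add: inner_form_def)
  show ?thesis
    by (rule linearI; rule sharp_eqI[OF assms])
      (simp_all add: bilinear_ladd[OF bl] bilinear_lmul[OF bl] inner_form_sharp[OF assms] inner_add_left)
qed

text \<open>Raising an index commutes with linear isometries. It is used with D the derivative of a
  coordinate change, both for scalar curvature and for the norm of a covector.\<close>

lemma sharp_pullback:
  assumes b: "inner_form b" and b': "inner_form b'" and D: "surj D"
    and eq: "\<And>v w. b v w = b' (D v) (D w)" and a: "\<And>v. a \<bullet> v = a' \<bullet> D v"
  shows "D (sharp b a) = sharp b' a'" "a \<bullet> sharp b a = a' \<bullet> sharp b' a'"
proof -
  show 1: "D (sharp b a) = sharp b' a'"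
  proof (rule sharp_eqI[OF b', symmetric])
    fix w obtain v where "w = D v" using D by (metis surjD)
    then show "b' (D (sharp b a)) w = a' \<bullet> w" using eq[of "sharp b a" v] inner_form_sharp[OF b] a by simp
  qed
  show "a \<bullet> sharp b a = a' \<bullet> sharp b' a'" by (simp add: a 1)
qed

subsection \<open>Products of families of bilinear maps with vector fields\<close>

text \<open>The product rule at a zero of the second factor, where mere continuity of c suffices.
  For \<open>sharp\<close> the coefficient is the very function whose differentiability is in
  question.\<close>

lemma has_derivative_mult_vanishing:
  fixes G :: "'e::real_normed_vector \<Rightarrow> real"
  assumes G: "(G has_derivative G') (at x)" and c: "isCont c x"
  shows "((\<lambda>y. c y * (G y - G x)) has_derivative (\<lambda>v. c x * G' v)) (at x)"
proof -
  have bG: "bounded_linear G'" using G by (rule has_derivative_bounded_linear)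
  obtain K where K: "\<And>v. norm (G' v) \<le> norm v * K" using bounded_linear.bounded[OF bG] by blast
  have q: "((\<lambda>y. norm (G y - G x - G' (y - x)) / norm (y - x)) \<longlongrightarrow> 0) (at x)"
    using G by (simp add: has_derivative_iff_norm)
  have "((\<lambda>y. \<bar>c y\<bar> * (norm (G y - G x - G' (y - x)) / norm (y - x)) + \<bar>c y - c x\<bar> * \<bar>K\<bar>) \<longlongrightarrow> \<bar>c x\<bar> * 0 + \<bar>c x - c x\<bar> * \<bar>K\<bar>) (at x)"
    using c q by (intro tendsto_intros) (auto simp: isCont_def)
  then have lim: "((\<lambda>y. \<bar>c y\<bar> * (norm (G y - G x - G' (y - x)) / norm (y - x)) + \<bar>c y - c x\<bar> * \<bar>K\<bar>) \<longlongrightarrow> 0) (at x)" by simp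
  have "((\<lambda>y. norm (c y * (G y - G x) - c x * (G x - G x) - c x * G' (y - x)) / norm (y - x)) \<longlongrightarrow> 0) (at x)"
  proof (rule tendsto_sandwich[OF _ _ tendsto_const lim])
    show "\<forall>\<^sub>F y in at x. norm (c y * (G y - G x) - c x * (G x - G x) - c x * G' (y - x)) / norm (y - x)
      \<le> \<bar>c y\<bar> * (norm (G y - G x - G' (y - x)) / norm (y - x)) + \<bar>c y - c x\<bar> * \<bar>K\<bar>"
      unfolding eventually_at
    proof (intro exI[of _ 1] conjI ballI impI)
      fix y assume "y \<noteq> x \<and> dist y x < 1"
      then have n: "norm (y - x) > 0" by simp
      have "c y * (G y - G x) - c x * (G x - G x) - c x * G' (y - x) = c y * (G y - G x - G' (y - x)) + (c y - c x) * G' (y - x)"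
        by (simp add: algebra_simps)
      also have "norm \<dots> \<le> \<bar>c y\<bar> * norm (G y - G x - G' (y - x)) + \<bar>c y - c x\<bar> * norm (G' (y - x))"
        by (rule order_trans[OF norm_triangle_ineq]) (simp add: abs_mult)
      also have "\<dots> \<le> \<bar>c y\<bar> * norm (G y - G x - G' (y - x)) + \<bar>c y - c x\<bar> * (norm (y - x) * \<bar>K\<bar>)"
        using order_trans[OF K[of "y - x"] mult_left_mono[OF abs_ge_self norm_ge_zero]] by (intro add_left_mono mult_left_mono) auto
      finally show "norm (c y * (G y - G x) - c x * (G x - G x) - c x * G' (y - x)) / norm (y - x)
        \<le> \<bar>c y\<bar> * (norm (G y - G x - G' (y - x)) / norm (y - x)) + \<bar>c y - c x\<bar> * \<bar>K\<bar>"
        using n by (simp add: divide_le_eq distrib_right) (simp add: ac_simps)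
    qed auto
  qed auto
  then show ?thesis
    using bounded_linear_mult_right[of "c x", THEN bounded_linear_compose, OF bG]
    by (simp add: has_derivative_iff_norm)
qed

lemma bilinear_basis_expand:
  fixes b :: "'e::euclidean_space \<Rightarrow> 'f::euclidean_space \<Rightarrow> 'h::real_vector"
  assumes "bilinear b"
  shows "b v w = (\<Sum>i\<in>Basis. \<Sum>j\<in>Basis. ((v \<bullet> i) * (w \<bullet> j)) *\<^sub>R b i j)"
proof -
  have l: "linear (\<lambda>v. b v w)" "linear (b v)" for v w using assms by (auto simp: bilinear_def)
  have "b v w = (\<Sum>i\<in>Basis. (v \<bullet> i) *\<^sub>R b i w)" by (rule linear_expand[OF l(1)])
  also have "\<dots> = (\<Sum>i\<in>Basis. (v \<bullet> i) *\<^sub>R (\<Sum>j\<in>Basis. (w \<bullet> j) *\<^sub>R b i j))"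
    by (intro sum.cong refl arg_cong[where f = "\<lambda>z. _ *\<^sub>R z"] linear_expand[OF l(2)])
  finally show ?thesis by (simp add: scaleR_sum_right)
qed

text \<open>A product rule with three factors: base point and both arguments vary. Only the entries
  for fixed vectors are known to be differentiable, hence the expansion in bases.\<close>

lemma has_derivative_bilinear_family:
  fixes b :: "'f::euclidean_space \<Rightarrow> 'p::euclidean_space \<Rightarrow> 'q::euclidean_space \<Rightarrow> 'h::real_normed_vector"
    and G :: "'e::euclidean_space \<Rightarrow> 'f"
  assumes V: "open V" "G x \<in> V" and bl: "\<And>q. q \<in> V \<Longrightarrow> bilinear (b q)"
    and db: "\<And>i j. (\<lambda>q. b q i j) differentiable (at (G x))"
    and G: "(G has_derivative G') (at x)" and P: "(P has_derivative P') (at x)" and Q: "(Q has_derivative Q') (at x)"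
  shows "((\<lambda>y. b (G y) (P y) (Q y)) has_derivative
     (\<lambda>v. dir_deriv (G' v) (\<lambda>q. b q (P x) (Q x)) (G x) + b (G x) (P' v) (Q x) + b (G x) (P x) (Q' v))) (at x)"
proof -
  have bx: "bilinear (b (G x))" using bl V by blast
  have d: "((\<lambda>q. b q i j) has_derivative (\<lambda>v. dir_deriv v (\<lambda>q. b q i j) (G x))) (at (G x))" for i j
    by (rule has_derivative_dir_deriv[OF db])
  have s: "((\<lambda>q. \<Sum>i\<in>Basis. \<Sum>j\<in>Basis. (a i * c j) *\<^sub>R b q i j) has_derivative
     (\<lambda>v. \<Sum>i\<in>Basis. \<Sum>j\<in>Basis. (a i * c j) *\<^sub>R dir_deriv v (\<lambda>q. b q i j) (G x))) (at (G x))" for a c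
    by (intro has_derivative_sum has_derivative_scaleR_right d)
  have dPQ: "dir_deriv v (\<lambda>q. b q p q') (G x) = (\<Sum>i\<in>Basis. \<Sum>j\<in>Basis. ((p \<bullet> i) * (q' \<bullet> j)) *\<^sub>R dir_deriv v (\<lambda>q. b q i j) (G x))" for v p q'
  proof (rule dir_deriv_eq)
    show "((\<lambda>q. b q p q') has_derivative (\<lambda>v. \<Sum>i\<in>Basis. \<Sum>j\<in>Basis. ((p \<bullet> i) * (q' \<bullet> j)) *\<^sub>R dir_deriv v (\<lambda>q. b q i j) (G x))) (at (G x))"
      by (rule has_derivative_transform_within_open[OF s V]) (rule bilinear_basis_expand[OF bl, symmetric])
  qed
  have "((\<lambda>y. \<Sum>i\<in>Basis. \<Sum>j\<in>Basis. ((P y \<bullet> i) * (Q y \<bullet> j)) *\<^sub>R b (G y) i j) has_derivative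
     (\<lambda>v. \<Sum>i\<in>Basis. \<Sum>j\<in>Basis. ((P x \<bullet> i) * (Q x \<bullet> j)) *\<^sub>R dir_deriv (G' v) (\<lambda>q. b q i j) (G x)
        + ((P x \<bullet> i) * (Q' v \<bullet> j) + (P' v \<bullet> i) * (Q x \<bullet> j)) *\<^sub>R b (G x) i j)) (at x)"
    by (intro has_derivative_sum has_derivative_scaleR has_derivative_mult has_derivative_inner_left P Q
        has_derivative_compose[OF G d])
  then have "((\<lambda>y. \<Sum>i\<in>Basis. \<Sum>j\<in>Basis. ((P y \<bullet> i) * (Q y \<bullet> j)) *\<^sub>R b (G y) i j) has_derivative
     (\<lambda>v. dir_deriv (G' v) (\<lambda>q. b q (P x) (Q x)) (G x) + b (G x) (P' v) (Q x) + b (G x) (P x) (Q' v))) (at x)"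
    by (rule has_derivative_eq_rhs)
      (simp add: dPQ[of _ "P x" "Q x"] bilinear_basis_expand[OF bx, of "P' _" "Q x"] bilinear_basis_expand[OF bx, of "P x" "Q' _"]
        sum.distrib scaleR_left_distrib ac_simps)
  moreover have "\<exists>N. open N \<and> x \<in> N \<and> (\<forall>y\<in>N. G y \<in> V)"
  proof -
    have "isCont G x" using G by (rule has_derivative_continuous)
    then show ?thesis using V continuous_at_open[of x G] by blast
  qed
  then obtain N where "open N" "x \<in> N" "\<forall>y\<in>N. G y \<in> V" by blast
  ultimately show ?thesis
    by (elim has_derivative_transform_within_open[of _ _ x UNIV N]) (auto intro!: bilinear_basis_expand[OF bl, symmetric])
qed

lemma dir_deriv_bilinear_family:
  fixes b :: "'f::euclidean_space \<Rightarrow> 'p::euclidean_space \<Rightarrow> 'q::euclidean_space \<Rightarrow> 'h::real_normed_vector"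
    and G :: "'e::euclidean_space \<Rightarrow> 'f"
  assumes "open V" "G x \<in> V" "\<And>q. q \<in> V \<Longrightarrow> bilinear (b q)" "\<And>i j. (\<lambda>q. b q i j) differentiable (at (G x))"
    "G differentiable (at x)" "P differentiable (at x)" "Q differentiable (at x)"
  shows "dir_deriv v (\<lambda>y. b (G y) (P y) (Q y)) x =
     dir_deriv (dir_deriv v G x) (\<lambda>q. b q (P x) (Q x)) (G x) + b (G x) (dir_deriv v P x) (Q x) + b (G x) (P x) (dir_deriv v Q x)"
  by (rule dir_deriv_eq, rule has_derivative_bilinear_family[where V=V and G=G and P=P and Q=Q])
    (use assms in \<open>auto intro: has_derivative_dir_deriv\<close>)

subsection \<open>Metrics on open sets\<close>

locale local_metric =
  fixes U :: "'e::euclidean_space set" and \<gamma> :: "'e \<Rightarrow> 'e \<Rightarrow> 'e \<Rightarrow> real"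
  assumes open_U: "open U" and bil: "x \<in> U \<Longrightarrow> bilinear (\<gamma> x)" and sym: "x \<in> U \<Longrightarrow> \<gamma> x v w = \<gamma> x w v"
    and pos: "x \<in> U \<Longrightarrow> v \<noteq> 0 \<Longrightarrow> 0 < \<gamma> x v v" and smooth: "smooth_on (\<lambda>x. \<gamma> x v w) U"
begin

lemma form: "x \<in> U \<Longrightarrow> inner_form (\<gamma> x)"
  using bil pos by (simp add: inner_form_def)

lemma diff_metric: "x \<in> U \<Longrightarrow> (\<lambda>y. \<gamma> y v w) differentiable (at x)"
  by (rule smooth_on_differentiable[OF smooth])

text \<open>The resolvent identity for inverse matrices, \<open>H' = H - H (G' - G) H'\<close> with
  H and H' the inverses of the matrices G at x and G' at y. It yields continuity and
  differentiability of the inverse metric without determinants.\<close>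

lemma sharp_difference:
  assumes "x \<in> U" "y \<in> U"
  shows "sharp (\<gamma> y) a = sharp (\<gamma> x) a - (\<Sum>j\<in>Basis. \<Sum>i\<in>Basis. ((sharp (\<gamma> y) a \<bullet> j) * (\<gamma> y j i - \<gamma> x j i)) *\<^sub>R sharp (\<gamma> x) i)"
proof (rule inner_form_eqI[OF form[OF assms(1)]])
  fix w
  define s where "s = sharp (\<gamma> y) a"
  note bx = bil[OF assms(1)]
  have ls: "linear (\<lambda>v. \<gamma> x v w)" using bx by (simp add: bilinear_def)
  have exp: "\<gamma> z s w = (\<Sum>j\<in>Basis. \<Sum>i\<in>Basis. ((s \<bullet> j) * (w \<bullet> i)) * \<gamma> z j i)" if "z \<in> U" for z
    using bilinear_basis_expand[OF bil[OF that], of s w] by simp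
  have "\<gamma> x (\<Sum>j\<in>Basis. \<Sum>i\<in>Basis. ((s \<bullet> j) * (\<gamma> y j i - \<gamma> x j i)) *\<^sub>R sharp (\<gamma> x) i) w
     = (\<Sum>j\<in>Basis. \<Sum>i\<in>Basis. ((s \<bullet> j) * (\<gamma> y j i - \<gamma> x j i)) * (i \<bullet> w))"
    by (simp add: linear_sum[OF ls] linear_scale[OF ls] inner_form_sharp[OF form[OF assms(1)]])
  also have "\<dots> = \<gamma> y s w - \<gamma> x s w"
    unfolding exp[OF assms(1)] exp[OF assms(2)]
    by (simp add: sum_subtractf[symmetric] algebra_simps inner_commute)
  also have "\<gamma> y s w = a \<bullet> w" unfolding s_def by (rule inner_form_sharp[OF form[OF assms(2)]])
  finally show "\<gamma> x (sharp (\<gamma> y) a) w = \<gamma> x (sharp (\<gamma> x) a - (\<Sum>j\<in>Basis. \<Sum>i\<in>Basis. ((sharp (\<gamma> y) a \<bullet> j) * (\<gamma> y j i - \<gamma> x j i)) *\<^sub>R sharp (\<gamma> x) i)) w"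
    by (simp add: bilinear_lsub[OF bx] inner_form_sharp[OF form[OF assms(1)]] s_def)
qed

text \<open>The identity bounds the difference by the norm of the unknown value at y times a factor
  tending to zero. Once that factor is below 1/2, absorption bounds the value at y by twice the
  value at x.\<close>

lemma isCont_sharp:
  assumes "x \<in> U" shows "isCont (\<lambda>y. sharp (\<gamma> y) a) x"
proof -
  define \<delta> where "\<delta> = (\<lambda>y. \<Sum>j\<in>Basis. \<Sum>i\<in>Basis. \<bar>\<gamma> y j i - \<gamma> x j i\<bar> * norm (sharp (\<gamma> x) i))"
  have "((\<lambda>y. \<gamma> y j i) \<longlongrightarrow> \<gamma> x j i) (at x)" for j i
    using differentiable_imp_continuous_within[OF diff_metric[OF assms]] by (simp add: isCont_def)
  then have "(\<delta> \<longlongrightarrow> (\<Sum>j\<in>(Basis :: 'e set). \<Sum>i\<in>(Basis :: 'e set). \<bar>\<gamma> x j i - \<gamma> x j i\<bar> * norm (sharp (\<gamma> x) i))) (at x)"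
    unfolding \<delta>_def by (intro tendsto_intros)
  then have \<delta>0: "(\<delta> \<longlongrightarrow> 0) (at x)" by simp
  have b: "norm (sharp (\<gamma> y) a - sharp (\<gamma> x) a) \<le> norm (sharp (\<gamma> y) a) * \<delta> y" if "y \<in> U" for y
  proof -
    define S where "S = (\<Sum>j\<in>Basis. \<Sum>i\<in>Basis. ((sharp (\<gamma> y) a \<bullet> j) * (\<gamma> y j i - \<gamma> x j i)) *\<^sub>R sharp (\<gamma> x) i)"
    have "sharp (\<gamma> y) a = sharp (\<gamma> x) a - S" unfolding S_def by (rule sharp_difference[OF assms that])
    then have "sharp (\<gamma> y) a - sharp (\<gamma> x) a = - S" by simp
    then have "norm (sharp (\<gamma> y) a - sharp (\<gamma> x) a) = norm (\<Sum>j\<in>Basis. \<Sum>i\<in>Basis. ((sharp (\<gamma> y) a \<bullet> j) * (\<gamma> y j i - \<gamma> x j i)) *\<^sub>R sharp (\<gamma> x) i)"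
      by (simp only: norm_minus_cancel S_def)
    also have "\<dots> \<le> (\<Sum>j\<in>Basis. \<Sum>i\<in>Basis. norm (((sharp (\<gamma> y) a \<bullet> j) * (\<gamma> y j i - \<gamma> x j i)) *\<^sub>R sharp (\<gamma> x) i))"
      by (intro order_trans[OF norm_sum] sum_mono norm_sum)
    also have "\<dots> \<le> (\<Sum>j\<in>Basis. \<Sum>i\<in>Basis. norm (sharp (\<gamma> y) a) * (\<bar>\<gamma> y j i - \<gamma> x j i\<bar> * norm (sharp (\<gamma> x) i)))"
      by (intro sum_mono) (auto simp: abs_mult mult.assoc intro!: mult_right_mono Basis_le_norm)
    also have "\<dots> = norm (sharp (\<gamma> y) a) * \<delta> y" by (simp add: \<delta>_def sum_distrib_left)
    finally show ?thesis .
  qed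
  have ev: "\<forall>\<^sub>F y in at x. y \<in> U \<and> \<delta> y < 1/2"
  proof (rule eventually_conj)
    show "\<forall>\<^sub>F y in at x. y \<in> U" using open_U assms by (rule eventually_at_in_open')
    show "\<forall>\<^sub>F y in at x. \<delta> y < 1/2" using \<delta>0 by (rule order_tendstoD) simp
  qed
  have "((\<lambda>y. sharp (\<gamma> y) a - sharp (\<gamma> x) a) \<longlongrightarrow> 0) (at x)"
  proof (rule tendsto_norm_zero_cancel, rule tendsto_sandwich[OF _ _ tendsto_const])
    show "\<forall>\<^sub>F y in at x. norm (sharp (\<gamma> y) a - sharp (\<gamma> x) a) \<le> 2 * norm (sharp (\<gamma> x) a) * \<delta> y"
      using ev
    proof eventually_elim
      case (elim y)
      have d0: "\<delta> y \<ge> 0" unfolding \<delta>_def by (intro sum_nonneg mult_nonneg_nonneg) auto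
      have "norm (sharp (\<gamma> y) a) \<le> norm (sharp (\<gamma> x) a) + norm (sharp (\<gamma> y) a - sharp (\<gamma> x) a)"
        by (metis add.commute norm_triangle_sub)
      also have "\<dots> \<le> norm (sharp (\<gamma> x) a) + norm (sharp (\<gamma> y) a) * (1/2)"
        using b[of y] elim mult_left_mono[of "\<delta> y" "1/2" "norm (sharp (\<gamma> y) a)"] by simp
      finally have "norm (sharp (\<gamma> y) a) \<le> 2 * norm (sharp (\<gamma> x) a)" by simp
      then show ?case using b[of y] elim mult_right_mono[OF _ d0] order_trans by blast
    qed
    show "((\<lambda>y. 2 * norm (sharp (\<gamma> x) a) * \<delta> y) \<longlongrightarrow> 0) (at x)" using tendsto_mult_right_zero[OF \<delta>0] .
  qed auto
  then show ?thesis by (simp add: isCont_def LIM_zero_iff)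
qed

lemma has_derivative_sharp:
  assumes "x \<in> U"
  shows "((\<lambda>y. sharp (\<gamma> y) a) has_derivative
     (\<lambda>v. - (\<Sum>j\<in>Basis. \<Sum>i\<in>Basis. ((sharp (\<gamma> x) a \<bullet> j) * dir_deriv v (\<lambda>y. \<gamma> y j i) x) *\<^sub>R sharp (\<gamma> x) i))) (at x)"
proof -
  have c: "isCont (\<lambda>y. sharp (\<gamma> y) a \<bullet> j) x" for j
    by (intro isCont_inner isCont_sharp[OF assms]) simp
  have "((\<lambda>y. sharp (\<gamma> x) a - (\<Sum>j\<in>Basis. \<Sum>i\<in>Basis. ((sharp (\<gamma> y) a \<bullet> j) * (\<gamma> y j i - \<gamma> x j i)) *\<^sub>R sharp (\<gamma> x) i)) has_derivative
     (\<lambda>v. 0 - (\<Sum>j\<in>Basis. \<Sum>i\<in>Basis. ((sharp (\<gamma> x) a \<bullet> j) * dir_deriv v (\<lambda>y. \<gamma> y j i) x) *\<^sub>R sharp (\<gamma> x) i))) (at x)"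
    by (intro has_derivative_diff has_derivative_const has_derivative_sum has_derivative_scaleR_left
        has_derivative_mult_vanishing has_derivative_dir_deriv diff_metric assms c)
  then have "((\<lambda>y. sharp (\<gamma> x) a - (\<Sum>j\<in>Basis. \<Sum>i\<in>Basis. ((sharp (\<gamma> y) a \<bullet> j) * (\<gamma> y j i - \<gamma> x j i)) *\<^sub>R sharp (\<gamma> x) i)) has_derivative
     (\<lambda>v. - (\<Sum>j\<in>Basis. \<Sum>i\<in>Basis. ((sharp (\<gamma> x) a \<bullet> j) * dir_deriv v (\<lambda>y. \<gamma> y j i) x) *\<^sub>R sharp (\<gamma> x) i))) (at x)" by simp
  then show ?thesis
    by (rule has_derivative_transform_within_open[OF _ open_U assms]) (rule sharp_difference[OF assms, symmetric])
qed

text \<open>Bootstrapping: the derivative is a polynomial in \<open>sharp\<close> itself and the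
  derivatives of the metric, so class C^k gives class C^(k+1).\<close>

lemma smooth_sharp: "smooth_on (\<lambda>x. sharp (\<gamma> x) a) U"
proof -
  have "Ck_on k (\<lambda>x. sharp (\<gamma> x) a) U" for k
  proof (induction k arbitrary: a)
    case 0
    show ?case using isCont_sharp by (auto intro: continuous_at_imp_continuous_on)
  next
    case (Suc k)
    have "Ck_on k (dir_deriv v (\<lambda>x. sharp (\<gamma> x) a)) U" for v
    proof (rule Ck_on_cong[OF open_U])
      show "Ck_on k (\<lambda>x. \<Sum>j\<in>Basis. \<Sum>i\<in>Basis. (- (sharp (\<gamma> x) a \<bullet> j) * dir_deriv v (\<lambda>y. \<gamma> y j i) x) *\<^sub>R sharp (\<gamma> x) i) U"
        by (intro Ck_on_sum open_U Ck_on_bilinear[OF bounded_bilinear_scaleR] Ck_on_bilinear[OF bounded_bilinear_mult]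
            Ck_on_bounded_linear[OF bounded_linear_minus[OF bounded_linear_ident]]
            Ck_on_bilinear[OF bounded_bilinear_inner] Suc Ck_on_const smooth_on_Ck[OF smooth_on_dir_deriv[OF smooth]])
      show "(\<Sum>j\<in>Basis. \<Sum>i\<in>Basis. (- (sharp (\<gamma> x) a \<bullet> j) * dir_deriv v (\<lambda>y. \<gamma> y j i) x) *\<^sub>R sharp (\<gamma> x) i) = dir_deriv v (\<lambda>x. sharp (\<gamma> x) a) x"
        if "x \<in> U" for x
        unfolding dir_deriv_eq[OF has_derivative_sharp[OF that]] by (simp add: sum_negf)
    qed
    then show ?case using has_derivative_sharp by (auto simp: differentiable_def)
  qed
  then show ?thesis by (simp add: smooth_on_def)
qed

section \<open>Christoffel symbols and the curvature tensor\<close>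

abbreviation "Dg x u v w \<equiv> dir_deriv u (\<lambda>y. \<gamma> y v w) x"

lemma dir_deriv_scaleR_real:
  "f differentiable (at x) \<Longrightarrow> dir_deriv v (\<lambda>y. c *\<^sub>R f y) x = c *\<^sub>R dir_deriv v f x"
  by (rule dir_deriv_eq) (intro has_derivative_scaleR_right has_derivative_dir_deriv)

lemma Dg_linear:
  assumes x: "x \<in> U"
  shows "linear (\<lambda>u. Dg x u v w)" "linear (\<lambda>v. Dg x u v w)" "linear (\<lambda>w. Dg x u v w)"
proof -
  show "linear (\<lambda>u. Dg x u v w)" by (rule linear_dir_deriv[OF diff_metric[OF x]])
  have *: "linear (\<lambda>v. Dg x u v w)" for u w
  proof (rule linearI)
    fix a b c
    show "Dg x u (a + b) w = Dg x u a w + Dg x u b w"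
    proof -
      have "Dg x u (a + b) w = dir_deriv u (\<lambda>y. \<gamma> y a w + \<gamma> y b w) x"
        by (rule dir_deriv_cong[OF open_U x]) (simp add: bilinear_ladd[OF bil])
      then show ?thesis
        by (simp add: dir_deriv_eq[OF has_derivative_add[OF has_derivative_dir_deriv has_derivative_dir_deriv]] diff_metric[OF x])
    qed
    show "Dg x u (c *\<^sub>R a) w = c *\<^sub>R Dg x u a w"
    proof -
      have "Dg x u (c *\<^sub>R a) w = dir_deriv u (\<lambda>y. c *\<^sub>R \<gamma> y a w) x"
        by (rule dir_deriv_cong[OF open_U x]) (simp add: bilinear_lmul[OF bil])
      then show ?thesis using dir_deriv_scaleR_real[OF diff_metric[OF x]] by metis
    qed
  qed
  then show "linear (\<lambda>v. Dg x u v w)" .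
  have "(\<lambda>w. Dg x u v w) = (\<lambda>w. Dg x u w v)"
    by (intro ext dir_deriv_cong[OF open_U x]) (simp add: sym)
  then show "linear (\<lambda>w. Dg x u v w)" using * by simp
qed

abbreviation "\<Gamma> \<equiv> christoffel \<gamma>"

text \<open>Koszul's formula for constant fields. Testing against z removes the inverse metric from
  the definition, and later arguments use only this characterisation.\<close>

lemma metric_christoffel:
  assumes x: "x \<in> U"
  shows "\<gamma> x (\<Gamma> x v w) z = (1/2) * (Dg x v w z + Dg x w v z - Dg x z v w)"
proof -
  have l: "linear (\<lambda>a. \<gamma> x a z)" using bil[OF x] by (simp add: bilinear_def)
  let ?c = "\<lambda>z. Dg x v w z + Dg x w v z - Dg x z v w"
  have lc: "linear ?c" by (intro linear_compose_add linear_compose_sub Dg_linear[OF x])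
  have "\<gamma> x (\<Gamma> x v w) z = (1/2) * (\<Sum>i\<in>Basis. ?c i * (i \<bullet> z))"
    unfolding christoffel_def by (simp add: linear_scale[OF l] linear_sum[OF l] inner_form_sharp[OF form[OF x]])
  also have "(\<Sum>i\<in>Basis. ?c i * (i \<bullet> z)) = ?c z"
    using linear_expand[OF lc, of z] by (simp add: inner_commute mult.commute)
  finally show ?thesis .
qed

lemma bilinear_christoffel:
  assumes x: "x \<in> U" shows "bilinear (\<Gamma> x)"
proof -
  note L = Dg_linear[OF x]
  note simps = metric_christoffel[OF x] bilinear_ladd[OF bil[OF x]] bilinear_lmul[OF bil[OF x]]
    linear_add[OF L(1)] linear_add[OF L(2)] linear_add[OF L(3)] linear_scale[OF L(1)] linear_scale[OF L(2)] linear_scale[OF L(3)]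
  show ?thesis unfolding bilinear_def
    by (intro conjI allI linearI; rule inner_form_eqI[OF form[OF x]]) (simp_all add: simps algebra_simps)
qed

lemma smooth_christoffel: "smooth_on (\<lambda>x. \<Gamma> x v w) U"
  unfolding christoffel_def
  by (intro smooth_on_scaleR[OF open_U smooth_on_const] smooth_on_sum open_U smooth_on_scaleR smooth_on_add smooth_on_diff
      smooth_on_dir_deriv smooth smooth_sharp)

lemma diff_christoffel: "x \<in> U \<Longrightarrow> (\<lambda>y. \<Gamma> y v w) differentiable (at x)"
  by (rule smooth_on_differentiable[OF smooth_christoffel])

lemma dir_deriv_christoffel_linear:
  assumes x: "x \<in> U"
  shows "linear (\<lambda>v. dir_deriv u (\<lambda>y. \<Gamma> y v w) x)" "linear (\<lambda>w. dir_deriv u (\<lambda>y. \<Gamma> y v w) x)"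
proof -
  have add: "dir_deriv u (\<lambda>y. \<Gamma> y a b + \<Gamma> y a' b') x = dir_deriv u (\<lambda>y. \<Gamma> y a b) x + dir_deriv u (\<lambda>y. \<Gamma> y a' b') x" for a b a' b'
    by (rule dir_deriv_eq) (intro has_derivative_add has_derivative_dir_deriv diff_christoffel x)
  show "linear (\<lambda>v. dir_deriv u (\<lambda>y. \<Gamma> y v w) x)"
  proof (rule linearI)
    fix a b c
    show "dir_deriv u (\<lambda>y. \<Gamma> y (a + b) w) x = dir_deriv u (\<lambda>y. \<Gamma> y a w) x + dir_deriv u (\<lambda>y. \<Gamma> y b w) x"
      unfolding add[symmetric] by (rule dir_deriv_cong[OF open_U x]) (simp add: bilinear_ladd[OF bilinear_christoffel])
    show "dir_deriv u (\<lambda>y. \<Gamma> y (c *\<^sub>R a) w) x = c *\<^sub>R dir_deriv u (\<lambda>y. \<Gamma> y a w) x"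
      unfolding dir_deriv_scaleR_real[OF diff_christoffel[OF x], symmetric]
      by (rule dir_deriv_cong[OF open_U x]) (simp add: bilinear_lmul[OF bilinear_christoffel])
  qed
  show "linear (\<lambda>w. dir_deriv u (\<lambda>y. \<Gamma> y v w) x)"
  proof (rule linearI)
    fix a b c
    show "dir_deriv u (\<lambda>y. \<Gamma> y v (a + b)) x = dir_deriv u (\<lambda>y. \<Gamma> y v a) x + dir_deriv u (\<lambda>y. \<Gamma> y v b) x"
      unfolding add[symmetric] by (rule dir_deriv_cong[OF open_U x]) (simp add: bilinear_radd[OF bilinear_christoffel])
    show "dir_deriv u (\<lambda>y. \<Gamma> y v (c *\<^sub>R a)) x = c *\<^sub>R dir_deriv u (\<lambda>y. \<Gamma> y v a) x"
      unfolding dir_deriv_scaleR_real[OF diff_christoffel[OF x], symmetric]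
      by (rule dir_deriv_cong[OF open_U x]) (simp add: bilinear_rmul[OF bilinear_christoffel])
  qed
qed

lemma linear_riemann:
  assumes x: "x \<in> U"
  shows "linear (\<lambda>u. riemann_curv \<gamma> x u v w)" "linear (\<lambda>v. riemann_curv \<gamma> x u v w)" "linear (\<lambda>w. riemann_curv \<gamma> x u v w)"
proof -
  have b: "linear (\<lambda>a. \<Gamma> x a c)" "linear (\<Gamma> x c)" for c
    using bilinear_christoffel[OF x] by (auto simp: bilinear_def)
  have bb: "linear (\<lambda>a. \<Gamma> x c (\<Gamma> x a d))" "linear (\<lambda>a. \<Gamma> x c (\<Gamma> x d a))" for c d
    using linear_compose[OF b(1)[of d] b(2)[of c]] linear_compose[OF b(2)[of d] b(2)[of c]] by (auto simp: o_def)
  note I = linear_compose_add linear_compose_sub b bb dir_deriv_christoffel_linear[OF x] linear_dir_deriv[OF diff_christoffel[OF x]]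
  show "linear (\<lambda>u. riemann_curv \<gamma> x u v w)" "linear (\<lambda>v. riemann_curv \<gamma> x u v w)" "linear (\<lambda>w. riemann_curv \<gamma> x u v w)"
    unfolding riemann_curv_def by (intro I)+
qed

lemma bilinear_ricci:
  assumes x: "x \<in> U" shows "bilinear (ricci_curv \<gamma> x)"
proof -
  note L = linear_riemann[OF x]
  show ?thesis unfolding bilinear_def ricci_curv_def
    by (intro conjI allI linearI)
      (simp_all add: linear_add[OF L(2)] linear_add[OF L(3)] linear_scale[OF L(2)] linear_scale[OF L(3)]
        inner_add_left sum.distrib sum_distrib_left)
qed

text \<open>Continuity on the compact slice is what makes the total scalar curvature a finite
  integral.\<close>

lemma continuous_scalar_curv: "continuous_on U (scalar_curv \<gamma>)"
proof -
  \<comment> \<open>The inner Christoffel vector depends on the point, so it is expanded in the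
    basis to reduce to constant arguments.\<close>
  have G2: "smooth_on (\<lambda>x. \<Gamma> x u (\<Gamma> x v w)) U" for u v w
  proof (rule smooth_on_cong[OF open_U])
    show "smooth_on (\<lambda>x. \<Sum>i\<in>Basis. (\<Gamma> x v w \<bullet> i) *\<^sub>R \<Gamma> x u i) U"
      by (intro smooth_on_sum open_U smooth_on_scaleR smooth_on_inner smooth_christoffel smooth_on_const)
    show "(\<Sum>i\<in>Basis. (\<Gamma> x v w \<bullet> i) *\<^sub>R \<Gamma> x u i) = \<Gamma> x u (\<Gamma> x v w)" if "x \<in> U" for x
      using linear_expand[of "\<Gamma> x u" "\<Gamma> x v w"] bilinear_christoffel[OF that] by (simp add: bilinear_def)
  qed
  have R: "smooth_on (\<lambda>x. riemann_curv \<gamma> x u v w) U" for u v w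
    unfolding riemann_curv_def
    by (intro smooth_on_add smooth_on_diff open_U G2 smooth_on_dir_deriv[OF smooth_christoffel, unfolded dir_deriv_def[abs_def], folded dir_deriv_def])
  have Ric: "smooth_on (\<lambda>x. ricci_curv \<gamma> x v w) U" for v w
    unfolding ricci_curv_def by (intro smooth_on_sum open_U smooth_on_inner R smooth_on_const)
  have "continuous_on U (\<lambda>x. \<Sum>i\<in>Basis. \<Sum>j\<in>Basis. (sharp (\<gamma> x) i \<bullet> j) * ricci_curv \<gamma> x i j)"
    by (intro continuous_intros smooth_on_continuous_on[OF smooth_sharp] smooth_on_continuous_on[OF Ric])
  then show ?thesis
  proof (rule continuous_on_eq)
    fix x assume x: "x \<in> U"
    have l: "linear (ricci_curv \<gamma> x i)" for i using bilinear_ricci[OF x] by (simp add: bilinear_def)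
    show "(\<Sum>i\<in>Basis. \<Sum>j\<in>Basis. (sharp (\<gamma> x) i \<bullet> j) * ricci_curv \<gamma> x i j) = scalar_curv \<gamma> x"
      unfolding scalar_curv_def by (intro sum.cong refl) (simp add: linear_expand[OF l, of _ "sharp (\<gamma> x) _"])
  qed
qed

end

subsection \<open>Invariance under isometries\<close>

text \<open>The trace of D A K with K a left inverse of D. The two spaces may be different types, as
  for a chart of X and a product chart.\<close>

lemma trace_conjugate:
  fixes A :: "'e::euclidean_space \<Rightarrow> 'e" and D :: "'e \<Rightarrow> 'f::euclidean_space"
  assumes "linear A" "linear D" "linear K" "\<And>v. K (D v) = v"
  shows "(\<Sum>j\<in>Basis. D (A (K j)) \<bullet> j) = (\<Sum>i\<in>Basis. A i \<bullet> i)"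
proof -
  have AK: "linear (\<lambda>v. A (K v))" using linear_compose[OF assms(3,1)] by (simp add: o_def)
  have "D (A (K j)) \<bullet> j = (\<Sum>i\<in>Basis. (A (K j) \<bullet> i) * (D i \<bullet> j))" for j
    using linear_expand[OF assms(2), of "A (K j)"] by (simp add: inner_sum_left)
  then have "(\<Sum>j\<in>Basis. D (A (K j)) \<bullet> j) = (\<Sum>j\<in>Basis. \<Sum>i\<in>Basis. (A (K j) \<bullet> i) * (D i \<bullet> j))" by simp
  also have "\<dots> = (\<Sum>i\<in>Basis. \<Sum>j\<in>Basis. (A (K j) \<bullet> i) * (D i \<bullet> j))" by (rule sum.swap)
  also have "\<dots> = (\<Sum>i\<in>Basis. A (K (D i)) \<bullet> i)"
    by (intro sum.cong refl) (simp add: linear_expand[OF AK, of "D _"] inner_sum_left mult.commute)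
  finally show ?thesis by (simp add: assms(4))
qed

text \<open>K x is the inverse of the derivative of G at x. The same locale serves transition maps,
  for independence of charts, and \<open>nmap\<close>, for the comparison with the cylinder.\<close>

locale local_isometry = E: local_metric U \<gamma> + F: local_metric V \<gamma>'
  for U :: "'e::euclidean_space set" and \<gamma> and V :: "'f::euclidean_space set" and \<gamma>' +
  fixes G :: "'e \<Rightarrow> 'f" and K :: "'e \<Rightarrow> 'f \<Rightarrow> 'e"
  assumes G_maps: "x \<in> U \<Longrightarrow> G x \<in> V" and G_smooth: "smooth_on G U"
    and isometry: "x \<in> U \<Longrightarrow> \<gamma> x v w = \<gamma>' (G x) (dir_deriv v G x) (dir_deriv w G x)"
    and K_linear: "x \<in> U \<Longrightarrow> linear (K x)"
    and KD: "x \<in> U \<Longrightarrow> K x (dir_deriv v G x) = v" and DK: "x \<in> U \<Longrightarrow> dir_deriv (K x w') G x = w'"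
begin

lemma diff_G: "x \<in> U \<Longrightarrow> G differentiable (at x)"
  and diff_DG: "x \<in> U \<Longrightarrow> dir_deriv v G differentiable (at x)"
  and diff_D2G: "x \<in> U \<Longrightarrow> dir_deriv u (dir_deriv v G) differentiable (at x)"
  by (rule smooth_on_differentiable[OF G_smooth], assumption)
    (rule smooth_on_differentiable[OF smooth_on_dir_deriv[OF G_smooth]], assumption,
     rule smooth_on_differentiable[OF smooth_on_dir_deriv[OF smooth_on_dir_deriv[OF G_smooth]]], assumption)

lemma linear_DG: "x \<in> U \<Longrightarrow> linear (\<lambda>v. dir_deriv v G x)"
  by (rule linear_dir_deriv[OF diff_G])

lemma D2_sym: "x \<in> U \<Longrightarrow> dir_deriv u (dir_deriv v G) x = dir_deriv v (dir_deriv u G) x"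
  by (rule dir_deriv_commute[OF E.open_U G_smooth])

lemma Dg_pullback:
  assumes x: "x \<in> U"
  shows "E.Dg x u v w = F.Dg (G x) (dir_deriv u G x) (dir_deriv v G x) (dir_deriv w G x)
     + \<gamma>' (G x) (dir_deriv u (dir_deriv v G) x) (dir_deriv w G x) + \<gamma>' (G x) (dir_deriv v G x) (dir_deriv u (dir_deriv w G) x)"
proof -
  have "E.Dg x u v w = dir_deriv u (\<lambda>y. \<gamma>' (G y) (dir_deriv v G y) (dir_deriv w G y)) x"
    by (rule dir_deriv_cong[OF E.open_U x]) (rule isometry)
  also have "\<dots> = F.Dg (G x) (dir_deriv u G x) (dir_deriv v G x) (dir_deriv w G x)
     + \<gamma>' (G x) (dir_deriv u (dir_deriv v G) x) (dir_deriv w G x) + \<gamma>' (G x) (dir_deriv v G x) (dir_deriv u (dir_deriv w G) x)"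
    using G_maps[OF x]
    by (intro dir_deriv_bilinear_family[OF F.open_U] F.bil F.diff_metric diff_G diff_DG x)
  finally show ?thesis .
qed

text \<open>The pulled back first derivatives are inserted into Koszul's formula. By symmetry of
  second derivatives and of the metric, four of the six second-order terms cancel, and the other two
  coincide.\<close>

lemma christoffel_pullback:
  assumes x: "x \<in> U"
  shows "dir_deriv (E.\<Gamma> x v w) G x = dir_deriv v (dir_deriv w G) x + F.\<Gamma> (G x) (dir_deriv v G x) (dir_deriv w G x)"
proof (rule inner_form_eqI[OF F.form[OF G_maps[OF x]]])
  fix z'
  define z where "z = K x z'"
  have z': "z' = dir_deriv z G x" by (simp add: z_def DK[OF x])
  note Gx = G_maps[OF x]
  have "\<gamma>' (G x) (dir_deriv (E.\<Gamma> x v w) G x) z' = \<gamma> x (E.\<Gamma> x v w) z" by (simp add: z' isometry[OF x])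
  also have "\<dots> = (1/2) * (E.Dg x v w z + E.Dg x w v z - E.Dg x z v w)" by (rule E.metric_christoffel[OF x])
  also have "\<dots> = \<gamma>' (G x) (dir_deriv v (dir_deriv w G) x) z' + (1/2) * (F.Dg (G x) (dir_deriv v G x) (dir_deriv w G x) z'
      + F.Dg (G x) (dir_deriv w G x) (dir_deriv v G x) z' - F.Dg (G x) z' (dir_deriv v G x) (dir_deriv w G x))"
    unfolding Dg_pullback[OF x] z'
    by (simp add: D2_sym[OF x, of w v] D2_sym[OF x, of z] F.sym[OF Gx, of "dir_deriv w G x"] F.sym[OF Gx, of "dir_deriv v G x"] algebra_simps)
  also have "\<dots> = \<gamma>' (G x) (dir_deriv v (dir_deriv w G) x + F.\<Gamma> (G x) (dir_deriv v G x) (dir_deriv w G x)) z'"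
    by (simp add: F.metric_christoffel[OF Gx] bilinear_ladd[OF F.bil[OF Gx]])
  finally show "\<gamma>' (G x) (dir_deriv (E.\<Gamma> x v w) G x) z' =
     \<gamma>' (G x) (dir_deriv v (dir_deriv w G) x + F.\<Gamma> (G x) (dir_deriv v G x) (dir_deriv w G x)) z'" .
qed

lemma dir_deriv_DG_field:
  assumes x: "x \<in> U" and P: "P differentiable (at x)"
  shows "dir_deriv u (\<lambda>y. dir_deriv (P y) G y) x = dir_deriv u (dir_deriv (P x) G) x + dir_deriv (dir_deriv u P x) G x"
proof -
  \<comment> \<open>The derivative of G is linear in one argument only; a dummy scalar argument, set
    to 1, turns it into a bilinear family.\<close>
  have "dir_deriv u (\<lambda>y. dir_deriv (P y) G y) x = dir_deriv u (\<lambda>y. (\<lambda>q p (s::real). s *\<^sub>R dir_deriv p G q) y (P y) 1) x"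
    by simp
  also have "\<dots> = dir_deriv (dir_deriv u (\<lambda>y. y) x) (\<lambda>q. 1 *\<^sub>R dir_deriv (P x) G q) x + 1 *\<^sub>R dir_deriv (dir_deriv u P x) G x
      + dir_deriv u (\<lambda>y. 1) x *\<^sub>R dir_deriv (P x) G x"
  proof (rule dir_deriv_bilinear_family[OF E.open_U, where G = "\<lambda>y. y"])
    show "bilinear (\<lambda>p s. s *\<^sub>R dir_deriv p G q)" if "q \<in> U" for q
      unfolding bilinear_def
      by (intro conjI allI linearI)
        (simp_all add: linear_add[OF linear_DG[OF that]] linear_scale[OF linear_DG[OF that]] algebra_simps)
    show "(\<lambda>q. j *\<^sub>R dir_deriv i G q) differentiable at x" for i j
      by (intro differentiable_scaleR differentiable_const diff_DG x)
  qed (use x P in auto)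
  also have "dir_deriv u (\<lambda>y :: 'e. y) x = u" by (rule dir_deriv_eq) (rule has_derivative_ident)
  also have "dir_deriv u (\<lambda>y :: 'e. 1 :: real) x = 0" by (rule dir_deriv_eq) (rule has_derivative_const)
  finally show ?thesis by simp
qed

text \<open>The transformation law of the Christoffel symbols, differentiated once. All noncovariant
  terms are collected in the last bracket, which is symmetric in u and v.\<close>

lemma riemann_half_pullback:
  assumes x: "x \<in> U"
  shows "dir_deriv (dir_deriv u (\<lambda>y. E.\<Gamma> y v w) x + E.\<Gamma> x u (E.\<Gamma> x v w)) G x =
    dir_deriv (dir_deriv u G x) (\<lambda>q. F.\<Gamma> q (dir_deriv v G x) (dir_deriv w G x)) (G x)
     + F.\<Gamma> (G x) (dir_deriv u G x) (F.\<Gamma> (G x) (dir_deriv v G x) (dir_deriv w G x))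
     + (dir_deriv u (dir_deriv v (dir_deriv w G)) x + F.\<Gamma> (G x) (dir_deriv u (dir_deriv v G) x) (dir_deriv w G x)
     + F.\<Gamma> (G x) (dir_deriv v G x) (dir_deriv u (dir_deriv w G) x) + F.\<Gamma> (G x) (dir_deriv u G x) (dir_deriv v (dir_deriv w G) x))"
proof -
  note Gx = G_maps[OF x]
  have 1: "dir_deriv u (\<lambda>y. dir_deriv (E.\<Gamma> y v w) G y) x
      = dir_deriv u (\<lambda>y. dir_deriv v (dir_deriv w G) y + F.\<Gamma> (G y) (dir_deriv v G y) (dir_deriv w G y)) x"
    by (rule dir_deriv_cong[OF E.open_U x]) (rule christoffel_pullback)
  have h: "((\<lambda>y. F.\<Gamma> (G y) (dir_deriv v G y) (dir_deriv w G y)) has_derivative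
     (\<lambda>u. dir_deriv (dir_deriv u G x) (\<lambda>q. F.\<Gamma> q (dir_deriv v G x) (dir_deriv w G x)) (G x)
       + F.\<Gamma> (G x) (dir_deriv u (dir_deriv v G) x) (dir_deriv w G x) + F.\<Gamma> (G x) (dir_deriv v G x) (dir_deriv u (dir_deriv w G) x))) (at x)"
    by (rule has_derivative_bilinear_family[where V=V and G=G and P="dir_deriv v G" and Q="dir_deriv w G" and b="F.\<Gamma>"])
      (intro F.open_U F.bilinear_christoffel F.diff_christoffel Gx has_derivative_dir_deriv diff_G diff_DG x | assumption)+
  have 2: "dir_deriv u (\<lambda>y. dir_deriv v (dir_deriv w G) y + F.\<Gamma> (G y) (dir_deriv v G y) (dir_deriv w G y)) x
    = dir_deriv u (dir_deriv v (dir_deriv w G)) x + (dir_deriv (dir_deriv u G x) (\<lambda>q. F.\<Gamma> q (dir_deriv v G x) (dir_deriv w G x)) (G x)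
       + F.\<Gamma> (G x) (dir_deriv u (dir_deriv v G) x) (dir_deriv w G x) + F.\<Gamma> (G x) (dir_deriv v G x) (dir_deriv u (dir_deriv w G) x))"
    by (rule dir_deriv_eq[OF has_derivative_add[OF has_derivative_dir_deriv[OF diff_D2G[OF x]] h]])
  have 3: "dir_deriv u (\<lambda>y. dir_deriv (E.\<Gamma> y v w) G y) x = dir_deriv u (dir_deriv (E.\<Gamma> x v w) G) x + dir_deriv (dir_deriv u (\<lambda>y. E.\<Gamma> y v w) x) G x"
    by (rule dir_deriv_DG_field[OF x E.diff_christoffel[OF x]])
  have 4: "dir_deriv (E.\<Gamma> x u (E.\<Gamma> x v w)) G x = dir_deriv u (dir_deriv (E.\<Gamma> x v w) G) x
     + (F.\<Gamma> (G x) (dir_deriv u G x) (dir_deriv v (dir_deriv w G) x) + F.\<Gamma> (G x) (dir_deriv u G x) (F.\<Gamma> (G x) (dir_deriv v G x) (dir_deriv w G x)))"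
    unfolding christoffel_pullback[OF x, of u] christoffel_pullback[OF x, of v w]
    by (simp add: bilinear_radd[OF F.bilinear_christoffel[OF Gx]])
  show ?thesis
    unfolding linear_add[OF linear_DG[OF x]] 4 using 1 2 3 by (simp add: algebra_simps)
qed

text \<open>Curvature is the antisymmetrisation in u and v of the expression just treated, so the
  symmetric bracket drops out.\<close>

lemma riemann_pullback:
  assumes x: "x \<in> U"
  shows "dir_deriv (riemann_curv \<gamma> x u v w) G x = riemann_curv \<gamma>' (G x) (dir_deriv u G x) (dir_deriv v G x) (dir_deriv w G x)"
proof -
  have "riemann_curv \<gamma> x u v w = (dir_deriv u (\<lambda>y. E.\<Gamma> y v w) x + E.\<Gamma> x u (E.\<Gamma> x v w)) - (dir_deriv v (\<lambda>y. E.\<Gamma> y u w) x + E.\<Gamma> x v (E.\<Gamma> x u w))"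
    by (simp add: riemann_curv_def)
  then have "dir_deriv (riemann_curv \<gamma> x u v w) G x = dir_deriv (dir_deriv u (\<lambda>y. E.\<Gamma> y v w) x + E.\<Gamma> x u (E.\<Gamma> x v w)) G x
     - dir_deriv (dir_deriv v (\<lambda>y. E.\<Gamma> y u w) x + E.\<Gamma> x v (E.\<Gamma> x u w)) G x"
    using linear_diff[OF linear_DG[OF x]] by metis
  also have "\<dots> = riemann_curv \<gamma>' (G x) (dir_deriv u G x) (dir_deriv v G x) (dir_deriv w G x)"
    unfolding riemann_half_pullback[OF x] riemann_curv_def
    by (simp add: dir_deriv_commute[OF E.open_U smooth_on_dir_deriv[OF G_smooth] x, of u v] D2_sym[OF x, of u v] algebra_simps)
  finally show ?thesis .
qed

lemma ricci_pullback:
  assumes x: "x \<in> U"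
  shows "ricci_curv \<gamma>' (G x) (dir_deriv v G x) (dir_deriv w G x) = ricci_curv \<gamma> x v w"
proof -
  have "ricci_curv \<gamma>' (G x) (dir_deriv v G x) (dir_deriv w G x) = (\<Sum>j\<in>Basis. dir_deriv (riemann_curv \<gamma> x (K x j) v w) G x \<bullet> j)"
    unfolding ricci_curv_def by (simp add: riemann_pullback[OF x] DK[OF x])
  also have "\<dots> = (\<Sum>i\<in>Basis. riemann_curv \<gamma> x i v w \<bullet> i)"
    by (rule trace_conjugate[OF E.linear_riemann(1)[OF x] linear_DG[OF x] K_linear[OF x] KD[OF x]])
  finally show ?thesis by (simp add: ricci_curv_def)
qed

lemma surj_DG: "x \<in> U \<Longrightarrow> surj (\<lambda>v. dir_deriv v G x)"
  by (metis DK surjI)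

text \<open>Contraction with the inverse metric does not depend on the basis: the coefficients of
  \<open>sharp\<close> in the target basis are moved onto K, where K undoes the derivative of
  G.\<close>

lemma scalar_pullback:
  assumes x: "x \<in> U"
  shows "scalar_curv \<gamma>' (G x) = scalar_curv \<gamma> x"
proof -
  note Gx = G_maps[OF x]
  have bl: "bilinear (ricci_curv \<gamma> x)" by (rule E.bilinear_ricci[OF x])
  have sl: "linear (sharp (\<gamma> x))" by (rule linear_sharp[OF E.form[OF x]])
  have s: "sharp (\<gamma>' (G x)) j = dir_deriv (\<Sum>i\<in>Basis. (j \<bullet> dir_deriv i G x) *\<^sub>R sharp (\<gamma> x) i) G x" for j
  proof -
    have "(\<Sum>i\<in>Basis. (j \<bullet> dir_deriv i G x) *\<^sub>R i) \<bullet> v = j \<bullet> dir_deriv v G x" for v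
      using linear_expand[OF linear_DG[OF x], of v] by (simp add: inner_sum_left inner_sum_right inner_commute mult.commute)
    then have "sharp (\<gamma>' (G x)) j = dir_deriv (sharp (\<gamma> x) (\<Sum>i\<in>Basis. (j \<bullet> dir_deriv i G x) *\<^sub>R i)) G x"
      by (intro sharp_pullback(1)[OF E.form[OF x] F.form[OF Gx] surj_DG[OF x] isometry[OF x], symmetric]) simp
    then show ?thesis by (simp add: linear_sum[OF sl] linear_scale[OF sl])
  qed
  have lK: "linear (\<lambda>v. ricci_curv \<gamma> x (K x v) a)" for a
    using linear_compose[OF K_linear[OF x], of "\<lambda>v. ricci_curv \<gamma> x v a"] bl by (simp add: bilinear_def o_def)
  have lr: "linear (ricci_curv \<gamma> x a)" for a using bl by (simp add: bilinear_def)
  have "scalar_curv \<gamma>' (G x) = (\<Sum>j\<in>Basis. ricci_curv \<gamma>' (G x) (dir_deriv (K x j) G x) (sharp (\<gamma>' (G x)) j))"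
    unfolding scalar_curv_def by (simp add: DK[OF x])
  also have "\<dots> = (\<Sum>j\<in>Basis. ricci_curv \<gamma> x (K x j) (\<Sum>i\<in>Basis. (j \<bullet> dir_deriv i G x) *\<^sub>R sharp (\<gamma> x) i))"
    by (simp add: s ricci_pullback[OF x])
  also have "\<dots> = (\<Sum>j\<in>Basis. \<Sum>i\<in>Basis. (j \<bullet> dir_deriv i G x) * ricci_curv \<gamma> x (K x j) (sharp (\<gamma> x) i))"
    by (simp add: linear_sum[OF lr] linear_scale[OF lr])
  also have "\<dots> = (\<Sum>i\<in>Basis. \<Sum>j\<in>Basis. (dir_deriv i G x \<bullet> j) * ricci_curv \<gamma> x (K x j) (sharp (\<gamma> x) i))"
    by (subst sum.swap) (simp add: inner_commute)
  also have "\<dots> = (\<Sum>i\<in>Basis. ricci_curv \<gamma> x (K x (dir_deriv i G x)) (sharp (\<gamma> x) i))"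
    by (intro sum.cong refl, subst linear_expand[OF lK]) simp
  also have "\<dots> = scalar_curv \<gamma> x" by (simp add: KD[OF x] scalar_curv_def)
  finally show ?thesis .
qed

end

subsection \<open>Cylinders\<close>

definition cyl_form :: "('e::euclidean_space \<Rightarrow> 'e \<Rightarrow> 'e \<Rightarrow> real) \<Rightarrow> 'e \<times> real \<Rightarrow> 'e \<times> real \<Rightarrow> 'e \<times> real \<Rightarrow> real" where
  "cyl_form h q v w = h (fst q) (fst v) (fst w) + snd v * snd w"

lemma sum_Basis_prod_real:
  fixes f :: "'e::euclidean_space \<times> real \<Rightarrow> 'a::comm_monoid_add"
  shows "(\<Sum>i\<in>Basis. f i) = (\<Sum>i\<in>Basis. f (i, 0)) + f (0, 1)"
proof -
  have "(Basis :: ('e \<times> real) set) = (\<lambda>i. (i, 0)) ` Basis \<union> {(0, 1)}" by (auto simp: Basis_prod_def)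
  moreover have "(\<Sum>i\<in>(\<lambda>i. (i, 0)) ` Basis \<union> {(0, 1)}. f i) = (\<Sum>i\<in>(\<lambda>i :: 'e. (i, 0 :: real)) ` Basis. f i) + f (0, 1)"
    by (subst sum.union_disjoint) auto
  moreover have "(\<Sum>i\<in>(\<lambda>i :: 'e. (i, 0 :: real)) ` Basis. f i) = (\<Sum>i\<in>Basis. f (i, 0))"
    by (subst sum.reindex) (auto simp: inj_on_def)
  ultimately show ?thesis by simp
qed

context local_metric
begin

lemma cyl_metric: "local_metric (U \<times> (UNIV :: real set)) (cyl_form \<gamma>)"
proof
  show "open (U \<times> (UNIV :: real set))" using open_U by (intro open_Times) auto
  fix q :: "'e \<times> real" assume q: "q \<in> U \<times> UNIV"
  then have x: "fst q \<in> U" by auto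
  note bl = bil[OF x]
  show "bilinear (cyl_form \<gamma> q)" unfolding bilinear_def cyl_form_def
    by (intro conjI allI linearI)
      (auto simp: bilinear_ladd[OF bl] bilinear_radd[OF bl] bilinear_lmul[OF bl] bilinear_rmul[OF bl] algebra_simps)
  show "cyl_form \<gamma> q v w = cyl_form \<gamma> q w v" for v w using sym[OF x] by (simp add: cyl_form_def mult.commute)
  show "0 < cyl_form \<gamma> q v v" if "v \<noteq> 0" for v
  proof (cases "fst v = 0")
    case True
    then have "snd v \<noteq> 0" using that by (simp add: prod_eq_iff)
    then show ?thesis using True by (auto simp: cyl_form_def bilinear_lzero[OF bl] zero_less_mult_iff)
  next
    case False then show ?thesis using pos[OF x False] by (simp add: cyl_form_def add_pos_nonneg)
  qed
next
  fix v w :: "'e \<times> real"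
  have o: "open (U \<times> (UNIV :: real set))" using open_U by (intro open_Times) auto
  show "smooth_on (\<lambda>q. cyl_form \<gamma> q v w) (U \<times> UNIV)" unfolding cyl_form_def
    by (intro smooth_on_add o smooth_on_const smooth_on_compose[OF o open_U _ smooth_on_linear[OF bounded_linear_fst] smooth]) auto
qed

lemma dir_deriv_fst:
  assumes "f differentiable (at (fst q))"
  shows "dir_deriv v (\<lambda>q :: 'e \<times> real. f (fst q)) q = dir_deriv (fst v) f (fst q)"
  by (rule dir_deriv_eq)
    (rule has_derivative_compose[OF has_derivative_fst[OF has_derivative_ident] has_derivative_dir_deriv[OF assms]])

lemma sharp_cyl:
  assumes "fst q \<in> U"
  shows "sharp (cyl_form \<gamma> q) a = (sharp (\<gamma> (fst q)) (fst a), snd a)"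
proof -
  interpret C: local_metric "U \<times> (UNIV :: real set)" "cyl_form \<gamma>" by (rule cyl_metric)
  have "q \<in> U \<times> UNIV" using assms by (simp add: mem_Times_iff)
  then show ?thesis
    by (intro sharp_eqI[OF C.form]) (auto simp: cyl_form_def inner_form_sharp[OF form[OF assms]] inner_prod_def)
qed

text \<open>Nothing depends on t, and the line direction is orthogonal of constant length, so
  Koszul's formula leaves only the component along U.\<close>

lemma christoffel_cyl:
  assumes x: "fst q \<in> U"
  shows "christoffel (cyl_form \<gamma>) q v w = (\<Gamma> (fst q) (fst v) (fst w), 0)"
proof -
  interpret C: local_metric "U \<times> (UNIV :: real set)" "cyl_form \<gamma>" by (rule cyl_metric)
  have q: "q \<in> U \<times> UNIV" using assms by (simp add: mem_Times_iff)
  have d: "dir_deriv u (\<lambda>q. cyl_form \<gamma> q a b) q = Dg (fst q) (fst u) (fst a) (fst b)" for u a b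
  proof -
    have "dir_deriv u (\<lambda>q. cyl_form \<gamma> q a b) q = dir_deriv (fst u) (\<lambda>x. \<gamma> x (fst a) (fst b) + snd a * snd b) (fst q)"
      unfolding cyl_form_def by (rule dir_deriv_fst) (intro differentiable_add diff_metric x differentiable_const)
    also have "\<dots> = Dg (fst q) (fst u) (fst a) (fst b)"
      by (rule dir_deriv_eq) (rule has_derivative_add_const[OF has_derivative_dir_deriv[OF diff_metric[OF x]]])
    finally show ?thesis .
  qed
  show ?thesis
    by (rule inner_form_eqI[OF C.form[OF q]])
      (simp add: C.metric_christoffel[OF q] d, simp add: cyl_form_def metric_christoffel[OF x])
qed

lemma riemann_cyl:
  assumes x: "fst q \<in> U"
  shows "riemann_curv (cyl_form \<gamma>) q u v w = (riemann_curv \<gamma> (fst q) (fst u) (fst v) (fst w), 0)"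
proof -
  have o: "open (U \<times> (UNIV :: real set))" using open_U by (intro open_Times) auto
  have q: "q \<in> U \<times> UNIV" using assms by (simp add: mem_Times_iff)
  have d: "dir_deriv u (\<lambda>q. christoffel (cyl_form \<gamma>) q v w) q = (dir_deriv (fst u) (\<lambda>y. \<Gamma> y (fst v) (fst w)) (fst q), 0)" for u v w
  proof -
    have "dir_deriv u (\<lambda>q. christoffel (cyl_form \<gamma>) q v w) q = dir_deriv u (\<lambda>q. (\<Gamma> (fst q) (fst v) (fst w), 0 :: real)) q"
      by (rule dir_deriv_cong[OF o q]) (simp add: christoffel_cyl mem_Times_iff)
    also have "\<dots> = (dir_deriv (fst u) (\<lambda>y. \<Gamma> y (fst v) (fst w)) (fst q), 0)"
      by (rule dir_deriv_eq) (intro has_derivative_Pair has_derivative_const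
        has_derivative_compose[OF has_derivative_fst[OF has_derivative_ident] has_derivative_dir_deriv[OF diff_christoffel[OF x]]])
    finally show ?thesis .
  qed
  show ?thesis unfolding riemann_curv_def[of "cyl_form \<gamma>"] d
    by (simp add: christoffel_cyl[OF x] riemann_curv_def)
qed

text \<open>The line direction is flat: its term in each of the two traces vanishes.\<close>

lemma scalar_cyl:
  assumes x: "fst q \<in> U"
  shows "scalar_curv (cyl_form \<gamma>) q = scalar_curv \<gamma> (fst q)"
proof -
  have ric: "ricci_curv (cyl_form \<gamma>) q v w = ricci_curv \<gamma> (fst q) (fst v) (fst w)" for v w
    unfolding ricci_curv_def sum_Basis_prod_real by (simp add: riemann_cyl[OF x])
  have "ricci_curv \<gamma> (fst q) 0 a = 0" for a using bilinear_lzero[OF bilinear_ricci[OF x]] .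
  then show ?thesis unfolding scalar_curv_def sum_Basis_prod_real by (simp add: ric sharp_cyl[OF x])
qed

end

section \<open>Scalar curvature and covectors on manifolds and cylindrical ends\<close>

lemma local_metric_subset: "local_metric U \<gamma> \<Longrightarrow> open V \<Longrightarrow> V \<subseteq> U \<Longrightarrow> local_metric V \<gamma>"
  unfolding local_metric_def using smooth_on_subset by blast

context riemannian_manifold
begin

lemma local_metric_chart: "c \<in> A \<Longrightarrow> local_metric (chart_img c) (g c)"
  by unfold_locales (auto simp: open_img bilinear_metric metric_pos smooth_metric intro: metric_sym)

lemma dir_deriv_transition_inverse:
  assumes "c \<in> A" "d \<in> A" "x \<in> overlap c d"
  shows "dir_deriv (dir_deriv v (transition c d) x) (transition d c) (transition c d x) = v"
proof -
  have "((\<lambda>x. transition d c (transition c d x)) has_derivative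
    (\<lambda>v. dir_deriv (dir_deriv v (transition c d) x) (transition d c) (transition c d x))) (at x)"
    by (rule has_derivative_compose[OF smooth_on_has_derivative[OF smooth_transition[OF assms(1,2)] assms(3)]
          smooth_on_has_derivative[OF smooth_transition[OF assms(2,1)] transition_overlap[OF assms]]])
  moreover have "((\<lambda>x. transition d c (transition c d x)) has_derivative (\<lambda>v. v)) (at x)"
    by (rule has_derivative_transform_within_open[OF has_derivative_ident open_overlap[OF assms(1,2)] assms(3)])
      (use transition_inverse[OF assms(1,2)] in auto)
  ultimately show ?thesis by (metis has_derivative_unique)
qed

lemma scalar_curv_transition:
  assumes c: "c \<in> A" and d: "d \<in> A" and x: "x \<in> overlap c d"
  shows "scalar_curv (g d) (transition c d x) = scalar_curv (g c) x"
proof -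
  interpret E: local_metric "overlap c d" "g c"
    by (rule local_metric_subset[OF local_metric_chart[OF c] open_overlap[OF c d]]) (auto simp: overlap_eq[OF c])
  interpret F: local_metric "overlap d c" "g d"
    by (rule local_metric_subset[OF local_metric_chart[OF d] open_overlap[OF d c]]) (auto simp: overlap_eq[OF d])
  interpret local_isometry "overlap c d" "g c" "overlap d c" "g d" "transition c d"
    "\<lambda>x w. dir_deriv w (transition d c) (transition c d x)"
  proof (intro local_isometry.intro local_isometry_axioms.intro E.local_metric_axioms F.local_metric_axioms)
    fix x assume x: "x \<in> overlap c d"
    show "transition c d x \<in> overlap d c" by (rule transition_overlap[OF c d x])
    show "g c x v w = g d (transition c d x) (dir_deriv v (transition c d) x) (dir_deriv w (transition c d) x)" for v w
      by (rule metric_transition[OF c d x])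
    show "linear (\<lambda>w. dir_deriv w (transition d c) (transition c d x))"
      by (rule linear_dir_deriv[OF smooth_on_differentiable[OF smooth_transition[OF d c] transition_overlap[OF c d x]]])
    show "dir_deriv (dir_deriv v (transition c d) x) (transition d c) (transition c d x) = v" for v
      by (rule dir_deriv_transition_inverse[OF c d x])
    show "dir_deriv (dir_deriv w (transition d c) (transition c d x)) (transition c d) x = w" for w
      using dir_deriv_transition_inverse[OF d c transition_overlap[OF c d x], of w]
      by (simp add: transition_inverse[OF c d x])
  qed (rule smooth_transition[OF c d])
  show ?thesis by (rule scalar_pullback[OF x])
qed

lemma scalar_curvature_chart:
  assumes c: "c \<in> A" and p: "p \<in> chart_dom c"
  shows "scalar_curvature A g p = scalar_curv (g c) (chart_map c p)"
proof -
  let ?d = "chart_at A p"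
  have x: "chart_map c p \<in> overlap c ?d" using p chart_at[of p] by (auto simp: overlap_def)
  have "transition c ?d (chart_map c p) = chart_map ?d p" by (simp add: transition_def inv_map[OF c p])
  then show ?thesis using scalar_curv_transition[OF c chart_at(1) x] by (simp add: scalar_curvature_def)
qed

lemma continuous_scalar_curvature: "continuous_on UNIV (scalar_curvature A g)"
proof (rule continuous_at_imp_continuous_on, rule ballI)
  fix p
  let ?c = "chart_at A p"
  note c = chart_at(1)[of p]
  have "continuous_on (chart_dom ?c) (\<lambda>p. scalar_curv (g ?c) (chart_map ?c p))"
    by (rule continuous_on_compose2[OF local_metric.continuous_scalar_curv[OF local_metric_chart[OF c]] cont_map[OF c]])
      (use map_img[OF c] in blast)
  then have "continuous_on (chart_dom ?c) (scalar_curvature A g)"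
    by (rule continuous_on_eq) (simp add: scalar_curvature_chart[OF c])
  then show "isCont (scalar_curvature A g) p"
    using continuous_on_eq_continuous_at[OF open_dom[OF c]] chart_at(2) by blast
qed

lemma covector_norm2_nonneg: "0 \<le> covector_norm2 A g \<omega> p"
proof -
  let ?c = "chart_at A p"
  interpret local_metric "chart_img ?c" "g ?c" by (rule local_metric_chart[OF chart_at(1)])
  have x: "chart_map ?c p \<in> chart_img ?c" by (rule map_img[OF chart_at])
  let ?a = "\<omega> ?c (chart_map ?c p)" and ?s = "sharp (g ?c (chart_map ?c p)) (\<omega> ?c (chart_map ?c p))"
  have "?a \<bullet> ?s = g ?c (chart_map ?c p) ?s ?s" by (rule inner_form_sharp[OF form[OF x], symmetric])
  also have "\<dots> \<ge> 0" using pos[OF x, of ?s] bilinear_lzero[OF bil[OF x]] by (cases "?s = 0") auto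
  finally show ?thesis by (simp add: covector_norm2_def Let_def)
qed

end

context cyl_end
begin

lemma dir_deriv_nmap_cmap:
  assumes c: "c \<in> B" and d: "d \<in> A" and y: "y \<in> ndom c d"
  shows "dir_deriv (dir_deriv w (cmap c d) (nmap c d y)) (nmap c d) y = w"
proof -
  note q = nmap_cdom[OF assms]
  have "(nmap c d has_derivative (\<lambda>v. dir_deriv v (nmap c d) y)) (at (cmap c d (nmap c d y)))"
    unfolding q(2) by (rule nmap_has_derivative[OF assms])
  then have "((\<lambda>q. nmap c d (cmap c d q)) has_derivative (\<lambda>w. dir_deriv (dir_deriv w (cmap c d) (nmap c d y)) (nmap c d) y)) (at (nmap c d y))"
    by (rule has_derivative_compose[OF smooth_on_has_derivative[OF smooth_cmap[OF c d] q(1)]])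
  moreover have "((\<lambda>q. nmap c d (cmap c d q)) has_derivative (\<lambda>v. v)) (at (nmap c d y))"
    by (rule has_derivative_transform_within_open[OF has_derivative_ident open_cdom[OF c d] q(1)]) (use cmap_ndom[OF c d] in auto)
  ultimately show ?thesis by (metis has_derivative_unique)
qed

lemma nmap_isometry:
  assumes c: "c \<in> B" and d: "d \<in> A"
  shows "local_isometry (ndom c d) (g d) (chart_img c \<times> UNIV) (cyl_form (h c)) (nmap c d)
    (\<lambda>y w. dir_deriv w (cmap c d) (nmap c d y))"
proof -
  interpret E: local_metric "ndom c d" "g d"
    by (rule local_metric_subset[OF X.local_metric_chart[OF d] open_ndom[OF c d]]) (auto simp: ndom_def)
  interpret H: local_metric "chart_img c" "h c" by (rule Z.local_metric_chart[OF c])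
  interpret F: local_metric "chart_img c \<times> UNIV" "cyl_form (h c)" by (rule H.cyl_metric)
  show ?thesis
  proof (intro local_isometry.intro local_isometry_axioms.intro E.local_metric_axioms F.local_metric_axioms)
    fix y assume y: "y \<in> ndom c d"
    note q = nmap_cdom(1)[OF c d y]
    show "nmap c d y \<in> chart_img c \<times> UNIV" using q by (auto simp: cdom_def mem_Times_iff)
    show "g d y v w = cyl_form (h c) (nmap c d y) (dir_deriv v (nmap c d) y) (dir_deriv w (nmap c d) y)" for v w
      unfolding cyl_form_def by (rule metric_nmap[OF c d y])
    show "linear (\<lambda>w. dir_deriv w (cmap c d) (nmap c d y))"
      by (rule linear_dir_deriv[OF smooth_on_differentiable[OF smooth_cmap[OF c d] q]])
    show "dir_deriv (dir_deriv v (nmap c d) y) (cmap c d) (nmap c d y) = v" for v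
      by (rule dir_deriv_cmap_nmap[OF c d y])
    show "dir_deriv (dir_deriv w (cmap c d) (nmap c d y)) (nmap c d) y = w" for w
      by (rule dir_deriv_nmap_cmap[OF c d y])
  qed (rule smooth_nmap[OF c d])
qed

lemma scalar_curvature_end:
  assumes p: "p \<in> cyl_part"
  shows "scalar_curvature A g p = scalar_curvature B h (fst (\<Psi> p))"
proof -
  let ?d = "chart_at A p" and ?c = "chart_at B (fst (\<Psi> p))"
  note d = X.chart_at[of p] and c = Z.chart_at[of "fst (\<Psi> p)"]
  have y: "chart_map ?d p \<in> ndom ?c ?d" by (rule nmap_at[OF d(1) c(1) p d(2) c(2)])
  interpret H: local_metric "chart_img ?c" "h ?c" by (rule Z.local_metric_chart[OF c(1)])
  interpret local_isometry "ndom ?c ?d" "g ?d" "chart_img ?c \<times> UNIV" "cyl_form (h ?c)" "nmap ?c ?d"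
    "\<lambda>y w. dir_deriv w (cmap ?c ?d) (nmap ?c ?d y)" by (rule nmap_isometry[OF c(1) d(1)])
  have fst: "fst (nmap ?c ?d (chart_map ?d p)) = chart_map ?c (fst (\<Psi> p))"
    by (simp add: nmap_def X.inv_map[OF d])
  have "fst (nmap ?c ?d (chart_map ?d p)) \<in> chart_img ?c" unfolding fst by (rule Z.map_img[OF c])
  then show ?thesis
    using scalar_pullback[OF y] H.scalar_cyl[of "nmap ?c ?d (chart_map ?d p)"]
    by (simp add: scalar_curvature_def Let_def fst)
qed

end

subsection \<open>Functions of product form on the end\<close>

text \<open>The function on Z is given through local approximability, the property that passes to
  products and pullbacks. The factor \<phi> vanishes up to t = 2, so each point of X has a
  neighbourhood either inside the cylinder or in the region where the product is zero.\<close>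

locale end_function = cyl_end A g B h W \<Phi>
  for A :: "('a::{t2_space, second_countable_topology}, real^'n) atlas" and g
    and B :: "('z::{t2_space, second_countable_topology}, real^'k) atlas" and h W \<Phi> +
  fixes u :: "'z \<Rightarrow> real" and \<omega> :: "('z, real^'k) covector" and \<phi> \<phi>' :: "real \<Rightarrow> real" and C :: real
  assumes \<omega>_covector: "covector_field B \<omega>"
    and \<phi>_deriv: "(\<phi> has_real_derivative \<phi>' t) (at t)" and \<phi>'_cont: "continuous_on UNIV \<phi>'"
    and \<phi>_bound: "\<bar>\<phi> t\<bar> \<le> C" "\<bar>\<phi>' t\<bar> \<le> C" and \<phi>_zero: "t \<le> 2 \<Longrightarrow> \<phi> t = 0" "t \<le> 2 \<Longrightarrow> \<phi>' t = 0"
    and u_sob: "c \<in> B \<Longrightarrow> x \<in> chart_img c \<Longrightarrow> \<exists>N. x \<in> N \<and> sob_on N (\<lambda>x. u (chart_inv c x)) (\<omega> c)"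
begin

definition uX :: "'a \<Rightarrow> real" where
  "uX p = (if p \<in> cyl_part then u (fst (\<Psi> p)) * \<phi> (snd (\<Psi> p)) else 0)"

text \<open>The components of d(u \<phi>) = \<phi> du + u \<phi>' dt in a product chart.\<close>

definition cyl\<omega> :: "('z, real^'k) chart \<Rightarrow> (real^'k) \<times> real \<Rightarrow> (real^'k) \<times> real" where
  "cyl\<omega> c q = (\<phi> (snd q) *\<^sub>R \<omega> c (fst q), u (chart_inv c (fst q)) * \<phi>' (snd q))"

text \<open>The pullback of \<open>cyl\<omega>\<close> to a chart of X. The chart of Z is an
  arbitrary choice depending on the point; \<open>cyl\<omega>_chart\<close> makes it immaterial, so
  the transformation law holds everywhere and not merely almost everywhere.\<close>

definition duX :: "('a, real^'n) covector" where
  "duX d y = (if chart_inv d y \<in> cyl_part then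
     (let c = chart_at B (fst (\<Psi> (chart_inv d y))) in
       \<Sum>i\<in>Basis. (cyl\<omega> c (nmap c d y) \<bullet> dir_deriv i (nmap c d) y) *\<^sub>R i) else 0)"

text \<open>A change of chart on Z affects only the first component, where the transformation law of
  \<omega> applies; t and the value of u are unchanged.\<close>

lemma cyl\<omega>_chart:
  assumes c: "c \<in> B" and c': "c' \<in> B" and d: "d \<in> A" and y: "y \<in> ndom c d" "y \<in> ndom c' d"
  shows "cyl\<omega> c (nmap c d y) \<bullet> dir_deriv v (nmap c d) y = cyl\<omega> c' (nmap c' d y) \<bullet> dir_deriv v (nmap c' d) y"
proof -
  define x where "x = fst (nmap c d y)"
  let ?\<tau> = "transition c c'"
  have x: "x \<in> overlap c c'" using y c unfolding x_def by (auto simp: ndom_def nmap_def overlap_def)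
  have eq: "nmap c' d y' = (?\<tau> (fst (nmap c d y')), snd (nmap c d y'))" if "y' \<in> ndom c d \<inter> ndom c' d" for y'
    using that c by (auto simp: ndom_def nmap_def transition_def Z.inv_map prod_eq_iff)
  have D: "((\<lambda>y'. (?\<tau> (fst (nmap c d y')), snd (nmap c d y'))) has_derivative
     (\<lambda>v. (dir_deriv (fst (dir_deriv v (nmap c d) y)) ?\<tau> x, snd (dir_deriv v (nmap c d) y)))) (at y)"
    using nmap_has_derivative[OF c d y(1)] smooth_on_has_derivative[OF Z.smooth_transition[OF c c'] x]
    unfolding x_def
    by (intro has_derivative_Pair has_derivative_compose[OF has_derivative_fst] has_derivative_snd) auto
  have "(nmap c' d has_derivative (\<lambda>v. (dir_deriv (fst (dir_deriv v (nmap c d) y)) ?\<tau> x, snd (dir_deriv v (nmap c d) y)))) (at y)"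
    by (rule has_derivative_transform_within_open[OF D, of "ndom c d \<inter> ndom c' d"])
      (use open_ndom[OF c d] open_ndom[OF c' d] y eq in auto)
  then have D': "dir_deriv v (nmap c' d) y = (dir_deriv (fst (dir_deriv v (nmap c d) y)) ?\<tau> x, snd (dir_deriv v (nmap c d) y))"
    by (rule dir_deriv_eq)
  have "\<omega> c x \<bullet> fst (dir_deriv v (nmap c d) y) = \<omega> c' (?\<tau> x) \<bullet> dir_deriv (fst (dir_deriv v (nmap c d) y)) ?\<tau> x"
    using \<omega>_covector c c' x unfolding covector_field_def by blast
  moreover have "chart_inv c' (?\<tau> x) = chart_inv c x"
    using x c c' by (auto simp: transition_def Z.overlap_eq Z.inv_map)
  ultimately show ?thesis
    using eq[of y] y unfolding D' cyl\<omega>_def inner_prod_def by (simp add: x_def)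
qed

lemma duX_eq:
  assumes c: "c \<in> B" and d: "d \<in> A" and y: "y \<in> ndom c d"
  shows "duX d y = (\<Sum>i\<in>Basis. (cyl\<omega> c (nmap c d y) \<bullet> dir_deriv i (nmap c d) y) *\<^sub>R i)"
proof -
  have p: "chart_inv d y \<in> cyl_part" using y by (simp add: ndom_def)
  let ?c = "chart_at B (fst (\<Psi> (chart_inv d y)))"
  have y': "y \<in> ndom ?c d" using y Z.chart_at by (auto simp: ndom_def)
  show ?thesis using p cyl\<omega>_chart[OF Z.chart_at(1) c d y' y] by (simp add: duX_def Let_def)
qed

lemma duX_inner:
  assumes c: "c \<in> B" and d: "d \<in> A" and y: "y \<in> ndom c d"
  shows "duX d y \<bullet> v = cyl\<omega> c (nmap c d y) \<bullet> dir_deriv v (nmap c d) y"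
  unfolding duX_eq[OF assms]
  using linear_expand[OF linear_dir_deriv[OF smooth_on_differentiable[OF smooth_nmap[OF c d] y]], of v]
  by (simp add: inner_sum_left inner_sum_right inner_commute[of v] mult.commute)

lemma duX_zero: "chart_inv d y \<notin> cyl_part \<Longrightarrow> duX d y = 0"
  by (simp add: duX_def)

lemma covector_field_duX: "covector_field A duX"
  unfolding covector_field_def
proof (intro ballI allI)
  fix d d' y v assume d: "d \<in> A" and d': "d' \<in> A" and y: "y \<in> overlap d d'"
  let ?\<tau> = "transition d d'"
  have inv: "chart_inv d' (?\<tau> y') = chart_inv d y'" if "y' \<in> overlap d d'" for y'
    using that d d' by (auto simp: transition_def X.overlap_eq X.inv_map)
  show "duX d y \<bullet> v = duX d' (?\<tau> y) \<bullet> dir_deriv v ?\<tau> y"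
  proof (cases "chart_inv d y \<in> cyl_part")
    case True
    define c where "c = chart_at B (fst (\<Psi> (chart_inv d y)))"
    have c: "c \<in> B" "fst (\<Psi> (chart_inv d y)) \<in> chart_dom c" using Z.chart_at by (auto simp: c_def)
    have yn: "y \<in> ndom c d" using True c y d by (auto simp: ndom_def X.overlap_eq)
    have yn': "?\<tau> y \<in> ndom c d'" using True c y X.transition_overlap[OF d d' y] d' by (auto simp: ndom_def inv X.overlap_eq)
    have "((\<lambda>y'. nmap c d' (?\<tau> y')) has_derivative (\<lambda>v. dir_deriv (dir_deriv v ?\<tau> y) (nmap c d') (?\<tau> y))) (at y)"
      by (rule has_derivative_compose[OF smooth_on_has_derivative[OF X.smooth_transition[OF d d'] y] nmap_has_derivative[OF c(1) d' yn']])
    then have "(nmap c d has_derivative (\<lambda>v. dir_deriv (dir_deriv v ?\<tau> y) (nmap c d') (?\<tau> y))) (at y)"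
      by (rule has_derivative_transform_within_open[OF _ X.open_overlap[OF d d'] y]) (simp add: nmap_def inv)
    then have "dir_deriv v (nmap c d) y = dir_deriv (dir_deriv v ?\<tau> y) (nmap c d') (?\<tau> y)" by (rule dir_deriv_eq)
    moreover have "nmap c d' (?\<tau> y) = nmap c d y" by (simp add: nmap_def inv[OF y])
    ultimately show ?thesis by (simp add: duX_inner[OF c(1) d yn] duX_inner[OF c(1) d' yn'])
  next
    case False then show ?thesis using inv[OF y] by (simp add: duX_zero)
  qed
qed

text \<open>There is no cross term, because dt is orthogonal to the covectors of Z in the product
  metric.\<close>

lemma covector_norm2_duX:
  "covector_norm2 A g duX p = (if p \<in> cyl_part then
     (\<phi> (snd (\<Psi> p)))\<^sup>2 * covector_norm2 B h \<omega> (fst (\<Psi> p)) + (\<phi>' (snd (\<Psi> p)))\<^sup>2 * (u (fst (\<Psi> p)))\<^sup>2 else 0)"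
proof (cases "p \<in> cyl_part")
  case True
  let ?d = "chart_at A p" and ?c = "chart_at B (fst (\<Psi> p))"
  note d = X.chart_at[of p] and c = Z.chart_at[of "fst (\<Psi> p)"]
  define y where "y = chart_map ?d p"
  have y: "y \<in> ndom ?c ?d" unfolding y_def by (rule nmap_at[OF d(1) c(1) True d(2) c(2)])
  interpret H: local_metric "chart_img ?c" "h ?c" by (rule Z.local_metric_chart[OF c(1)])
  interpret local_isometry "ndom ?c ?d" "g ?d" "chart_img ?c \<times> UNIV" "cyl_form (h ?c)" "nmap ?c ?d"
    "\<lambda>y w. dir_deriv w (cmap ?c ?d) (nmap ?c ?d y)" by (rule nmap_isometry[OF c(1) d(1)])
  have n: "nmap ?c ?d y = (chart_map ?c (fst (\<Psi> p)), snd (\<Psi> p))"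
    by (simp add: nmap_def y_def X.inv_map[OF d] prod_eq_iff)
  have x: "chart_map ?c (fst (\<Psi> p)) \<in> chart_img ?c" by (rule Z.map_img[OF c])
  let ?s = "sharp (h ?c (chart_map ?c (fst (\<Psi> p))))"
  have ls: "linear ?s" by (rule linear_sharp[OF H.form[OF x]])
  have "covector_norm2 A g duX p = duX ?d y \<bullet> sharp (g ?d y) (duX ?d y)"
    by (simp add: covector_norm2_def Let_def y_def)
  also have "\<dots> = cyl\<omega> ?c (nmap ?c ?d y) \<bullet> sharp (cyl_form (h ?c) (nmap ?c ?d y)) (cyl\<omega> ?c (nmap ?c ?d y))"
    by (rule sharp_pullback(2)[OF E.form[OF y] F.form[OF G_maps[OF y]] surj_DG[OF y] isometry[OF y] duX_inner[OF c(1) d(1) y]])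
  also have "\<dots> = (\<phi> (snd (\<Psi> p)))\<^sup>2 * covector_norm2 B h \<omega> (fst (\<Psi> p)) + (\<phi>' (snd (\<Psi> p)))\<^sup>2 * (u (fst (\<Psi> p)))\<^sup>2"
    using x by (simp add: n H.sharp_cyl cyl\<omega>_def linear_scale[OF ls] Z.inv_map[OF c] covector_norm2_def Let_def power2_eq_square)
  finally show ?thesis using True by simp
next
  case False
  let ?d = "chart_at A p"
  note d = X.chart_at[of p]
  have "duX ?d (chart_map ?d p) = 0" using False by (simp add: duX_zero X.inv_map[OF d])
  then show ?thesis using False by (simp add: covector_norm2_def Let_def)
qed

text \<open>Inside the cylinder the product of approximants is pulled back by \<open>nmap\<close> on
  a ball so small that the constants required by \<open>sob_on_pullback\<close> exist. Elsewhere the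
  function is zero near the point.\<close>

lemma sob_local:
  assumes d: "d \<in> A" and y: "y \<in> chart_img d"
  shows "\<exists>M. y \<in> M \<and> sob_on M (\<lambda>y. uX (chart_inv d y)) (duX d)"
proof (cases "chart_inv d y \<in> cyl_part")
  case True
  define c where "c = chart_at B (fst (\<Psi> (chart_inv d y)))"
  have c: "c \<in> B" "fst (\<Psi> (chart_inv d y)) \<in> chart_dom c" using Z.chart_at by (auto simp: c_def)
  have yn: "y \<in> ndom c d" using True c y by (simp add: ndom_def)
  let ?T = "nmap c d"
  have q: "fst (?T y) \<in> chart_img c" "1 < snd (?T y)" using nmap_cdom(1)[OF c(1) d yn] by (auto simp: cdom_def)
  obtain N where N: "fst (?T y) \<in> N" "sob_on N (\<lambda>x. u (chart_inv c x)) (\<omega> c)" using u_sob[OF c(1) q(1)] by blast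
  \<comment> \<open>Any bounded interval around the height of the point would do; it starts at 1
    because the coordinates are used for t > 1 only.\<close>
  define b where "b = snd (?T y) + 1"
  have b: "1 < b" "snd (?T y) < b" using q by (auto simp: b_def)
  have cyl: "sob_on (N \<times> {1<..<b}) (\<lambda>p. u (chart_inv c (fst p)) * \<phi> (snd p)) (cyl\<omega> c)"
    using sob_on_cylinder[OF N(2) \<phi>_deriv \<phi>'_cont \<phi>_bound b(1)] by (simp add: cyl\<omega>_def[abs_def])
  have oN: "open (N \<times> {1<..<b})" using cyl by (simp add: sob_on_def)
  have cT: "continuous_on (ndom c d) ?T" by (rule smooth_on_continuous_on[OF smooth_nmap[OF c(1) d]])
  have cD: "continuous_on (ndom c d) (\<lambda>y. dir_deriv v ?T y)" for v
    using smooth_on_continuous_on[OF smooth_on_dir_deriv[OF smooth_nmap[OF c(1) d]]] .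
  have cj: "continuous_on (ndom c d) (jac c d)"
    unfolding jac_def det_def by (simp, intro continuous_intros cD)
  have jy: "jac c d y > 0" by (rule jac_pos[OF c(1) d yn])
  define O1 where "O1 = ndom c d \<inter> ?T -` (N \<times> {1<..<b})"
  \<comment> \<open>Here the Jacobian exceeds half its value at y, which explains the constant
    \<open>2 / jac c d y\<close> in the pullback.\<close>
  define O2 where "O2 = ndom c d \<inter> jac c d -` {jac c d y / 2<..}"
  have "open O1" unfolding O1_def by (rule continuous_open_preimage[OF cT open_ndom[OF c(1) d] oN])
  moreover have "open O2" unfolding O2_def by (rule continuous_open_preimage[OF cj open_ndom[OF c(1) d]]) simp
  moreover have "y \<in> O1 \<inter> O2" using yn N(1) b q jy by (auto simp: O1_def O2_def mem_Times_iff)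
  ultimately obtain r where r: "r > 0" "cball y r \<subseteq> O1 \<inter> O2" by (metis open_Int open_contains_cball)
  define M where "M = ball y r"
  have MO: "cball y r \<subseteq> ndom c d" "M \<subseteq> O1" "M \<subseteq> O2" "M \<subseteq> ndom c d"
    using r by (auto simp: M_def O1_def subset_iff)
  have "\<exists>Bd. \<forall>x\<in>cball y r. \<forall>i\<in>(Basis :: (real^'n) set). norm (dir_deriv i ?T x) \<le> Bd"
  proof -
    have "bounded (dir_deriv i ?T ` cball y r)" for i
      by (intro compact_imp_bounded compact_continuous_image continuous_on_subset[OF cD MO(1)]) simp
    then have "\<forall>i. \<exists>Bi. \<forall>x\<in>cball y r. norm (dir_deriv i ?T x) \<le> Bi" by (simp add: bounded_iff)
    then obtain Bi where Bi: "\<And>i x. x \<in> cball y r \<Longrightarrow> norm (dir_deriv i ?T x) \<le> Bi i" by metis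
    show ?thesis
    proof (intro exI ballI)
      fix x and i :: "real^'n" assume "x \<in> cball y r" "i \<in> Basis"
      then have "norm (dir_deriv i ?T x) \<le> \<bar>Bi i\<bar>" using Bi[of x i] by simp
      also have "\<dots> \<le> (\<Sum>i\<in>Basis. \<bar>Bi i\<bar>)" using \<open>i \<in> Basis\<close> by (intro member_le_sum) auto
      finally show "norm (dir_deriv i ?T x) \<le> (\<Sum>i\<in>Basis. \<bar>Bi i\<bar>)" .
    qed
  qed
  then obtain Bd where Bd: "\<And>x i. x \<in> cball y r \<Longrightarrow> i \<in> (Basis :: (real^'n) set) \<Longrightarrow> norm (dir_deriv i ?T x) \<le> Bd" by blast
  have Mo: "open M" by (simp add: M_def)
  have "sob_on M (\<lambda>x. u (chart_inv c (fst (?T x))) * \<phi> (snd (?T x))) (\<lambda>x. \<Sum>i\<in>Basis. (cyl\<omega> c (?T x) \<bullet> dir_deriv i ?T x) *\<^sub>R i)"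
  proof (rule sob_on_pullback[where v = "\<lambda>p. u (chart_inv c (fst p)) * \<phi> (snd p)" and T' = "\<lambda>x v. dir_deriv v ?T x" and C = "2 / jac c d y" and B = "\<bar>Bd\<bar>",
        OF bij_axis bij_cbasis Mo])
    show "?T ` M \<in> sets borel" using Mo by (intro nmap_image_borel[OF c(1) d MO(4)]) auto
    show "?T ` M \<subseteq> N \<times> {1<..<b}" using MO(2) by (auto simp: O1_def)
    show "(?T has_derivative (\<lambda>v. dir_deriv v ?T x)) (at x)" if "x \<in> M" for x
      using nmap_has_derivative[OF c(1) d] MO(4) that by blast
    show "inj_on ?T M" by (rule inj_on_subset[OF nmap_inj[OF c(1) d] MO(4)])
    show "continuous_on M (\<lambda>x. dir_deriv v ?T x)" for v by (rule continuous_on_subset[OF cD MO(4)])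
    show "1 \<le> 2 / jac c d y * \<bar>det (\<chi> i j. dir_deriv (axis j 1) ?T x \<bullet> cbasis i)\<bar>" if "x \<in> M" for x
    proof -
      have "jac c d x > jac c d y / 2" using MO(3) that by (auto simp: O2_def)
      then show ?thesis using jy by (simp add: jac_def[symmetric] field_simps)
    qed
    show "norm (dir_deriv i ?T x) \<le> \<bar>Bd\<bar>" if "x \<in> M" "i \<in> Basis" for x i
      using Bd[of x i] that by (simp add: M_def)
  qed (use jy cyl in auto)
  then have "sob_on M (\<lambda>y. uX (chart_inv d y)) (duX d)"
  proof (rule sob_on_cong[rotated 2])
    fix x assume "x \<in> M"
    then have x: "x \<in> ndom c d" using MO(4) by auto
    then show "u (chart_inv c (fst (?T x))) * \<phi> (snd (?T x)) = uX (chart_inv d x)"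
      using c by (simp add: uX_def nmap_def ndom_def Z.inv_map)
    show "(\<Sum>i\<in>Basis. (cyl\<omega> c (?T x) \<bullet> dir_deriv i ?T x) *\<^sub>R i) = duX d x" by (rule duX_eq[OF c(1) d x, symmetric])
  qed
  then show ?thesis using r(1) by (intro exI[of _ M]) (simp add: M_def)
next
  case False
  \<comment> \<open>P is closed and lies in the cylinder, so its complement is an open neighbourhood
    of the point. There the remaining part of the cylinder has t <= 2, where \<phi> and its
    derivative vanish.\<close>
  define P where "P = \<Phi> ` (UNIV \<times> {2..})"
  have cP: "closed P" unfolding P_def by (rule closed_end) simp
  have Pc: "P \<subseteq> cyl_part" unfolding P_def cyl_part_def by auto
  define M where "M = chart_map d ` (chart_dom d \<inter> - P)"
  have Mo: "open M" unfolding M_def using cP by (intro X.open_image[OF d]) auto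
  have yM: "y \<in> M" unfolding M_def X.image_eq_preimage[OF d] using y False Pc by auto
  have notP: "chart_inv d x \<notin> P" "x \<in> chart_img d" if "x \<in> M" for x using that unfolding M_def X.image_eq_preimage[OF d] by auto
  have small: "snd (\<Psi> (chart_inv d x)) \<le> 2" if "x \<in> M" "chart_inv d x \<in> cyl_part" for x
  proof (rule ccontr)
    assume "\<not> snd (\<Psi> (chart_inv d x)) \<le> 2"
    then have "chart_inv d x \<in> P" using \<Phi>\<Psi>[of "chart_inv d x"] that(2) unfolding P_def cyl_part_iff
      by (intro image_eqI[of _ _ "\<Psi> (chart_inv d x)"]) (auto simp: mem_Times_iff)
    then show False using notP that by blast
  qed
  have "sob_on M (\<lambda>y. uX (chart_inv d y)) (duX d)"
  proof (rule sob_on_cong[OF _ _ sob_on_zero[OF Mo]])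
    fix x assume x: "x \<in> M"
    show "0 = uX (chart_inv d x)" using small[OF x] \<phi>_zero(1) by (auto simp: uX_def)
    show "0 = duX d x"
    proof (cases "chart_inv d x \<in> cyl_part")
      case True
      let ?c = "chart_at B (fst (\<Psi> (chart_inv d x)))"
      have xn: "x \<in> ndom ?c d" using True notP(2)[OF x] Z.chart_at by (auto simp: ndom_def)
      have "snd (nmap ?c d x) \<le> 2" using small[OF x True] by (simp add: nmap_def)
      then have "cyl\<omega> ?c (nmap ?c d x) = 0" using \<phi>_zero by (simp add: cyl\<omega>_def prod_eq_iff)
      then show ?thesis using duX_eq[OF Z.chart_at(1) d xn] by simp
    qed (simp add: duX_zero)
  qed
  then show ?thesis using yM by blast
qed

lemma weak_differential_uX: "weak_differential A uX duX"
  unfolding weak_differential_def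
proof (intro conjI covector_field_duX ballI allI impI)
  fix d K assume d: "d \<in> A" and K: "compact K \<and> K \<subseteq> chart_img d"
  have loc: "\<exists>N. open N \<and> x \<in> N \<and> set_integrable lborel N (uX \<circ> chart_inv d) \<and> set_integrable lborel N (duX d)" if "x \<in> K" for x
    using sob_local[OF d, of x] K that unfolding sob_on_def o_def by blast
  show "set_integrable lborel K (uX \<circ> chart_inv d)"
    by (rule set_integrable_local) (use loc K in blast)+
  show "set_integrable lborel K (duX d)"
    by (rule set_integrable_local) (use loc K in blast)+
next
  fix d \<eta> v assume d: "d \<in> A" and \<eta>: "test_function (chart_img d) \<eta>"
  have sm: "smooth_on \<eta> UNIV" and K: "compact (closure {x. \<eta> x \<noteq> 0})" "closure {x. \<eta> x \<noteq> 0} \<subseteq> chart_img d"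
    using \<eta> by (auto simp: test_function_def)
  have z: "\<eta> x = 0" if "x \<notin> closure {x. \<eta> x \<noteq> 0}" for x using that closure_subset[of "{x. \<eta> x \<noteq> 0}"] by blast
  have gr: "grad \<eta> x \<bullet> v = dir_deriv v \<eta> x" for x by (rule grad_inner[OF smooth_on_differentiable[OF sm]]) simp
  show "(LINT x:chart_img d|lborel. uX (chart_inv d x) * dir_deriv v \<eta> x) = - (LINT x:chart_img d|lborel. (duX d x \<bullet> v) * \<eta> x)"
    using sob_local_imp_weak[OF X.open_img[OF d] sob_local[OF d] smooth_on_has_gradient_on[OF sm] K z, of v]
    by (simp add: gr)
qed

end

section \<open>The cylindrical Yamabe constant\<close>

text \<open>The concrete profile \<psi>: squaring the positive part of x (1 - x) gives a C^1
  function that vanishes off the unit interval.\<close>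

definition tent :: "real \<Rightarrow> real" where "tent x = (max 0 (x * (1 - x)))\<^sup>2"

definition tent' :: "real \<Rightarrow> real" where "tent' x = 2 * max 0 (x * (1 - x)) * (1 - 2 * x)"

lemma tent_deriv: "(tent has_real_derivative tent' x) (at x)"
proof -
  have "((\<lambda>x. x * (1 - x)) has_real_derivative 1 - 2 * x) (at x)" by (auto intro!: derivative_eq_intros)
  from DERIV_chain2[OF has_real_derivative_max_0_power2 this] show ?thesis
    by (simp add: tent_def[abs_def] tent'_def)
qed

lemma tent_outside:
  assumes "x \<notin> {0..1}" shows "tent x = 0" "tent' x = 0"
proof -
  have "x * (1 - x) \<le> 0" using assms by (auto simp: mult_le_0_iff)
  then show "tent x = 0" "tent' x = 0" by (auto simp: tent_def tent'_def)
qed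

lemma tent_bound: "0 \<le> tent x" "\<bar>tent x\<bar> \<le> 1" "\<bar>tent' x\<bar> \<le> 2"
proof -
  have "x * (1 - x) \<le> 1"
    using zero_le_power2[of "x - 1/2"] by (simp add: power2_eq_square algebra_simps)
  then have m: "0 \<le> max 0 (x * (1 - x))" "max 0 (x * (1 - x)) \<le> 1" by auto
  show "0 \<le> tent x" by (simp add: tent_def)
  show "\<bar>tent x\<bar> \<le> 1" using power_mono[OF m(2,1), of 2] by (simp add: tent_def)
  show "\<bar>tent' x\<bar> \<le> 2"
  proof (cases "x \<in> {0..1}")
    case True
    then have "\<bar>1 - 2 * x\<bar> \<le> 1" by auto
    then have "max 0 (x * (1 - x)) * \<bar>1 - 2 * x\<bar> \<le> 1 * 1" using m by (intro mult_mono) auto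
    then show ?thesis using m by (simp add: tent'_def abs_mult)
  qed (simp add: tent_outside)
qed

lemma tent_continuous: "continuous_on UNIV tent" "continuous_on UNIV tent'"
  unfolding tent_def tent'_def by (intro continuous_intros)+

lemma tent_integrable:
  "integrable lborel (\<lambda>x. (tent x)\<^sup>2)" "integrable lborel (\<lambda>x. (tent' x)\<^sup>2)"
  "p > 0 \<Longrightarrow> integrable lborel (\<lambda>x. tent x powr p)"
proof -
  show "integrable lborel (\<lambda>x. (tent x)\<^sup>2)" "integrable lborel (\<lambda>x. (tent' x)\<^sup>2)"
    by (rule integrable_compact_support[of _ "{0..1}"]; (intro continuous_intros tent_continuous)?; simp add: tent_outside)+
  show "integrable lborel (\<lambda>x. tent x powr p)" if "p > 0"
    by (rule integrable_compact_support[of _ "{0..1}"]; (intro continuous_on_powr' tent_continuous continuous_on_const)?)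
      (use that tent_bound(1) in \<open>auto simp: tent_outside\<close>)
qed

lemma tent_ge: "x \<in> {1/4..3/4} \<Longrightarrow> tent x \<ge> 1/64"
proof -
  assume x: "x \<in> {1/4..3/4}"
  \<comment> \<open>On this interval x (1 - x) is at least 3/16, hence at least 1/8, and 1/64 is the
    square of 1/8. The value is crude, as it only serves to make integrals positive.\<close>
  have "0 \<le> (x - 1/4) * (3/4 - x)" using x by auto
  also have "\<dots> = x * (1 - x) - 3/16" by (simp add: field_simps)
  finally have "(1/8)\<^sup>2 \<le> (max 0 (x * (1 - x)))\<^sup>2" by (intro power_mono) auto
  then show "tent x \<ge> 1/64" by (simp add: tent_def power2_eq_square)
qed

lemma integral_pos_of_bump:
  fixes f :: "real \<Rightarrow> real"
  assumes f: "integrable lborel f" "\<And>x. 0 \<le> f x" "\<And>x. x \<in> {1/4..3/4} \<Longrightarrow> c \<le> f x" and c: "c > 0"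
  shows "(\<integral>x. f x \<partial>lborel) > 0"
proof -
  have "integrable lborel (indicat_real {1/4..3/4 :: real})" by (auto intro!: integrable_real_indicator simp: ennreal_less_top less_top[symmetric])
  then have "(\<integral>x. c * indicat_real {1/4..3/4 :: real} x \<partial>lborel) \<le> (\<integral>x. f x \<partial>lborel)"
  proof (intro Bochner_Integration.integral_mono integrable_mult_right f(1))
    show "c * indicat_real {1/4..3/4} x \<le> f x" for x using f(2,3)[of x] c by (cases "x \<in> {1/4..3/4}") auto
  qed
  then show ?thesis using c by simp
qed

section \<open>Rescaling and the limit of large T\<close>

lemma rescale_integral:
  fixes G :: "real \<Rightarrow> real"
  assumes T: "T > 0" and G: "integrable lborel G"
  shows "integrable lborel (\<lambda>t. G ((t - 2) / T))" "(\<integral>t. G ((t - 2) / T) \<partial>lborel) = T * (\<integral>x. G x \<partial>lborel)"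
proof -
  show "integrable lborel (\<lambda>t. G ((t - 2) / T))"
    using G lborel_integrable_real_affine_iff[of T "\<lambda>t. G ((t - 2) / T)" 2] T by simp
  show "(\<integral>t. G ((t - 2) / T) \<partial>lborel) = T * (\<integral>x. G x \<partial>lborel)"
    using lborel_integral_real_affine[of T "\<lambda>t. G ((t - 2) / T)" 2] T by simp
qed

text \<open>For large T at least half of the linear term survives in the numerator. Division by the
  power T^s leaves -\<kappa> T^(1-s), which is unbounded because s < 1.\<close>

lemma quotient_unbounded_below:
  fixes e b K s M :: real
  assumes "e < 0" "K > 0" "0 < s" "s < 1"
  shows "\<exists>T>0. (T * e + b / T) / (T * K) powr s \<le> M"
proof -
  define \<kappa> where "\<kappa> = - e / (2 * K powr s)"
  have \<kappa>: "\<kappa> > 0" using assms by (simp add: \<kappa>_def divide_neg_pos)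
  define Q where "Q = \<bar>M\<bar> / \<kappa> + 1"
  have Q: "Q > 0" using \<kappa> by (auto simp: Q_def intro!: add_nonneg_pos)
  \<comment> \<open>The three lower bounds serve in turn to replace b / T by |b|, to absorb |b| into
    half of the linear term, and to obtain T^(1-s) >= Q. The choice of Q gives \<kappa> Q = |M| +
    \<kappa>.\<close>
  define T where "T = max 1 (max (2 * \<bar>b\<bar> / (- e)) (Q powr (1 / (1 - s))))"
  have T: "T \<ge> 1" "T \<ge> 2 * \<bar>b\<bar> / (- e)" "T \<ge> Q powr (1 / (1 - s))" by (auto simp: T_def)
  have "b / T \<le> \<bar>b\<bar>" using T(1) by (simp add: divide_le_eq) (metis abs_ge_self abs_ge_zero mult_left_mono mult.right_neutral order_trans)
  moreover have "\<bar>b\<bar> \<le> T * (- e) / 2" using T(2) assms(1) by (simp add: field_simps)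
  moreover have "T * (- e) / 2 = - (T * e / 2)" by simp
  ultimately have num: "T * e + b / T \<le> T * e / 2" by linarith
  have "Q = (Q powr (1 / (1 - s))) powr (1 - s)" using Q assms by (simp add: powr_powr)
  also have "\<dots> \<le> T powr (1 - s)" using T(3) assms by (intro powr_mono2) auto
  finally have QT: "Q \<le> T powr (1 - s)" .
  have "(T * e + b / T) / (T * K) powr s \<le> (T * e / 2) / (T * K) powr s"
    using num by (intro divide_right_mono) auto
  also have "\<dots> = - \<kappa> * T powr (1 - s)"
  proof -
    have "T powr (1 - s) = T / T powr s" using T(1) by (simp add: powr_diff)
    then show ?thesis using T(1) assms by (simp add: \<kappa>_def powr_mult ac_simps)
  qed
  also have "\<dots> \<le> - \<kappa> * Q" using QT \<kappa> by simp
  also have "\<dots> \<le> M" using \<kappa> by (simp add: Q_def algebra_simps)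
  finally show ?thesis using T(1) by (intro exI[of _ T]) auto
qed

context cyl_end
begin

section \<open>Integration over the end\<close>

lemma integrable_prod:
  assumes a: "integrable Z.vol a" and b: "integrable lborel (b :: real \<Rightarrow> real)"
  shows "integrable (Z.vol \<Otimes>\<^sub>M lborel) (\<lambda>q. a (fst q) * b (snd q))"
    "(\<integral>q. a (fst q) * b (snd q) \<partial>(Z.vol \<Otimes>\<^sub>M lborel)) = (\<integral>z. a z \<partial>Z.vol) * (\<integral>t. b t \<partial>lborel)"
proof -
  interpret finite_measure Z.vol by (rule finite_measure_Z)
  interpret pair_sigma_finite Z.vol "lborel :: real measure" ..
  have am: "a \<in> borel_measurable Z.vol" and bm: "b \<in> borel_measurable lborel" using a b by auto
  show i: "integrable (Z.vol \<Otimes>\<^sub>M lborel) (\<lambda>q. a (fst q) * b (snd q))"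
  proof (rule Fubini_integrable)
    show "(\<lambda>q. a (fst q) * b (snd q)) \<in> borel_measurable (Z.vol \<Otimes>\<^sub>M lborel)"
      by (intro borel_measurable_times measurable_compose[OF measurable_fst am] measurable_compose[OF measurable_snd bm])
    show "integrable Z.vol (\<lambda>x. \<integral>y. norm (a (fst (x, y)) * b (snd (x, y))) \<partial>lborel)"
      using a by (simp add: abs_mult)
    show "AE x in Z.vol. integrable lborel (\<lambda>y. a (fst (x, y)) * b (snd (x, y)))"
      using b by simp
  qed
  show "(\<integral>q. a (fst q) * b (snd q) \<partial>(Z.vol \<Otimes>\<^sub>M lborel)) = (\<integral>z. a z \<partial>Z.vol) * (\<integral>t. b t \<partial>lborel)"
    using integral_fst'[OF i] by simp
qed

lemma \<Psi>_measurable: "(\<lambda>p. if p \<in> cyl_part then \<Psi> p else undefined) \<in> borel_measurable borel"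
  by (rule borel_measurable_continuous_on_if)
    (use open_cyl_part cont_\<Psi> in \<open>auto simp: cyl_part_iff elim: continuous_on_subset\<close>)

lemma end_integral:
  fixes F :: "'z \<times> real \<Rightarrow> real"
  assumes F: "integrable (Z.vol \<Otimes>\<^sub>M lborel) F" and F0: "\<And>q. snd q \<le> 1 \<Longrightarrow> F q = 0"
    and f: "\<And>p. f p = (if p \<in> cyl_part then F (\<Psi> p) else 0)"
  shows "integrable X.vol f" "(\<integral>p. f p \<partial>X.vol) = (\<integral>q. F q \<partial>(Z.vol \<Otimes>\<^sub>M lborel))"
proof -
  let ?ZR = "Z.vol \<Otimes>\<^sub>M (lborel :: real measure)"
  let ?\<Phi> = "\<lambda>q. if q \<in> UNIV \<times> {1<..} then \<Phi> q else undefined"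
  have ub: "UNIV \<times> {1<..} \<in> sets (borel :: ('z \<times> real) measure)" by (auto intro!: open_Times borel_open)
  have cp: "cyl_part \<in> sets borel" using open_cyl_part by simp
  have Fm: "F \<in> borel_measurable borel"
    using borel_measurable_integrable[OF F] unfolding measurable_cong_sets[OF sets_Z_line refl] .
  have "(\<lambda>p. indicator cyl_part p * F (if p \<in> cyl_part then \<Psi> p else undefined)) \<in> borel_measurable borel"
    using cp by (intro borel_measurable_times measurable_compose[OF \<Psi>_measurable Fm]) auto
  also have "(\<lambda>p. indicator cyl_part p * F (if p \<in> cyl_part then \<Psi> p else undefined)) = f" by (auto simp: f indicator_def)
  finally have fm: "f \<in> borel_measurable borel" .
  have fm': "f \<in> borel_measurable X.vol" using fm unfolding measurable_cong_sets[OF X.sets_vol refl] .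
  have m\<Phi>: "?\<Phi> \<in> measurable (density ?ZR (indicator (UNIV \<times> {1<..}))) borel"
    unfolding measurable_cong_sets[OF trans[OF sets_density sets_Z_line] refl] by (rule \<Phi>_measurable)
  have m\<Phi>': "?\<Phi> \<in> measurable ?ZR borel"
    unfolding measurable_cong_sets[OF sets_Z_line refl] by (rule \<Phi>_measurable)
  have indX: "(\<lambda>p. ennreal (indicat_real cyl_part p)) = indicator cyl_part" by (auto simp: indicator_def)
  have indZ: "(\<lambda>q. ennreal (indicat_real (UNIV \<times> {1<..}) q)) = indicator (UNIV \<times> {1<..} :: ('z \<times> real) set)" by (auto simp: indicator_def)
  have mX: "indicat_real cyl_part \<in> borel_measurable X.vol"
    unfolding measurable_cong_sets[OF X.sets_vol refl] using cp by simp
  have mZ: "indicat_real (UNIV \<times> {1<..}) \<in> borel_measurable ?ZR"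
    unfolding measurable_cong_sets[OF sets_Z_line refl] using ub by simp
  have eX: "(\<lambda>p. indicat_real cyl_part p *\<^sub>R f p) = f" by (auto simp: f indicator_def)
  have eZ: "(\<lambda>q. indicat_real (UNIV \<times> {1<..}) q *\<^sub>R f (?\<Phi> q)) = F"
  proof
    fix q :: "'z \<times> real"
    show "indicat_real (UNIV \<times> {1<..}) q *\<^sub>R f (?\<Phi> q) = F q"
    proof (cases "1 < snd q")
      case True
      then have "\<Phi> q \<in> cyl_part" "\<Psi> (\<Phi> q) = q" using \<Psi>\<Phi>[of q] by (auto simp: cyl_part_def mem_Times_iff)
      then show ?thesis using True by (simp add: f mem_Times_iff)
    next
      case False then show ?thesis using F0[of q] by (simp add: mem_Times_iff)
    qed
  qed
  have f\<Phi>: "(\<lambda>q. f (?\<Phi> q)) \<in> borel_measurable ?ZR" by (rule measurable_compose[OF m\<Phi>' fm])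
  have "integrable X.vol f \<longleftrightarrow> integrable (density X.vol (indicator cyl_part)) f"
    using integrable_density[OF fm' mX] unfolding indX eX by simp
  also have "\<dots> \<longleftrightarrow> integrable (density ?ZR (indicator (UNIV \<times> {1<..}))) (\<lambda>q. f (?\<Phi> q))"
    unfolding end_measure_eq by (rule integrable_distr_eq[OF m\<Phi> fm])
  also have "\<dots> \<longleftrightarrow> integrable ?ZR F"
    using integrable_density[OF f\<Phi> mZ] unfolding indZ eZ by simp
  finally show "integrable X.vol f" using F by simp
  have "(\<integral>p. f p \<partial>X.vol) = (\<integral>p. f p \<partial>density X.vol (indicator cyl_part))"
    using integral_density[OF fm' mX] unfolding indX eX by simp
  also have "\<dots> = (\<integral>q. f (?\<Phi> q) \<partial>density ?ZR (indicator (UNIV \<times> {1<..})))"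
    unfolding end_measure_eq by (rule integral_distr[OF m\<Phi> fm])
  also have "\<dots> = (\<integral>q. F q \<partial>?ZR)"
    using integral_density[OF f\<Phi> mZ] unfolding indZ eZ by simp
  finally show "(\<integral>p. f p \<partial>X.vol) = (\<integral>q. F q \<partial>?ZR)" .
qed

text \<open>Boundedness of u guarantees that |u|^p is integrable. A divergent integral would be
  recorded as 0 and the quotient would then be 0 as well, instead of a large negative number.
  Approximability rather than a weak differential is assumed, since truncated functions and
  constants both supply it directly.\<close>

lemma yamabe_of_negative_energy:
  fixes u :: "'z \<Rightarrow> real" and \<omega> :: "('z, real^'k) covector" and C :: real
  assumes n3: "CARD('n) \<ge> 3" and \<omega>: "covector_field B \<omega>" and um: "u \<in> borel_measurable borel" and ub: "\<And>z. \<bar>u z\<bar> \<le> C"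
    and u_sob: "\<And>c x. c \<in> B \<Longrightarrow> x \<in> chart_img c \<Longrightarrow> \<exists>N. x \<in> N \<and> sob_on N (\<lambda>x. u (chart_inv c x)) (\<omega> c)"
    and i1: "integrable Z.vol (\<lambda>z. (u z)\<^sup>2)" and i2: "integrable Z.vol (covector_norm2 B h \<omega>)"
    and i3: "integrable Z.vol (\<lambda>z. scalar_curvature B h z * (u z)\<^sup>2)"
    and neg: "conf_energy CARD('n) B h u \<omega> < 0"
  shows "cylindrical_yamabe A g = - \<infinity>"
proof -
  define n where "n = real CARD('n)"
  define p where "p = 2 * n / (n - 2)"
  define s where "s = (n - 2) / n"
  define \<alpha> where "\<alpha> = conf_coeff CARD('n)"
  have n: "n \<ge> 3" using n3 by (simp add: n_def)
  have p: "p > 2" using n by (simp add: p_def field_simps)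
  have s: "0 < s" "s < 1" using n by (auto simp: s_def)
  have \<alpha>: "\<alpha> > 0" using n by (simp add: \<alpha>_def conf_coeff_def n_def[symmetric])
  define e where "e = (\<lambda>z. \<alpha> * covector_norm2 B h \<omega> z + scalar_curvature B h z * (u z)\<^sup>2)"
  define E where "E = (\<integral>z. e z \<partial>Z.vol)"
  define U where "U = (\<integral>z. (u z)\<^sup>2 \<partial>Z.vol)"
  define P where "P = (\<integral>z. \<bar>u z\<bar> powr p \<partial>Z.vol)"
  have E: "E < 0" using neg by (simp add: E_def e_def conf_energy_def \<alpha>_def)
  have ie: "integrable Z.vol e" unfolding e_def using i2 i3 by simp
  have um': "u \<in> borel_measurable Z.vol" using um unfolding measurable_cong_sets[OF Z.sets_vol refl] .
  \<comment> \<open>As p > 2, the pointwise bound |u|^p <= |C|^(p-2) u^2 reduces this to square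
    integrability.\<close>
  have iP: "integrable Z.vol (\<lambda>z. \<bar>u z\<bar> powr p)"
  proof (rule Bochner_Integration.integrable_bound[OF integrable_mult_right[OF i1, of "\<bar>C\<bar> powr (p - 2)"]])
    show "(\<lambda>z. \<bar>u z\<bar> powr p) \<in> borel_measurable Z.vol" using um' by measurable
    show "AE z in Z.vol. norm (\<bar>u z\<bar> powr p) \<le> norm (\<bar>C\<bar> powr (p - 2) * (u z)\<^sup>2)"
    proof (rule AE_I2)
      fix z
      show "norm (\<bar>u z\<bar> powr p) \<le> norm (\<bar>C\<bar> powr (p - 2) * (u z)\<^sup>2)"
      proof (cases "u z = 0")
        case False
        have "\<bar>u z\<bar> powr p = \<bar>u z\<bar> powr ((p - 2) + 2)" by simp
        also have "\<dots> = \<bar>u z\<bar> powr (p - 2) * (u z)\<^sup>2"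
          unfolding powr_add using False by simp
        also have "\<dots> \<le> \<bar>C\<bar> powr (p - 2) * (u z)\<^sup>2"
          using ub[of z] p by (intro mult_right_mono powr_mono2) auto
        finally show ?thesis by (simp add: abs_mult)
      qed (use p in simp)
    qed
  qed
  \<comment> \<open>If u vanished almost everywhere, the energy would reduce to the gradient term,
    which is nonnegative.\<close>
  have nz: "\<not> (AE z in Z.vol. u z = 0)"
  proof
    assume "AE z in Z.vol. u z = 0"
    then have "AE z in Z.vol. 0 \<le> e z"
      by eventually_elim (use \<alpha> Z.covector_norm2_nonneg in \<open>simp add: e_def\<close>)
    then have "0 \<le> E" unfolding E_def by (rule integral_nonneg_AE)
    then show False using E by simp
  qed
  have U: "U > 0"
  proof -
    have "U \<ge> 0" unfolding U_def by (rule Bochner_Integration.integral_nonneg) simp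
    moreover have "U \<noteq> 0" using integral_nonneg_eq_0_iff_AE[OF i1] nz by (simp add: U_def)
    ultimately show ?thesis by simp
  qed
  have P: "P > 0"
  proof -
    have "P \<ge> 0" unfolding P_def by (rule Bochner_Integration.integral_nonneg) simp
    moreover have "P \<noteq> 0" using integral_nonneg_eq_0_iff_AE[OF iP] nz by (simp add: P_def)
    ultimately show ?thesis by simp
  qed
  define a where "a = (\<integral>x. (tent x)\<^sup>2 \<partial>lborel)"
  define b where "b = (\<integral>x. (tent' x)\<^sup>2 \<partial>lborel)"
  define k where "k = (\<integral>x. tent x powr p \<partial>lborel)"
  have a: "a > 0" unfolding a_def
    by (rule integral_pos_of_bump[OF tent_integrable(1), of "(1/64)\<^sup>2"]) (auto intro!: power_mono tent_ge)
  have k: "k > 0" unfolding k_def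
    by (rule integral_pos_of_bump[OF tent_integrable(3), of p "(1/64) powr p"]) (use p in \<open>auto intro!: powr_mono2 tent_ge\<close>)
  let ?S = "{ereal (conf_energy CARD('n) A g u du /
                  (LINT p|riemannian_volume A g. \<bar>u p\<bar> powr (2 * CARD('n) / (real CARD('n) - 2))) powr ((real CARD('n) - 2) / CARD('n)))
           | u du. sobolev12 A g u du \<and> nonzero_ae A g u}"
  have Y: "cylindrical_yamabe A g = Inf ?S" by (simp add: cylindrical_yamabe_def Let_def)
  have quot: "ereal ((T * (a * E) + (\<alpha> * b * U) / T) / (T * (k * P)) powr s) \<in> ?S" if T: "T > 0" for T
  proof -
    define \<phi> where "\<phi> = (\<lambda>t. tent ((t - 2) / T))"
    define \<phi>' where "\<phi>' = (\<lambda>t. tent' ((t - 2) / T) / T)"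
    \<comment> \<open>The constant dominates both |\<phi>| <= 1 and |\<phi>'| <= 2 / T.\<close>
    interpret F: end_function A g B h W \<Phi> u \<omega> \<phi> \<phi>' "1 + 2 / T"
    proof
      show "(\<phi> has_real_derivative \<phi>' t) (at t)" for t
      proof -
        have "((\<lambda>t. (t - 2) / T) has_real_derivative 1 / T) (at t)" using T by (auto intro!: derivative_eq_intros)
        from DERIV_chain2[OF tent_deriv this] show ?thesis by (simp add: \<phi>_def \<phi>'_def)
      qed
      show "continuous_on UNIV \<phi>'" unfolding \<phi>'_def
        using T by (intro continuous_intros continuous_on_compose2[OF tent_continuous(2)]) auto
      show "\<bar>\<phi> t\<bar> \<le> 1 + 2 / T" for t using tent_bound(2)[of "(t - 2) / T"] T by (simp add: \<phi>_def add_increasing2)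
      show "\<bar>\<phi>' t\<bar> \<le> 1 + 2 / T" for t
        using divide_right_mono[OF tent_bound(3)[of "(t - 2) / T"], of T] T by (simp add: \<phi>'_def abs_divide add_increasing)
      show "\<phi> t = 0" "\<phi>' t = 0" if "t \<le> 2" for t
      proof -
        define x where "x = (t - 2) / T"
        have "x \<le> 0" using that T by (simp add: x_def divide_le_0_iff)
        then have "tent x = 0 \<and> tent' x = 0"
          \<comment> \<open>The end point 0 belongs to the closed interval excluded in
            \<open>tent_outside\<close> and is computed directly.\<close>
          by (cases "x = 0") (auto simp: tent_outside, auto simp: tent_def tent'_def)
        then show "\<phi> t = 0" "\<phi>' t = 0" by (auto simp: \<phi>_def \<phi>'_def x_def)
      qed
    qed (fact \<omega> | rule u_sob; assumption)+
    have \<phi>0: "\<phi> t = 0" "\<phi>' t = 0" if "t \<le> 1" for t using F.\<phi>_zero[of t] that by auto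
    have I\<phi>: "integrable lborel (\<lambda>t. (\<phi> t)\<^sup>2)" "(\<integral>t. (\<phi> t)\<^sup>2 \<partial>lborel) = T * a"
      using rescale_integral[OF T tent_integrable(1)] by (auto simp: \<phi>_def a_def)
    have I\<phi>': "integrable lborel (\<lambda>t. (\<phi>' t)\<^sup>2)" "(\<integral>t. (\<phi>' t)\<^sup>2 \<partial>lborel) = b / T"
    proof -
      have eq: "(\<lambda>t. (\<phi>' t)\<^sup>2) = (\<lambda>t. (tent' ((t - 2) / T))\<^sup>2 / T\<^sup>2)" by (auto simp: \<phi>'_def power_divide)
      show "integrable lborel (\<lambda>t. (\<phi>' t)\<^sup>2)" unfolding eq using rescale_integral(1)[OF T tent_integrable(2)] by simp
      show "(\<integral>t. (\<phi>' t)\<^sup>2 \<partial>lborel) = b / T" unfolding eq using rescale_integral(2)[OF T tent_integrable(2)] T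
        by (simp add: b_def power2_eq_square)
    qed
    have I\<phi>p: "integrable lborel (\<lambda>t. \<bar>\<phi> t\<bar> powr p)" "(\<integral>t. \<bar>\<phi> t\<bar> powr p \<partial>lborel) = T * k"
      using rescale_integral[OF T tent_integrable(3)[of p]] p tent_bound(1) by (auto simp: \<phi>_def k_def)
    have uX2: "integrable X.vol (\<lambda>p. (F.uX p)\<^sup>2)" "(\<integral>p. (F.uX p)\<^sup>2 \<partial>X.vol) = U * (T * a)"
    proof -
      have f: "(F.uX p)\<^sup>2 = (if p \<in> cyl_part then (\<lambda>q. (u (fst q))\<^sup>2 * (\<phi> (snd q))\<^sup>2) (\<Psi> p) else 0)" for p
        by (simp add: F.uX_def power_mult_distrib)
      have z: "(u (fst q))\<^sup>2 * (\<phi> (snd q))\<^sup>2 = 0" if "snd q \<le> 1" for q using \<phi>0(1)[OF that] by simp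
      note ei = end_integral[OF integrable_prod(1)[OF i1 I\<phi>(1)] z f]
      show "integrable X.vol (\<lambda>p. (F.uX p)\<^sup>2)" by (rule ei(1))
      show "(\<integral>p. (F.uX p)\<^sup>2 \<partial>X.vol) = U * (T * a)"
        using ei(2) integrable_prod(2)[OF i1 I\<phi>(1)] I\<phi>(2) by (simp add: U_def)
    qed
    have uXp: "(\<integral>q. \<bar>F.uX q\<bar> powr p \<partial>X.vol) = P * (T * k)"
    proof -
      have f: "\<bar>F.uX q\<bar> powr p = (if q \<in> cyl_part then (\<lambda>q. \<bar>u (fst q)\<bar> powr p * \<bar>\<phi> (snd q)\<bar> powr p) (\<Psi> q) else 0)" for q
        using p by (simp add: F.uX_def abs_mult powr_mult)
      have z: "\<bar>u (fst q)\<bar> powr p * \<bar>\<phi> (snd q)\<bar> powr p = 0" if "snd q \<le> 1" for q using \<phi>0(1)[OF that] by simp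
      show ?thesis
        using end_integral(2)[OF integrable_prod(1)[OF iP I\<phi>p(1)] z f] integrable_prod(2)[OF iP I\<phi>p(1)] I\<phi>p(2)
        by (simp add: P_def)
    qed
    have duX2: "integrable X.vol (covector_norm2 A g F.duX)"
    proof -
      have f: "covector_norm2 A g F.duX p = (if p \<in> cyl_part then
          (\<lambda>q. covector_norm2 B h \<omega> (fst q) * (\<phi> (snd q))\<^sup>2 + (u (fst q))\<^sup>2 * (\<phi>' (snd q))\<^sup>2) (\<Psi> p) else 0)" for p
        unfolding F.covector_norm2_duX by simp
      have z: "covector_norm2 B h \<omega> (fst q) * (\<phi> (snd q))\<^sup>2 + (u (fst q))\<^sup>2 * (\<phi>' (snd q))\<^sup>2 = 0" if "snd q \<le> 1" for q
        using \<phi>0[OF that] by simp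
      show ?thesis
        by (rule end_integral(1)[OF Bochner_Integration.integrable_add[OF integrable_prod(1)[OF i2 I\<phi>(1)] integrable_prod(1)[OF i1 I\<phi>'(1)]] z f])
    qed
    have en: "conf_energy CARD('n) A g F.uX F.duX = T * (a * E) + (\<alpha> * b * U) / T"
    proof -
      \<comment> \<open>\<phi>^2 multiplies the whole energy density e of the slice, while \<phi>'^2
        multiplies only \<alpha> u^2. Over t these squares integrate to T a and b / T.\<close>
      have f: "conf_coeff CARD('n) * covector_norm2 A g F.duX p + scalar_curvature A g p * (F.uX p)\<^sup>2 = (if p \<in> cyl_part then
          (\<lambda>q. e (fst q) * (\<phi> (snd q))\<^sup>2 + (\<alpha> * (u (fst q))\<^sup>2) * (\<phi>' (snd q))\<^sup>2) (\<Psi> p) else 0)" for p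
        unfolding F.covector_norm2_duX
        by (simp add: F.uX_def scalar_curvature_end e_def \<alpha>_def algebra_simps)
      have z: "e (fst q) * (\<phi> (snd q))\<^sup>2 + (\<alpha> * (u (fst q))\<^sup>2) * (\<phi>' (snd q))\<^sup>2 = 0" if "snd q \<le> 1" for q
        using \<phi>0[OF that] by simp
      have i1': "integrable Z.vol (\<lambda>z. \<alpha> * (u z)\<^sup>2)" using i1 by simp
      note j = integrable_prod[OF ie I\<phi>(1)] integrable_prod[OF i1' I\<phi>'(1)]
      have "conf_energy CARD('n) A g F.uX F.duX = (\<integral>q. e (fst q) * (\<phi> (snd q))\<^sup>2 + (\<alpha> * (u (fst q))\<^sup>2) * (\<phi>' (snd q))\<^sup>2 \<partial>(Z.vol \<Otimes>\<^sub>M lborel))"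
        unfolding conf_energy_def by (rule end_integral(2)[OF Bochner_Integration.integrable_add[OF j(1) j(3)] z f])
      also have "\<dots> = E * (T * a) + (\<alpha> * U) * (b / T)"
        unfolding Bochner_Integration.integral_add[OF j(1) j(3)] j(2) j(4) I\<phi>(2) I\<phi>'(2) by (simp add: E_def U_def)
      finally show ?thesis by (simp add: ac_simps)
    qed
    have uXm: "F.uX \<in> borel_measurable borel"
    proof -
      have m\<phi>: "\<phi> \<in> borel_measurable borel"
        using DERIV_isCont[OF F.\<phi>_deriv] by (intro borel_measurable_continuous_onI continuous_at_imp_continuous_on) auto
      have mf: "(\<lambda>q. u (fst q) * \<phi> (snd q)) \<in> borel_measurable borel"
        by (intro borel_measurable_times measurable_compose[OF _ um] measurable_compose[OF _ m\<phi>] borel_measurable_continuous_onI continuous_intros)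
      have "(\<lambda>p. indicator cyl_part p * (\<lambda>q. u (fst q) * \<phi> (snd q)) (if p \<in> cyl_part then \<Psi> p else undefined)) \<in> borel_measurable borel"
        using open_cyl_part by (intro borel_measurable_times measurable_compose[OF \<Psi>_measurable mf]) auto
      also have "(\<lambda>p. indicator cyl_part p * (\<lambda>q. u (fst q) * \<phi> (snd q)) (if p \<in> cyl_part then \<Psi> p else undefined)) = F.uX"
        by (auto simp: F.uX_def indicator_def)
      finally show ?thesis .
    qed
    have sob: "sobolev12 A g F.uX F.duX"
      unfolding sobolev12_def using uXm F.weak_differential_uX uX2(1) duX2 by blast
    have nzX: "nonzero_ae A g F.uX"
      unfolding nonzero_ae_def
    proof
      assume "AE p in X.vol. F.uX p = 0"
      then have "(\<integral>p. (F.uX p)\<^sup>2 \<partial>X.vol) = 0" by (intro integral_eq_zero_AE) auto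
      then show False using uX2(2) U T a by simp
    qed
    have "conf_energy CARD('n) A g F.uX F.duX /
         (LINT p|riemannian_volume A g. \<bar>F.uX p\<bar> powr (2 * CARD('n) / (real CARD('n) - 2))) powr ((real CARD('n) - 2) / CARD('n))
       = (T * (a * E) + (\<alpha> * b * U) / T) / (T * (k * P)) powr s"
      using en uXp by (simp add: p_def s_def n_def ac_simps)
    then show ?thesis using sob nzX by (intro CollectI exI[of _ F.uX] exI[of _ F.duX]) simp
  qed
  show ?thesis unfolding Y
  proof (rule ereal_bot)
    fix M :: real
    have "a * E < 0" "k * P > 0" using a E k P by (auto simp: mult_pos_neg)
    then obtain T where T: "T > 0" "(T * (a * E) + (\<alpha> * b * U) / T) / (T * (k * P)) powr s \<le> M"
      using quotient_unbounded_below[OF _ _ s] by blast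
    have "Inf ?S \<le> ereal ((T * (a * E) + (\<alpha> * b * U) / T) / (T * (k * P)) powr s)" by (rule Inf_lower[OF quot[OF T(1)]])
    also have "\<dots> \<le> ereal M" using T(2) by simp
    finally show "Inf ?S \<le> ereal M" .
  qed
qed

text \<open>
  A Sobolev function of negative energy is truncated to the bounded function \<open>m arctan (u / m)\<close>, whose
  energy converges to that of \<open>u\<close>; boundedness makes the \<open>L\<^sup>p\<close> norm of the trial function finite
  without the Sobolev embedding.
\<close>

lemma yamabe_of_negative_eigenvalue:
  assumes n3: "CARD('n) \<ge> 3" and ev: "first_eigenvalue CARD('n) B h < 0"
  shows "cylindrical_yamabe A g = - \<infinity>"
proof -
  obtain u du where ud: "sobolev12 B h u du" "nonzero_ae B h u"
    and lt: "ereal (conf_energy CARD('n) B h u du / (LINT p|Z.vol. (u p)\<^sup>2)) < 0"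
    using ev unfolding first_eigenvalue_def Inf_less_iff by auto
  have um: "u \<in> borel_measurable borel" and wd: "weak_differential B u du"
    and i1: "integrable Z.vol (\<lambda>p. (u p)\<^sup>2)" and i2: "integrable Z.vol (covector_norm2 B h du)"
    using ud(1) by (auto simp: sobolev12_def)
  have um': "u \<in> borel_measurable Z.vol" using um unfolding measurable_cong_sets[OF Z.sets_vol refl] .
  have "(LINT p|Z.vol. (u p)\<^sup>2) \<ge> 0" by (rule Bochner_Integration.integral_nonneg) simp
  moreover have "conf_energy CARD('n) B h u du / (LINT p|Z.vol. (u p)\<^sup>2) < 0" using lt by simp
  ultimately have neg: "conf_energy CARD('n) B h u du < 0" by (meson divide_less_0_iff not_le)
  define \<alpha> where "\<alpha> = conf_coeff CARD('n)"
  define R where "R = scalar_curvature B h"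
  \<comment> \<open>A negative integral cannot be the default value 0 of a nonintegrable function,
    so the energy density is integrable. Subtracting the gradient term leaves integrability of R
    u^2, which membership in the Sobolev class does not state.\<close>
  have "integrable Z.vol (\<lambda>p. \<alpha> * covector_norm2 B h du p + R p * (u p)\<^sup>2)"
    using neg not_integrable_integral_eq by (force simp: conf_energy_def \<alpha>_def R_def)
  then have "integrable Z.vol (\<lambda>p. (\<alpha> * covector_norm2 B h du p + R p * (u p)\<^sup>2) - \<alpha> * covector_norm2 B h du p)"
    using i2 by (intro Bochner_Integration.integrable_diff) auto
  then have i3: "integrable Z.vol (\<lambda>p. R p * (u p)\<^sup>2)" by simp
  \<comment> \<open>The successor keeps the denominators positive. F fixes 0, is bounded and has
    slope at most 1; as m grows, F tends to the identity and its slope to 1.\<close>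
  define F where "F = (\<lambda>(m::nat) s. real (Suc m) * arctan (s / real (Suc m)))"
  define F' where "F' = (\<lambda>(m::nat) s. 1 / (1 + (s / real (Suc m))\<^sup>2))"
  have F: "(F m has_real_derivative F' m s) (at s)" for m s
    unfolding F_def F'_def by (auto intro!: derivative_eq_intros simp: inverse_eq_divide)
  have pos1: "1 + (s / real (Suc m))\<^sup>2 \<ge> 1" for s m by simp
  have cF': "continuous_on UNIV (F' m)" for m
    unfolding F'_def by (intro continuous_intros ballI) (simp, metis not_one_le_zero pos1)
  have F'b: "\<bar>F' m s\<bar> \<le> 1" for m s
  proof -
    have "\<bar>1 / D\<bar> \<le> 1" if "D \<ge> 1" for D :: real using that by simp
    from this[OF pos1] show ?thesis by (simp only: F'_def)
  qed
  have Fm: "F m \<in> borel_measurable borel" "F' m \<in> borel_measurable borel" for m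
    using cF' DERIV_isCont[OF F] by (intro borel_measurable_continuous_onI; auto intro!: continuous_at_imp_continuous_on dest: continuous_on_eq_continuous_at[OF open_UNIV, THEN iffD1])+
  have F0: "F m 0 = 0" for m by (simp add: F_def)
  have Flip: "\<bar>F m s\<bar> \<le> \<bar>s\<bar>" for m s
    using field_differentiable_bound[of UNIV "F m" "F' m" 1 s 0] F F'b by (simp add: F0)
  have Fbd: "\<bar>F m s\<bar> \<le> real (Suc m) * (pi / 2)" for m s
    using arctan_bounded[of "s / real (Suc m)"] unfolding F_def abs_mult
    by (intro mult_mono) (auto simp: abs_le_iff)
  have lim0: "(\<lambda>m. s / real (Suc m)) \<longlonglongrightarrow> 0" for s :: real
    by (rule LIMSEQ_Suc[OF lim_const_over_n])
  have Flim': "(\<lambda>m. F' m s) \<longlonglongrightarrow> 1" for s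
  proof -
    have "(\<lambda>m. 1 / (1 + (s / real (Suc m))\<^sup>2)) \<longlonglongrightarrow> 1 / (1 + 0\<^sup>2)"
      by (intro tendsto_intros lim0) auto
    then show ?thesis by (simp add: F'_def)
  qed
  have Flim: "(\<lambda>m. F m s) \<longlonglongrightarrow> s" for s
  proof (cases "s = 0")
    case False
    have "(arctan has_real_derivative inverse (1 + 0\<^sup>2)) (at 0)" by (rule DERIV_arctan)
    then have "((\<lambda>h. arctan h / h) \<longlongrightarrow> 1) (at 0)" by (simp add: DERIV_def)
    moreover have "filterlim (\<lambda>m. s / real (Suc m)) (at 0) sequentially"
      using lim0 False by (intro filterlim_atI) auto
    ultimately have "(\<lambda>m. arctan (s / real (Suc m)) / (s / real (Suc m))) \<longlonglongrightarrow> 1" by (rule filterlim_compose)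
    then have "(\<lambda>m. s * (arctan (s / real (Suc m)) / (s / real (Suc m)))) \<longlonglongrightarrow> s * 1" by (intro tendsto_intros)
    moreover have "s * (arctan (s / real (Suc m)) / (s / real (Suc m))) = F m s" for m
      using False by (simp add: F_def field_simps)
    ultimately show ?thesis by simp
  qed (simp add: F0)
  define um where "um = (\<lambda>m z. F m (u z))"
  define \<omega>m where "\<omega>m = (\<lambda>m c x. F' m (u (chart_inv c x)) *\<^sub>R du c x)"
  have nm: "covector_norm2 B h (\<omega>m m) z = (F' m (u z))\<^sup>2 * covector_norm2 B h du z" for m z
  proof -
    let ?c = "chart_at B z"
    note c = Z.chart_at[of z]
    interpret H: local_metric "chart_img ?c" "h ?c" by (rule Z.local_metric_chart[OF c(1)])
    have ls: "linear (sharp (h ?c (chart_map ?c z)))" by (rule linear_sharp[OF H.form[OF Z.map_img[OF c]]])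
    show ?thesis
      by (simp add: covector_norm2_def Let_def \<omega>m_def Z.inv_map[OF c] linear_scale[OF ls] power2_eq_square)
  qed
  have F'1: "(F' m s)\<^sup>2 \<le> 1" for m s using F'b[of m s] by (simp add: abs_square_le_1)
  have mF: "(\<lambda>z. F m (u z)) \<in> borel_measurable Z.vol" "(\<lambda>z. F' m (u z)) \<in> borel_measurable Z.vol" for m
    by (rule measurable_compose[OF um' Fm(1)], rule measurable_compose[OF um' Fm(2)])
  have j1: "integrable Z.vol (\<lambda>z. (um m z)\<^sup>2)" for m
  proof (rule Bochner_Integration.integrable_bound[OF i1])
    show "AE z in Z.vol. norm ((um m z)\<^sup>2) \<le> norm ((u z)\<^sup>2)"
      using Flip by (auto simp: um_def abs_le_square_iff[symmetric])
  qed (use mF in \<open>simp add: um_def\<close>)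
  have b2: "norm (covector_norm2 B h (\<omega>m m) z) \<le> covector_norm2 B h du z" for m z
    using mult_right_mono[OF F'1 Z.covector_norm2_nonneg, of m "u z" du z] Z.covector_norm2_nonneg[of du z]
    by (simp add: nm abs_mult)
  have m2: "covector_norm2 B h (\<omega>m m) \<in> borel_measurable Z.vol" for m
    unfolding nm[abs_def] using mF(2)[of m] borel_measurable_integrable[OF i2] by simp
  have j2: "integrable Z.vol (covector_norm2 B h (\<omega>m m))" for m
    by (rule Bochner_Integration.integrable_bound[OF i2 m2]) (use b2 Z.covector_norm2_nonneg in auto)
  \<comment> \<open>The squared ratio of truncated to original function, at most 1; where u
    vanishes, division by zero gives 0. Writing R um^2 as (R u^2) r yields measurability and
    domination together.\<close>
  define r where "r = (\<lambda>m z. (F m (u z) / u z)\<^sup>2)"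
  have r1: "r m z \<le> 1" "0 \<le> r m z" for m z
  proof -
    have "\<bar>F m (u z) / u z\<bar> \<le> 1" using Flip[of m "u z"] by (cases "u z = 0") (auto simp: abs_divide divide_le_eq)
    then show "r m z \<le> 1" by (simp add: r_def abs_square_le_1)
  qed (simp add: r_def)
  have r2: "R z * (um m z)\<^sup>2 = (R z * (u z)\<^sup>2) * r m z" for m z
    by (cases "u z = 0") (auto simp: um_def r_def F0 power_divide)
  have b3: "norm (R z * (um m z)\<^sup>2) \<le> \<bar>R z * (u z)\<^sup>2\<bar>" for m z
    unfolding r2 using mult_left_mono[OF r1(1) abs_ge_zero[of "R z * (u z)\<^sup>2"], of m z] r1(2)[of m z] by (simp add: abs_mult)
  have m3: "(\<lambda>z. R z * (um m z)\<^sup>2) \<in> borel_measurable Z.vol" for m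
    unfolding r2 r_def using mF(1)[of m] um' borel_measurable_integrable[OF i3] by measurable
  have j3: "integrable Z.vol (\<lambda>z. R z * (um m z)\<^sup>2)" for m
    by (rule Bochner_Integration.integrable_bound[OF i3 m3]) (use b3 in auto)
  have "(\<lambda>m. \<integral>z. \<alpha> * covector_norm2 B h (\<omega>m m) z + R z * (um m z)\<^sup>2 \<partial>Z.vol) \<longlonglongrightarrow> (\<integral>z. \<alpha> * covector_norm2 B h du z + R z * (u z)\<^sup>2 \<partial>Z.vol)"
  proof (rule integral_dominated_convergence[where w = "\<lambda>z. \<bar>\<alpha>\<bar> * covector_norm2 B h du z + \<bar>R z * (u z)\<^sup>2\<bar>"])
    show "integrable Z.vol (\<lambda>z. \<bar>\<alpha>\<bar> * covector_norm2 B h du z + \<bar>R z * (u z)\<^sup>2\<bar>)" using i2 i3 by auto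
    show "AE z in Z.vol. (\<lambda>m. \<alpha> * covector_norm2 B h (\<omega>m m) z + R z * (um m z)\<^sup>2) \<longlonglongrightarrow> \<alpha> * covector_norm2 B h du z + R z * (u z)\<^sup>2"
    proof (rule AE_I2)
      fix z
      have "(\<lambda>m. \<alpha> * ((F' m (u z))\<^sup>2 * covector_norm2 B h du z) + R z * (F m (u z))\<^sup>2) \<longlonglongrightarrow> \<alpha> * (1\<^sup>2 * covector_norm2 B h du z) + R z * (u z)\<^sup>2"
        by (intro tendsto_intros Flim Flim')
      then show "(\<lambda>m. \<alpha> * covector_norm2 B h (\<omega>m m) z + R z * (um m z)\<^sup>2) \<longlonglongrightarrow> \<alpha> * covector_norm2 B h du z + R z * (u z)\<^sup>2"
        by (simp add: nm um_def)
    qed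
    show "AE z in Z.vol. norm (\<alpha> * covector_norm2 B h (\<omega>m m) z + R z * (um m z)\<^sup>2) \<le> \<bar>\<alpha>\<bar> * covector_norm2 B h du z + \<bar>R z * (u z)\<^sup>2\<bar>" for m
    proof (rule AE_I2)
      fix z
      show "norm (\<alpha> * covector_norm2 B h (\<omega>m m) z + R z * (um m z)\<^sup>2) \<le> \<bar>\<alpha>\<bar> * covector_norm2 B h du z + \<bar>R z * (u z)\<^sup>2\<bar>"
        by (rule order_trans[OF norm_triangle_ineq add_mono[OF _ b3]])
          (use mult_left_mono[OF b2 abs_ge_zero, of \<alpha> m z] in \<open>simp add: abs_mult\<close>)
    qed
    show "(\<lambda>z. \<alpha> * covector_norm2 B h (\<omega>m m) z + R z * (um m z)\<^sup>2) \<in> borel_measurable Z.vol" for m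
      by (intro borel_measurable_add borel_measurable_times[OF borel_measurable_const m2] m3)
  qed (use i2 i3 in auto)
  then have "(\<lambda>m. conf_energy CARD('n) B h (um m) (\<omega>m m)) \<longlonglongrightarrow> conf_energy CARD('n) B h u du"
    by (simp add: conf_energy_def \<alpha>_def R_def)
  then have "\<forall>\<^sub>F m in sequentially. conf_energy CARD('n) B h (um m) (\<omega>m m) < 0" using neg by (rule order_tendstoD(2))
  then obtain m where m: "conf_energy CARD('n) B h (um m) (\<omega>m m) < 0" by (auto simp: eventually_sequentially)
  have cf: "covector_field B du" using wd by (simp add: weak_differential_def)
  show ?thesis
  proof (rule yamabe_of_negative_energy[OF n3 _ _ _ _ j1 j2 _ m])
    show "covector_field B (\<omega>m m)"
      unfolding covector_field_def
    proof (intro ballI allI)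
      fix c d x v assume cd: "c \<in> B" "d \<in> B" and x: "x \<in> overlap c d"
      have "chart_inv d (transition c d x) = chart_inv c x"
        using x cd by (auto simp: transition_def Z.overlap_eq Z.inv_map)
      moreover have "du c x \<bullet> v = du d (transition c d x) \<bullet> dir_deriv v (transition c d) x"
        using cf cd x unfolding covector_field_def by blast
      ultimately show "\<omega>m m c x \<bullet> v = \<omega>m m d (transition c d x) \<bullet> dir_deriv v (transition c d) x"
        by (simp add: \<omega>m_def)
    qed
    show "um m \<in> borel_measurable borel" unfolding um_def by (rule measurable_compose[OF um Fm(1)])
    show "\<bar>um m z\<bar> \<le> real (Suc m) * (pi / 2)" for z unfolding um_def by (rule Fbd)
    show "integrable Z.vol (\<lambda>z. scalar_curvature B h z * (um m z)\<^sup>2)" using j3[of m] by (simp add: R_def)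
    fix c x assume c: "c \<in> B" and x: "x \<in> chart_img c"
    \<comment> \<open>The weak differential is converted into approximability before truncating,
      because the chain rule is available for \<open>sob_on\<close>.\<close>
    have "\<exists>N. x \<in> N \<and> sob_on N (u \<circ> chart_inv c) (du c)"
    proof (rule weak_derivative_imp_sob_on[OF Z.open_img[OF c] _ _ x])
      show "set_integrable lborel K (u \<circ> chart_inv c) \<and> set_integrable lborel K (du c)" if "compact K" "K \<subseteq> chart_img c" for K
        using wd c that unfolding weak_differential_def by blast
      show "(LINT x:chart_img c|lborel. (u \<circ> chart_inv c) x * dir_deriv w \<eta> x) = - (LINT x:chart_img c|lborel. (du c x \<bullet> w) * \<eta> x)"
        if "test_function (chart_img c) \<eta>" for \<eta> w
        using wd c that unfolding weak_differential_def o_def by blast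
    qed
    then obtain N where N: "x \<in> N" "sob_on N (u \<circ> chart_inv c) (du c)" by blast
    have "sob_on N (\<lambda>x. F m ((u \<circ> chart_inv c) x)) (\<lambda>x. F' m ((u \<circ> chart_inv c) x) *\<^sub>R du c x)"
      by (rule sob_on_chain[OF N(2) F cF' F'b F0])
    then show "\<exists>N. x \<in> N \<and> sob_on N (\<lambda>x. um m (chart_inv c x)) (\<omega>m m c)"
      using N(1) by (auto simp: um_def \<omega>m_def[abs_def])
  qed
qed

text \<open>The energy of the constant 1 is the total scalar curvature. It is finite because the
  curvature is continuous on a compact manifold, and strictly negative because the volume of Z is
  not zero.\<close>

lemma yamabe_of_negative_scalar_curvature:
  assumes n3: "CARD('n) \<ge> 3" and neg: "\<And>z. scalar_curvature B h z < 0"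
  shows "cylindrical_yamabe A g = - \<infinity>"
proof -
  interpret finite_measure Z.vol by (rule finite_measure_Z)
  let ?R = "scalar_curvature B h"
  have Rm: "?R \<in> borel_measurable Z.vol"
    unfolding measurable_cong_sets[OF Z.sets_vol refl] by (rule borel_measurable_continuous_onI[OF Z.continuous_scalar_curvature])
  have "compact (?R ` UNIV)" by (rule compact_continuous_image[OF Z.continuous_scalar_curvature compact_Z])
  then obtain M where M: "\<And>z. norm (?R z) \<le> M" by (metis bounded_iff compact_imp_bounded rangeI)
  have iR: "integrable Z.vol ?R" by (rule integrable_const_bound[OF _ Rm]) (use M in auto)
  have n0: "covector_norm2 B h (\<lambda>_ _. 0) z = 0" for z by (simp add: covector_norm2_def)
  have "(\<integral>z. - ?R z \<partial>Z.vol) \<ge> 0" using less_imp_le[OF neg] by (intro Bochner_Integration.integral_nonneg) auto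
  moreover have "(\<integral>z. - ?R z \<partial>Z.vol) \<noteq> 0"
  proof
    assume "(\<integral>z. - ?R z \<partial>Z.vol) = 0"
    then have "AE z in Z.vol. - ?R z = 0"
      using integral_nonneg_eq_0_iff_AE[of Z.vol "\<lambda>z. - ?R z"] iR less_imp_le[OF neg] by auto
    then have "AE z in Z.vol. False" by eventually_elim (use neg in \<open>auto simp: less_le\<close>)
    then have "emeasure Z.vol (space Z.vol) = 0" by (simp add: AE_iff_measurable[OF sets.top])
    then show False using Z.volume_nonzero by simp
  qed
  ultimately have "(\<integral>z. ?R z \<partial>Z.vol) < 0" by simp
  then have "conf_energy CARD('n) B h (\<lambda>_. 1) (\<lambda>_ _. 0) < 0" by (simp add: conf_energy_def n0)
  then show ?thesis
  proof (rule yamabe_of_negative_energy[OF n3, rotated -1])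
    show "covector_field B (\<lambda>_ _. 0)" by (simp add: covector_field_def)
    show "\<bar>1 :: real\<bar> \<le> 1" by simp
    fix c x assume "c \<in> B" "x \<in> chart_img c"
    have "sob_on (ball x 1) (\<lambda>x. 1) (\<lambda>x. 0)"
      by (rule sob_on_C1) (auto simp: has_gradient_on_def set_integrable_def integrable_indicator_iff emeasure_lborel_ball_finite[unfolded infinity_ennreal_def])
    then show "\<exists>N. x \<in> N \<and> sob_on N (\<lambda>x. 1) (\<lambda>x. 0)" by (intro exI[of _ "ball x 1"]) simp
  qed (use iR in \<open>auto simp: n0[abs_def]\<close>)
qed

end

theorem lemma2p7:
  fixes A :: "('a::{t2_space, second_countable_topology}, real^'n) atlas"
    and B :: "('z::{t2_space, second_countable_topology}, real^'k) atlas"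
    and W :: "'a set"
    and h :: "('z, real^'k) tensor2"
  assumes "CARD('n) \<ge> 3"
    and "open_manifold_tame_ends A B W"
    and "riemannian_metric B h"
  shows "(first_eigenvalue CARD('n) B h < 0 \<longrightarrow>
            (\<forall>g. cylindrical_metric A B W g h \<longrightarrow> cylindrical_yamabe A g = -\<infinity>))
       \<and> ((\<forall>z. scalar_curvature B h z < 0) \<longrightarrow>
            (\<forall>g. cylindrical_metric A B W g h \<longrightarrow> cylindrical_yamabe A g = -\<infinity>))"
proof -
  \<comment> \<open>The coordinates must be ones in which g is a product, so \<Phi> is taken from
    \<open>cylindrical_metric\<close>; the hypothesis on tame ends supplies the atlases, openness of
    W, compactness of Z and the relation of dimensions.\<close>
  have "\<exists>\<Phi>. cyl_end A g B h W \<Phi>" if "cylindrical_metric A B W g h" for g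
  proof -
    obtain \<Phi> where \<Phi>: "end_coordinates A B W \<Phi>"
      "\<forall>c\<in>B. \<forall>d\<in>A. \<forall>z\<in>chart_dom c. \<forall>t\<ge>1. \<Phi> (z, t) \<in> chart_dom d \<longrightarrow>
          (let F = (\<lambda>(x, s). chart_map d (\<Phi> (chart_inv c x, s))); y = (chart_map c z, t) in
           \<forall>v w a b. g d (F y) (dir_deriv (v, a) F y) (dir_deriv (w, b) F y) = h c (fst y) v w + a * b)"
      using \<open>cylindrical_metric A B W g h\<close> unfolding cylindrical_metric_def by blast
    have "cyl_end A g B h W \<Phi>"
    proof
      show "smooth_atlas A" "smooth_atlas B" "open W" "compact (UNIV :: 'z set)"
        using assms(2) by (auto simp: open_manifold_tame_ends_def)
      show "CARD('n) = CARD('k) + 1" using assms(2) by (simp add: open_manifold_tame_ends_def)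
      show "riemannian_metric A g" "riemannian_metric B h"
        using that by (auto simp: cylindrical_metric_def)
      show "end_coordinates A B W \<Phi>" by (rule \<Phi>(1))
    qed (use \<Phi>(2) in blast)
    then show ?thesis by blast
  qed
  then show ?thesis
    using cyl_end.yamabe_of_negative_eigenvalue[OF _ assms(1)] cyl_end.yamabe_of_negative_scalar_curvature[OF _ assms(1)]
    by blast
qed

end
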